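(* Let $(M,\varphi)$ be an integrable $G_2$ manifold of constant type, i.e. $d{*}\varphi=\theta\wedge{*}\varphi$ and $(d\varphi,*\varphi)=const.$, with characteristic connection $\nabla$ and torsion 3-form $T$. Suppose that the curvature $R$ of $\nabla$ is a Ricci flat $G_2$-instanton, i.e. $R\in\mathfrak{g}_2\otimes\mathfrak{g}_2$ and $Ric=0$. Then the torsion 3-form is harmonic, $\delta T=dT=0$, and the covariant derivatives of $T$ with respect to the Levi-Civita connection and the characteristic connection coincide, $\nabla^gT=\nabla T$.
   Context: A $G_2$ structure on a smooth 7-manifold $M$ is a 3-form $\varphi$ which near each point has, in a suitable local coframe $e_1,\dots,e_7$, the form $\varphi=e_{127}+e_{135}-e_{146}-e_{236}-e_{245}+e_{347}+e_{567}$, where $e_{ijk}=e_i\wedge e_j\wedge e_k$. It determines a Riemannian metric $g$ and an orientation for which such coframes are oriented orthonormal; $*$ is the Hodge star, $\Phi=*\varphi$, $\nabla^g$ the Levi-Civita connection, and $\delta=(-1)^p*d*$ the codifferential on $p$-forms. Components are taken in local orthonormal frames, $\varphi=\frac16\varphi_{ijk}e_{ijk}$, repeated indices are summed, and vectors and 1-forms are identified via $g$. The scalar product $(d\varphi,*\varphi)$ is the pointwise one on 4-forms, so $d\varphi\wedge\varphi=(d\varphi,*\varphi)\,vol$. The Lee form is $\theta=-\frac13*( *d\varphi\wedge\varphi)$. The $G_2$ structure is integrable if $d{*}\varphi=\theta\wedge{*}\varphi$. It is then of constant type if the function $(d\varphi,*\varphi)$ is constant. On an integrable $G_2$ manifold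 there is a unique metric connection $\nabla$ with $\nabla\varphi=0$ whose torsion $T(X,Y,Z)=g(\nabla_XY-\nabla_YX-[X,Y],Z)$ is a 3-form (the characteristic connection); $g(\nabla_XY,Z)=g(\nabla^g_XY,Z)+\frac12T(X,Y,Z)$ and $T=-*d\varphi+*(\theta\wedge\varphi)+\frac16(d\varphi,*\varphi)\varphi$. Curvature: $R(X,Y)Z=[\nabla_X,\nabla_Y]Z-\nabla_{[X,Y]}Z$, $R(X,Y,Z,V)=g(R(X,Y)Z,V)$, $Ric(X,Y)=\sum_iR(e_i,X,Y,e_i)$. The curvature $R$ is a $G_2$-instanton if $R_{abij}\varphi_{abk}=0$ (the curvature 2-form, in its first pair of arguments, lies in $\mathfrak{g}_2\cong\Lambda^2_{14}=\{\alpha\in\Lambda^2: *(\alpha\wedge\varphi)=-\alpha\}$); since $\nabla\varphi=0$, the second pair always lies in $\mathfrak g_2$. *)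

theory Defs
  imports "HOL-Analysis.Analysis" "HOL-Combinatorics.Permutations"
begin

section \<open>Smooth manifolds of dimension 7\<close>

text \<open>
  Continuous partial derivatives of all orders up to \<open>k\<close>, for a real function on an open subset of
  Euclidean 7-space.
\<close>

primrec ck_on :: "nat \<Rightarrow> (real^7) set \<Rightarrow> (real^7 \<Rightarrow> real) \<Rightarrow> bool" where
  "ck_on 0 S f \<longleftrightarrow> continuous_on S f"
| "ck_on (Suc k) S f \<longleftrightarrow> (\<forall>x\<in>S. f differentiable (at x)) \<and>
     (\<forall>i. ck_on k S (\<lambda>x. frechet_derivative f (at x) (axis i 1)))"

definition smooth_on :: "(real^7) set \<Rightarrow> (real^7 \<Rightarrow> real) \<Rightarrow> bool" where
  "smooth_on S f \<longleftrightarrow> (\<forall>k. ck_on k S f)"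

text \<open>
  A chart is a pair of its domain and its coordinate map; the values of the map outside the domain
  are irrelevant. All local objects below are functions of points of the manifold, not of their
  coordinates.
\<close>

type_synonym 'm chart = "'m set \<times> ('m \<Rightarrow> real^7)"

definition is_chart :: "'m topology \<Rightarrow> 'm chart \<Rightarrow> bool" where
  "is_chart M c \<longleftrightarrow> openin M (fst c) \<and> open (snd c ` fst c) \<and>
     homeomorphic_map (subtopology M (fst c)) (top_of_set (snd c ` fst c)) (snd c)"

definition read_in :: "'m chart \<Rightarrow> ('m \<Rightarrow> real) \<Rightarrow> real^7 \<Rightarrow> real" where
  "read_in c f = f \<circ> inv_into (fst c) (snd c)"

definition smooth_in :: "'m chart \<Rightarrow> 'm set \<Rightarrow> ('m \<Rightarrow> real) \<Rightarrow> bool" where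
  "smooth_in c V f \<longleftrightarrow> smooth_on (snd c ` V) (read_in c f)"

text \<open>The partial derivative of \<open>f\<close> along the \<open>i\<close>-th coordinate of the chart \<open>c\<close>, at the point \<open>p\<close>.\<close>

definition pd :: "'m chart \<Rightarrow> 7 \<Rightarrow> ('m \<Rightarrow> real) \<Rightarrow> 'm \<Rightarrow> real" where
  "pd c i f p = frechet_derivative (read_in c f) (at (snd c p)) (axis i 1)"

definition smooth_manifold :: "'m topology \<Rightarrow> 'm chart set \<Rightarrow> bool" where
  "smooth_manifold M A \<longleftrightarrow>
     Hausdorff_space M \<and> second_countable M \<and>
     (\<forall>c\<in>A. is_chart M c) \<and> (\<Union>c\<in>A. fst c) = topspace M \<and>
     (\<forall>c\<in>A. \<forall>c'\<in>A. \<forall>i. smooth_in c (fst c \<inter> fst c') (\<lambda>q. snd c' q $ i))"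

text \<open>With coordinates \<open>x\<close> of \<open>c\<close> and \<open>x'\<close> of \<open>c'\<close>, this is \<open>\<partial>x\<^sup>i / \<partial>x'\<^sup>a\<close>.\<close>

definition jac :: "'m chart \<Rightarrow> 'm chart \<Rightarrow> 'm \<Rightarrow> 7 \<Rightarrow> 7 \<Rightarrow> real" where
  "jac c c' p i a = pd c' a (\<lambda>q. snd c q $ i) p"


section \<open>Tensor fields and differential forms\<close>

text \<open>
  A covariant \<open>k\<close>-tensor at a point, in a fixed basis, is given by its components, indexed by the
  lists of length \<open>k\<close> over the 7-element type \<open>7\<close>; values on lists of other lengths are irrelevant.
  The numerals \<open>1, \<dots>, 7\<close> denote the seven elements of that type (and \<open>7 = 0\<close>).
  A tensor field on a manifold is a family of components, one for each chart \<open>c\<close>, with respect to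
  the coordinate basis of \<open>c\<close>, subject to the transformation law.
\<close>

type_synonym tens = "7 list \<Rightarrow> real"
type_synonym 'm field = "'m chart \<Rightarrow> 'm \<Rightarrow> tens"

definition idx :: "nat \<Rightarrow> 7 list set" where
  "idx k = {I. length I = k}"

definition tensor_field :: "'m chart set \<Rightarrow> nat \<Rightarrow> 'm field \<Rightarrow> bool" where
  "tensor_field A k \<alpha> \<longleftrightarrow>
     (\<forall>c\<in>A. \<forall>I\<in>idx k. smooth_in c (fst c) (\<lambda>q. \<alpha> c q I)) \<and>
     (\<forall>c\<in>A. \<forall>c'\<in>A. \<forall>p \<in> fst c \<inter> fst c'. \<forall>J\<in>idx k.
        \<alpha> c' p J = (\<Sum>I\<in>idx k. (\<Prod>s<k. jac c c' p (I ! s) (J ! s)) * \<alpha> c p I))"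

definition field_eq :: "'m chart set \<Rightarrow> nat \<Rightarrow> 'm field \<Rightarrow> 'm field \<Rightarrow> bool" where
  "field_eq A k \<alpha> \<beta> \<longleftrightarrow> (\<forall>c\<in>A. \<forall>p\<in>fst c. \<forall>I\<in>idx k. \<alpha> c p I = \<beta> c p I)"

abbreviation zero_field :: "'m field" where
  "zero_field \<equiv> \<lambda>c p I. 0"

definition alternating :: "nat \<Rightarrow> tens \<Rightarrow> bool" where
  "alternating k \<alpha> \<longleftrightarrow>
     (\<forall>I\<in>idx k. \<forall>\<sigma>. \<sigma> permutes {..<k} \<longrightarrow> \<alpha> (permute_list \<sigma> I) = of_int (sign \<sigma>) * \<alpha> I)"

definition diff_form :: "'m chart set \<Rightarrow> nat \<Rightarrow> 'm field \<Rightarrow> bool" where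
  "diff_form A k \<alpha> \<longleftrightarrow> tensor_field A k \<alpha> \<and> (\<forall>c\<in>A. \<forall>p\<in>fst c. alternating k (\<alpha> c p))"

text \<open>
  The exterior product of a \<open>k\<close>-form and an \<open>l\<close>-form, normalised so that
  \<open>(e\<^sub>1 \<and> \<dots> \<and> e\<^sub>k)(v\<^sub>1, \<dots>, v\<^sub>k) = det (e\<^sub>i(v\<^sub>j))\<close>; correspondingly a \<open>k\<close>-form is \<open>1/k!\<close> times the full
  sum of its components against the exterior products of basis 1-forms.
\<close>

definition wedge :: "nat \<Rightarrow> nat \<Rightarrow> tens \<Rightarrow> tens \<Rightarrow> tens" where
  "wedge k l \<alpha> \<beta> = (\<lambda>I. (\<Sum>\<sigma> | \<sigma> permutes {..<k + l}.
       of_int (sign \<sigma>) * \<alpha> (take k (permute_list \<sigma> I)) * \<beta> (drop k (permute_list \<sigma> I)))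
     / (fact k * fact l))"

definition wedge_field :: "nat \<Rightarrow> nat \<Rightarrow> 'm field \<Rightarrow> 'm field \<Rightarrow> 'm field" where
  "wedge_field k l \<alpha> \<beta> = (\<lambda>c p. wedge k l (\<alpha> c p) (\<beta> c p))"

primrec wedge_list :: "tens list \<Rightarrow> tens" where
  "wedge_list [] = (\<lambda>I. 1)"
| "wedge_list (\<alpha> # \<alpha>s) = wedge 1 (length \<alpha>s) \<alpha> (wedge_list \<alpha>s)"

definition ext_d :: "'m field \<Rightarrow> 'm field" where
  "ext_d \<alpha> = (\<lambda>c p I. \<Sum>s<length I. (-1) ^ s *
     pd c (I ! s) (\<lambda>q. \<alpha> c q (take s I @ drop (Suc s) I)) p)"


section \<open>Riemannian metrics\<close>

definition riemannian_metric :: "'m chart set \<Rightarrow> 'm field \<Rightarrow> bool" where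
  "riemannian_metric A g \<longleftrightarrow> tensor_field A 2 g \<and>
     (\<forall>c\<in>A. \<forall>p\<in>fst c. (\<forall>i j. g c p [i, j] = g c p [j, i]) \<and>
        (\<forall>v::real^7. v \<noteq> 0 \<longrightarrow> (\<Sum>i\<in>UNIV. \<Sum>j\<in>UNIV. g c p [i, j] * v $ i * v $ j) > 0))"

definition ginv :: "tens \<Rightarrow> 7 \<Rightarrow> 7 \<Rightarrow> real" where
  "ginv g i j = matrix_inv (\<chi> a b. g [a, b]) $ i $ j"

text \<open>All indices raised with the metric.\<close>

definition raise :: "tens \<Rightarrow> tens \<Rightarrow> tens" where
  "raise g \<alpha> = (\<lambda>I. \<Sum>J\<in>idx (length I). (\<Prod>s<length I. ginv g (I ! s) (J ! s)) * \<alpha> J)"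

text \<open>The scalar product of \<open>k\<close>-forms for which increasing products of an orthonormal coframe are orthonormal.\<close>

definition form_inner :: "tens \<Rightarrow> nat \<Rightarrow> tens \<Rightarrow> tens \<Rightarrow> real" where
  "form_inner g k \<alpha> \<beta> = (\<Sum>I\<in>idx k. raise g \<alpha> I * \<beta> I) / fact k"

text \<open>
  The orientation enters through the Riemannian volume form \<open>\<omega>\<close>. For \<open>k\<close>-forms, the operator
  \<open>star\<close> satisfies \<open>\<alpha> \<and> star \<beta> = (\<alpha>, \<beta>) \<omega>\<close>.
\<close>

definition star :: "'m field \<Rightarrow> 'm field \<Rightarrow> nat \<Rightarrow> 'm field \<Rightarrow> 'm field" where
  "star g \<omega> k \<alpha> = (\<lambda>c p J. (\<Sum>I\<in>idx k. raise (g c p) (\<alpha> c p) I * \<omega> c p (I @ J)) / fact k)"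

definition codiff :: "'m field \<Rightarrow> 'm field \<Rightarrow> nat \<Rightarrow> 'm field \<Rightarrow> 'm field" where
  "codiff g \<omega> k \<alpha> = (\<lambda>c p I. (-1) ^ k * star g \<omega> (8 - k) (ext_d (star g \<omega> k \<alpha>)) c p I)"


section \<open>Linear connections\<close>

text \<open>
  A connection is given in each chart by its Christoffel symbols: \<open>D c p k i j\<close> is the coefficient of
  \<open>\<partial>\<^sub>k\<close> in \<open>\<nabla>\<close> of \<open>\<partial>\<^sub>j\<close> along \<open>\<partial>\<^sub>i\<close>.
\<close>

type_synonym 'm christoffel = "'m chart \<Rightarrow> 'm \<Rightarrow> 7 \<Rightarrow> 7 \<Rightarrow> 7 \<Rightarrow> real"

definition connection :: "'m chart set \<Rightarrow> 'm christoffel \<Rightarrow> bool" where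
  "connection A D \<longleftrightarrow>
     (\<forall>c\<in>A. \<forall>k i j. smooth_in c (fst c) (\<lambda>q. D c q k i j)) \<and>
     (\<forall>c\<in>A. \<forall>c'\<in>A. \<forall>p \<in> fst c \<inter> fst c'. \<forall>k a b.
        (\<Sum>m\<in>UNIV. jac c c' p k m * D c' p m a b) =
        pd c' a (\<lambda>q. jac c c' q k b) p +
        (\<Sum>i\<in>UNIV. \<Sum>j\<in>UNIV. jac c c' p i a * jac c c' p j b * D c p k i j))"

text \<open>The covariant derivative of a covariant tensor field; the direction of differentiation is the first index.\<close>

definition cov_deriv :: "'m christoffel \<Rightarrow> 'm field \<Rightarrow> 'm field" where
  "cov_deriv D \<alpha> = (\<lambda>c p I. let i = hd I; J = tl I in
     pd c i (\<lambda>q. \<alpha> c q J) p -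
     (\<Sum>s<length J. \<Sum>l\<in>UNIV. D c p l i (J ! s) * \<alpha> c p (J[s := l])))"

definition parallel :: "'m chart set \<Rightarrow> 'm christoffel \<Rightarrow> nat \<Rightarrow> 'm field \<Rightarrow> bool" where
  "parallel A D k \<alpha> \<longleftrightarrow> field_eq A (Suc k) (cov_deriv D \<alpha>) zero_field"

text \<open>\<open>T(X, Y, Z) = g(\<nabla>\<^sub>X Y - \<nabla>\<^sub>Y X - [X, Y], Z)\<close>; coordinate vector fields commute.\<close>

definition torsion :: "'m field \<Rightarrow> 'm christoffel \<Rightarrow> 'm field" where
  "torsion g D = (\<lambda>c p I. \<Sum>l\<in>UNIV.
     (D c p l (I ! 0) (I ! 1) - D c p l (I ! 1) (I ! 0)) * g c p [l, I ! 2])"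

definition levi_civita :: "'m chart set \<Rightarrow> 'm field \<Rightarrow> 'm christoffel \<Rightarrow> bool" where
  "levi_civita A g D \<longleftrightarrow> connection A D \<and> parallel A D 2 g \<and>
     field_eq A 3 (torsion g D) zero_field"

text \<open>
  The coefficient of \<open>\<partial>\<^sub>l\<close> in \<open>R(\<partial>\<^sub>i, \<partial>\<^sub>j)\<partial>\<^sub>k\<close>, where
  \<open>R(X, Y)Z = \<nabla>\<^sub>X\<nabla>\<^sub>Y Z - \<nabla>\<^sub>Y\<nabla>\<^sub>X Z - \<nabla>\<close> of \<open>Z\<close> along \<open>[X, Y]\<close>.
\<close>

definition curv_op :: "'m christoffel \<Rightarrow> 'm chart \<Rightarrow> 'm \<Rightarrow> 7 \<Rightarrow> 7 \<Rightarrow> 7 \<Rightarrow> 7 \<Rightarrow> real" where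
  "curv_op D c p l i j k =
     pd c i (\<lambda>q. D c q l j k) p - pd c j (\<lambda>q. D c q l i k) p +
     (\<Sum>m\<in>UNIV. D c p m j k * D c p l i m - D c p m i k * D c p l j m)"

text \<open>\<open>R(X, Y, Z, V) = g(R(X, Y)Z, V)\<close>\<close>

definition curvature :: "'m field \<Rightarrow> 'm christoffel \<Rightarrow> 'm field" where
  "curvature g D = (\<lambda>c p I. \<Sum>l\<in>UNIV.
     curv_op D c p l (I ! 0) (I ! 1) (I ! 2) * g c p [l, I ! 3])"

text \<open>
  \<open>Ric(X, Y)\<close> is the sum of \<open>R(e\<^sub>i, X, Y, e\<^sub>i)\<close> over an orthonormal frame; in an arbitrary frame the
  sum becomes a contraction with the inverse metric. The same applies to the sum over \<open>a, b\<close> in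
  \<open>g2_instanton\<close> below.
\<close>

definition ricci :: "'m field \<Rightarrow> 'm christoffel \<Rightarrow> 'm field" where
  "ricci g D = (\<lambda>c p I. \<Sum>a\<in>UNIV. \<Sum>b\<in>UNIV.
     ginv (g c p) a b * curvature g D c p [a, I ! 0, I ! 1, b])"


section \<open>$G_2$ structures\<close>

definition g2_model :: "(7 \<Rightarrow> tens) \<Rightarrow> tens" where
  "g2_model e = (\<lambda>I.
     wedge_list [e 1, e 2, e 7] I + wedge_list [e 1, e 3, e 5] I
     - wedge_list [e 1, e 4, e 6] I - wedge_list [e 2, e 3, e 6] I
     - wedge_list [e 2, e 4, e 5] I + wedge_list [e 3, e 4, e 7] I
     + wedge_list [e 5, e 6, e 7] I)"

text \<open>
  Smooth coframes on an open set \<open>V\<close> inside the domain of a chart \<open>c\<close>: the 1-forms \<open>e a\<close> are given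
  by their components with respect to \<open>c\<close>.
\<close>

definition coframe :: "'m topology \<Rightarrow> 'm chart \<Rightarrow> 'm set \<Rightarrow> ('m \<Rightarrow> 7 \<Rightarrow> tens) \<Rightarrow> bool" where
  "coframe M c V e \<longleftrightarrow> openin M V \<and> V \<subseteq> fst c \<and>
     (\<forall>a i. smooth_in c V (\<lambda>q. e q a [i])) \<and>
     (\<forall>q\<in>V. det (\<chi> a i. e q a [i]) \<noteq> 0)"

definition adapted_coframe ::
    "'m topology \<Rightarrow> 'm field \<Rightarrow> 'm chart \<Rightarrow> 'm set \<Rightarrow> ('m \<Rightarrow> 7 \<Rightarrow> tens) \<Rightarrow> bool" where
  "adapted_coframe M \<phi> c V e \<longleftrightarrow> coframe M c V e \<and>
     (\<forall>q\<in>V. \<forall>I\<in>idx 3. \<phi> c q I = g2_model (e q) I)"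

definition g2_structure :: "'m topology \<Rightarrow> 'm chart set \<Rightarrow> 'm field \<Rightarrow> bool" where
  "g2_structure M A \<phi> \<longleftrightarrow> diff_form A 3 \<phi> \<and>
     (\<forall>c\<in>A. \<forall>p\<in>fst c. \<exists>V e. p \<in> V \<and> adapted_coframe M \<phi> c V e)"

text \<open>
  The metric and the orientation determined by a $G_2$ structure: those for which all adapted
  coframes are orthonormal and oriented. The orientation is recorded as the volume form \<open>\<omega>\<close>.
\<close>

definition g2_metric_volume ::
    "'m topology \<Rightarrow> 'm chart set \<Rightarrow> 'm field \<Rightarrow> 'm field \<Rightarrow> 'm field \<Rightarrow> bool" where
  "g2_metric_volume M A \<phi> g \<omega> \<longleftrightarrow> riemannian_metric A g \<and> diff_form A 7 \<omega> \<and>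
     (\<forall>c\<in>A. \<forall>V e. adapted_coframe M \<phi> c V e \<longrightarrow> (\<forall>q\<in>V.
        (\<forall>i j. g c q [i, j] = (\<Sum>a\<in>UNIV. e q a [i] * e q a [j])) \<and>
        (\<forall>I\<in>idx 7. \<omega> c q I = wedge_list [e q 1, e q 2, e q 3, e q 4, e q 5, e q 6, e q 7] I)))"

definition lee_form :: "'m field \<Rightarrow> 'm field \<Rightarrow> 'm field \<Rightarrow> 'm field" where
  "lee_form g \<omega> \<phi> = (\<lambda>c p I. - (1 / 3) *
     star g \<omega> 6 (wedge_field 3 3 (star g \<omega> 4 (ext_d \<phi>)) \<phi>) c p I)"

definition g2_integrable :: "'m chart set \<Rightarrow> 'm field \<Rightarrow> 'm field \<Rightarrow> 'm field \<Rightarrow> bool" where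
  "g2_integrable A g \<omega> \<phi> \<longleftrightarrow>
     field_eq A 5 (ext_d (star g \<omega> 3 \<phi>)) (wedge_field 1 4 (lee_form g \<omega> \<phi>) (star g \<omega> 3 \<phi>))"

definition g2_constant_type :: "'m chart set \<Rightarrow> 'm field \<Rightarrow> 'm field \<Rightarrow> 'm field \<Rightarrow> bool" where
  "g2_constant_type A g \<omega> \<phi> \<longleftrightarrow>
     (\<exists>r. \<forall>c\<in>A. \<forall>p\<in>fst c. form_inner (g c p) 4 (ext_d \<phi> c p) (star g \<omega> 3 \<phi> c p) = r)"

text \<open>The metric connection preserving \<open>\<phi>\<close> whose torsion is a 3-form (unique when it exists).\<close>

definition characteristic_connection ::
    "'m chart set \<Rightarrow> 'm field \<Rightarrow> 'm field \<Rightarrow> 'm christoffel \<Rightarrow> bool" where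
  "characteristic_connection A g \<phi> D \<longleftrightarrow> connection A D \<and> parallel A D 2 g \<and>
     parallel A D 3 \<phi> \<and> diff_form A 3 (torsion g D)"

definition g2_instanton ::
    "'m chart set \<Rightarrow> 'm field \<Rightarrow> 'm field \<Rightarrow> 'm christoffel \<Rightarrow> bool" where
  "g2_instanton A g \<phi> D \<longleftrightarrow> (\<forall>c\<in>A. \<forall>p\<in>fst c. \<forall>i j k.
     (\<Sum>a\<in>UNIV. \<Sum>b\<in>UNIV. \<Sum>a'\<in>UNIV. \<Sum>b'\<in>UNIV.
        ginv (g c p) a a' * ginv (g c p) b b' *
        curvature g D c p [a, b, i, j] * \<phi> c p [a', b', k]) = 0)"

end

theory Submission
  imports Defs
begin

text \<open>
  In an adapted coframe the components of \<open>\<phi>\<close> and \<open>*\<phi>\<close> are constants \<open>\<phi>\<^sub>i\<^sub>j\<^sub>k\<close>, \<open>\<psi>\<^sub>i\<^sub>j\<^sub>k\<^sub>l\<close>, parallel for the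
  characteristic connection \<open>\<nabla>\<close>. Put \<open>\<sigma>\<^sub>i\<^sub>j\<^sub>k\<^sub>l = T\<^sub>i\<^sub>j\<^sub>s T\<^sub>k\<^sub>l\<^sub>s + T\<^sub>j\<^sub>k\<^sub>s T\<^sub>i\<^sub>l\<^sub>s + T\<^sub>k\<^sub>i\<^sub>s T\<^sub>j\<^sub>l\<^sub>s\<close>; the Levi-Civita derivative of
  \<open>T\<close> differs from \<open>\<nabla>T\<close> by a multiple of \<open>\<sigma>\<close>. Contracting the first Bianchi identity
  \<open>R\<^sub>i\<^sub>j\<^sub>k\<^sub>l + R\<^sub>j\<^sub>k\<^sub>i\<^sub>l + R\<^sub>k\<^sub>i\<^sub>j\<^sub>l = \<nabla>\<^sub>i T\<^sub>j\<^sub>k\<^sub>l + \<nabla>\<^sub>j T\<^sub>k\<^sub>i\<^sub>l + \<nabla>\<^sub>k T\<^sub>i\<^sub>j\<^sub>l + \<sigma>\<^sub>i\<^sub>j\<^sub>k\<^sub>l\<close> with the metric, \<open>\<phi>\<close> and \<open>\<psi>\<close>, and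
  using \<open>R \<in> g\<^sub>2 \<otimes> g\<^sub>2\<close>, \<open>Ric = 0\<close> and the constancy of \<open>(d\<phi>, *\<phi>) = \<phi>\<^sub>i\<^sub>j\<^sub>k T\<^sub>i\<^sub>j\<^sub>k\<close>, one finds that \<open>T\<close> is
  coclosed, that \<open>dT = 2/3 \<sigma>\<close>, and that the vector \<open>\<theta>\<^sub>m = \<psi>\<^sub>i\<^sub>j\<^sub>l\<^sub>m T\<^sub>i\<^sub>j\<^sub>l\<close> satisfies \<open>\<nabla>\<^sub>k \<theta>\<^sub>m = N\<^sub>k\<^sub>m\<close> with the
  symmetric tensor \<open>N\<^sub>k\<^sub>m = 1/3 \<psi>\<^sub>i\<^sub>j\<^sub>l\<^sub>m \<sigma>\<^sub>i\<^sub>j\<^sub>l\<^sub>k\<close>, which annihilates \<open>\<theta>\<close>.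

  It remains to see that \<open>\<sigma> = 0\<close>, and \<open>\<sigma>\<close> is determined by \<open>N\<close>. The twice contracted second Bianchi
  identity reads \<open>T\<^sub>s\<^sub>k\<^sub>i R\<^sub>j\<^sub>s\<^sub>k\<^sub>i = 0\<close>; this makes the norm of \<open>T\<close> constant, and the norm of \<open>\<theta>\<close> is constant because
  \<open>N \<theta> = 0\<close>. The trace of \<open>N\<close> is a combination of the two norms and of \<open>(\<phi>\<^sub>i\<^sub>j\<^sub>k T\<^sub>i\<^sub>j\<^sub>k)\<^sup>2\<close>, hence constant as well, so
  the traced Ricci identity for \<open>\<theta>\<close> shows that \<open>N\<close> is divergence free. The divergence of the
  equation \<open>N \<theta> = 0\<close> is now \<open>\<Sum> N\<^sub>k\<^sub>m\<^sup>2 = 0\<close>.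
\<close>

section \<open>The model 3-form and its dual\<close>

text \<open>Pair symmetry of \<open>R\<close> is not known for a connection with torsion, so the
  conditions on its two pairs of arguments are used separately. Contracting the Bianchi identity
  with phi over its first three slots, and again with the third slot left free, gives
  \<open>3 X + s = 0\<close> and \<open>2 X + s = 0\<close>, where \<open>s\<close> is the
  contraction of sigma with phi; the unequal coefficients force both to vanish.

  Under G2 the 3-forms and the 4-forms split into pieces of dimension 1, 7 and 27. Contraction with
  psi embeds the 4-forms into the 7 by 7 matrices, the piece of dimension 7 becoming the skew part.
  For sigma that piece is measured by \<open>s\<close>; hence \<open>N\<close> is symmetric.
  Identities between 4-forms may be checked on matrices, where \<open>dT\<close> appears as -1 - 1/3
  + 2 times sigma: this is the factor 2/3.

  The other pieces of sigma are reached through derivatives: \<open>N\<close> is the covariant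
  derivative of theta, so \<open>N theta = 0\<close> can be differentiated once more, and the
  divergence of \<open>N\<close> is under control because the traced Ricci identity sees the
  curvature only through its Ricci tensor.\<close>

lemma UNIV7: "(UNIV::7 set) = {1,2,3,4,5,6,7}"
proof -
  have "card {1,2,3,4,5,6,7::7} = CARD(7)" by simp
  then show ?thesis by (metis card_subset_eq finite subset_UNIV)
qed

lemma sum7: "(\<Sum>i\<in>UNIV. f (i::7)) = f 1 + f 2 + f 3 + f 4 + f 5 + f 6 + (f 7 :: 'a::comm_monoid_add)"
  unfolding UNIV7 by (simp add: add.assoc)

lemma all7: "(\<forall>i::7. P i) \<longleftrightarrow> P 1 \<and> P 2 \<and> P 3 \<and> P 4 \<and> P 5 \<and> P 6 \<and> P 7"
proof -
  have "(\<forall>i::7. P i) \<longleftrightarrow> (\<forall>i\<in>{1,2,3,4,5,6,7}. P i)" using UNIV7 by blast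
  then show ?thesis by simp
qed

abbreviation (input) sum_idx :: "(7 \<Rightarrow> real) \<Rightarrow> real" (binder "\<^bold>\<Sum>" 10)
  where "sum_idx f \<equiv> sum f UNIV"

definition kd :: "7 \<Rightarrow> 7 \<Rightarrow> real" where "kd i j = (if i = j then 1 else 0)"

lemma kd_table:
  "kd 1 1 = 1" "kd 1 2 = 0" "kd 1 3 = 0" "kd 1 4 = 0" "kd 1 5 = 0" "kd 1 6 = 0" "kd 1 7 = 0"
  "kd 2 1 = 0" "kd 2 2 = 1" "kd 2 3 = 0" "kd 2 4 = 0" "kd 2 5 = 0" "kd 2 6 = 0" "kd 2 7 = 0"
  "kd 3 1 = 0" "kd 3 2 = 0" "kd 3 3 = 1" "kd 3 4 = 0" "kd 3 5 = 0" "kd 3 6 = 0" "kd 3 7 = 0"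
  "kd 4 1 = 0" "kd 4 2 = 0" "kd 4 3 = 0" "kd 4 4 = 1" "kd 4 5 = 0" "kd 4 6 = 0" "kd 4 7 = 0"
  "kd 5 1 = 0" "kd 5 2 = 0" "kd 5 3 = 0" "kd 5 4 = 0" "kd 5 5 = 1" "kd 5 6 = 0" "kd 5 7 = 0"
  "kd 6 1 = 0" "kd 6 2 = 0" "kd 6 3 = 0" "kd 6 4 = 0" "kd 6 5 = 0" "kd 6 6 = 1" "kd 6 7 = 0"
  "kd 7 1 = 0" "kd 7 2 = 0" "kd 7 3 = 0" "kd 7 4 = 0" "kd 7 5 = 0" "kd 7 6 = 0" "kd 7 7 = 1"
  by (simp_all add: kd_def)

lemma sum_if_const: "(\<^bold>\<Sum>i. if b then f i else 0) = (if b then \<^bold>\<Sum>i. f i else 0)"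
  by simp

lemma kd_mult: "kd i j * x = (if i = j then x else 0)" "x * kd i j = (if i = j then x else 0)"
  by (simp_all add: kd_def)

lemma mult_if_zero:
  "x * (if b then y else 0) = (if b then x * y else (0::real))"
  "(if b then y else 0) * x = (if b then y * x else (0::real))"
  by simp_all

lemmas kd_simps = kd_mult mult_if_zero sum_if_const

lemma kd_sym: "kd i j = kd j i"
  by (simp add: kd_def)

lemma sum_kd [simp]:
  "(\<^bold>\<Sum>i. kd i j * f i) = f j" "(\<^bold>\<Sum>i. kd j i * f i) = f j"
  "(\<^bold>\<Sum>i. f i * kd i j) = f j" "(\<^bold>\<Sum>i. f i * kd j i) = f j"
  by (simp_all add: kd_mult)

text \<open>The cross product of basis vectors is \<open>e\<^sub>i \<times> e\<^sub>j = sg i j \<cdot> e\<^sub>k\<close> with \<open>k = pr i j\<close>; \<open>pr i i\<close> is arbitrary.\<close>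

definition sg :: "7 \<Rightarrow> 7 \<Rightarrow> real" where
  "sg i j = (if i = 1 then (if j = 1 then 0 else if j = 2 then 1 else if j = 3 then 1 else if j = 4 then -1 else if j = 5 then -1 else if j = 6 then 1 else -1)
     else if i = 2 then (if j = 1 then -1 else if j = 2 then 0 else if j = 3 then -1 else if j = 4 then -1 else if j = 5 then 1 else if j = 6 then 1 else 1)
     else if i = 3 then (if j = 1 then -1 else if j = 2 then 1 else if j = 3 then 0 else if j = 4 then 1 else if j = 5 then 1 else if j = 6 then -1 else -1)
     else if i = 4 then (if j = 1 then 1 else if j = 2 then 1 else if j = 3 then -1 else if j = 4 then 0 else if j = 5 then -1 else if j = 6 then -1 else 1)
     else if i = 5 then (if j = 1 then 1 else if j = 2 then -1 else if j = 3 then -1 else if j = 4 then 1 else if j = 5 then 0 else if j = 6 then 1 else -1)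
     else if i = 6 then (if j = 1 then -1 else if j = 2 then -1 else if j = 3 then 1 else if j = 4 then 1 else if j = 5 then -1 else if j = 6 then 0 else 1)
     else (if j = 1 then 1 else if j = 2 then -1 else if j = 3 then 1 else if j = 4 then -1 else if j = 5 then 1 else if j = 6 then -1 else 0))"

definition pr :: "7 \<Rightarrow> 7 \<Rightarrow> 7" where
  "pr i j = (if i = 1 then (if j = 1 then 1 else if j = 2 then 7 else if j = 3 then 5 else if j = 4 then 6 else if j = 5 then 3 else if j = 6 then 4 else 2)
     else if i = 2 then (if j = 1 then 7 else if j = 2 then 2 else if j = 3 then 6 else if j = 4 then 5 else if j = 5 then 4 else if j = 6 then 3 else 1)
     else if i = 3 then (if j = 1 then 5 else if j = 2 then 6 else if j = 3 then 3 else if j = 4 then 7 else if j = 5 then 1 else if j = 6 then 2 else 4)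
     else if i = 4 then (if j = 1 then 6 else if j = 2 then 5 else if j = 3 then 7 else if j = 4 then 4 else if j = 5 then 2 else if j = 6 then 1 else 3)
     else if i = 5 then (if j = 1 then 3 else if j = 2 then 4 else if j = 3 then 1 else if j = 4 then 2 else if j = 5 then 5 else if j = 6 then 7 else 6)
     else if i = 6 then (if j = 1 then 4 else if j = 2 then 3 else if j = 3 then 2 else if j = 4 then 1 else if j = 5 then 7 else if j = 6 then 6 else 5)
     else (if j = 1 then 2 else if j = 2 then 1 else if j = 3 then 4 else if j = 4 then 3 else if j = 5 then 6 else if j = 6 then 5 else 7))"

lemma sg_table:
  "sg 1 1 = 0" "sg 1 2 = 1" "sg 1 3 = 1" "sg 1 4 = -1" "sg 1 5 = -1" "sg 1 6 = 1" "sg 1 7 = -1"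
  "sg 2 1 = -1" "sg 2 2 = 0" "sg 2 3 = -1" "sg 2 4 = -1" "sg 2 5 = 1" "sg 2 6 = 1" "sg 2 7 = 1"
  "sg 3 1 = -1" "sg 3 2 = 1" "sg 3 3 = 0" "sg 3 4 = 1" "sg 3 5 = 1" "sg 3 6 = -1" "sg 3 7 = -1"
  "sg 4 1 = 1" "sg 4 2 = 1" "sg 4 3 = -1" "sg 4 4 = 0" "sg 4 5 = -1" "sg 4 6 = -1" "sg 4 7 = 1"
  "sg 5 1 = 1" "sg 5 2 = -1" "sg 5 3 = -1" "sg 5 4 = 1" "sg 5 5 = 0" "sg 5 6 = 1" "sg 5 7 = -1"
  "sg 6 1 = -1" "sg 6 2 = -1" "sg 6 3 = 1" "sg 6 4 = 1" "sg 6 5 = -1" "sg 6 6 = 0" "sg 6 7 = 1"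
  "sg 7 1 = 1" "sg 7 2 = -1" "sg 7 3 = 1" "sg 7 4 = -1" "sg 7 5 = 1" "sg 7 6 = -1" "sg 7 7 = 0"
  by (simp_all add: sg_def)

lemma pr_table:
  "pr 1 1 = 1" "pr 1 2 = 7" "pr 1 3 = 5" "pr 1 4 = 6" "pr 1 5 = 3" "pr 1 6 = 4" "pr 1 7 = 2"
  "pr 2 1 = 7" "pr 2 2 = 2" "pr 2 3 = 6" "pr 2 4 = 5" "pr 2 5 = 4" "pr 2 6 = 3" "pr 2 7 = 1"
  "pr 3 1 = 5" "pr 3 2 = 6" "pr 3 3 = 3" "pr 3 4 = 7" "pr 3 5 = 1" "pr 3 6 = 2" "pr 3 7 = 4"
  "pr 4 1 = 6" "pr 4 2 = 5" "pr 4 3 = 7" "pr 4 4 = 4" "pr 4 5 = 2" "pr 4 6 = 1" "pr 4 7 = 3"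
  "pr 5 1 = 3" "pr 5 2 = 4" "pr 5 3 = 1" "pr 5 4 = 2" "pr 5 5 = 5" "pr 5 6 = 7" "pr 5 7 = 6"
  "pr 6 1 = 4" "pr 6 2 = 3" "pr 6 3 = 2" "pr 6 4 = 1" "pr 6 5 = 7" "pr 6 6 = 6" "pr 6 7 = 5"
  "pr 7 1 = 2" "pr 7 2 = 1" "pr 7 3 = 4" "pr 7 4 = 3" "pr 7 5 = 6" "pr 7 6 = 5" "pr 7 7 = 7"
  by (simp_all add: pr_def)
definition phi :: "7 \<Rightarrow> 7 \<Rightarrow> 7 \<Rightarrow> real"
  where "phi i j k = sg i j * kd (pr i j) k"

text \<open>This is the contraction identity of the cross product solved for the 4-form, so
  \<open>phi_phi\<close> holds by construction. That the result is the Hodge dual of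
  \<open>phi\<close> is proved later, in \<open>hodge3_phi\<close>.\<close>

definition psi :: "7 \<Rightarrow> 7 \<Rightarrow> 7 \<Rightarrow> 7 \<Rightarrow> real"
  where "psi i j k l = sg i j * sg k l * kd (pr i j) (pr k l) - kd i k * kd j l + kd i l * kd j k"

lemma phi_alt: "phi j i k = - phi i j k" "phi i k j = - phi i j k"
proof -
  have "\<forall>i j k. phi j i k = - phi i j k \<and> phi i k j = - phi i j k"
    unfolding all7 phi_def sg_table pr_table kd_def by simp
  then show "phi j i k = - phi i j k" "phi i k j = - phi i j k" by blast+
qed

lemma phi_phi: "(\<^bold>\<Sum>s. phi i j s * phi k l s) = kd i k * kd j l - kd i l * kd j k + psi i j k l"
proof -
  have "(\<^bold>\<Sum>s. phi i j s * phi k l s) = (\<^bold>\<Sum>s. kd (pr i j) s * (sg i j * sg k l * kd (pr k l) s))"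
    by (rule sum.cong) (simp_all add: phi_def)
  then show ?thesis by (simp add: psi_def kd_sym)
qed

lemma psi_alt: "psi j i k l = - psi i j k l" "psi i k j l = - psi i j k l" "psi i j l k = - psi i j k l"
proof -
  \<comment> \<open>Only the exchange of the two middle indices needs the multiplication table; the
    outer exchanges are inherited from \<open>phi\<close> through \<open>phi_phi\<close>.\<close>
  have "\<forall>i j k l. psi i k j l = - psi i j k l"
    unfolding all7 psi_def sg_table pr_table kd_def by simp
  then show "psi i k j l = - psi i j k l" by blast
  have a: "(\<^bold>\<Sum>s. phi j i s * phi k l s) = - (\<^bold>\<Sum>s. phi i j s * phi k l s)" for i j k l
    by (simp add: phi_alt(1)[of i j] sum_negf)
  have b: "(\<^bold>\<Sum>s. phi i j s * phi l k s) = - (\<^bold>\<Sum>s. phi i j s * phi k l s)" for i j k l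
    by (simp add: phi_alt(1)[of l k] sum_negf)
  show "psi j i k l = - psi i j k l" using a[of j i k l] by (simp add: phi_phi)
  show "psi i j l k = - psi i j k l" using b[of i j l k] by (simp add: phi_phi)
qed

text \<open>In the order of the type \<open>7\<close> itself the element \<open>7 = 0\<close> would come first.\<close>

definition rk :: "7 \<Rightarrow> nat" where
  "rk i = (if i = 1 then 1 else if i = 2 then 2 else if i = 3 then 3 else if i = 4 then 4
    else if i = 5 then 5 else if i = 6 then 6 else 7)"

lemma rk_table: "rk 1 = 1" "rk 2 = 2" "rk 3 = 3" "rk 4 = 4" "rk 5 = 5" "rk 6 = 6" "rk 7 = 7"
  by (simp_all add: rk_def)

lemma phi_cyc: "phi j k i = phi i j k"
  using phi_alt by metis

text \<open>A check of all 7^5 index tuples is avoided by a symmetry argument. The difference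
  \<open>E\<close> of the two sides is skew in its first two and in its last three indices, and it
  changes sign when the block \<open>i j\<close> is exchanged with the block \<open>l m\<close>
  (\<open>e4\<close>). These rules make \<open>E\<close> totally alternating, and then
  \<open>e4\<close> contradicts the sign of the permutation unless \<open>E\<close>
  vanishes.\<close>

lemma phi_psi:
  "(\<^bold>\<Sum>s. phi i j s * psi s k l m) =
     kd i k * phi j l m + kd i l * phi k j m + kd i m * phi k l j
     - kd j k * phi i l m - kd j l * phi k i m - kd j m * phi k l i"
proof -
  define X where "X i j k l m = (\<^bold>\<Sum>s. phi i j s * psi s k l m)" for i j k l m
  define Y where "Y i j k l m = kd i k * phi j l m + kd i l * phi k j m + kd i m * phi k l j
     - kd j k * phi i l m - kd j l * phi k i m - kd j m * phi k l i" for i j k l m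
  define E where "E i j k l m = X i j k l m - Y i j k l m" for i j k l m
  have e1: "E j i k l m = - E i j k l m" for i j k l m
    by (simp add: E_def X_def Y_def phi_alt(1)[of i j] sum_negf)
  have e2: "E i j l k m = - E i j k l m" for i j k l m
    by (simp add: E_def X_def Y_def psi_alt(2)[of _ l k] phi_alt(1)[of j k m] phi_alt(1)[of l j m]
      phi_alt(1)[of l k j] phi_alt(1)[of i k m] phi_alt(1)[of l i m] phi_alt(1)[of l k i] sum_negf)
  have e3: "E i j k m l = - E i j k l m" for i j k l m
    by (simp add: E_def X_def Y_def psi_alt(3)[of _ _ m l] phi_alt(2)[of j m l] phi_alt(2)[of k j l]
      phi_alt(2)[of k m j] phi_alt(2)[of i m l] phi_alt(2)[of k i l] phi_alt(2)[of k m i] sum_negf)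
  have ps: "psi i j k l = (\<^bold>\<Sum>s. phi i j s * phi k l s) - kd i k * kd j l + kd i l * kd j k" for i j k l
    by (simp add: phi_phi)
  \<comment> \<open>The triple contraction of \<open>phi\<close> along a chain can be evaluated from
    either end; the two evaluations differ by the metric terms on the right.\<close>
  have "X i j k l m + X l m i j k = kd i k * phi l m j - kd j k * phi l m i - phi i j l * kd k m + phi i j m * kd k l" for i j k l m
  proof -
    have "X i j k l m = (\<^bold>\<Sum>s. \<^bold>\<Sum>r. phi i j s * (phi s k r * phi l m r))
        + (\<^bold>\<Sum>s. (phi i j s * kd k l) * kd s m) - (\<^bold>\<Sum>s. (phi i j s * kd k m) * kd s l)"
      unfolding X_def by (simp add: ps[of _ k] algebra_simps sum.distrib sum_subtractf sum_distrib_left)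
    also have "(\<^bold>\<Sum>s. \<^bold>\<Sum>r. phi i j s * (phi s k r * phi l m r)) = (\<^bold>\<Sum>r. (\<^bold>\<Sum>s. phi i j s * phi k r s) * phi l m r)"
      by (subst sum.swap) (simp add: sum_distrib_right phi_cyc mult.assoc)
    also have "\<dots> = kd i k * phi l m j - kd j k * phi l m i - (\<^bold>\<Sum>r. phi l m r * psi r i j k)"
    proof -
      have c: "psi i j k r = - psi r i j k" for r
        using psi_alt by (metis minus_minus)
      show ?thesis
        by (simp add: phi_phi c algebra_simps sum.distrib sum_subtractf kd_simps sum_negf)
    qed
    finally show ?thesis by (simp add: X_def sum_distrib_right[symmetric] kd_mult)
  qed
  moreover have "Y i j k l m + Y l m i j k = kd i k * phi l m j - kd j k * phi l m i - phi i j l * kd k m + phi i j m * kd k l" for i j k l m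
  proof -
    have "phi k j m = - phi j k m" "phi k l j = phi j k l" "phi k i m = - phi i k m" "phi k l i = phi i k l"
      "phi m j k = phi j k m" "phi i m k = - phi i k m" "phi l j k = phi j k l" "phi i l k = - phi i k l"
      "phi l m j = phi j l m" "phi l m i = phi i l m"
      using phi_alt phi_cyc by metis+
    then show ?thesis
      by (simp add: Y_def kd_sym[of l i] kd_sym[of l j] kd_sym[of l k] kd_sym[of m i] kd_sym[of m j] kd_sym[of m k])
  qed
  ultimately have e4: "E i j k l m = - E l m i j k" for i j k l m
    unfolding E_def by (smt (verit))
  have cyc: "E k i j l m = E i j k l m" for i j k l m
    using e4[of i j k l m] e4[of l m j k i] e2 e3 by (smt (verit))
  have e5: "E i k j l m = - E i j k l m" for i j k l m
    using cyc[of i k j l m] cyc e1 by (smt (verit))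
  \<comment> \<open>Moving two indices past three takes six transpositions, an even
    permutation.\<close>
  have "E l m i j k = E i j k l m"
  proof -
    have "E l m i j k = E i l m j k" using e5 e1 by (smt (verit))
    also have "\<dots> = E i j l m k" using e5 e2 by (smt (verit))
    also have "\<dots> = E i j k l m" using e2 e3 by (smt (verit))
    finally show ?thesis .
  qed
  then have "E i j k l m = 0" using e4[of i j k l m] by simp
  then show ?thesis by (simp add: E_def X_def Y_def)
qed

section \<open>Contractions of alternating tensors\<close>

lemma sum_rot3: "(\<^bold>\<Sum>i j k. f j k i) = (\<^bold>\<Sum>i j k. f i j k)"
proof -
  have "(\<^bold>\<Sum>i j k. f j k i) = (\<^bold>\<Sum>j i k. f j k i)" by (rule sum.swap)
  also have "\<dots> = (\<^bold>\<Sum>j k i. f j k i)" by (rule sum.cong[OF refl], rule sum.swap)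
  finally show ?thesis .
qed

lemma sum2_sym:
  fixes f :: "7 \<Rightarrow> 7 \<Rightarrow> real"
  assumes "\<And>i j. f j i = f i j" "\<And>i. f i i = 0"
  shows "(\<^bold>\<Sum>i j. f i j) = 2 * (f 1 2 + f 1 3 + f 1 4 + f 1 5 + f 1 6 + f 1 7 + f 2 3 + f 2 4 + f 2 5 + f 2 6 + f 2 7 + f 3 4 + f 3 5 + f 3 6 + f 3 7 + f 4 5 + f 4 6 + f 4 7 + f 5 6 + f 5 7 + f 6 7)"
  by (simp add: sum7 assms)

lemma sum3_sym:
  fixes f :: "7 \<Rightarrow> 7 \<Rightarrow> 7 \<Rightarrow> real"
  assumes "\<And>i j k. f j i k = f i j k" "\<And>i j k. f i k j = f i j k" "\<And>i k. f i i k = 0"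
  shows "(\<^bold>\<Sum>i j k. f i j k) = 6 * (f 1 2 3 + f 1 2 4 + f 1 2 5 + f 1 2 6 + f 1 2 7 + f 1 3 4 + f 1 3 5 + f 1 3 6 + f 1 3 7 + f 1 4 5 + f 1 4 6 + f 1 4 7 + f 1 5 6 + f 1 5 7 + f 1 6 7 + f 2 3 4 + f 2 3 5 + f 2 3 6 + f 2 3 7 + f 2 4 5 + f 2 4 6 + f 2 4 7 + f 2 5 6 + f 2 5 7 + f 2 6 7 + f 3 4 5 + f 3 4 6 + f 3 4 7 + f 3 5 6 + f 3 5 7 + f 3 6 7 + f 4 5 6 + f 4 5 7 + f 4 6 7 + f 5 6 7)"
proof -
  have d: "f i k k = 0" for i k by (metis assms)
  show ?thesis by (simp add: sum7 assms d)
qed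

definition alt2 :: "(7 \<Rightarrow> 7 \<Rightarrow> real) \<Rightarrow> bool"
  where "alt2 F \<longleftrightarrow> (\<forall>i j. F j i = - F i j)"

definition alt3 :: "(7 \<Rightarrow> 7 \<Rightarrow> 7 \<Rightarrow> real) \<Rightarrow> bool"
  where "alt3 T \<longleftrightarrow> (\<forall>i j k. T j i k = - T i j k \<and> T i k j = - T i j k)"

definition alt4 :: "(7 \<Rightarrow> 7 \<Rightarrow> 7 \<Rightarrow> 7 \<Rightarrow> real) \<Rightarrow> bool"
  where "alt4 W \<longleftrightarrow> (\<forall>i j k l. W j i k l = - W i j k l \<and> W i k j l = - W i j k l \<and> W i j l k = - W i j k l)"

lemma alt2D: "alt2 F \<Longrightarrow> F j i = - F i j"
  unfolding alt2_def by blast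

lemma alt3D: assumes "alt3 T" shows "T j i k = - T i j k" "T i k j = - T i j k" "T i i k = 0" "T i k k = 0" "T i k i = 0"
proof -
  show a: "T j i k = - T i j k" "T i k j = - T i j k" for i j k using assms unfolding alt3_def by metis+
  show "T i i k = 0" "T i k k = 0" "T i k i = 0"
    using a(1)[of i i k] a(2)[of i k k] a(2)[of i i k] by linarith+
qed

lemma alt3_cyc: "alt3 T \<Longrightarrow> T j k i = T i j k"
  by (metis alt3D(1,2))

lemma alt4D: assumes "alt4 W" shows "W j i k l = - W i j k l" "W i k j l = - W i j k l" "W i j l k = - W i j k l"
    "W i i k l = 0" "W i k k l = 0" "W i k l l = 0"
proof -
  show a: "W j i k l = - W i j k l" "W i k j l = - W i j k l" "W i j l k = - W i j k l" for i j k l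
    using assms unfolding alt4_def by metis+
  show "W i i k l = 0" "W i k k l = 0" "W i k l l = 0" using a(1)[of i i k l] a(2)[of i k k l] a(3)[of i k l l] by linarith+
qed

text \<open>The guard on \<open>rk\<close> orients the exchange rules: every rewrite removes an
  inversion, so simplification terminates with increasing indices.\<close>

lemma alt3_sort:
  assumes "alt3 T"
  shows "rk j < rk i \<Longrightarrow> T i j k = - T j i k" "rk k < rk j \<Longrightarrow> T i j k = - T i k j"
    "T i i k = 0" "T i k k = 0"
  using alt3D[OF assms] by metis+

lemma alt4_sort:
  assumes "alt4 W"
  shows "rk j < rk i \<Longrightarrow> W i j k l = - W j i k l" "rk k < rk j \<Longrightarrow> W i j k l = - W i k j l"
    "rk l < rk k \<Longrightarrow> W i j k l = - W i j l k" "W i i k l = 0" "W i k k l = 0" "W i k l l = 0"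
  using alt4D[OF assms] by metis+

section \<open>Contractions of 3-forms and 4-forms with phi and psi\<close>

definition Pm :: "(7 \<Rightarrow> 7 \<Rightarrow> 7 \<Rightarrow> real) \<Rightarrow> 7 \<Rightarrow> 7 \<Rightarrow> real"
  where "Pm T m s = (\<^bold>\<Sum>i j. phi m i j * T s i j)"

definition tv :: "(7 \<Rightarrow> 7 \<Rightarrow> 7 \<Rightarrow> real) \<Rightarrow> 7 \<Rightarrow> real"
  where "tv T m = (\<^bold>\<Sum>i j l. psi i j l m * T i j l)"

definition sv :: "(7 \<Rightarrow> 7 \<Rightarrow> 7 \<Rightarrow> 7 \<Rightarrow> real) \<Rightarrow> 7 \<Rightarrow> real"
  where "sv W k = (\<^bold>\<Sum>i j l. phi i j l * W i j l k)"

definition Sg :: "(7 \<Rightarrow> 7 \<Rightarrow> 7 \<Rightarrow> 7 \<Rightarrow> real) \<Rightarrow> 7 \<Rightarrow> 7 \<Rightarrow> real"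
  where "Sg W k m = (\<^bold>\<Sum>i j l. psi i j l m * W i j l k)"

lemma phi_contr2:
  assumes "alt2 F"
  shows "(\<^bold>\<Sum>i j. phi 1 i j * F i j) = 2 * (F 2 7 + F 3 5 - F 4 6)"
    "(\<^bold>\<Sum>i j. phi 2 i j * F i j) = 2 * (- F 1 7 - F 3 6 - F 4 5)"
    "(\<^bold>\<Sum>i j. phi 3 i j * F i j) = 2 * (- F 1 5 + F 2 6 + F 4 7)"
    "(\<^bold>\<Sum>i j. phi 4 i j * F i j) = 2 * (F 1 6 + F 2 5 - F 3 7)"
    "(\<^bold>\<Sum>i j. phi 5 i j * F i j) = 2 * (F 1 3 - F 2 4 + F 6 7)"
    "(\<^bold>\<Sum>i j. phi 6 i j * F i j) = 2 * (- F 1 4 - F 2 3 - F 5 7)"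
    "(\<^bold>\<Sum>i j. phi 7 i j * F i j) = 2 * (F 1 2 + F 3 4 + F 5 6)"
proof -
  have s: "phi m j i * F j i = phi m i j * F i j" "phi m i i * F i i = 0" for m i j
    using alt2D[OF assms, of i i] by (simp_all add: alt2D[OF assms, of i j] phi_alt(2)[of m i j])
  show "(\<^bold>\<Sum>i j. phi 1 i j * F i j) = 2 * (F 2 7 + F 3 5 - F 4 6)"
    "(\<^bold>\<Sum>i j. phi 2 i j * F i j) = 2 * (- F 1 7 - F 3 6 - F 4 5)"
    "(\<^bold>\<Sum>i j. phi 3 i j * F i j) = 2 * (- F 1 5 + F 2 6 + F 4 7)"
    "(\<^bold>\<Sum>i j. phi 4 i j * F i j) = 2 * (F 1 6 + F 2 5 - F 3 7)"
    "(\<^bold>\<Sum>i j. phi 5 i j * F i j) = 2 * (F 1 3 - F 2 4 + F 6 7)"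
    "(\<^bold>\<Sum>i j. phi 6 i j * F i j) = 2 * (- F 1 4 - F 2 3 - F 5 7)"
    "(\<^bold>\<Sum>i j. phi 7 i j * F i j) = 2 * (F 1 2 + F 3 4 + F 5 6)"
    unfolding sum2_sym[of "\<lambda>i j. phi _ i j * F i j", OF s] by (simp_all add: phi_def sg_table pr_table kd_table)
qed

lemma phi_contr3:
  assumes "alt3 X"
  shows "(\<^bold>\<Sum>i j l. phi i j l * X i j l) = 6 * (X 1 2 7 + X 1 3 5 - X 1 4 6 - X 2 3 6 - X 2 4 5 + X 3 4 7 + X 5 6 7)"
proof -
  have s: "phi j i k * X j i k = phi i j k * X i j k" "phi i k j * X i k j = phi i j k * X i j k" "phi i i k * X i i k = 0" for i j k
    by (simp_all add: alt3D(1)[OF assms, of j i] alt3D(2)[OF assms, of i k j] alt3D(3)[OF assms] phi_alt(1)[of j i] phi_alt(2)[of i k j])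
  show ?thesis
    unfolding sum3_sym[of "\<lambda>i j k. phi i j k * X i j k", OF s] by (simp add: phi_def sg_table pr_table kd_table)
qed

lemma psi_contr3:
  assumes "alt3 X"
  shows "(\<^bold>\<Sum>i j l. psi i j l 1 * X i j l) = 6 * (- X 2 3 4 - X 2 5 6 - X 3 6 7 - X 4 5 7)"
    "(\<^bold>\<Sum>i j l. psi i j l 2 * X i j l) = 6 * (X 1 3 4 + X 1 5 6 - X 3 5 7 + X 4 6 7)"
    "(\<^bold>\<Sum>i j l. psi i j l 3 * X i j l) = 6 * (- X 1 2 4 + X 1 6 7 + X 2 5 7 - X 4 5 6)"
    "(\<^bold>\<Sum>i j l. psi i j l 4 * X i j l) = 6 * (X 1 2 3 + X 1 5 7 - X 2 6 7 + X 3 5 6)"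
    "(\<^bold>\<Sum>i j l. psi i j l 5 * X i j l) = 6 * (- X 1 2 6 - X 1 4 7 - X 2 3 7 - X 3 4 6)"
    "(\<^bold>\<Sum>i j l. psi i j l 6 * X i j l) = 6 * (X 1 2 5 - X 1 3 7 + X 2 4 7 + X 3 4 5)"
    "(\<^bold>\<Sum>i j l. psi i j l 7 * X i j l) = 6 * (X 1 3 6 + X 1 4 5 + X 2 3 5 - X 2 4 6)"
proof -
  have s: "psi j i k m * X j i k = psi i j k m * X i j k" "psi i k j m * X i k j = psi i j k m * X i j k" "psi i i k m * X i i k = 0" for i j k m
    by (simp_all add: alt3D(1)[OF assms, of j i] alt3D(2)[OF assms, of i k j] alt3D(3)[OF assms] psi_alt(1)[of j i] psi_alt(2)[of i k j])
  show "(\<^bold>\<Sum>i j l. psi i j l 1 * X i j l) = 6 * (- X 2 3 4 - X 2 5 6 - X 3 6 7 - X 4 5 7)"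
    "(\<^bold>\<Sum>i j l. psi i j l 2 * X i j l) = 6 * (X 1 3 4 + X 1 5 6 - X 3 5 7 + X 4 6 7)"
    "(\<^bold>\<Sum>i j l. psi i j l 3 * X i j l) = 6 * (- X 1 2 4 + X 1 6 7 + X 2 5 7 - X 4 5 6)"
    "(\<^bold>\<Sum>i j l. psi i j l 4 * X i j l) = 6 * (X 1 2 3 + X 1 5 7 - X 2 6 7 + X 3 5 6)"
    "(\<^bold>\<Sum>i j l. psi i j l 5 * X i j l) = 6 * (- X 1 2 6 - X 1 4 7 - X 2 3 7 - X 3 4 6)"
    "(\<^bold>\<Sum>i j l. psi i j l 6 * X i j l) = 6 * (X 1 2 5 - X 1 3 7 + X 2 4 7 + X 3 4 5)"
    "(\<^bold>\<Sum>i j l. psi i j l 7 * X i j l) = 6 * (X 1 3 6 + X 1 4 5 + X 2 3 5 - X 2 4 6)"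
    unfolding sum3_sym[of "\<lambda>i j k. psi i j k _ * X i j k", OF s] by (simp_all add: psi_def sg_table pr_table kd_table)
qed

lemma alt3_slice: "alt3 T \<Longrightarrow> alt2 (T s)"
  unfolding alt2_def alt3_def by blast

lemma alt4_slice: "alt4 W \<Longrightarrow> alt3 (\<lambda>i j l. W i j l k)"
  unfolding alt4_def alt3_def by blast

text \<open>The matrix \<open>Pm T\<close> separates the three G2-components of a 3-form: trace,
  skew part, traceless symmetric part. Its skew part and \<open>tv T\<close> both represent the
  piece of dimension 7 and are therefore proportional; the factor is read off from
  components.\<close>

lemma Pm_skew:
  assumes "alt3 T"
  shows "Pm T m s - Pm T s m = (1/3) * (\<^bold>\<Sum>n. phi m s n * tv T n)"
proof -
  have "\<forall>m s. Pm T m s - Pm T s m = (1/3) * (\<^bold>\<Sum>n. phi m s n * tv T n)"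
    unfolding all7 sum7[of "\<lambda>n. phi _ _ n * tv T n"]
    unfolding Pm_def tv_def phi_contr2[OF alt3_slice[OF assms]] psi_contr3[OF assms]
    by (simp add: alt3_sort[OF assms] rk_table phi_def sg_table pr_table kd_table)
  then show ?thesis by blast
qed

text \<open>The three pieces of a 3-form are irreducible and inequivalent, so the norm of
  \<open>T\<close>, the squared trace and the norm of \<open>tv T\<close> span the invariant
  quadratic forms. The coefficients are confirmed on the 35 independent components of
  \<open>T\<close>.\<close>

lemma Pm_norm:
  assumes "alt3 T"
  shows "9 * (\<^bold>\<Sum>m s. (Pm T m s)^2) = 12 * (\<^bold>\<Sum>i j k. (T i j k)^2) + (\<^bold>\<Sum>m. Pm T m m)^2 + (\<^bold>\<Sum>m. (tv T m)^2)"
proof -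
  have s: "(T j i k)^2 = (T i j k)^2" "(T i k j)^2 = (T i j k)^2" "(T i i k)^2 = 0" for i j k
    by (simp_all add: alt3D(1)[OF assms, of j i] alt3D(2)[OF assms, of i k j] alt3D(3)[OF assms])
  show ?thesis
    unfolding sum3_sym[of "\<lambda>i j k. (T i j k)^2", OF s] unfolding sum7
    unfolding Pm_def tv_def phi_contr2[OF alt3_slice[OF assms]] psi_contr3[OF assms]
    by (simp add: alt3_sort[OF assms] rk_table power2_eq_square algebra_simps)
qed

text \<open>The skew part of \<open>Sg W\<close> and the vector \<open>sv W\<close> both represent
  the piece of dimension 7 of a 4-form, so one vanishes with the other.\<close>

lemma Sg_sym:
  assumes "alt4 W" and "\<And>k. sv W k = 0"
  shows "Sg W k m = Sg W m k"
proof -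
  have v: "\<forall>k. sv W k = 0" using assms(2) by blast
  have "\<forall>k m. Sg W k m = Sg W m k"
    using v unfolding all7
    by (simp add: Sg_def sv_def phi_contr3[OF alt4_slice[OF assms(1)]] psi_contr3[OF alt4_slice[OF assms(1)]]
        alt4_sort[OF assms(1)] rk_table)
  then show ?thesis by blast
qed

text \<open>Injectivity of the embedding of 4-forms into matrices: the 49 entries of
  \<open>Sg W\<close> are signed sums of at most four components of \<open>W\<close>, and this
  linear system determines all 35 of them. Equations between 4-forms are reduced to matrices in this
  way.\<close>

lemma Sg_zero:
  assumes "alt4 W" and "\<And>k m. Sg W k m = 0"
  shows "W i j k l = 0"
proof -
  have v: "\<forall>m k. Sg W k m = 0" using assms(2) by blast
  have e: "W 1 2 3 4 = 0"
    "W 1 2 3 5 = 0"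
    "W 1 2 3 6 = 0"
    "W 1 2 3 7 = 0"
    "W 1 2 4 5 = 0"
    "W 1 2 4 6 = 0"
    "W 1 2 4 7 = 0"
    "W 1 2 5 6 = 0"
    "W 1 2 5 7 = 0"
    "W 1 2 6 7 = 0"
    "W 1 3 4 5 = 0"
    "W 1 3 4 6 = 0"
    "W 1 3 4 7 = 0"
    "W 1 3 5 6 = 0"
    "W 1 3 5 7 = 0"
    "W 1 3 6 7 = 0"
    "W 1 4 5 6 = 0"
    "W 1 4 5 7 = 0"
    "W 1 4 6 7 = 0"
    "W 1 5 6 7 = 0"
    "W 2 3 4 5 = 0"
    "W 2 3 4 6 = 0"
    "W 2 3 4 7 = 0"
    "W 2 3 5 6 = 0"
    "W 2 3 5 7 = 0"
    "W 2 3 6 7 = 0"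
    "W 2 4 5 6 = 0"
    "W 2 4 5 7 = 0"
    "W 2 4 6 7 = 0"
    "W 2 5 6 7 = 0"
    "W 3 4 5 6 = 0"
    "W 3 4 5 7 = 0"
    "W 3 4 6 7 = 0"
    "W 3 5 6 7 = 0"
    "W 4 5 6 7 = 0"
    using v unfolding all7
    by (simp_all add: Sg_def psi_contr3[OF alt4_slice[OF assms(1)]] alt4_sort[OF assms(1)] rk_table)
  have "\<forall>i j k l. W i j k l = 0"
    unfolding all7 by (simp add: alt4_sort[OF assms(1)] rk_table e)
  then show ?thesis by blast
qed

lemma sum_rot4: "(\<^bold>\<Sum>i j l s. f i j l s) = (\<^bold>\<Sum>l s i j. f i j l s)"
proof -
  have "(\<^bold>\<Sum>i j l s. f i j l s) = (\<^bold>\<Sum>i l s j. f i j l s)"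
    by (rule sum.cong[OF refl]) (rule sum_rot3)
  also have "\<dots> = (\<^bold>\<Sum>l s i j. f i j l s)"
    by (rule sum_rot3[of "\<lambda>l s i. \<^bold>\<Sum>j. f i j l s", simplified])
  finally show ?thesis .
qed

lemma sum_push2:
  "(\<^bold>\<Sum>n. (\<^bold>\<Sum>i j. f i j * g i j n) * h n) = (\<^bold>\<Sum>i j. f i j * (\<^bold>\<Sum>n. g i j n * h n))"
  by (simp add: sum_distrib_right sum_distrib_left mult.assoc sum_rot3[of "\<lambda>i j n. f i j * (g i j n * h n)"])

lemma sum_push1:
  "(\<^bold>\<Sum>n. (\<^bold>\<Sum>i. f i * g i n) * h n) = (\<^bold>\<Sum>i. f i * (\<^bold>\<Sum>n. g i n * h n))"
  by (simp add: sum_distrib_right sum_distrib_left mult.assoc)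
    (rule sum.swap)

section \<open>The subalgebra g2 of the 2-forms\<close>

definition g2c :: "(7 \<Rightarrow> 7 \<Rightarrow> real) \<Rightarrow> bool"
  where "g2c F \<longleftrightarrow> alt2 F \<and> (\<forall>k. (\<^bold>\<Sum>i j. F i j * phi i j k) = 0)"

text \<open>Contract the defining equation once more with \<open>phi\<close>: \<open>phi_phi\<close>
  produces \<open>psi\<close> and two metric terms, and these two give
  \<open>2 * F k l\<close>.\<close>

lemma g2c_psi:
  assumes "g2c F"
  shows "(\<^bold>\<Sum>i j. F i j * psi i j k l) = - 2 * F k l"
proof -
  have "0 = (\<^bold>\<Sum>n. (\<^bold>\<Sum>i j. F i j * phi i j n) * phi k l n)"
    using assms by (simp add: g2c_def)
  also have "\<dots> = (\<^bold>\<Sum>i j. F i j * (kd i k * kd j l - kd i l * kd j k + psi i j k l))"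
    unfolding sum_push2 phi_phi ..
  also have "\<dots> = F k l - F l k + (\<^bold>\<Sum>i j. F i j * psi i j k l)"
    by (simp add: algebra_simps sum.distrib sum_subtractf kd_simps)
  finally show ?thesis using assms unfolding g2c_def alt2_def by (smt (verit))
qed

lemma alt2_flip:
  assumes "alt2 F"
  shows "(\<^bold>\<Sum>a. F a x * g a) = - (\<^bold>\<Sum>a. F x a * g a)"
  by (simp add: alt2D[OF assms, of x] sum_negf)

text \<open>Contracting the defining equation with \<open>psi\<close> and expanding by
  \<open>phi_psi\<close> yields the derivation action of \<open>F\<close> on \<open>phi\<close>,
  each of its terms twice because \<open>F\<close> is skew.\<close>

lemma g2c_phi_inv:
  assumes "g2c F"
  shows "(\<^bold>\<Sum>s. F i s * phi s j k) + (\<^bold>\<Sum>s. F j s * phi i s k) + (\<^bold>\<Sum>s. F k s * phi i j s) = 0"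
proof -
  have a: "alt2 F" using assms by (simp add: g2c_def)
  have "0 = (\<^bold>\<Sum>n. (\<^bold>\<Sum>a b. F a b * phi a b n) * psi n i j k)"
    using assms by (simp add: g2c_def)
  also have "\<dots> = (\<^bold>\<Sum>a b. F a b * (kd a i * phi b j k + kd a j * phi i b k + kd a k * phi i j b
     - kd b i * phi a j k - kd b j * phi i a k - kd b k * phi i j a))"
    unfolding sum_push2 phi_psi ..
  also have "\<dots> = (\<^bold>\<Sum>s. F i s * phi s j k) + (\<^bold>\<Sum>s. F j s * phi i s k) + (\<^bold>\<Sum>s. F k s * phi i j s)
     - (\<^bold>\<Sum>s. F s i * phi s j k) - (\<^bold>\<Sum>s. F s j * phi i s k) - (\<^bold>\<Sum>s. F s k * phi i j s)"
    by (simp add: algebra_simps sum.distrib sum_subtractf kd_simps)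
  finally show ?thesis
    by (simp add: alt2_flip[OF a])
qed

text \<open>By \<open>phi_phi\<close>, \<open>psi\<close> is a polynomial in \<open>phi\<close> and
  the metric, and a skew \<open>F\<close> that annihilates \<open>phi\<close> annihilates
  both.\<close>

lemma phi_inv_psi_inv:
  assumes a: "alt2 F"
    and inv: "\<And>i j k. (\<^bold>\<Sum>s. F i s * phi s j k) + (\<^bold>\<Sum>s. F j s * phi i s k) + (\<^bold>\<Sum>s. F k s * phi i j s) = 0"
  shows "(\<^bold>\<Sum>s. F i s * psi s j k l) + (\<^bold>\<Sum>s. F j s * psi i s k l) + (\<^bold>\<Sum>s. F k s * psi i j s l) + (\<^bold>\<Sum>s. F l s * psi i j k s) = 0"
proof -
  have ps: "psi i j k l = (\<^bold>\<Sum>s. phi i j s * phi k l s) - kd i k * kd j l + kd i l * kd j k" for i j k l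
    by (simp add: phi_phi)
  have e1: "(\<^bold>\<Sum>s. F i s * psi s j k l) = (\<^bold>\<Sum>n. (\<^bold>\<Sum>s. F i s * phi s j n) * phi k l n) - F i k * kd j l + F i l * kd j k" for i j k l
    unfolding sum_push1 unfolding ps by (simp add: algebra_simps sum.distrib sum_subtractf kd_simps)
  have e2: "(\<^bold>\<Sum>s. F j s * psi i s k l) = (\<^bold>\<Sum>n. (\<^bold>\<Sum>s. F j s * phi i s n) * phi k l n) - F j l * kd i k + F j k * kd i l" for i j k l
    unfolding sum_push1 unfolding ps by (simp add: algebra_simps sum.distrib sum_subtractf kd_simps)
  have e3: "(\<^bold>\<Sum>s. F k s * psi i j s l) = (\<^bold>\<Sum>n. (\<^bold>\<Sum>s. F k s * phi s l n) * phi i j n) - F k i * kd j l + F k j * kd i l" for i j k l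
    unfolding sum_push1 unfolding ps by (simp add: algebra_simps sum.distrib sum_subtractf kd_simps)
  have e4: "(\<^bold>\<Sum>s. F l s * psi i j k s) = (\<^bold>\<Sum>n. (\<^bold>\<Sum>s. F l s * phi k s n) * phi i j n) - F l j * kd i k + F l i * kd j k" for i j k l
    unfolding sum_push1 unfolding ps by (simp add: algebra_simps sum.distrib sum_subtractf kd_simps)
  have s1: "(\<^bold>\<Sum>s. F i s * phi s j n) + (\<^bold>\<Sum>s. F j s * phi i s n) = - (\<^bold>\<Sum>s. F n s * phi i j s)" for i j n
    using inv[of i j n] by linarith
  have "(\<^bold>\<Sum>n. (\<^bold>\<Sum>s. F i s * phi s j n) * phi k l n) + (\<^bold>\<Sum>n. (\<^bold>\<Sum>s. F j s * phi i s n) * phi k l n)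
     + (\<^bold>\<Sum>n. (\<^bold>\<Sum>s. F k s * phi s l n) * phi i j n) + (\<^bold>\<Sum>n. (\<^bold>\<Sum>s. F l s * phi k s n) * phi i j n)
     = - (\<^bold>\<Sum>n. (\<^bold>\<Sum>s. F n s * phi i j s) * phi k l n) - (\<^bold>\<Sum>n. (\<^bold>\<Sum>s. F n s * phi k l s) * phi i j n)"
  proof -
    have "(\<^bold>\<Sum>n. (\<^bold>\<Sum>s. F i s * phi s j n) * phi k l n) + (\<^bold>\<Sum>n. (\<^bold>\<Sum>s. F j s * phi i s n) * phi k l n)
      = - (\<^bold>\<Sum>n. (\<^bold>\<Sum>s. F n s * phi i j s) * phi k l n)" for i j k l
    proof -
      have "(\<^bold>\<Sum>n. (\<^bold>\<Sum>s. F i s * phi s j n) * phi k l n) + (\<^bold>\<Sum>n. (\<^bold>\<Sum>s. F j s * phi i s n) * phi k l n)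
        = (\<^bold>\<Sum>n. ((\<^bold>\<Sum>s. F i s * phi s j n) + (\<^bold>\<Sum>s. F j s * phi i s n)) * phi k l n)"
        by (simp only: sum.distrib distrib_right)
      then show ?thesis by (simp only: s1) (simp add: sum_negf)
    qed
    from this[of i j k l] this[of k l i j] show ?thesis by linarith
  qed
  \<comment> \<open>The two remaining double sums are exchanged by swapping the summation indices;
    skewness of \<open>F\<close> makes them cancel.\<close>
  also have "(\<^bold>\<Sum>n. (\<^bold>\<Sum>s. F n s * phi k l s) * phi i j n) = - (\<^bold>\<Sum>n. (\<^bold>\<Sum>s. F n s * phi i j s) * phi k l n)"
  proof -
    have "(\<^bold>\<Sum>n. (\<^bold>\<Sum>s. F n s * phi k l s) * phi i j n) = (\<^bold>\<Sum>n s. F n s * phi k l s * phi i j n)"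
      by (simp add: sum_distrib_right)
    also have "\<dots> = (\<^bold>\<Sum>s n. F n s * phi k l s * phi i j n)" by (rule sum.swap)
    also have "\<dots> = (\<^bold>\<Sum>s n. - (F s n * phi i j n * phi k l s))"
    proof (intro sum.cong refl)
      fix n s show "F n s * phi k l s * phi i j n = - (F s n * phi i j n * phi k l s)"
        using alt2D[OF a, of s n] by simp
    qed
    also have "\<dots> = - (\<^bold>\<Sum>n. (\<^bold>\<Sum>s. F n s * phi i j s) * phi k l n)"
      by (simp add: sum_distrib_right sum_negf)
    finally show ?thesis .
  qed
  finally have "(\<^bold>\<Sum>n. (\<^bold>\<Sum>s. F i s * phi s j n) * phi k l n) + (\<^bold>\<Sum>n. (\<^bold>\<Sum>s. F j s * phi i s n) * phi k l n)
     + (\<^bold>\<Sum>n. (\<^bold>\<Sum>s. F k s * phi s l n) * phi i j n) + (\<^bold>\<Sum>n. (\<^bold>\<Sum>s. F l s * phi k s n) * phi i j n) = 0"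
    by simp
  then show ?thesis
    unfolding e1[of i j k l] e2[of j i k l] e3[of k i j l] e4[of l i j k]
    using alt2D[OF a] by (smt (verit) mult_minus_left)
qed

section \<open>The 4-form quadratic in the torsion\<close>

definition sig :: "(7 \<Rightarrow> 7 \<Rightarrow> 7 \<Rightarrow> real) \<Rightarrow> 7 \<Rightarrow> 7 \<Rightarrow> 7 \<Rightarrow> 7 \<Rightarrow> real"
  where "sig T i j k l = (\<^bold>\<Sum>s. T i j s * T k l s + T j k s * T i l s + T k i s * T j l s)"

lemma alt4_sig:
  assumes "alt3 T"
  shows "alt4 (sig T)"
  unfolding alt4_def
proof (intro allI conjI)
  fix i j k l
  have r: "T j i s = - T i j s" for i j s using alt3D[OF assms] by blast
  show "sig T j i k l = - sig T i j k l"
    unfolding sig_def sum_negf[symmetric] by (rule sum.cong) (auto simp: r[of j i] r[of k i] r[of k j])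
  show "sig T i k j l = - sig T i j k l"
    unfolding sig_def sum_negf[symmetric] by (rule sum.cong) (auto simp: r[of k i] r[of j i] r[of k j])
  show "sig T i j l k = - sig T i j k l"
    unfolding sig_def sum_negf[symmetric] by (rule sum.cong) (auto simp: r[of l k] r[of k j] r[of k i] r[of l i] r[of l j])
qed

text \<open>The three products in \<open>sig\<close> are cyclic images of each other, so against a
  cyclically invariant coefficient they contribute equally.\<close>

lemma alt_contr_sig:
  assumes T: "alt3 T" and c: "\<And>i j l. c j l i = c i j l"
  shows "(\<^bold>\<Sum>i j l. c i j l * sig T i j l k) = 3 * (\<^bold>\<Sum>l s. (\<^bold>\<Sum>i j. c i j l * T i j s) * T l k s)"
proof -
  let ?f = "\<lambda>i j l. c i j l * (\<^bold>\<Sum>s. T i j s * T l k s)"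
  have "(\<^bold>\<Sum>i j l. c i j l * sig T i j l k) = (\<^bold>\<Sum>i j l. ?f i j l + ?f j l i + ?f l i j)"
    by (intro sum.cong refl) (simp add: sig_def sum.distrib algebra_simps c c[symmetric])
  also have "\<dots> = (\<^bold>\<Sum>i j l. ?f i j l) + (\<^bold>\<Sum>i j l. ?f j l i) + (\<^bold>\<Sum>i j l. ?f l i j)"
    by (simp only: sum.distrib)
  also have "\<dots> = 3 * (\<^bold>\<Sum>i j l. ?f i j l)"
    using sum_rot3[of ?f] sum_rot3[of "\<lambda>i j l. ?f l i j"] by simp
  also have "(\<^bold>\<Sum>i j l. ?f i j l) = (\<^bold>\<Sum>i j l s. c i j l * T i j s * T l k s)"
    by (simp add: sum_distrib_left mult.assoc)
  also have "\<dots> = (\<^bold>\<Sum>l s i j. c i j l * T i j s * T l k s)" by (rule sum_rot4)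
  finally show ?thesis by (simp add: sum_distrib_right)
qed

lemma alt3_contr_rot:
  assumes c: "\<And>i j l. c j l i = c i j l"
  shows "(\<^bold>\<Sum>i j l. c i j l * f j l i) = (\<^bold>\<Sum>i j l. c i j l * f i j l)"
    and "(\<^bold>\<Sum>i j l. c i j l * f l i j) = (\<^bold>\<Sum>i j l. c i j l * f i j l)"
proof -
  show a: "(\<^bold>\<Sum>i j l. c i j l * f j l i) = (\<^bold>\<Sum>i j l. c i j l * f i j l)" for f
    using sum_rot3[of "\<lambda>i j l. c i j l * f i j l"] by (simp add: c)
  show "(\<^bold>\<Sum>i j l. c i j l * f l i j) = (\<^bold>\<Sum>i j l. c i j l * f i j l)"
    using a[of "\<lambda>i j l. f l i j"] by simp
qed

lemma psi_cyc3: "psi j l i m = psi i j l m"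
  using psi_alt by (metis minus_minus)

lemma psi_swap_pairs: "psi k l i j = psi i j k l"
  using psi_alt by (metis minus_minus)

lemma Pm_trace: "(\<^bold>\<Sum>m. Pm T m m) = (\<^bold>\<Sum>i j l. phi i j l * T i j l)"
  by (simp add: Pm_def)

text \<open>Replacing \<open>psi\<close> by \<open>phi\<close> times \<open>phi\<close> minus metric
  terms turns the contraction into one with \<open>Pm T\<close>; the two metric terms account for
  the \<open>2\<close>.\<close>

lemma psi_contr_T:
  assumes "alt3 T"
  shows "(\<^bold>\<Sum>i j. psi i j l m * T i j s) = (\<^bold>\<Sum>n. phi l m n * Pm T n s) - 2 * T l m s"
proof -
  have "(\<^bold>\<Sum>n. phi l m n * Pm T n s) = (\<^bold>\<Sum>n. (\<^bold>\<Sum>i j. T s i j * phi i j n) * phi l m n)"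
    by (intro sum.cong refl) (simp add: Pm_def phi_cyc sum_distrib_left sum_distrib_right algebra_simps)
  also have "\<dots> = (\<^bold>\<Sum>i j. T s i j * (kd i l * kd j m - kd i m * kd j l + psi i j l m))"
    unfolding sum_push2 phi_phi ..
  also have "\<dots> = T s l m - T s m l + (\<^bold>\<Sum>i j. psi i j l m * T s i j)"
    by (simp add: algebra_simps sum.distrib sum_subtractf kd_simps)
  also have "T s l m - T s m l = 2 * T l m s"
    using alt3D[OF assms] by (smt (verit))
  also have "(\<^bold>\<Sum>i j. psi i j l m * T s i j) = (\<^bold>\<Sum>i j. psi i j l m * T i j s)"
    by (simp add: alt3_cyc[OF assms, of _ _ s])
  finally show ?thesis by simp
qed

text \<open>After \<open>psi_contr_T\<close> the term with \<open>phi\<close> closes up to a second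
  factor \<open>Pm T\<close> when the trace is taken, and the other term is the norm of
  \<open>T\<close>.\<close>

lemma tr_Sg_sig:
  assumes "alt3 T"
  shows "(\<^bold>\<Sum>k. Sg (sig T) k k) = 3 * (\<^bold>\<Sum>n s. (Pm T n s)^2) - 6 * (\<^bold>\<Sum>l k s. (T l k s)^2)"
proof -
  have "Sg (sig T) k k = 3 * (\<^bold>\<Sum>l s. (\<^bold>\<Sum>n. Pm T n s * (phi l k n * T l k s))) - 6 * (\<^bold>\<Sum>l s. (T l k s)^2)" for k
    unfolding Sg_def alt_contr_sig[OF assms, of "\<lambda>i j l. psi i j l k", OF psi_cyc3] psi_contr_T[OF assms]
    by (simp add: algebra_simps sum_subtractf sum_distrib_left power2_eq_square)
  then have "(\<^bold>\<Sum>k. Sg (sig T) k k) = 3 * (\<^bold>\<Sum>k l s n. Pm T n s * (phi l k n * T l k s)) - 6 * (\<^bold>\<Sum>k l s. (T l k s)^2)"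
    by (simp add: sum_subtractf sum_distrib_left)
  also have "(\<^bold>\<Sum>k l s. (T l k s)^2) = (\<^bold>\<Sum>l k s. (T l k s)^2)" by (rule sum.swap)
  also have "(\<^bold>\<Sum>k l s n. Pm T n s * (phi l k n * T l k s)) = (\<^bold>\<Sum>s n k l. Pm T n s * (phi l k n * T l k s))"
    by (rule sum_rot4)
  also have "\<dots> = (\<^bold>\<Sum>n s k l. Pm T n s * (phi l k n * T l k s))" by (rule sum.swap)
  also have "\<dots> = (\<^bold>\<Sum>n s l k. Pm T n s * (phi l k n * T l k s))"
    by (intro sum.cong refl sum.swap)
  also have "\<dots> = (\<^bold>\<Sum>n s. (Pm T n s)^2)"
  proof (intro sum.cong refl)
    fix n s
    have "(\<^bold>\<Sum>l k. phi l k n * T l k s) = Pm T n s"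
      by (simp add: Pm_def phi_cyc[of _ _ n] alt3_cyc[OF assms, of _ _ s])
    then show "(\<^bold>\<Sum>l k. Pm T n s * (phi l k n * T l k s)) = (Pm T n s)^2"
      by (simp add: sum_distrib_left[symmetric] power2_eq_square)
  qed
  finally show ?thesis .
qed

text \<open>\<open>Pm T l s\<close> is summed against \<open>T l k s\<close>, which is skew in
  \<open>l\<close> and \<open>s\<close>. So only the skew part of \<open>Pm T\<close> survives, and
  \<open>Pm_skew\<close> expresses it by \<open>tv T\<close>.\<close>

lemma sv_sig:
  assumes "alt3 T"
  shows "sv (sig T) k = - (1/2) * (\<^bold>\<Sum>n. Pm T n k * tv T n)"
proof -
  have P: "(\<^bold>\<Sum>i j. phi i j l * T i j s) = Pm T l s" for l s
    by (simp add: Pm_def phi_cyc[of _ _ l] alt3_cyc[OF assms, of _ _ s])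
  have "sv (sig T) k = 3 * (\<^bold>\<Sum>l s. Pm T l s * T l k s)"
    unfolding sv_def alt_contr_sig[OF assms, of phi, OF phi_cyc] P ..
  also have "(\<^bold>\<Sum>l s. Pm T l s * T l k s) = 1/2 * (\<^bold>\<Sum>l s. (Pm T l s - Pm T s l) * T l k s)"
  proof -
    have "(\<^bold>\<Sum>l s. Pm T s l * T l k s) = (\<^bold>\<Sum>l s. Pm T l s * T s k l)" by (rule sum.swap)
    also have "\<dots> = - (\<^bold>\<Sum>l s. Pm T l s * T l k s)"
    proof -
      have "Pm T l s * T s k l = - (Pm T l s * T l k s)" for l s
        using alt3D(1)[OF assms, of s k l] alt3D(2)[OF assms, of k s l] alt3D(1)[OF assms, of k l s] by simp
      then show ?thesis by (simp add: sum_negf)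
    qed
    finally show ?thesis by (simp add: algebra_simps sum_subtractf)
  qed
  also have "(\<^bold>\<Sum>l s. (Pm T l s - Pm T s l) * T l k s) = (1/3) * (\<^bold>\<Sum>l s n. tv T n * (phi l s n * T l k s))"
    unfolding Pm_skew[OF assms] by (simp add: sum_distrib_left sum_distrib_right algebra_simps)
  also have "(\<^bold>\<Sum>l s n. tv T n * (phi l s n * T l k s)) = (\<^bold>\<Sum>n l s. tv T n * (phi l s n * T l k s))"
    by (rule sum_rot3[symmetric])
  also have "\<dots> = - (\<^bold>\<Sum>n. Pm T n k * tv T n)"
  proof -
    have "tv T n * (phi l s n * T l k s) = - (phi n l s * T k l s * tv T n)" for n l s
      using alt3D(1)[OF assms, of l k s] phi_cyc[of l s n] by simp
    then show ?thesis by (simp add: Pm_def sum_negf sum_distrib_right)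
  qed
  finally show ?thesis by simp
qed

lemma skew_sum_zero:
  assumes "\<And>i j. f j i = - f i j"
  shows "(\<^bold>\<Sum>i j. f i j) = 0"
proof -
  have "(\<^bold>\<Sum>i j. f i j) = (\<^bold>\<Sum>i j. f j i)" by (rule sum.swap)
  also have "\<dots> = - (\<^bold>\<Sum>i j. f i j)" by (subst assms) (simp add: sum_negf)
  finally show ?thesis by simp
qed

text \<open>The 2-form \<open>F\<close>, the contraction of \<open>T\<close> with theta, lies in g2
  and hence annihilates \<open>psi\<close>. Contracting this invariance with \<open>T\<close> gives
  three equal terms, which are the claim, and a term in which theta is inserted twice into
  \<open>T\<close>.\<close>

lemma Sg_sig_tv:
  assumes T: "alt3 T" and s: "\<And>k. sv (sig T) k = 0"
  shows "(\<^bold>\<Sum>k. tv T k * Sg (sig T) k m) = 0"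
proof -
  define F where "F l s = (\<^bold>\<Sum>k. T l s k * tv T k)" for l s
  have F2: "alt2 F"
    unfolding alt2_def
  proof (intro allI)
    fix i j
    show "F j i = - F i j"
      unfolding F_def sum_negf[symmetric] by (intro sum.cong refl) (simp add: alt3D(1)[OF T, of j i])
  qed
  have "(\<^bold>\<Sum>i j. F i j * phi i j n) = 0" for n
  proof -
    have "(\<^bold>\<Sum>i j. F i j * phi i j n) = (\<^bold>\<Sum>i j k. tv T k * (phi n i j * T k i j))"
    proof -
      have "T i j k * tv T k * phi i j n = tv T k * (phi n i j * T k i j)" for i j k
        using phi_cyc[of i j n] alt3_cyc[OF T, of i j k] by simp
      then show ?thesis by (simp only: F_def sum_distrib_right)
    qed
    also have "\<dots> = (\<^bold>\<Sum>k i j. tv T k * (phi n i j * T k i j))"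
      by (rule sum_rot3[symmetric])
    also have "\<dots> = (\<^bold>\<Sum>k. Pm T n k * tv T k)"
      unfolding Pm_def by (simp add: mult.commute[of _ "tv T _"] sum_distrib_left)
    \<comment> \<open>The transpose of \<open>Pm T\<close> kills theta because
      \<open>sv (sig T)\<close> vanishes; the skew part of \<open>Pm T\<close> sends theta to a
      multiple of its cross product with itself.\<close>
    also have "\<dots> = (\<^bold>\<Sum>k. Pm T k n * tv T k) + (\<^bold>\<Sum>k. (Pm T n k - Pm T k n) * tv T k)"
      by (simp add: algebra_simps sum_subtractf)
    also have "(\<^bold>\<Sum>k. Pm T k n * tv T k) = 0" using s[of n] unfolding sv_sig[OF T] by simp
    also have "(\<^bold>\<Sum>k. (Pm T n k - Pm T k n) * tv T k) = 1/3 * (\<^bold>\<Sum>k l. phi n k l * (tv T l * tv T k))"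
      unfolding Pm_skew[OF T] by (simp add: sum_distrib_left sum_distrib_right algebra_simps)
    also have "(\<^bold>\<Sum>k l. phi n k l * (tv T l * tv T k)) = 0"
    proof (rule skew_sum_zero)
      fix i j show "phi n j i * (tv T i * tv T j) = - (phi n i j * (tv T j * tv T i))"
        using phi_alt(2)[of n j i] by simp
    qed
    finally show ?thesis by simp
  qed
  with F2 have "g2c F" by (simp add: g2c_def)
  note inv = phi_inv_psi_inv[OF F2 g2c_phi_inv[OF this]]
  let ?g = "\<lambda>i j s. T i j s * (\<^bold>\<Sum>l. F s l * psi i j l m)"
  have g1: "T i j s * (\<^bold>\<Sum>l. F i l * psi l j s m) = ?g j s i" for i j s
    using psi_cyc3[of j s _ m] alt3_cyc[OF T, of j s i] by simp
  have g2: "T i j s * (\<^bold>\<Sum>l. F j l * psi i l s m) = ?g s i j" for i j s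
    using psi_cyc3[of i _ s m] alt3_cyc[OF T, of i j s] by simp
  have "0 = (\<^bold>\<Sum>i j s. T i j s * ((\<^bold>\<Sum>l. F i l * psi l j s m) + (\<^bold>\<Sum>l. F j l * psi i l s m) + (\<^bold>\<Sum>l. F s l * psi i j l m) + (\<^bold>\<Sum>l. F m l * psi i j s l)))"
    unfolding inv by simp
  also have "\<dots> = (\<^bold>\<Sum>i j s. ?g j s i) + (\<^bold>\<Sum>i j s. ?g s i j) + (\<^bold>\<Sum>i j s. ?g i j s) + (\<^bold>\<Sum>i j s l. T i j s * (F m l * psi i j s l))"
    by (simp only: distrib_left sum.distrib g1 g2) (simp only: sum_distrib_left)
  also have "\<dots> = 3 * (\<^bold>\<Sum>i j s. ?g i j s) + (\<^bold>\<Sum>i j s l. T i j s * (F m l * psi i j s l))"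
    using sum_rot3[of ?g] sum_rot3[of "\<lambda>i j l. ?g l i j"] by simp
  also have "(\<^bold>\<Sum>i j s l. T i j s * (F m l * psi i j s l)) = (\<^bold>\<Sum>l. F m l * tv T l)"
  proof -
    have "(\<^bold>\<Sum>i j s l. T i j s * (F m l * psi i j s l)) = (\<^bold>\<Sum>s l i j. T i j s * (F m l * psi i j s l))"
      by (rule sum_rot4)
    also have "\<dots> = (\<^bold>\<Sum>l s i j. T i j s * (F m l * psi i j s l))" by (rule sum.swap)
    also have "\<dots> = (\<^bold>\<Sum>l i j s. T i j s * (F m l * psi i j s l))"
      by (rule sum.cong[OF refl]) (rule sum_rot3)
    finally show ?thesis by (simp add: tv_def sum_distrib_left algebra_simps)
  qed
  also have "(\<^bold>\<Sum>l. F m l * tv T l) = 0"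
  proof -
    have "(\<^bold>\<Sum>l. F m l * tv T l) = (\<^bold>\<Sum>l k. T m l k * (tv T k * tv T l))"
      by (simp add: F_def sum_distrib_right mult.assoc)
    also have "\<dots> = 0"
    proof (rule skew_sum_zero)
      fix i j show "T m j i * (tv T i * tv T j) = - (T m i j * (tv T j * tv T i))"
        using alt3D(2)[OF T, of m i j] by simp
    qed
    finally show ?thesis .
  qed
  finally have z: "(\<^bold>\<Sum>i j s. ?g i j s) = 0" by simp
  have "(\<^bold>\<Sum>k. tv T k * Sg (sig T) k m) = 3 * (\<^bold>\<Sum>k l s. tv T k * ((\<^bold>\<Sum>i j. psi i j l m * T i j s) * T l k s))"
    unfolding Sg_def alt_contr_sig[OF T, of "\<lambda>i j l. psi i j l m", OF psi_cyc3] by (simp add: sum_distrib_left mult.left_commute)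
  also have "(\<^bold>\<Sum>k l s. tv T k * ((\<^bold>\<Sum>i j. psi i j l m * T i j s) * T l k s)) = (\<^bold>\<Sum>l s k. tv T k * ((\<^bold>\<Sum>i j. psi i j l m * T i j s) * T l k s))"
    by (rule sum_rot3)
  also have "\<dots> = (\<^bold>\<Sum>l s. (\<^bold>\<Sum>i j. psi i j l m * T i j s) * F s l)"
  proof -
    have "tv T k * ((\<^bold>\<Sum>i j. psi i j l m * T i j s) * T l k s) = (\<^bold>\<Sum>i j. psi i j l m * T i j s) * (T s l k * tv T k)" for k l s
      using alt3_cyc[OF T, of l k s] by simp
    then show ?thesis unfolding F_def by (simp only: sum_distrib_left)
  qed
  also have "\<dots> = (\<^bold>\<Sum>l s i j. psi i j l m * T i j s * F s l)" by (simp add: sum_distrib_right)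
  also have "\<dots> = (\<^bold>\<Sum>i j l s. psi i j l m * T i j s * F s l)" by (rule sum_rot4[symmetric])
  also have "\<dots> = (\<^bold>\<Sum>i j s l. psi i j l m * T i j s * F s l)"
    by (intro sum.cong refl sum.swap)
  also have "\<dots> = (\<^bold>\<Sum>i j s. ?g i j s)" by (simp add: sum_distrib_left mult.commute mult.left_commute)
  finally show ?thesis using z by simp
qed

section \<open>Curvature identities at a point\<close>

text \<open>The identities available at one point, in an orthonormal frame: \<open>DT\<close> stands
  for the components of the covariant derivative of \<open>T\<close>, direction first. The
  conditions on the two pairs of arguments of \<open>R\<close> are listed separately, as no pair
  symmetry is assumed.\<close>

locale curvature_data =
  fixes T :: "7 \<Rightarrow> 7 \<Rightarrow> 7 \<Rightarrow> real"
    and DT :: "7 \<Rightarrow> 7 \<Rightarrow> 7 \<Rightarrow> 7 \<Rightarrow> real"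
    and R :: "7 \<Rightarrow> 7 \<Rightarrow> 7 \<Rightarrow> 7 \<Rightarrow> real"
  assumes T: "alt3 T" and DT: "\<And>i. alt3 (DT i)"
    and bianchi: "\<And>i j k l. R i j k l + R j k i l + R k i j l =
      DT i j k l + DT j k i l + DT k i j l + sig T i j k l"
    and R_skew: "\<And>i j k l. R j i k l = - R i j k l" "\<And>i j k l. R i j l k = - R i j k l"
    and R_inst: "\<And>i j k. (\<^bold>\<Sum>a b. R a b i j * phi a b k) = 0"
    and R_g2: "\<And>i j k. (\<^bold>\<Sum>a b. R i j a b * phi a b k) = 0"
    and R_ric: "\<And>i j. (\<^bold>\<Sum>a. R a i j a) = 0"
    and DT_phi: "\<And>k. (\<^bold>\<Sum>i j l. phi i j l * DT k i j l) = 0"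
begin

lemma g2c_R: "g2c (\<lambda>a b. R a b i j)" "g2c (R i j)"
  unfolding g2c_def alt2_def using R_skew R_inst R_g2 by blast+

lemma R_ric': "(\<^bold>\<Sum>a. R a i a j) = 0" "(\<^bold>\<Sum>a. R i a a j) = 0" "(\<^bold>\<Sum>a. R i a j a) = 0"
  using R_ric[of i j] by (simp_all add: R_skew(1)[of i] R_skew(2)[of _ _ j] sum_negf)

lemma DT_swap: "DT i k j l = - DT i j k l" "DT i j l k = - DT i j k l"
  using alt3D[OF DT] by blast+

lemma DT_cyc: "DT i k l j = DT i j k l"
  using alt3_cyc[OF DT] .

definition X where "X k = (\<^bold>\<Sum>i j l. phi i j l * DT i j l k)"
definition Y where "Y k m = (\<^bold>\<Sum>i j l. psi i j l m * DT i j l k)"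

lemma psi_R1: "(\<^bold>\<Sum>a b. psi a b l m * R a b i j) = - 2 * R l m i j"
  using g2c_psi[OF g2c_R(1)] by (simp add: mult.commute)

lemma psi_R2: "(\<^bold>\<Sum>a b. psi a b l m * R i j a b) = - 2 * R i j l m"
  using g2c_psi[OF g2c_R(2)] by (simp add: mult.commute)

lemma contr_cyc3:
  assumes c: "\<And>i j l. c j l i = c i j l"
  shows "(\<^bold>\<Sum>i j l. c i j l * (f i j l + f j l i + f l i j)) = 3 * (\<^bold>\<Sum>i j l. c i j l * f i j l)"
  by (simp only: distrib_left sum.distrib alt3_contr_rot[of c f, OF c])

text \<open>Contract the slots in which the Bianchi identity is cyclic. The curvature is met in its
  first pair only, so the instanton condition removes it, and the cyclic sum of \<open>DT\<close>
  gives three equal terms.\<close>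

lemma contr_a: "3 * X k + sv (sig T) k = 0"
proof -
  have "3 * X k + sv (sig T) k = (\<^bold>\<Sum>i j l. phi i j l * (DT i j l k + DT j l i k + DT l i j k)) + sv (sig T) k"
    unfolding X_def by (subst contr_cyc3[of phi "\<lambda>i j l. DT i j l k", OF phi_cyc]) simp
  also have "\<dots> = (\<^bold>\<Sum>i j l. phi i j l * (R i j l k + R j l i k + R l i j k))"
    unfolding bianchi sv_def by (simp add: distrib_left sum.distrib)
  also have "\<dots> = 3 * (\<^bold>\<Sum>i j l. phi i j l * R i j l k)"
    by (subst contr_cyc3[of phi "\<lambda>i j l. R i j l k", OF phi_cyc]) simp
  also have "(\<^bold>\<Sum>i j l. phi i j l * R i j l k) = (\<^bold>\<Sum>l i j. R i j l k * phi i j l)"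
    by (simp only: mult.commute[of "phi _ _ _"]) (rule sum_rot3[symmetric])
  finally show ?thesis by (simp add: R_inst)
qed

text \<open>The free index now sits in a cyclic slot. One curvature term vanishes by
  \<open>R_inst\<close> and two by \<open>R_g2\<close>; of the derivatives two give
  \<open>- X k\<close>, while the third differentiates the constant contraction of
  \<open>phi\<close> with \<open>T\<close>. Hence the coefficient 2 where \<open>contr_a\<close> has
  3.\<close>

lemma contr_b: "2 * X k + sv (sig T) k = 0"
proof -
  have r: "(\<^bold>\<Sum>i j l. phi i j l * R i j k l) = 0" "(\<^bold>\<Sum>i j l. phi i j l * R j k i l) = 0" "(\<^bold>\<Sum>i j l. phi i j l * R k i j l) = 0"
  proof -
    have "(\<^bold>\<Sum>i j l. phi i j l * R i j k l) = (\<^bold>\<Sum>l i j. R i j k l * phi i j l)"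
      by (simp only: mult.commute[of "phi _ _ _"]) (rule sum_rot3[symmetric])
    then show "(\<^bold>\<Sum>i j l. phi i j l * R i j k l) = 0" by (simp add: R_inst)
    have "(\<^bold>\<Sum>i j l. phi i j l * R j k i l) = (\<^bold>\<Sum>j i l. phi i j l * R j k i l)" by (rule sum.swap)
    also have "\<dots> = - (\<^bold>\<Sum>j i l. R j k i l * phi i l j)"
    proof -
      have "phi i j l * R j k i l = - (R j k i l * phi i l j)" for i j l using phi_alt(2)[of i j l] by simp
      then show ?thesis by (simp only: sum_negf)
    qed
    finally show "(\<^bold>\<Sum>i j l. phi i j l * R j k i l) = 0" by (simp add: R_g2)
    have "(\<^bold>\<Sum>i j l. phi i j l * R k i j l) = (\<^bold>\<Sum>i j l. R k i j l * phi j l i)"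
      by (simp only: phi_cyc mult.commute)
    then show "(\<^bold>\<Sum>i j l. phi i j l * R k i j l) = 0" by (simp add: R_g2)
  qed
  have "(\<^bold>\<Sum>i j l. phi i j l * DT j k i l) = (\<^bold>\<Sum>j i l. phi i j l * DT j k i l)" by (rule sum.swap)
  also have "\<dots> = - X k"
  proof -
    have "phi i j l * DT j k i l = - (phi j i l * DT j i l k)" for i j l
      using phi_alt(1)[of i j l] DT_cyc[of j i l k] by simp
    then show ?thesis unfolding X_def by (simp only: sum_negf)
  qed
  finally have d2: "(\<^bold>\<Sum>i j l. phi i j l * DT j k i l) = - X k" .
  have d1: "(\<^bold>\<Sum>i j l. phi i j l * DT i j k l) = - X k"
    unfolding X_def by (simp add: DT_swap(2)[of _ _ k] sum_negf)
  have d4: "(\<^bold>\<Sum>i j l. phi i j l * sig T i j k l) = - sv (sig T) k"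
    unfolding sv_def by (simp add: alt4D(3)[OF alt4_sig[OF T], of _ _ k] sum_negf)
  have "0 = (\<^bold>\<Sum>i j l. phi i j l * (R i j k l + R j k i l + R k i j l))"
    by (simp only: distrib_left sum.distrib r)
  also have "\<dots> = - 2 * X k - sv (sig T) k"
    unfolding bianchi by (simp only: distrib_left sum.distrib d1 d2 d4 DT_phi)
  finally show ?thesis by simp
qed

lemma X_zero: "X k = 0" and sv_zero: "sv (sig T) k = 0"
  using contr_a[of k] contr_b[of k] by simp_all

text \<open>On g2 contraction with \<open>psi\<close> is multiplication by -2, so each curvature
  term becomes a Ricci contraction.\<close>

lemma contr_c: "3 * Y k m + Sg (sig T) k m = 0"
proof -
  have "3 * Y k m + Sg (sig T) k m = (\<^bold>\<Sum>i j l. psi i j l m * (DT i j l k + DT j l i k + DT l i j k)) + Sg (sig T) k m"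
    unfolding Y_def by (subst contr_cyc3[of "\<lambda>i j l. psi i j l m" "\<lambda>i j l. DT i j l k", OF psi_cyc3]) simp
  also have "\<dots> = (\<^bold>\<Sum>i j l. psi i j l m * (R i j l k + R j l i k + R l i j k))"
    unfolding bianchi Sg_def by (simp add: distrib_left sum.distrib)
  also have "\<dots> = 3 * (\<^bold>\<Sum>i j l. psi i j l m * R i j l k)"
    by (subst contr_cyc3[of "\<lambda>i j l. psi i j l m" "\<lambda>i j l. R i j l k", OF psi_cyc3]) simp
  also have "(\<^bold>\<Sum>i j l. psi i j l m * R i j l k) = (\<^bold>\<Sum>l i j. psi i j l m * R i j l k)"
    by (rule sum_rot3[symmetric])
  also have "\<dots> = 0" unfolding psi_R1 sum_distrib_left[symmetric] R_ric' by simp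
  finally show ?thesis by simp
qed

text \<open>The free index is moved as in \<open>contr_b\<close>. Curvature again reduces to Ricci
  contractions, but the derivative in the free direction now survives as
  \<open>tv (DT k)\<close>.\<close>

lemma contr_d: "tv (DT k) m = 2 * Y k m + Sg (sig T) k m"
proof -
  have "(\<^bold>\<Sum>i j l. psi i j l m * R i j k l) = (\<^bold>\<Sum>l i j. psi i j l m * R i j k l)"
    by (rule sum_rot3[symmetric])
  also have "\<dots> = 0" unfolding psi_R1 sum_distrib_left[symmetric] R_ric by simp
  finally have r1: "(\<^bold>\<Sum>i j l. psi i j l m * R i j k l) = 0" .
  have "(\<^bold>\<Sum>i j l. psi i j l m * R j k i l) = (\<^bold>\<Sum>j i l. psi i j l m * R j k i l)" by (rule sum.swap)
  also have "\<dots> = - (\<^bold>\<Sum>j i l. psi i l j m * R j k i l)"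
  proof -
    have "psi i j l m * R j k i l = - (psi i l j m * R j k i l)" for i j l using psi_alt(2)[of i j l m] by simp
    then show ?thesis by (simp only: sum_negf)
  qed
  also have "\<dots> = 0" unfolding psi_R2 sum_distrib_left[symmetric] R_ric' by simp
  finally have r2: "(\<^bold>\<Sum>i j l. psi i j l m * R j k i l) = 0" .
  have r3: "(\<^bold>\<Sum>i j l. psi i j l m * R k i j l) = 0"
  proof -
    have "(\<^bold>\<Sum>j l. psi i j l m * R k i j l) = - 2 * R k i i m" for i
      using psi_R2[of i m k i] by (simp only: psi_cyc3)
    then show ?thesis by (simp only: sum_distrib_left[symmetric] R_ric' mult_zero_right)
  qed
  have d1: "(\<^bold>\<Sum>i j l. psi i j l m * DT i j k l) = - Y k m"
    unfolding Y_def by (simp add: DT_swap(2)[of _ _ k] sum_negf)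
  have "(\<^bold>\<Sum>i j l. psi i j l m * DT j k i l) = (\<^bold>\<Sum>j i l. psi i j l m * DT j k i l)" by (rule sum.swap)
  also have "\<dots> = - Y k m"
  proof -
    have "psi i j l m * DT j k i l = - (psi j i l m * DT j i l k)" for i j l
      using psi_alt(1)[of i j l m] DT_cyc[of j i l k] by simp
    then show ?thesis unfolding Y_def by (simp only: sum_negf)
  qed
  finally have d2: "(\<^bold>\<Sum>i j l. psi i j l m * DT j k i l) = - Y k m" .
  have d4: "(\<^bold>\<Sum>i j l. psi i j l m * sig T i j k l) = - Sg (sig T) k m"
    unfolding Sg_def by (simp add: alt4D(3)[OF alt4_sig[OF T], of _ _ k] sum_negf)
  have "0 = (\<^bold>\<Sum>i j l. psi i j l m * (R i j k l + R j k i l + R k i j l))"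
    by (simp only: distrib_left sum.distrib r1 r2 r3)
  also have "\<dots> = - 2 * Y k m + tv (DT k) m - Sg (sig T) k m"
    unfolding bianchi by (simp only: distrib_left sum.distrib d1 d2 d4 tv_def)
  finally show ?thesis by simp
qed

lemma tv_DT: "tv (DT k) m = Sg (sig T) k m / 3"
  using contr_c[of k m] contr_d[of k m] by simp

text \<open>Trace the Bianchi identity over \<open>i\<close> and \<open>l\<close>: the curvature
  leaves two Ricci contractions and a trace over a skew pair, and \<open>sig\<close> is
  alternating.\<close>

lemma div_T: "(\<^bold>\<Sum>i. DT i i j k) = 0"
proof -
  have s: "sig T i j k i = 0" for i
    using alt4D[OF alt4_sig[OF T]] by (smt (verit))
  have "0 = (\<^bold>\<Sum>i. R i j k i + R j k i i + R k i j i)"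
  proof -
    have "R j k i i = 0" for i using R_skew(2)[of j k i i] by simp
    then show ?thesis by (simp add: sum.distrib R_ric R_ric')
  qed
  also have "\<dots> = (\<^bold>\<Sum>i. DT i i j k)"
    unfolding bianchi by (simp add: s alt3D(3-5)[OF DT] DT_cyc[of _ j k])
  finally show ?thesis by simp
qed

text \<open>The frame components of the exterior derivative of \<open>T\<close>, written with the
  characteristic connection. The Levi-Civita derivative of \<open>T\<close> exceeds
  \<open>DT\<close> by half of \<open>sig\<close>, and alternating over four slots turns this half
  into \<open>2 * sig\<close>.\<close>

definition dT where
  "dT i j k l = DT i j k l + DT j k i l + DT k i j l - DT l i j k + 2 * sig T i j k l"

lemma dT_alt: "alt4 dT"
  unfolding alt4_def
proof (intro allI conjI)
  fix i j k l
  note s = alt4D(1-3)[OF alt4_sig[OF T]]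
  show "dT j i k l = - dT i j k l"
    unfolding dT_def using s(1)[of j i k l] DT_swap[of j k i l] DT_swap[of i j k l] DT_swap[of k i j l] DT_swap[of l i j k]
      DT_swap(1)[of i k j l] DT_swap(1)[of j i k l] DT_swap(1)[of k j i l] DT_swap(1)[of l j i k] by simp
  show "dT i k j l = - dT i j k l"
    unfolding dT_def using s(2)[of i k j l] DT_swap(1)[of i k j l] DT_swap(1)[of k j i l] DT_swap(1)[of j i k l] DT_swap(2)[of l i k j] by simp
  show "dT i j l k = - dT i j k l"
    unfolding dT_def using s(3)[of i j l k] DT_swap(2)[of i j l k] DT_cyc[of j k l i] DT_swap(2)[of j l i k] DT_swap(1)[of j i l k]
      DT_swap(2)[of j i k l] DT_swap(1)[of j l i k] DT_swap(2)[of k i l j] DT_cyc[of l i j k] DT_cyc[of l j k i] DT_cyc[of k i j l] DT_cyc[of k j l i] DT_cyc[of j k i l] DT_cyc[of j l k i] DT_cyc[of k l i j] DT_cyc[of l k i j] DT_swap(1)[of j k l i] DT_swap(2)[of j k l i] DT_swap(1)[of l i j k] DT_swap(2)[of l i k j] DT_swap(1)[of k i j l]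
    by linarith
qed

text \<open>Both sides are alternating, so it suffices to compare their images under
  \<open>Sg\<close>. By \<open>contr_c\<close> and \<open>tv_DT\<close> the difference has image -1
  - 1/3 + 4/3 times that of \<open>sig T\<close>.\<close>

lemma dT_eq: "dT i j k l = 2 / 3 * sig T i j k l"
proof -
  let ?W = "\<lambda>i j k l. dT i j k l - 2 / 3 * sig T i j k l"
  have a: "alt4 ?W"
    unfolding alt4_def
  proof (intro allI conjI)
    fix i j k l
    show "?W j i k l = - ?W i j k l" "?W i k j l = - ?W i j k l" "?W i j l k = - ?W i j k l"
      using alt4D(1)[OF dT_alt, of j i k l] alt4D(1)[OF alt4_sig[OF T], of j i k l]
        alt4D(2)[OF dT_alt, of i k j l] alt4D(2)[OF alt4_sig[OF T], of i k j l]
        alt4D(3)[OF dT_alt, of i j l k] alt4D(3)[OF alt4_sig[OF T], of i j l k] by linarith+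
  qed
  have "Sg ?W k m = 0" for k m
  proof -
    have "Sg ?W k m = (\<^bold>\<Sum>i j l. psi i j l m * (DT i j l k + DT j l i k + DT l i j k)) - tv (DT k) m + 4 / 3 * Sg (sig T) k m"
      unfolding Sg_def dT_def tv_def by (simp add: algebra_simps sum.distrib sum_subtractf sum_distrib_left)
    also have "\<dots> = 3 * Y k m - tv (DT k) m + 4 / 3 * Sg (sig T) k m"
      unfolding Y_def by (subst contr_cyc3[of "\<lambda>i j l. psi i j l m" "\<lambda>i j l. DT i j l k", OF psi_cyc3]) simp
    also have "\<dots> = 0" using contr_c[of k m] tv_DT[of k m] by simp
    finally show ?thesis .
  qed
  from Sg_zero[OF a this, of i j k l] show ?thesis by simp
qed

text \<open>A product of \<open>T\<close> with itself contracted over two slots is symmetric in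
  \<open>i\<close> and \<open>a\<close>, whereas \<open>T i j a\<close> is skew in them.\<close>

lemma T_sig: "(\<^bold>\<Sum>s k i. T s k i * sig T s k i j) = 0"
proof -
  have "(\<^bold>\<Sum>s k i. T s k i * sig T s k i j) = 3 * (\<^bold>\<Sum>i a. (\<^bold>\<Sum>s k. T s k i * T s k a) * T i j a)"
    by (rule alt_contr_sig[OF T alt3_cyc[OF T]])
  also have "(\<^bold>\<Sum>i a. (\<^bold>\<Sum>s k. T s k i * T s k a) * T i j a) = 0"
  proof (rule skew_sum_zero)
    fix i a
    have "T a j i = - T i j a" using alt3D[OF T] by (smt (verit))
    then show "(\<^bold>\<Sum>s k. T s k a * T s k i) * T a j i = - ((\<^bold>\<Sum>s k. T s k i * T s k a) * T i j a)"
      by (simp add: mult.commute)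
  qed
  finally show ?thesis by simp
qed

text \<open>Contracting \<open>T\<close> with the Bianchi identity in two slot arrangements and with
  \<open>dT_eq\<close> gives \<open>K = V\<close>, \<open>- K = U - 2 * V\<close> and
  \<open>3 * V = U\<close>; all terms cubic in \<open>T\<close> disappear by \<open>T_sig\<close>.
  This system has only the zero solution, and \<open>U\<close> is half the derivative of the norm of
  \<open>T\<close>.\<close>

lemma T_DT_zero:
  assumes "\<And>j. (\<^bold>\<Sum>s k i. T s k i * R j s k i) = 0"
  shows "(\<^bold>\<Sum>s k i. T s k i * DT j s k i) = 0"
proof -
  have c: "(\<^bold>\<Sum>s k i. T s k i * (f s k i + f k i s + f i s k)) = 3 * (\<^bold>\<Sum>s k i. T s k i * f s k i)" for f
    by (rule contr_cyc3) (rule alt3_cyc[OF T])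
  have sw: "(\<^bold>\<Sum>s k i. T s k i * f k s i) = - (\<^bold>\<Sum>s k i. T s k i * f s k i)" for f
  proof -
    have "(\<^bold>\<Sum>s k i. T s k i * f k s i) = (\<^bold>\<Sum>k s i. T s k i * f k s i)" by (rule sum.swap)
    also have "\<dots> = - (\<^bold>\<Sum>k s i. T k s i * f k s i)"
    proof -
      have "T s k i * f k s i = - (T k s i * f k s i)" for s k i using alt3D(1)[OF T, of s k i] by simp
      then show ?thesis by (simp only: sum_negf)
    qed
    finally show ?thesis .
  qed
  define K where "K = (\<^bold>\<Sum>s k i. T s k i * R s k i j)"
  define V where "V = (\<^bold>\<Sum>s k i. T s k i * DT s k i j)"
  define U where "U = (\<^bold>\<Sum>s k i. T s k i * DT j s k i)"
  have 1: "3 * K = 3 * V"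
  proof -
    have "3 * K = (\<^bold>\<Sum>s k i. T s k i * (R s k i j + R k i s j + R i s k j))" unfolding K_def by (rule c[symmetric])
    also have "\<dots> = (\<^bold>\<Sum>s k i. T s k i * (DT s k i j + DT k i s j + DT i s k j)) + (\<^bold>\<Sum>s k i. T s k i * sig T s k i j)"
      unfolding bianchi by (simp only: distrib_left sum.distrib)
    also have "\<dots> = 3 * V" unfolding V_def T_sig by (simp only: c add_0_right)
    finally show ?thesis .
  qed
  have 2: "- K = U - 2 * V"
  proof -
    have "R s k j i = - R s k i j" "R k j s i = - R j k s i" for s k i using R_skew by blast+
    then have "(\<^bold>\<Sum>s k i. T s k i * (R j s k i + R s k j i + R k j s i)) = - K - (\<^bold>\<Sum>s k i. T s k i * R j k s i)"
      unfolding K_def by (simp add: distrib_left right_diff_distrib sum.distrib sum_subtractf sum_negf assms)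
    also have "(\<^bold>\<Sum>s k i. T s k i * R j k s i) = 0" using sw[of "\<lambda>s k i. R j s k i"] assms by simp
    finally have "- K = (\<^bold>\<Sum>s k i. T s k i * (R j s k i + R s k j i + R k j s i))" by simp
    also have "\<dots> = U + (\<^bold>\<Sum>s k i. T s k i * DT s k j i) + (\<^bold>\<Sum>s k i. T s k i * DT k j s i) + (\<^bold>\<Sum>s k i. T s k i * sig T j s k i)"
      unfolding bianchi U_def by (simp only: distrib_left sum.distrib)
    also have "(\<^bold>\<Sum>s k i. T s k i * DT s k j i) = - V"
      unfolding V_def using DT_swap(2)[of _ _ j] by (simp add: sum_negf)
    also have "(\<^bold>\<Sum>s k i. T s k i * DT k j s i) = - V"
      using sw[of "\<lambda>s k i. DT s k i j"] unfolding V_def by (simp only: DT_cyc[of _ _ _ j])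
    also have "(\<^bold>\<Sum>s k i. T s k i * sig T j s k i) = - (\<^bold>\<Sum>s k i. T s k i * sig T s k i j)"
    proof -
      have "sig T j s k i = - sig T s k i j" for s k i using alt4D(1-3)[OF alt4_sig[OF T]] by (smt (verit))
      then show ?thesis by (simp add: sum_negf)
    qed
    finally show ?thesis unfolding T_sig by simp
  qed
  have 3: "3 * V - U = 0"
  proof -
    have "0 = (\<^bold>\<Sum>s k i. T s k i * dT s k i j)"
      unfolding dT_eq mult.left_commute[of _ "2/3"] sum_distrib_left[symmetric] T_sig by simp
    also have "\<dots> = (\<^bold>\<Sum>s k i. T s k i * (DT s k i j + DT k i s j + DT i s k j)) - U + 2 * (\<^bold>\<Sum>s k i. T s k i * sig T s k i j)"
      unfolding dT_def U_def by (simp add: algebra_simps sum.distrib sum_subtractf sum_distrib_left)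
    also have "\<dots> = 3 * V - U" unfolding V_def T_sig by (simp only: c mult_zero_right add_0_right)
    finally show ?thesis by simp
  qed
  show ?thesis using 1 2 3 unfolding U_def by linarith
qed

lemma Sg_symm: "Sg (sig T) k m = Sg (sig T) m k"
  by (rule Sg_sym[OF alt4_sig[OF T] sv_zero])

lemma Sg_tv: "(\<^bold>\<Sum>k. tv T k * Sg (sig T) k m) = 0"
  by (rule Sg_sig_tv[OF T sv_zero])

end

section \<open>The action of so(7) on 3-tensors\<close>

definition act3 :: "(7 \<Rightarrow> 7 \<Rightarrow> real) \<Rightarrow> (7 \<Rightarrow> 7 \<Rightarrow> 7 \<Rightarrow> real) \<Rightarrow> 7 \<Rightarrow> 7 \<Rightarrow> 7 \<Rightarrow> real"
  where "act3 F C a b c = (\<^bold>\<Sum>s. F a s * C s b c) + (\<^bold>\<Sum>s. F b s * C a s c) + (\<^bold>\<Sum>s. F c s * C a b s)"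

text \<open>A skew matrix acts skew-adjointly in every slot. This is what removes connection terms
  from derivatives of contractions.\<close>

lemma act3_dual:
  assumes F: "alt2 F"
  shows "(\<^bold>\<Sum>a b c. C a b c * act3 F T a b c) = - (\<^bold>\<Sum>a b c. act3 F C a b c * T a b c)"
proof -
  have 1: "(\<^bold>\<Sum>a b c. C a b c * (\<^bold>\<Sum>s. F a s * T s b c)) = - (\<^bold>\<Sum>a b c. (\<^bold>\<Sum>s. F a s * C s b c) * T a b c)" for C T
  proof -
    have "(\<^bold>\<Sum>a b c. C a b c * (\<^bold>\<Sum>s. F a s * T s b c)) = (\<^bold>\<Sum>a b c s. C a b c * (F a s * T s b c))"
      by (simp only: sum_distrib_left)
    also have "\<dots> = (\<^bold>\<Sum>a s b c. C a b c * (F a s * T s b c))"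
      by (rule sum.cong[OF refl]) (rule sum_rot3[symmetric])
    also have "\<dots> = (\<^bold>\<Sum>s a b c. C a b c * (F a s * T s b c))" by (rule sum.swap)
    also have "\<dots> = (\<^bold>\<Sum>a s b c. - (F a s * C s b c * T a b c))"
    proof (intro sum.cong refl)
      fix a s b c show "C s b c * (F s a * T a b c) = - (F a s * C s b c * T a b c)"
        using alt2D[OF F, of s a] by simp
    qed
    also have "\<dots> = (\<^bold>\<Sum>a b c s. - (F a s * C s b c * T a b c))"
      by (rule sum.cong[OF refl]) (rule sum_rot3)
    finally show ?thesis by (simp only: sum_negf sum_distrib_right)
  qed
  have 2: "(\<^bold>\<Sum>a b c. C a b c * (\<^bold>\<Sum>s. F b s * T a s c)) = - (\<^bold>\<Sum>a b c. (\<^bold>\<Sum>s. F b s * C a s c) * T a b c)" for C T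
  proof -
    have "(\<^bold>\<Sum>b a c. C a b c * (\<^bold>\<Sum>s. F b s * T a s c)) = - (\<^bold>\<Sum>b a c. (\<^bold>\<Sum>s. F b s * C a s c) * T a b c)"
      by (rule 1[of "\<lambda>b a c. C a b c" "\<lambda>b a c. T a b c"])
    then show ?thesis
      by (simp only: sum.swap[of "\<lambda>b a. \<^bold>\<Sum>c. C a b c * (\<^bold>\<Sum>s. F b s * T a s c)"] sum.swap[of "\<lambda>b a. \<^bold>\<Sum>c. (\<^bold>\<Sum>s. F b s * C a s c) * T a b c"])
  qed
  have 3: "(\<^bold>\<Sum>a b c. C a b c * (\<^bold>\<Sum>s. F c s * T a b s)) = - (\<^bold>\<Sum>a b c. (\<^bold>\<Sum>s. F c s * C a b s) * T a b c)"
  proof -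
    have "(\<^bold>\<Sum>c a b. C a b c * (\<^bold>\<Sum>s. F c s * T a b s)) = - (\<^bold>\<Sum>c a b. (\<^bold>\<Sum>s. F c s * C a b s) * T a b c)"
      by (rule 1[of "\<lambda>c a b. C a b c" "\<lambda>c a b. T a b c"])
    then show ?thesis
      by (simp only: sum_rot3[of "\<lambda>a b c. C a b c * (\<^bold>\<Sum>s. F c s * T a b s)"]
          sum_rot3[of "\<lambda>a b c. (\<^bold>\<Sum>s. F c s * C a b s) * T a b c"])
  qed
  show ?thesis
    unfolding act3_def by (simp only: distrib_left distrib_right sum.distrib 1[of C T] 2[of C T] 3 minus_add_distrib)
qed

lemma act3_alt:
  assumes "alt3 T"
  shows "act3 F T b a c = - act3 F T a b c" "act3 F T a c b = - act3 F T a b c"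
proof -
  have r1: "T s a c = - T a s c" "T b s c = - T s b c" "T b a s = - T a b s" for s
    by (rule alt3D(1)[OF assms])+
  show "act3 F T b a c = - act3 F T a b c" unfolding act3_def by (simp add: r1 sum_negf)
  have r2: "T s c b = - T s b c" "T a s b = - T a b s" "T a c s = - T a s c" for s
    by (rule alt3D(2)[OF assms])+
  show "act3 F T a c b = - act3 F T a b c" unfolding act3_def by (simp add: r2 sum_negf)
qed

lemma act3_self:
  assumes "alt2 F"
  shows "(\<^bold>\<Sum>a b c. C a b c * act3 F C a b c) = 0"
proof -
  have "(\<^bold>\<Sum>a b c. act3 F C a b c * C a b c) = (\<^bold>\<Sum>a b c. C a b c * act3 F C a b c)"
    by (simp only: mult.commute)
  then show ?thesis using act3_dual[OF assms, of C C] by linarith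
qed

lemma act3_phi_dual:
  assumes "alt2 F" and "\<And>a b c. act3 F phi a b c = 0"
  shows "(\<^bold>\<Sum>a b c. phi a b c * act3 F T a b c) = 0"
  unfolding act3_dual[OF assms(1)] assms(2) by simp

text \<open>\<open>psi\<close> is invariant under \<open>F\<close> in all four slots together, so
  moving the action away from its first three slots leaves it on the free index
  \<open>m\<close>.\<close>

lemma act3_psi_dual:
  assumes "alt2 F" and "\<And>a b c. act3 F phi a b c = 0"
  shows "(\<^bold>\<Sum>a b c. psi a b c m * act3 F T a b c) = (\<^bold>\<Sum>s. F m s * tv T s)"
proof -
  have i: "act3 F (\<lambda>a b c. psi a b c m) a b c = - (\<^bold>\<Sum>s. F m s * psi a b c s)" for a b c
    using phi_inv_psi_inv[OF assms(1), of a b c m] assms(2) unfolding act3_def by fastforce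
  have "(\<^bold>\<Sum>a b c. psi a b c m * act3 F T a b c) = (\<^bold>\<Sum>a b c s. F m s * (psi a b c s * T a b c))"
    unfolding act3_dual[OF assms(1), of "\<lambda>a b c. psi a b c m"] i
    by (simp add: sum_negf sum_distrib_right mult.assoc)
  also have "\<dots> = (\<^bold>\<Sum>c s a b. F m s * (psi a b c s * T a b c))" by (rule sum_rot4)
  also have "\<dots> = (\<^bold>\<Sum>s c a b. F m s * (psi a b c s * T a b c))" by (rule sum.swap)
  also have "\<dots> = (\<^bold>\<Sum>s a b c. F m s * (psi a b c s * T a b c))"
    by (rule sum.cong[OF refl]) (rule sum_rot3)
  finally show ?thesis by (simp only: tv_def sum_distrib_left)
qed

lemma kd_self: "kd i i = 1"
  by (simp add: kd_def)

lemma alt3_phi: "alt3 phi"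
  unfolding alt3_def using phi_alt by blast

lemma Pm_phi: "Pm phi n s = 6 * kd n s"
proof -
  have "Pm phi n s = (\<^bold>\<Sum>i. kd n s * kd i i - kd n i * kd i s + psi n i s i)"
    unfolding Pm_def phi_phi ..
  moreover have "psi n i s i = 0" for i
    using psi_alt(2)[of n i s i] psi_alt(3)[of n s i i] psi_alt(2)[of n s i i] by linarith
  ultimately show ?thesis by (simp add: sum_subtractf kd_self)
qed

text \<open>The converse of \<open>g2c_phi_inv\<close>. Contract the action with \<open>psi\<close>:
  its three terms are cyclic images of each other, and \<open>psi\<close> contracted with
  \<open>phi\<close> over two slots is \<open>4 * phi\<close>.\<close>

lemma act3_phi_g2c:
  assumes F: "alt2 F" and inv: "\<And>a b c. act3 F phi a b c = 0"
  shows "g2c F"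
  unfolding g2c_def
proof (intro conjI allI F)
  fix k
  let ?f = "\<lambda>i j l. \<^bold>\<Sum>s. F i s * phi s j l"
  have a: "act3 F phi i j l = ?f i j l + ?f j l i + ?f l i j" for i j l
    unfolding act3_def using phi_cyc by (metis (no_types, lifting) sum.cong)
  have "0 = (\<^bold>\<Sum>i j l. psi i j l k * (?f i j l + ?f j l i + ?f l i j))"
    unfolding a[symmetric] inv by simp
  also have "\<dots> = 3 * (\<^bold>\<Sum>i j l. psi i j l k * ?f i j l)"
    by (simp only: distrib_left sum.distrib alt3_contr_rot[of "\<lambda>i j l. psi i j l k" ?f, OF psi_cyc3])
  also have "(\<^bold>\<Sum>i j l. psi i j l k * ?f i j l) = (\<^bold>\<Sum>i j l s. F i s * (psi i j l k * phi s j l))"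
    by (simp only: sum_distrib_left mult.left_commute)
  also have "\<dots> = (\<^bold>\<Sum>i s j l. F i s * (psi i j l k * phi s j l))"
    by (rule sum.cong[OF refl]) (rule sum_rot3[symmetric])
  also have "\<dots> = (\<^bold>\<Sum>i s. F i s * (4 * phi i k s))"
  proof -
    have "(\<^bold>\<Sum>j l. psi i j l k * phi s j l) = 4 * phi i k s" for i s
    proof -
      have "(\<^bold>\<Sum>j l. psi i j l k * phi s j l) = (\<^bold>\<Sum>j l. psi j l i k * phi j l s)"
        by (simp only: psi_cyc3 phi_cyc[of _ _ s])
      also have "\<dots> = 4 * phi i k s"
        unfolding psi_contr_T[OF alt3_phi] Pm_phi by (simp add: kd_simps sum_distrib_left algebra_simps)
      finally show ?thesis .
    qed
    then show ?thesis by (simp only: sum_distrib_left[symmetric])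
  qed
  also have "\<dots> = - 4 * (\<^bold>\<Sum>i s. F i s * phi i s k)"
    unfolding sum_distrib_left by (intro sum.cong refl) (simp add: phi_alt(2)[of _ k])
  finally show "(\<^bold>\<Sum>i s. F i s * phi i s k) = 0" by simp
qed

text \<open>The stabiliser of \<open>phi\<close> is closed under brackets. In the slot carrying the
  product, invariance moves both factors to the other slots; what appears there beyond the reversed
  product is symmetric in \<open>X\<close> and \<open>Y\<close>.\<close>

lemma act3_commutator:
  assumes X: "\<And>a b c. act3 X phi a b c = 0" and Y: "\<And>a b c. act3 Y phi a b c = 0"
  shows "act3 (\<lambda>a b. (\<^bold>\<Sum>t. X a t * Y t b)) phi a b c = act3 (\<lambda>a b. (\<^bold>\<Sum>t. Y a t * X t b)) phi a b c"
proof -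
  have slot: "(\<^bold>\<Sum>s. (\<^bold>\<Sum>t. X a t * Y t s) * phi s b c)
     = (\<^bold>\<Sum>s. (\<^bold>\<Sum>t. Y b t * X t s) * phi a s c) + (\<^bold>\<Sum>s. (\<^bold>\<Sum>t. Y c t * X t s) * phi a b s)
       + (\<^bold>\<Sum>s. Y b s * (\<^bold>\<Sum>t. X c t * phi a s t)) + (\<^bold>\<Sum>s. Y c s * (\<^bold>\<Sum>t. X b t * phi a t s))"
    if X: "\<And>a b c. act3 X phi a b c = 0" and Y: "\<And>a b c. act3 Y phi a b c = 0" for X Y
  proof -
    have x: "(\<^bold>\<Sum>s. X a s * phi s b c) = - (\<^bold>\<Sum>s. X b s * phi a s c) - (\<^bold>\<Sum>s. X c s * phi a b s)" for a b c
      using X[of a b c] unfolding act3_def by linarith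
    have y: "(\<^bold>\<Sum>s. Y a s * phi s b c) = - (\<^bold>\<Sum>s. Y b s * phi a s c) - (\<^bold>\<Sum>s. Y c s * phi a b s)" for a b c
      using Y[of a b c] unfolding act3_def by linarith
    have sw: "(\<^bold>\<Sum>t. X a t * (\<^bold>\<Sum>s. Y d s * f t s)) = (\<^bold>\<Sum>s. Y d s * (\<^bold>\<Sum>t. X a t * f t s))" for d f
    proof -
      have "(\<^bold>\<Sum>t. X a t * (\<^bold>\<Sum>s. Y d s * f t s)) = (\<^bold>\<Sum>t s. X a t * (Y d s * f t s))" by (simp only: sum_distrib_left)
      also have "\<dots> = (\<^bold>\<Sum>s t. X a t * (Y d s * f t s))" by (rule sum.swap)
      finally show ?thesis by (simp only: sum_distrib_left mult.left_commute)
    qed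
    have "(\<^bold>\<Sum>s. (\<^bold>\<Sum>t. X a t * Y t s) * phi s b c) = (\<^bold>\<Sum>t. X a t * (\<^bold>\<Sum>s. Y t s * phi s b c))"
      by (rule sum_push1)
    also have "\<dots> = - (\<^bold>\<Sum>t. X a t * (\<^bold>\<Sum>s. Y b s * phi t s c)) - (\<^bold>\<Sum>t. X a t * (\<^bold>\<Sum>s. Y c s * phi t b s))"
      unfolding y by (simp add: right_diff_distrib sum_subtractf sum_negf)
    also have "\<dots> = - (\<^bold>\<Sum>s. Y b s * (\<^bold>\<Sum>t. X a t * phi t s c)) - (\<^bold>\<Sum>s. Y c s * (\<^bold>\<Sum>t. X a t * phi t b s))"
      by (simp only: sw)
    also have "\<dots> = (\<^bold>\<Sum>s. Y b s * (\<^bold>\<Sum>t. X s t * phi a t c)) + (\<^bold>\<Sum>s. Y b s * (\<^bold>\<Sum>t. X c t * phi a s t))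
        + (\<^bold>\<Sum>s. Y c s * (\<^bold>\<Sum>t. X b t * phi a t s)) + (\<^bold>\<Sum>s. Y c s * (\<^bold>\<Sum>t. X s t * phi a b t))"
      unfolding x by (simp add: right_diff_distrib sum_subtractf sum_negf)
    finally show ?thesis unfolding sum_push1 by simp
  qed
  have cr: "(\<^bold>\<Sum>s. Y b s * (\<^bold>\<Sum>t. X c t * phi a s t)) = (\<^bold>\<Sum>s. X c s * (\<^bold>\<Sum>t. Y b t * phi a t s))" for X Y b c
  proof -
    have "(\<^bold>\<Sum>s. Y b s * (\<^bold>\<Sum>t. X c t * phi a s t)) = (\<^bold>\<Sum>s t. Y b s * (X c t * phi a s t))" by (simp only: sum_distrib_left)
    also have "\<dots> = (\<^bold>\<Sum>t s. Y b s * (X c t * phi a s t))" by (rule sum.swap)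
    finally show ?thesis by (simp only: sum_distrib_left mult.left_commute)
  qed
  show ?thesis
    using slot[OF X Y] slot[OF Y X] cr[of Y b X c] cr[of X b Y c] unfolding act3_def by linarith
qed

section \<open>Frame components evaluated on the values of a coframe\<close>

definition bil :: "(7 \<Rightarrow> 7 \<Rightarrow> real) \<Rightarrow> (7 \<Rightarrow> real) \<Rightarrow> (7 \<Rightarrow> real) \<Rightarrow> real"
  where "bil X u v = (\<^bold>\<Sum>a b. X a b * u a * v b)"

definition tri :: "(7 \<Rightarrow> 7 \<Rightarrow> 7 \<Rightarrow> real) \<Rightarrow> (7 \<Rightarrow> real) \<Rightarrow> (7 \<Rightarrow> real) \<Rightarrow> (7 \<Rightarrow> real) \<Rightarrow> real"
  where "tri Q u v w = (\<^bold>\<Sum>a b c. Q a b c * u a * v b * w c)"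

lemma bil_add:
  "bil X (\<lambda>a. u a + u' a) v = bil X u v + bil X u' v" "bil X u (\<lambda>a. v a + v' a) = bil X u v + bil X u v'"
  "bil X (\<lambda>a. u a - u' a) v = bil X u v - bil X u' v" "bil X u (\<lambda>a. v a - v' a) = bil X u v - bil X u v'"
  "bil (\<lambda>a b. X a b + X' a b) u v = bil X u v + bil X' u v" "bil (\<lambda>a b. X a b - X' a b) u v = bil X u v - bil X' u v"
  by (simp_all add: bil_def algebra_simps sum.distrib sum_subtractf)

lemma bil_skew: "alt2 X \<Longrightarrow> bil X v u = - bil X u v"
proof -
  assume X: "alt2 X"
  have "bil X v u = (\<^bold>\<Sum>b a. X a b * v a * u b)" unfolding bil_def by (rule sum.swap)
  also have "\<dots> = (\<^bold>\<Sum>b a. - (X b a * u b * v a))"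
  proof (intro sum.cong refl)
    fix a b show "X a b * v a * u b = - (X b a * u b * v a)" using alt2D[OF X, of b a] by simp
  qed
  finally show ?thesis by (simp add: bil_def sum_negf)
qed

lemma bil_act:
  assumes F: "alt2 F"
  shows "bil X (\<lambda>a. \<^bold>\<Sum>s. F a s * u s) v = - bil (\<lambda>a b. \<^bold>\<Sum>s. F a s * X s b) u v"
    "bil X u (\<lambda>a. \<^bold>\<Sum>s. F a s * v s) = - bil (\<lambda>a b. \<^bold>\<Sum>s. F b s * X a s) u v"
proof -
  have "bil X (\<lambda>a. \<^bold>\<Sum>s. F a s * u s) v = (\<^bold>\<Sum>a b s. X a b * (F a s * u s) * v b)"
    by (simp only: bil_def sum_distrib_left sum_distrib_right)
  also have "\<dots> = (\<^bold>\<Sum>s a b. X a b * (F a s * u s) * v b)" by (rule sum_rot3[symmetric])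
  also have "\<dots> = (\<^bold>\<Sum>s b a. X a b * (F a s * u s) * v b)" by (rule sum.cong[OF refl]) (rule sum.swap)
  also have "\<dots> = (\<^bold>\<Sum>s b a. - (F s a * X a b * u s * v b))"
  proof (intro sum.cong refl)
    fix s a b show "X a b * (F a s * u s) * v b = - (F s a * X a b * u s * v b)" using alt2D[OF F, of a s] by simp
  qed
  finally show "bil X (\<lambda>a. \<^bold>\<Sum>s. F a s * u s) v = - bil (\<lambda>a b. \<^bold>\<Sum>s. F a s * X s b) u v"
    by (simp only: bil_def sum_negf sum_distrib_right)
  have "bil X u (\<lambda>a. \<^bold>\<Sum>s. F a s * v s) = (\<^bold>\<Sum>a b s. X a b * u a * (F b s * v s))"
    by (simp only: bil_def sum_distrib_left)
  also have "\<dots> = (\<^bold>\<Sum>a s b. X a b * u a * (F b s * v s))" by (rule sum.cong[OF refl]) (rule sum.swap)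
  also have "\<dots> = (\<^bold>\<Sum>a s b. - (F s b * X a b * u a * v s))"
  proof (intro sum.cong refl)
    fix s a b show "X a b * u a * (F b s * v s) = - (F s b * X a b * u a * v s)" using alt2D[OF F, of b s] by simp
  qed
  finally show "bil X u (\<lambda>a. \<^bold>\<Sum>s. F a s * v s) = - bil (\<lambda>a b. \<^bold>\<Sum>s. F b s * X a s) u v"
    by (simp only: bil_def sum_negf sum_distrib_right)
qed

lemma tri_rot: "tri Q v w u = tri (\<lambda>a b c. Q b c a) u v w"
proof -
  have "tri Q v w u = (\<^bold>\<Sum>a b c. Q b c a * u a * v b * w c)"
    unfolding tri_def by (subst sum_rot3[symmetric]) (simp only: mult.commute mult.left_commute mult.assoc)
  then show ?thesis by (simp add: tri_def)
qed

lemma tri_add: "tri (\<lambda>a b c. P a b c + Q a b c) u v w = tri P u v w + tri Q u v w"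
  by (simp add: tri_def algebra_simps sum.distrib)

lemma bil_slice: "bil (\<lambda>a b. \<^bold>\<Sum>d. u d * Q d a b) v w = tri Q u v w"
proof -
  have "bil (\<lambda>a b. \<^bold>\<Sum>d. u d * Q d a b) v w = (\<^bold>\<Sum>a b d. Q d a b * u d * v a * w b)"
    by (simp only: bil_def sum_distrib_left sum_distrib_right mult.commute mult.left_commute mult.assoc)
  also have "\<dots> = (\<^bold>\<Sum>d a b. Q d a b * u d * v a * w b)" by (rule sum_rot3[symmetric])
  finally show ?thesis by (simp only: tri_def)
qed

lemma bil_first: "bil X (\<lambda>a. bil (\<lambda>d f. T d f a) u v) w = tri (\<lambda>d f b. \<^bold>\<Sum>a. T d f a * X a b) u v w"
proof -
  have "bil X (\<lambda>a. bil (\<lambda>d f. T d f a) u v) w = (\<^bold>\<Sum>a b d f. T d f a * X a b * u d * v f * w b)"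
    by (simp only: bil_def sum_distrib_right sum_distrib_left mult.commute mult.left_commute mult.assoc)
  also have "\<dots> = (\<^bold>\<Sum>d f a b. T d f a * X a b * u d * v f * w b)" by (rule sum_rot4)
  also have "\<dots> = (\<^bold>\<Sum>d f b a. T d f a * X a b * u d * v f * w b)" by (intro sum.cong refl sum.swap)
  finally show ?thesis by (simp only: tri_def sum_distrib_right)
qed

text \<open>
  Exterior derivative of a 2-form with frame components \<open>X\<close>: \<open>e\<close>, \<open>pe\<close>, \<open>pX\<close> are the values of the
  coframe and of the partial derivatives of the coframe and of \<open>X\<close>.
\<close>

lemma ext_two_form:
  fixes e :: "7 \<Rightarrow> 7 \<Rightarrow> real"
  assumes A: "\<And>k. alt2 (A k)" and X: "alt2 X"
    and tors: "\<And>k i a. pe k i a - (\<^bold>\<Sum>s. A k a s * e i s) - (pe i k a - (\<^bold>\<Sum>s. A i a s * e k s)) = bil (\<lambda>d f. T d f a) (e k) (e i)"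
    and NX: "\<And>k a b. pX k a b - (\<^bold>\<Sum>s. A k a s * X s b) - (\<^bold>\<Sum>s. A k b s * X a s) = (\<^bold>\<Sum>d. e k d * DX d a b)"
    and pZ: "\<And>k i j. pZ k i j = bil (pX k) (e i) (e j) + bil X (pe k i) (e j) + bil X (e i) (pe k j)"
  shows "pZ k i j + pZ i j k + pZ j k i = tri (\<lambda>a b c. DX a b c + DX b c a + DX c a b +
      (\<^bold>\<Sum>s. T a b s * X s c) + (\<^bold>\<Sum>s. T b c s * X s a) + (\<^bold>\<Sum>s. T c a s * X s b)) (e k) (e i) (e j)"
proof -
  \<comment> \<open>\<open>d\<close> is the covariant derivative of the coframe. Written with it,
    the connection terms of \<open>pe\<close> cancel those of \<open>pX\<close> by
    \<open>bil_act\<close>, and only covariant derivatives and torsion remain.\<close>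
  define d where "d k i a = pe k i a - (\<^bold>\<Sum>s. A k a s * e i s)" for k i a
  have pe: "pe k i = (\<lambda>a. d k i a + (\<^bold>\<Sum>s. A k a s * e i s))" for k i by (simp add: d_def fun_eq_iff)
  have pXe: "pX k = (\<lambda>a b. (\<^bold>\<Sum>d. e k d * DX d a b) + (\<^bold>\<Sum>s. A k a s * X s b) + (\<^bold>\<Sum>s. A k b s * X a s))" for k
    using NX by (simp add: fun_eq_iff algebra_simps)
  have z: "pZ k i j = tri DX (e k) (e i) (e j) + bil X (d k i) (e j) + bil X (e i) (d k j)" for k i j
    unfolding pZ pe pXe by (simp only: bil_add bil_act[OF A] bil_slice)
  have t: "bil X (d k i) w - bil X (d i k) w = tri (\<lambda>a b c. \<^bold>\<Sum>s. T a b s * X s c) (e k) (e i) w" for k i w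
    unfolding bil_add(3)[symmetric] unfolding d_def tors bil_first ..
  show ?thesis
    unfolding z tri_add
    using t[of k i "e j"] t[of i j "e k"] t[of j k "e i"]
      bil_skew[OF X, of "d k j" "e i"] bil_skew[OF X, of "d i k" "e j"] bil_skew[OF X, of "d j i" "e k"]
      tri_rot[of DX "e i" "e j" "e k"] tri_rot[of DX "e j" "e k" "e i"] tri_rot[of "\<lambda>a b c. DX b c a" "e i" "e j" "e k"]
      tri_rot[of "\<lambda>a b c. \<^bold>\<Sum>s. T a b s * X s c" "e i" "e j" "e k"]
      tri_rot[of "\<lambda>a b c. \<^bold>\<Sum>s. T a b s * X s c" "e j" "e k" "e i"]
      tri_rot[of "\<lambda>a b c. \<^bold>\<Sum>s. T b c s * X s a" "e i" "e j" "e k"]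
    by simp
qed

lemma coframe_cancel1:
  fixes e :: "7 \<Rightarrow> 7 \<Rightarrow> real"
  assumes inv: "\<And>a b. (\<^bold>\<Sum>i. Ei a i * e i b) = kd a b" and z: "\<And>i. (\<^bold>\<Sum>a. x a * e i a) = 0"
  shows "x a = 0"
proof -
  have "0 = (\<^bold>\<Sum>i. (\<^bold>\<Sum>b. x b * e i b) * Ei a i)" using z by simp
  also have "\<dots> = (\<^bold>\<Sum>b. x b * (\<^bold>\<Sum>i. e i b * Ei a i))" by (rule sum_push1)
  also have "\<dots> = x a" using inv[of a] by (simp add: mult.commute)
  finally show ?thesis by simp
qed

lemma coframe_cancel2:
  fixes e :: "7 \<Rightarrow> 7 \<Rightarrow> real"
  assumes inv: "\<And>a b. (\<^bold>\<Sum>i. Ei a i * e i b) = kd a b" and z: "\<And>i j. bil X (e i) (e j) = 0"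
  shows "X a b = 0"
proof (rule coframe_cancel1[where x = "X a" and a = b, OF inv])
  fix j
  show "(\<^bold>\<Sum>b. X a b * e j b) = 0"
  proof (rule coframe_cancel1[where x = "\<lambda>a. \<^bold>\<Sum>b. X a b * e j b" and a = a, OF inv])
    fix i show "(\<^bold>\<Sum>a. (\<^bold>\<Sum>b. X a b * e j b) * e i a) = 0"
      using z[of i j] by (simp add: bil_def sum_distrib_right mult.assoc mult.commute[of "e j _"])
  qed
qed

lemma coframe_cancel3:
  fixes e :: "7 \<Rightarrow> 7 \<Rightarrow> real"
  assumes inv: "\<And>a b. (\<^bold>\<Sum>i. Ei a i * e i b) = kd a b" and z: "\<And>i j k. tri Q (e i) (e j) (e k) = 0"
  shows "Q a b c = 0"
proof (rule coframe_cancel1[where x = "Q a b" and a = c, OF inv])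
  fix k
  show "(\<^bold>\<Sum>c. Q a b c * e k c) = 0"
  proof (rule coframe_cancel2[where X = "\<lambda>a b. \<^bold>\<Sum>c. Q a b c * e k c" and a = a and b = b, OF inv])
    fix i j show "bil (\<lambda>a b. \<^bold>\<Sum>c. Q a b c * e k c) (e i) (e j) = 0"
      using z[of i j k] by (simp add: bil_def tri_def sum_distrib_right mult.assoc mult.commute[of "e k _"] mult.left_commute[of "e k _"])
  qed
qed

definition mm :: "(7 \<Rightarrow> 7 \<Rightarrow> real) \<Rightarrow> (7 \<Rightarrow> 7 \<Rightarrow> real) \<Rightarrow> 7 \<Rightarrow> 7 \<Rightarrow> real"
  where "mm X Y a b = (\<^bold>\<Sum>s. X a s * Y s b)"

lemma mm_lin:
  "mm X (\<lambda>a b. P a b + Q a b) a b = mm X P a b + mm X Q a b"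
  "mm X (\<lambda>a b. P a b - Q a b) a b = mm X P a b - mm X Q a b"
  "mm (\<lambda>a b. P a b + Q a b) X a b = mm P X a b + mm Q X a b"
  "mm (\<lambda>a b. P a b - Q a b) X a b = mm P X a b - mm Q X a b"
  by (simp_all add: mm_def algebra_simps sum.distrib sum_subtractf)

lemma mm_assoc: "mm (mm X Y) Z = mm X (mm Y Z)"
  unfolding mm_def by (intro ext sum_push1)

text \<open>Second derivatives cancel by \<open>dd\<close>, and the products of three connection
  matrices cancel by associativity.\<close>

lemma second_bianchi_matrix:
  fixes A :: "7 \<Rightarrow> 7 \<Rightarrow> 7 \<Rightarrow> real"
  assumes dd: "\<And>k i j. ddA k i j = ddA i k j"
    and F: "\<And>i j. F i j = (\<lambda>a b. dA i j a b - dA j i a b - mm (A i) (A j) a b + mm (A j) (A i) a b)"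
    and pF: "\<And>k i j a b. pF k i j a b = ddA k i j a b - ddA k j i a b - (mm (dA k i) (A j) a b + mm (A i) (dA k j) a b)
      + (mm (dA k j) (A i) a b + mm (A j) (dA k i) a b)"
  shows "(pF k i j a b - mm (A k) (F i j) a b + mm (F i j) (A k) a b) + (pF i j k a b - mm (A i) (F j k) a b + mm (F j k) (A i) a b)
    + (pF j k i a b - mm (A j) (F k i) a b + mm (F k i) (A j) a b) = 0"
  unfolding pF F mm_lin mm_assoc using dd[of k i j] dd[of k j i] dd[of i j k] by (simp add: mm_assoc)

section \<open>Moving frames\<close>

text \<open>All that the frame calculus needs to know about functions on a chart: an algebra with
  commuting derivations, local on \<open>V\<close>. Identities are required at points of
  \<open>V\<close> only, because functions are unconstrained elsewhere.\<close>

locale smooth_derivations =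
  fixes V :: "'p set" and sm :: "('p \<Rightarrow> real) \<Rightarrow> bool" and pd :: "7 \<Rightarrow> ('p \<Rightarrow> real) \<Rightarrow> 'p \<Rightarrow> real"
  assumes sm_const: "sm (\<lambda>q. c)"
    and sm_add: "sm f \<Longrightarrow> sm g \<Longrightarrow> sm (\<lambda>q. f q + g q)"
    and sm_mult: "sm f \<Longrightarrow> sm g \<Longrightarrow> sm (\<lambda>q. f q * g q)"
    and sm_pd: "sm f \<Longrightarrow> sm (pd i f)"
    and pd_const: "p \<in> V \<Longrightarrow> pd i (\<lambda>q. c) p = 0"
    and pd_add: "p \<in> V \<Longrightarrow> sm f \<Longrightarrow> sm g \<Longrightarrow> pd i (\<lambda>q. f q + g q) p = pd i f p + pd i g p"
    and pd_mult: "p \<in> V \<Longrightarrow> sm f \<Longrightarrow> sm g \<Longrightarrow> pd i (\<lambda>q. f q * g q) p = pd i f p * g p + f p * pd i g p"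
    and pd_comm: "p \<in> V \<Longrightarrow> sm f \<Longrightarrow> pd i (pd j f) p = pd j (pd i f) p"
    and pd_cong: "p \<in> V \<Longrightarrow> (\<And>q. q \<in> V \<Longrightarrow> f q = g q) \<Longrightarrow> pd i f p = pd i g p"
begin

lemma sm_uminus: "sm f \<Longrightarrow> sm (\<lambda>q. - f q)"
  using sm_mult[OF sm_const[of "-1"], of f] by simp

lemma sm_diff: "sm f \<Longrightarrow> sm g \<Longrightarrow> sm (\<lambda>q. f q - g q)"
  using sm_add[of f "\<lambda>q. - g q"] sm_uminus by simp

lemma sm_finite_sum: "(\<And>x. x \<in> S \<Longrightarrow> sm (\<lambda>q. f x q)) \<Longrightarrow> sm (\<lambda>q. \<Sum>x\<in>S. f x q)"
  by (induction S rule: infinite_finite_induct) (simp_all add: sm_const sm_add)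

lemma sm_sum: "(\<And>x. sm (\<lambda>q. f x q)) \<Longrightarrow> sm (\<lambda>q. \<Sum>x\<in>S. f x q)"
  by (rule sm_finite_sum)

lemmas sm_rules = sm_const sm_add sm_mult sm_uminus sm_diff sm_sum sm_pd

lemma pd_cmult: "p \<in> V \<Longrightarrow> sm f \<Longrightarrow> pd i (\<lambda>q. c * f q) p = c * pd i f p"
  by (simp add: pd_mult sm_const pd_const)

lemma pd_uminus: "p \<in> V \<Longrightarrow> sm f \<Longrightarrow> pd i (\<lambda>q. - f q) p = - pd i f p"
  using pd_cmult[of p f i "-1"] by simp

lemma pd_diff: "p \<in> V \<Longrightarrow> sm f \<Longrightarrow> sm g \<Longrightarrow> pd i (\<lambda>q. f q - g q) p = pd i f p - pd i g p"
  using pd_add[of p f "\<lambda>q. - g q" i] by (simp add: sm_uminus pd_uminus)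

lemma pd_finite_sum:
  assumes "p \<in> V"
  shows "(\<And>x. x \<in> S \<Longrightarrow> sm (\<lambda>q. f x q)) \<Longrightarrow> pd i (\<lambda>q. \<Sum>x\<in>S. f x q) p = (\<Sum>x\<in>S. pd i (\<lambda>q. f x q) p)"
  by (induction S rule: infinite_finite_induct) (simp_all add: pd_const pd_add sm_finite_sum assms)

lemma pd_sum: "p \<in> V \<Longrightarrow> (\<And>x. sm (\<lambda>q. f x q)) \<Longrightarrow> pd i (\<lambda>q. \<Sum>x\<in>S. f x q) p = (\<Sum>x\<in>S. pd i (\<lambda>q. f x q) p)"
  by (rule pd_finite_sum)

lemmas pd_rules = pd_const pd_add pd_mult pd_uminus pd_diff pd_sum

end

text \<open>
  The index \<open>i\<close> of \<open>pd i\<close>, \<open>e i a\<close>, \<open>Ei a i\<close> and \<open>A i a b\<close> refers to coordinates, all other indices to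
  the coframe: its element \<open>a\<close> has coordinate components \<open>e i a\<close>, and its covariant derivative along
  \<open>\<partial>\<^sub>i\<close> is \<open>\<Sum>\<^sub>b A i a b \<theta>\<^sub>b\<close>.
\<close>

locale moving_frame = smooth_derivations V sm pd
  for V :: "'p set" and sm pd +
  fixes e Ei :: "7 \<Rightarrow> 7 \<Rightarrow> 'p \<Rightarrow> real" and A T :: "7 \<Rightarrow> 7 \<Rightarrow> 7 \<Rightarrow> 'p \<Rightarrow> real"
    and R :: "7 \<Rightarrow> 7 \<Rightarrow> 7 \<Rightarrow> 7 \<Rightarrow> 'p \<Rightarrow> real" and r :: real
  assumes sm_e: "sm (e i a)" and sm_A: "sm (A i a b)" and sm_T: "sm (T a b c)" and sm_R: "sm (R a b c d)"
    and Ei_e: "p \<in> V \<Longrightarrow> (\<^bold>\<Sum>i. Ei a i p * e i b p) = kd a b"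
    and e_Ei: "p \<in> V \<Longrightarrow> (\<^bold>\<Sum>a. e i a p * Ei a j p) = kd i j"
    and A_skew: "p \<in> V \<Longrightarrow> alt2 (\<lambda>a b. A i a b p)"
    and A_phi: "p \<in> V \<Longrightarrow> act3 (\<lambda>a b. A i a b p) phi a b c = 0"
    and T_alt: "p \<in> V \<Longrightarrow> alt3 (\<lambda>a b c. T a b c p)"
    and cartan1: "p \<in> V \<Longrightarrow> pd i (e j a) p - (\<^bold>\<Sum>s. A i a s p * e j s p) - (pd j (e i a) p - (\<^bold>\<Sum>s. A j a s p * e i s p))
        = bil (\<lambda>b c. T b c a p) (\<lambda>b. e i b p) (\<lambda>c. e j c p)"
    and cartan2: "p \<in> V \<Longrightarrow> pd i (A j a b) p - pd j (A i a b) p - (\<^bold>\<Sum>s. A i a s p * A j s b p) + (\<^bold>\<Sum>s. A j a s p * A i s b p)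
        = bil (\<lambda>c d. R c d a b p) (\<lambda>c. e i c p) (\<lambda>d. e j d p)"
    and R_skew1: "p \<in> V \<Longrightarrow> R b a c d p = - R a b c d p"
    and R_skew2: "p \<in> V \<Longrightarrow> R a b d c p = - R a b c d p"
    and R_inst: "p \<in> V \<Longrightarrow> (\<^bold>\<Sum>a b. R a b i j p * phi a b k) = 0"
    and R_ric: "p \<in> V \<Longrightarrow> (\<^bold>\<Sum>a. R a i j a p) = 0"
    and const_type: "p \<in> V \<Longrightarrow> (\<^bold>\<Sum>i j l. phi i j l * T i j l p) = r"
begin

lemmas sm_all = sm_rules sm_e sm_A sm_T sm_R

section \<open>Bianchi identities in a moving frame\<close>

definition Fc where "Fc i j a b p = bil (\<lambda>c d. R c d a b p) (\<lambda>c. e i c p) (\<lambda>d. e j d p)"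

lemma Fc_A: "p \<in> V \<Longrightarrow> Fc i j a b p = pd i (A j a b) p - pd j (A i a b) p - mm (\<lambda>a b. A i a b p) (\<lambda>a b. A j a b p) a b
     + mm (\<lambda>a b. A j a b p) (\<lambda>a b. A i a b p) a b"
  unfolding Fc_def mm_def by (rule cartan2[symmetric])

text \<open>The usual curvature computation for a section \<open>f\<close>: second derivatives
  commute, first derivatives of \<open>f\<close> pair off, and the matrix of the curvature 2-form is
  left.\<close>

lemma D_comm:
  assumes p: "p \<in> V" and f: "\<And>a. sm (f a)"
  shows "pd k (\<lambda>q. pd i (f c) q - (\<^bold>\<Sum>s. A i c s q * f s q)) p - (\<^bold>\<Sum>s. A k c s p * (pd i (f s) p - (\<^bold>\<Sum>t. A i s t p * f t p)))
     - (pd i (\<lambda>q. pd k (f c) q - (\<^bold>\<Sum>s. A k c s q * f s q)) p - (\<^bold>\<Sum>s. A i c s p * (pd k (f s) p - (\<^bold>\<Sum>t. A k s t p * f t p))))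
     = - (\<^bold>\<Sum>s. Fc k i c s p * f s p)"
proof -
  have 1: "pd k (\<lambda>q. pd i (f c) q - (\<^bold>\<Sum>s. A i c s q * f s q)) p
     = pd k (pd i (f c)) p - (\<^bold>\<Sum>s. pd k (A i c s) p * f s p) - (\<^bold>\<Sum>s. A i c s p * pd k (f s) p)" for i k
    by (simp add: pd_rules sm_all f p sum.distrib)
  have 2: "(\<^bold>\<Sum>s. A k c s p * (pd i (f s) p - (\<^bold>\<Sum>t. A i s t p * f t p)))
     = (\<^bold>\<Sum>s. A k c s p * pd i (f s) p) - (\<^bold>\<Sum>t. mm (\<lambda>a b. A k a b p) (\<lambda>a b. A i a b p) c t * f t p)" for i k
    unfolding mm_def sum_push1 by (simp add: right_diff_distrib sum_subtractf)
  show ?thesis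
    unfolding 1 2 Fc_A[OF p] using pd_comm[OF p f, of k i c]
    by (simp add: algebra_simps sum.distrib sum_subtractf)
qed

definition DT where
  "DT d a b c p = (\<^bold>\<Sum>k. Ei d k p * (pd k (T a b c) p - act3 (\<lambda>x y. A k x y p) (\<lambda>x y z. T x y z p) a b c))"

lemma expand_frame:
  assumes "p \<in> V"
  shows "(\<^bold>\<Sum>d. e k d p * (\<^bold>\<Sum>l. Ei d l p * x l)) = x k"
proof -
  have "(\<^bold>\<Sum>d. e k d p * (\<^bold>\<Sum>l. Ei d l p * x l)) = (\<^bold>\<Sum>l. (\<^bold>\<Sum>d. e k d p * Ei d l p) * x l)"
    by (rule sum_push1[symmetric])
  then show ?thesis by (simp add: e_Ei[OF assms])
qed

lemma pd_T:
  assumes "p \<in> V"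
  shows "pd k (T a b c) p - act3 (\<lambda>x y. A k x y p) (\<lambda>x y z. T x y z p) a b c = (\<^bold>\<Sum>d. e k d p * DT d a b c p)"
  unfolding DT_def expand_frame[OF assms] ..

lemma alt2_T: "p \<in> V \<Longrightarrow> alt2 (\<lambda>a b. T a b c p)"
  using T_alt unfolding alt2_def alt3_def by blast

lemma pd_bil:
  assumes p: "p \<in> V" and X: "\<And>a b. sm (X a b)"
  shows "pd k (\<lambda>q. bil (\<lambda>a b. X a b q) (\<lambda>a. e i a q) (\<lambda>b. e j b q)) p
    = bil (\<lambda>a b. pd k (X a b) p) (\<lambda>a. e i a p) (\<lambda>b. e j b p) + bil (\<lambda>a b. X a b p) (\<lambda>a. pd k (e i a) p) (\<lambda>b. e j b p)
      + bil (\<lambda>a b. X a b p) (\<lambda>a. e i a p) (\<lambda>b. pd k (e j b) p)"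
  unfolding bil_def by (simp add: pd_rules sm_all X p sum.distrib distrib_right)

text \<open>The 2-form with components \<open>X\<close> may carry further frame indices, such as the
  last index of \<open>T\<close> or the last pair of \<open>R\<close>. \<open>C k\<close> is the
  connection acting on these, so that \<open>pZ\<close> is a covariant exterior derivative.\<close>

lemma frame_bianchi:
  assumes p: "p \<in> V" and X: "\<And>a b. sm (X a b)" and Xs: "alt2 (\<lambda>a b. X a b p)"
    and NX: "\<And>k a b. pd k (X a b) p - C k a b - (\<^bold>\<Sum>s. A k a s p * X s b p) - (\<^bold>\<Sum>s. A k b s p * X a s p) = (\<^bold>\<Sum>d. e k d p * DX d a b)"
    and pZ: "\<And>k i j. pZ k i j = pd k (\<lambda>q. bil (\<lambda>a b. X a b q) (\<lambda>a. e i a q) (\<lambda>b. e j b q)) p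
        - bil (C k) (\<lambda>a. e i a p) (\<lambda>b. e j b p)"
  shows "pZ k i j + pZ i j k + pZ j k i = tri (\<lambda>a b c. DX a b c + DX b c a + DX c a b +
      (\<^bold>\<Sum>s. T a b s p * X s c p) + (\<^bold>\<Sum>s. T b c s p * X s a p) + (\<^bold>\<Sum>s. T c a s p * X s b p)) (\<lambda>a. e k a p) (\<lambda>a. e i a p) (\<lambda>a. e j a p)"
proof (rule ext_two_form[where A = "\<lambda>k a b. A k a b p" and pX = "\<lambda>k a b. pd k (X a b) p - C k a b"
      and pe = "\<lambda>k i a. pd k (e i a) p" and X = "\<lambda>a b. X a b p" and T = "\<lambda>a b c. T a b c p"
      and e = "\<lambda>i a. e i a p", OF A_skew[OF p] Xs cartan1[OF p] NX])
  show "pZ k i j = bil (\<lambda>a b. pd k (X a b) p - C k a b) (\<lambda>a. e i a p) (\<lambda>a. e j a p)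
      + bil (\<lambda>a b. X a b p) (\<lambda>a. pd k (e i a) p) (\<lambda>a. e j a p) + bil (\<lambda>a b. X a b p) (\<lambda>a. e i a p) (\<lambda>a. pd k (e j a) p)" for k i j
    unfolding pZ pd_bil[OF p X] bil_add by simp
qed

lemma cancel3:
  assumes p: "p \<in> V"
    and z: "\<And>k i j. tri P (\<lambda>a. e k a p) (\<lambda>a. e i a p) (\<lambda>a. e j a p) = tri Q (\<lambda>a. e k a p) (\<lambda>a. e i a p) (\<lambda>a. e j a p)"
  shows "P a b c = Q a b c"
proof -
  have "P a b c - Q a b c = 0"
  proof (rule coframe_cancel3[where Q = "\<lambda>a b c. P a b c - Q a b c" and e = "\<lambda>i a. e i a p" and Ei = "\<lambda>a i. Ei a i p", OF Ei_e[OF p]])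
    show "tri (\<lambda>a b c. P a b c - Q a b c) (\<lambda>a. e i a p) (\<lambda>a. e j a p) (\<lambda>a. e k a p) = 0" for i j k
      using z[of i j k] by (simp add: tri_def left_diff_distrib sum_subtractf)
  qed
  then show ?thesis by simp
qed

lemma cancel2:
  assumes p: "p \<in> V" and z: "\<And>i j. bil P (\<lambda>a. e i a p) (\<lambda>a. e j a p) = bil Q (\<lambda>a. e i a p) (\<lambda>a. e j a p)"
  shows "P a b = Q a b"
proof -
  have "P a b - Q a b = 0"
  proof (rule coframe_cancel2[where X = "\<lambda>a b. P a b - Q a b" and e = "\<lambda>i a. e i a p" and Ei = "\<lambda>a i. Ei a i p", OF Ei_e[OF p]])
    show "bil (\<lambda>a b. P a b - Q a b) (\<lambda>a. e i a p) (\<lambda>a. e j a p) = 0" for i j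
      using z[of i j] by (simp add: bil_add)
  qed
  then show ?thesis by simp
qed

text \<open>The covariant exterior derivative of the torsion form is computed twice. The torsion
  form is the alternated covariant derivative of the coframe, so regrouping gives commutators, that
  is curvature; the product rule gives derivatives of \<open>T\<close> and terms quadratic in
  \<open>T\<close>. The coframe is then cancelled.\<close>

lemma first_bianchi:
  assumes p: "p \<in> V"
  shows "R a b c d p + R b c a d p + R c a b d p = DT a b c d p + DT b c a d p + DT c a b d p + sig (\<lambda>a b c. T a b c p) a b c d"
proof -
  define DE where "DE i j c q = pd i (e j c) q - (\<^bold>\<Sum>s. A i c s q * e j s q)" for i j c q
  have sDE: "sm (DE i j c)" for i j c unfolding DE_def by (intro sm_all)
  define Th where "Th i j c q = bil (\<lambda>a b. T a b c q) (\<lambda>a. e i a q) (\<lambda>b. e j b q)" for i j c q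
  have Th: "q \<in> V \<Longrightarrow> Th i j c q = DE i j c q - DE j i c q" for i j c q
    unfolding Th_def DE_def by (rule cartan1[symmetric])
  define C where "C k a b = (\<^bold>\<Sum>s. A k d s p * T a b s p)" for k a b
  define pZ where "pZ k i j = pd k (Th i j d) p - bil (C k) (\<lambda>a. e i a p) (\<lambda>b. e j b p)" for k i j
  have C: "bil (C k) (\<lambda>a. e i a p) (\<lambda>b. e j b p) = (\<^bold>\<Sum>s. A k d s p * (DE i j s p - DE j i s p))" for k i j
  proof -
    have "bil (C k) (\<lambda>a. e i a p) (\<lambda>b. e j b p) = (\<^bold>\<Sum>a b s. A k d s p * (T a b s p * e i a p * e j b p))"
      by (simp only: bil_def C_def sum_distrib_right mult.assoc)
    also have "\<dots> = (\<^bold>\<Sum>s a b. A k d s p * (T a b s p * e i a p * e j b p))" by (rule sum_rot3[symmetric])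
    finally show ?thesis unfolding Th[OF p, symmetric] by (simp only: Th_def bil_def sum_distrib_left)
  qed
  have pZ': "pZ k i j = (pd k (DE i j d) p - (\<^bold>\<Sum>s. A k d s p * DE i j s p)) - (pd k (DE j i d) p - (\<^bold>\<Sum>s. A k d s p * DE j i s p))" for k i j
  proof -
    have "pd k (Th i j d) p = pd k (\<lambda>q. DE i j d q - DE j i d q) p" by (rule pd_cong[OF p Th])
    then show ?thesis unfolding pZ_def C by (simp add: pd_diff p sDE right_diff_distrib sum_subtractf)
  qed
  have comm: "(pd k (DE i j d) p - (\<^bold>\<Sum>s. A k d s p * DE i j s p)) - (pd i (DE k j d) p - (\<^bold>\<Sum>s. A i d s p * DE k j s p))
     = tri (\<lambda>x y z. R x y z d p) (\<lambda>a. e k a p) (\<lambda>a. e i a p) (\<lambda>a. e j a p)" for k i j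
  proof -
    have "(pd k (DE i j d) p - (\<^bold>\<Sum>s. A k d s p * DE i j s p)) - (pd i (DE k j d) p - (\<^bold>\<Sum>s. A i d s p * DE k j s p))
      = - (\<^bold>\<Sum>s. Fc k i d s p * e j s p)"
      unfolding DE_def[abs_def] by (rule D_comm[OF p sm_e])
    also have "\<dots> = (\<^bold>\<Sum>s x y. R x y s d p * e k x p * e i y p * e j s p)"
      by (simp add: Fc_def bil_def sum_distrib_right sum_negf[symmetric] R_skew2[OF p, of _ _ d])
    also have "\<dots> = (\<^bold>\<Sum>x y s. R x y s d p * e k x p * e i y p * e j s p)" by (rule sum_rot3)
    finally show ?thesis by (simp add: tri_def)
  qed
  have "pZ k i j + pZ i j k + pZ j k i = tri (\<lambda>a b c. R a b c d p + R b c a d p + R c a b d p) (\<lambda>a. e k a p) (\<lambda>a. e i a p) (\<lambda>a. e j a p)" for k i j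
    unfolding pZ' tri_add using comm[of k i j] comm[of i j k] comm[of j k i]
      tri_rot[of "\<lambda>x y z. R x y z d p" "\<lambda>a. e i a p" "\<lambda>a. e j a p" "\<lambda>a. e k a p"]
      tri_rot[of "\<lambda>x y z. R x y z d p" "\<lambda>a. e j a p" "\<lambda>a. e k a p" "\<lambda>a. e i a p"]
      tri_rot[of "\<lambda>x y z. R y z x d p" "\<lambda>a. e i a p" "\<lambda>a. e j a p" "\<lambda>a. e k a p"]
    by linarith
  moreover have "pZ k i j + pZ i j k + pZ j k i = tri (\<lambda>a b c. DT a b c d p + DT b c a d p + DT c a b d p +
      (\<^bold>\<Sum>s. T a b s p * T s c d p) + (\<^bold>\<Sum>s. T b c s p * T s a d p) + (\<^bold>\<Sum>s. T c a s p * T s b d p)) (\<lambda>a. e k a p) (\<lambda>a. e i a p) (\<lambda>a. e j a p)" for k i j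
  proof (rule frame_bianchi[OF p, where X = "\<lambda>a b. T a b d" and C = C and DX = "\<lambda>a b c. DT a b c d p"])
    show "pd k (T a b d) p - C k a b - (\<^bold>\<Sum>s. A k a s p * T s b d p) - (\<^bold>\<Sum>s. A k b s p * T a s d p) = (\<^bold>\<Sum>x. e k x p * DT x a b d p)" for k a b
      unfolding pd_T[OF p, symmetric] act3_def C_def by simp
  qed (simp_all add: sm_T alt2_T p pZ_def Th_def[abs_def])
  ultimately have "R a b c d p + R b c a d p + R c a b d p = DT a b c d p + DT b c a d p + DT c a b d p +
      (\<^bold>\<Sum>s. T a b s p * T s c d p) + (\<^bold>\<Sum>s. T b c s p * T s a d p) + (\<^bold>\<Sum>s. T c a s p * T s b d p)"
    using cancel3[OF p, where P = "\<lambda>a b c. R a b c d p + R b c a d p + R c a b d p" and Q = "\<lambda>a b c. DT a b c d p + DT b c a d p + DT c a b d p +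
      (\<^bold>\<Sum>s. T a b s p * T s c d p) + (\<^bold>\<Sum>s. T b c s p * T s a d p) + (\<^bold>\<Sum>s. T c a s p * T s b d p)", of a b c] by simp
  moreover have "T s x d p = T x d s p" for s x using alt3_cyc[OF T_alt[OF p]] by metis
  ultimately show ?thesis by (simp add: sig_def sum.distrib)
qed

text \<open>The connection matrices annihilate \<open>phi\<close> at every point of
  \<open>V\<close>; so do their derivatives, as \<open>phi\<close> is constant, and their
  commutators. Hence the curvature matrices annihilate \<open>phi\<close>, which means that they lie
  in g2.\<close>

lemma R_g2:
  assumes p: "p \<in> V"
  shows "g2c (\<lambda>a b. R i j a b p)"
proof -
  have s: "alt2 (\<lambda>a b. R i j a b p)" for i j unfolding alt2_def using R_skew2[OF p] by blast
  have dA: "act3 (\<lambda>a b. pd i (A j a b) p) phi a b c = 0" for i j a b c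
  proof -
    have "0 = pd i (\<lambda>q. act3 (\<lambda>a b. A j a b q) phi a b c) p"
      using pd_cong[OF p, of "\<lambda>q. act3 (\<lambda>a b. A j a b q) phi a b c" "\<lambda>q. 0" i] A_phi pd_const[OF p] by simp
    also have "\<dots> = act3 (\<lambda>a b. pd i (A j a b) p) phi a b c"
      unfolding act3_def by (simp add: pd_rules sm_all p)
    finally show ?thesis by simp
  qed
  have F: "act3 (\<lambda>a b. Fc i j a b p) phi a b c = 0" for i j a b c
  proof -
    have "act3 (\<lambda>a b. Fc i j a b p) phi a b c = act3 (\<lambda>a b. pd i (A j a b) p) phi a b c - act3 (\<lambda>a b. pd j (A i a b) p) phi a b c
      - act3 (\<lambda>x y. mm (\<lambda>a b. A i a b p) (\<lambda>a b. A j a b p) x y) phi a b c + act3 (\<lambda>x y. mm (\<lambda>a b. A j a b p) (\<lambda>a b. A i a b p) x y) phi a b c"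
      unfolding Fc_A[OF p] act3_def by (simp add: algebra_simps sum.distrib sum_subtractf)
    then show ?thesis unfolding dA mm_def using act3_commutator[OF A_phi[OF p] A_phi[OF p]] by simp
  qed
  have "act3 (\<lambda>a b. R i j a b p) phi a b c = 0" for a b c i j
  proof (rule cancel2[OF p, where P = "\<lambda>i j. act3 (\<lambda>a b. R i j a b p) phi a b c" and Q = "\<lambda>i j. 0"])
    fix i j
    have l: "bil (\<lambda>x y. \<^bold>\<Sum>s. R x y u s p * f s) v w = (\<^bold>\<Sum>s. bil (\<lambda>x y. R x y u s p) v w * f s)" for u f v w
    proof -
      have "bil (\<lambda>x y. \<^bold>\<Sum>s. R x y u s p * f s) v w = (\<^bold>\<Sum>x y s. R x y u s p * v x * w y * f s)"
        by (simp only: bil_def sum_distrib_left sum_distrib_right mult.commute mult.left_commute mult.assoc)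
      also have "\<dots> = (\<^bold>\<Sum>s x y. R x y u s p * v x * w y * f s)" by (rule sum_rot3[symmetric])
      finally show ?thesis by (simp only: bil_def sum_distrib_right)
    qed
    show "bil (\<lambda>i j. act3 (\<lambda>a b. R i j a b p) phi a b c) (\<lambda>a. e i a p) (\<lambda>a. e j a p) = bil (\<lambda>i j. 0) (\<lambda>a. e i a p) (\<lambda>a. e j a p)"
      using F[of i j a b c] unfolding act3_def Fc_def bil_add l by (simp add: bil_def)
  qed
  then show ?thesis by (rule act3_phi_g2c[OF s])
qed

definition DR where
  "DR d x y a b p = (\<^bold>\<Sum>k. Ei d k p * (pd k (R x y a b) p - (\<^bold>\<Sum>s. A k x s p * R s y a b p) - (\<^bold>\<Sum>s. A k y s p * R x s a b p)
     - (\<^bold>\<Sum>s. A k a s p * R x y s b p) - (\<^bold>\<Sum>s. A k b s p * R x y a s p)))"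

text \<open>The covariant exterior derivative of the curvature form vanishes by the matrix identity,
  while \<open>frame_bianchi\<close> expresses it by covariant derivatives of \<open>R\<close> and
  torsion terms.\<close>

lemma second_bianchi:
  assumes p: "p \<in> V"
  shows "DR x y z a b p + DR y z x a b p + DR z x y a b p + (\<^bold>\<Sum>s. T x y s p * R s z a b p) + (\<^bold>\<Sum>s. T y z s p * R s x a b p)
    + (\<^bold>\<Sum>s. T z x s p * R s y a b p) = 0"
proof -
  define C where "C k x y = (\<^bold>\<Sum>s. A k a s p * R x y s b p) + (\<^bold>\<Sum>s. A k b s p * R x y a s p)" for k x y
  define pZ where "pZ k i j = pd k (Fc i j a b) p - bil (C k) (\<lambda>a. e i a p) (\<lambda>b. e j b p)" for k i j
  have l: "bil (\<lambda>x y. \<^bold>\<Sum>s. f s * Y x y s) v w = (\<^bold>\<Sum>s. f s * bil (\<lambda>x y. Y x y s) v w)" for Y f v w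
  proof -
    have "bil (\<lambda>x y. \<^bold>\<Sum>s. f s * Y x y s) v w = (\<^bold>\<Sum>x y s. f s * (Y x y s * v x * w y))"
      by (simp only: bil_def sum_distrib_right mult.assoc)
    also have "\<dots> = (\<^bold>\<Sum>s x y. f s * (Y x y s * v x * w y))" by (rule sum_rot3[symmetric])
    finally show ?thesis by (simp only: bil_def sum_distrib_left)
  qed
  \<comment> \<open>On the last pair of \<open>R\<close> the connection acts by a matrix commutator,
    the form required by \<open>second_bianchi_matrix\<close>.\<close>
  have C: "bil (C k) (\<lambda>a. e i a p) (\<lambda>b. e j b p) = mm (\<lambda>a b. A k a b p) (\<lambda>a b. Fc i j a b p) a b - mm (\<lambda>a b. Fc i j a b p) (\<lambda>a b. A k a b p) a b" for k i j
    unfolding C_def bil_add l mm_def Fc_def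
    by (simp add: alt2D[OF A_skew[OF p], of _ b] sum_negf mult.commute)
  define dA where "dA k i a b = pd k (A i a b) p" for k i a b
  define ddA where "ddA k i j a b = pd k (pd i (A j a b)) p" for k i j a b
  define pF where "pF k i j a b = pd k (Fc i j a b) p" for k i j a b
  have pF: "pF k i j a b = ddA k i j a b - ddA k j i a b - (mm (dA k i) (\<lambda>a b. A j a b p) a b + mm (\<lambda>a b. A i a b p) (dA k j) a b)
      + (mm (dA k j) (\<lambda>a b. A i a b p) a b + mm (\<lambda>a b. A j a b p) (dA k i) a b)" for k i j a b
  proof -
    have "pF k i j a b = pd k (\<lambda>q. pd i (A j a b) q - pd j (A i a b) q - mm (\<lambda>a b. A i a b q) (\<lambda>a b. A j a b q) a b
      + mm (\<lambda>a b. A j a b q) (\<lambda>a b. A i a b q) a b) p"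
      unfolding pF_def by (rule pd_cong[OF p Fc_A])
    then show ?thesis unfolding mm_def ddA_def dA_def by (simp add: pd_rules sm_all p sum.distrib)
  qed
  have "pZ k i j + pZ i j k + pZ j k i = 0" for k i j
  proof -
    have "ddA k i j = ddA i k j" for k i j
      unfolding ddA_def[abs_def] using pd_comm[OF p sm_A] by blast
    from second_bianchi_matrix[where ddA = ddA and A = "\<lambda>k a b. A k a b p" and F = "\<lambda>i j a b. Fc i j a b p" and dA = dA and pF = pF,
        OF this _ pF, of k i j a b]
    show ?thesis unfolding pZ_def C pF_def by (simp add: Fc_A[OF p] dA_def fun_eq_iff)
  qed
  moreover have "pZ k i j + pZ i j k + pZ j k i = tri (\<lambda>x y z. DR x y z a b p + DR y z x a b p + DR z x y a b p +
      (\<^bold>\<Sum>s. T x y s p * R s z a b p) + (\<^bold>\<Sum>s. T y z s p * R s x a b p) + (\<^bold>\<Sum>s. T z x s p * R s y a b p)) (\<lambda>a. e k a p) (\<lambda>a. e i a p) (\<lambda>a. e j a p)" for k i j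
  proof (rule frame_bianchi[OF p, where X = "\<lambda>x y. R x y a b" and C = C and DX = "\<lambda>x y z. DR x y z a b p"])
    show "pd k (R x y a b) p - C k x y - (\<^bold>\<Sum>s. A k x s p * R s y a b p) - (\<^bold>\<Sum>s. A k y s p * R x s a b p) = (\<^bold>\<Sum>d. e k d p * DR d x y a b p)" for k x y
      unfolding DR_def expand_frame[OF p] C_def by simp
    show "alt2 (\<lambda>x y. R x y a b p)" unfolding alt2_def using R_skew1[OF p] by blast
  qed (simp_all add: sm_R pZ_def Fc_def[abs_def])
  ultimately show ?thesis
    using cancel3[OF p, where Q = "\<lambda>x y z. 0" and P = "\<lambda>x y z. DR x y z a b p + DR y z x a b p + DR z x y a b p +
      (\<^bold>\<Sum>s. T x y s p * R s z a b p) + (\<^bold>\<Sum>s. T y z s p * R s x a b p) + (\<^bold>\<Sum>s. T z x s p * R s y a b p)", of x y z]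
    by (simp add: tri_def)
qed

lemma cancel1:
  assumes p: "p \<in> V" and z: "\<And>k. (\<^bold>\<Sum>a. e k a p * x a) = (\<^bold>\<Sum>a. e k a p * y a)"
  shows "x a = y a"
proof -
  have "x a - y a = 0"
    by (rule coframe_cancel1[where x = "\<lambda>a. x a - y a" and e = "\<lambda>i a. e i a p" and Ei = "\<lambda>a i. Ei a i p", OF Ei_e[OF p]])
      (use z in \<open>simp add: algebra_simps sum_subtractf\<close>)
  then show ?thesis by simp
qed

lemma contr_pd_T:
  assumes p: "p \<in> V"
  shows "(\<^bold>\<Sum>a b c. C a b c * pd k (T a b c) p) = (\<^bold>\<Sum>a b c. C a b c * act3 (\<lambda>x y. A k x y p) (\<lambda>x y z. T x y z p) a b c)
     + (\<^bold>\<Sum>d. e k d p * (\<^bold>\<Sum>a b c. C a b c * DT d a b c p))"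
proof -
  have t: "pd k (T a b c) p = act3 (\<lambda>x y. A k x y p) (\<lambda>x y z. T x y z p) a b c + (\<^bold>\<Sum>d. e k d p * DT d a b c p)" for a b c
    using pd_T[OF p, of k a b c] by simp
  have "(\<^bold>\<Sum>a b c. C a b c * (\<^bold>\<Sum>d. e k d p * DT d a b c p)) = (\<^bold>\<Sum>a b c d. e k d p * (C a b c * DT d a b c p))"
    by (simp only: sum_distrib_left mult.left_commute)
  also have "\<dots> = (\<^bold>\<Sum>a d b c. e k d p * (C a b c * DT d a b c p))"
    by (rule sum.cong[OF refl]) (rule sum_rot3[symmetric])
  also have "\<dots> = (\<^bold>\<Sum>d a b c. e k d p * (C a b c * DT d a b c p))" by (rule sum.swap)
  finally have "(\<^bold>\<Sum>a b c. C a b c * (\<^bold>\<Sum>d. e k d p * DT d a b c p)) = (\<^bold>\<Sum>d. e k d p * (\<^bold>\<Sum>a b c. C a b c * DT d a b c p))"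
    by (simp only: sum_distrib_left)
  then show ?thesis unfolding t distrib_left sum.distrib by simp
qed

lemma pd_zero: "p \<in> V \<Longrightarrow> (\<And>q. q \<in> V \<Longrightarrow> f q = c) \<Longrightarrow> pd k f p = 0"
  using pd_cong[of p f "\<lambda>q. c" k] pd_const[of p k c] by simp

lemma pd_neg_cong:
  assumes "p \<in> V" "\<And>q. q \<in> V \<Longrightarrow> f q = - g q" "sm g"
  shows "pd k f p = - pd k g p"
  using pd_cong[OF assms(1), of f "\<lambda>q. - g q" k] assms(2) pd_uminus[OF assms(1,3)] by simp

lemma curvature_data_at:
  assumes p: "p \<in> V"
  shows "curvature_data (\<lambda>a b c. T a b c p) (\<lambda>d a b c. DT d a b c p) (\<lambda>a b c d. R a b c d p)"
proof
  show "alt3 (\<lambda>a b c. T a b c p)" by (rule T_alt[OF p])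
  show "alt3 (\<lambda>a b c. DT i a b c p)" for i
    unfolding alt3_def
  proof (intro allI conjI)
    fix a b c
    have t: "q \<in> V \<Longrightarrow> T b a c q = - T a b c q" "q \<in> V \<Longrightarrow> T a c b q = - T a b c q" for a b c q
      using alt3D(1,2)[OF T_alt] by blast+
    have d: "pd k (T b a c) p = - pd k (T a b c) p" "pd k (T a c b) p = - pd k (T a b c) p" for k a b c
      by (rule pd_neg_cong[OF p t(1) sm_T] pd_neg_cong[OF p t(2) sm_T]; assumption)+
    note s = act3_alt[OF T_alt[OF p]]
    show "DT i b a c p = - DT i a b c p" "DT i a c b p = - DT i a b c p"
      unfolding DT_def sum_negf[symmetric] by (intro sum.cong refl; simp add: d(1)[of _ b a] d(2)[of _ a c b] s(1)[of _ b a] s(2)[of _ a c b] algebra_simps)+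
  qed
  show "R i j k l p + R j k i l p + R k i j l p = DT i j k l p + DT j k i l p + DT k i j l p + sig (\<lambda>a b c. T a b c p) i j k l" for i j k l
    by (rule first_bianchi[OF p])
  show "R j i k l p = - R i j k l p" "R i j l k p = - R i j k l p" for i j k l
    by (rule R_skew1[OF p] R_skew2[OF p])+
  show "(\<^bold>\<Sum>a b. R a b i j p * phi a b k) = 0" for i j k by (rule R_inst[OF p])
  show "(\<^bold>\<Sum>a b. R i j a b p * phi a b k) = 0" for i j k using R_g2[OF p, of i j] unfolding g2c_def by blast
  show "(\<^bold>\<Sum>a. R a i j a p) = 0" for i j by (rule R_ric[OF p])
  \<comment> \<open>Constancy of the type enters here: the contraction of \<open>phi\<close> with
    \<open>T\<close> has derivative zero, and its connection part vanishes because the connection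
    matrices annihilate \<open>phi\<close>.\<close>
  show "(\<^bold>\<Sum>i j l. phi i j l * DT k i j l p) = 0" for k
  proof (rule cancel1[OF p, where y = "\<lambda>k. 0"])
    fix k
    have "(\<^bold>\<Sum>i j l. phi i j l * pd k (T i j l) p) = pd k (\<lambda>q. \<^bold>\<Sum>i j l. phi i j l * T i j l q) p"
      by (simp add: pd_rules sm_all p)
    also have "\<dots> = 0" by (rule pd_zero[OF p const_type])
    finally show "(\<^bold>\<Sum>a. e k a p * (\<^bold>\<Sum>i j l. phi i j l * DT a i j l p)) = (\<^bold>\<Sum>a. e k a p * 0)"
      using contr_pd_T[OF p, of phi k] act3_phi_dual[OF A_skew[OF p] A_phi[OF p]] by simp
  qed
qed

lemma DR_skew:
  assumes p: "p \<in> V"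
  shows "DR d y x a b p = - DR d x y a b p" "DR d x y b a p = - DR d x y a b p"
proof -
  have t: "pd k (R y x a b) p = - pd k (R x y a b) p" "pd k (R x y b a) p = - pd k (R x y a b) p" for k x y a b
    by (rule pd_neg_cong[OF p R_skew1 sm_R] pd_neg_cong[OF p R_skew2 sm_R]; assumption)+
  have r1: "R s x a b p = - R x s a b p" "R y s a b p = - R s y a b p" "R y x s b p = - R x y s b p" "R y x a s p = - R x y a s p" for s
    by (rule R_skew1[OF p])+
  show "DR d y x a b p = - DR d x y a b p"
    unfolding DR_def sum_negf[symmetric] by (intro sum.cong refl) (simp add: t(1)[of _ y x] r1 sum_negf algebra_simps)
  have r2: "R s y b a p = - R s y a b p" "R x s b a p = - R x s a b p" "R x y s a p = - R x y a s p" "R x y b s p = - R x y s b p" for s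
    by (rule R_skew2[OF p])+
  show "DR d x y b a p = - DR d x y a b p"
    unfolding DR_def sum_negf[symmetric] by (intro sum.cong refl) (simp add: t(2)[of _ x y b a] r2 sum_negf algebra_simps)
qed

text \<open>Differentiate the vanishing Ricci tensor. The connection terms in the two contracted
  slots cancel by skewness; those in the free slots are again Ricci contractions.\<close>

lemma DR_ric:
  assumes p: "p \<in> V"
  shows "(\<^bold>\<Sum>f. DR d f x y f p) = 0"
proof -
  have "(\<^bold>\<Sum>f. pd k (R f x y f) p - (\<^bold>\<Sum>s. A k f s p * R s x y f p) - (\<^bold>\<Sum>s. A k x s p * R f s y f p)
     - (\<^bold>\<Sum>s. A k y s p * R f x s f p) - (\<^bold>\<Sum>s. A k f s p * R f x y s p)) = 0" for k
  proof -
    have 1: "(\<^bold>\<Sum>f. pd k (R f x y f) p) = 0"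
    proof -
      have "(\<^bold>\<Sum>f. pd k (R f x y f) p) = pd k (\<lambda>q. \<^bold>\<Sum>f. R f x y f q) p" by (simp add: pd_rules sm_all p)
      then show ?thesis using pd_zero[OF p R_ric] by simp
    qed
    have 2: "(\<^bold>\<Sum>f s. A k x s p * R f s y f p) = 0"
      using sum.swap[of "\<lambda>f s. A k x s p * R f s y f p" UNIV UNIV] by (simp add: sum_distrib_left[symmetric] R_ric[OF p])
    have 3: "(\<^bold>\<Sum>f s. A k y s p * R f x s f p) = 0"
      using sum.swap[of "\<lambda>f s. A k y s p * R f x s f p" UNIV UNIV] by (simp add: sum_distrib_left[symmetric] R_ric[OF p])
    have 4: "(\<^bold>\<Sum>f s. A k f s p * R s x y f p) = - (\<^bold>\<Sum>f s. A k f s p * R f x y s p)"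
    proof -
      have "(\<^bold>\<Sum>f s. A k f s p * R s x y f p) = (\<^bold>\<Sum>s f. A k f s p * R s x y f p)" by (rule sum.swap)
      also have "\<dots> = - (\<^bold>\<Sum>f s. A k f s p * R f x y s p)"
      proof -
        have "A k f s p * R s x y f p = - (A k s f p * R s x y f p)" for f s using alt2D[OF A_skew[OF p], of k f s] by simp
        then show ?thesis by (simp only: sum_negf)
      qed
      finally show ?thesis .
    qed
    show ?thesis by (simp add: sum_subtractf 1 2 3 4)
  qed
  then have "(\<^bold>\<Sum>k. Ei d k p * (\<^bold>\<Sum>f. pd k (R f x y f) p - (\<^bold>\<Sum>s. A k f s p * R s x y f p) - (\<^bold>\<Sum>s. A k x s p * R f s y f p)
     - (\<^bold>\<Sum>s. A k y s p * R f x s f p) - (\<^bold>\<Sum>s. A k f s p * R f x y s p))) = 0" by simp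
  then show ?thesis unfolding DR_def by (subst sum.swap) (simp only: sum_distrib_left)
qed

text \<open>Contract the second Bianchi identity twice. All three derivative terms and two of the
  three torsion terms contain a Ricci contraction; the claim is the term that is left.\<close>

lemma T_R_zero:
  assumes p: "p \<in> V"
  shows "(\<^bold>\<Sum>s k i. T s k i p * R j s k i p) = 0"
proof -
  have DR1: "(\<^bold>\<Sum>f. DR d c f f y p) = 0" "(\<^bold>\<Sum>f. DR c f d f d p) = 0" "(\<^bold>\<Sum>f. DR c f y d f p) = 0" for d c y
  proof -
    show "(\<^bold>\<Sum>f. DR c f y d f p) = 0" by (rule DR_ric[OF p])
    show "(\<^bold>\<Sum>f. DR d c f f y p) = 0"
      using DR_ric[OF p, of d c y] by (simp add: DR_skew(1)[OF p, of d _ c] DR_skew(2)[OF p, of d _ _ _ y] sum_negf)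
    show "(\<^bold>\<Sum>f. DR c f d f d p) = 0"
      using DR_ric[OF p, of c d d] by (simp add: DR_skew(2)[OF p, of c _ _ _ d] sum_negf)
  qed
  have R1: "(\<^bold>\<Sum>f. R s f f d p) = 0" "(\<^bold>\<Sum>d. R s d f d p) = 0" for s f d
    using R_ric[OF p, of s d] R_ric[OF p, of s f] by (simp_all add: R_skew1[OF p, of s] R_skew2[OF p, of _ _ _ d] sum_negf)
  have "0 = (\<^bold>\<Sum>d f. DR d j f f d p + DR j f d f d p + DR f d j f d p + (\<^bold>\<Sum>s. T d j s p * R s f f d p) + (\<^bold>\<Sum>s. T j f s p * R s d f d p)
    + (\<^bold>\<Sum>s. T f d s p * R s j f d p))"
    using second_bianchi[OF p] by simp
  also have "\<dots> = (\<^bold>\<Sum>d f. DR d j f f d p) + (\<^bold>\<Sum>d f. DR j f d f d p) + (\<^bold>\<Sum>d f. DR f d j f d p)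
     + (\<^bold>\<Sum>d f s. T d j s p * R s f f d p) + (\<^bold>\<Sum>d f s. T j f s p * R s d f d p) + (\<^bold>\<Sum>d f s. T f d s p * R s j f d p)"
    by (simp only: sum.distrib)
  also have "(\<^bold>\<Sum>d f. DR f d j f d p) = (\<^bold>\<Sum>f d. DR f d j f d p)" by (rule sum.swap)
  also have "(\<^bold>\<Sum>d f s. T d j s p * R s f f d p) = (\<^bold>\<Sum>d s f. T d j s p * R s f f d p)" by (rule sum.cong[OF refl]) (rule sum.swap)
  also have "(\<^bold>\<Sum>d f s. T j f s p * R s d f d p) = (\<^bold>\<Sum>f s d. T j f s p * R s d f d p)" by (rule sum_rot3)
  also have "(\<^bold>\<Sum>d f s. T f d s p * R s j f d p) = (\<^bold>\<Sum>f s d. T f d s p * R s j f d p)" by (rule sum_rot3)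
  also have "\<dots> = (\<^bold>\<Sum>s f d. T f d s p * R s j f d p)" by (rule sum.swap)
  also have "\<dots> = - (\<^bold>\<Sum>s k i. T s k i p * R j s k i p)"
  proof -
    have "T f d s p * R s j f d p = - (T s f d p * R j s f d p)" for s f d
      using alt3_cyc[OF T_alt[OF p], of f d s] R_skew1[OF p, of s j] by simp
    then show ?thesis by (simp only: sum_negf)
  qed
  finally show ?thesis by (simp add: DR1 R1 flip: sum_distrib_left)
qed

section \<open>The symmetric tensor N and the vanishing of sigma\<close>

definition N where "N k m q = Sg (sig (\<lambda>a b c. T a b c q)) k m / 3"
definition th where "th m q = tv (\<lambda>a b c. T a b c q) m"

lemma sm_N: "sm (N k m)"
proof -
  have "N k m = (\<lambda>q. 1 / 3 * Sg (sig (\<lambda>a b c. T a b c q)) k m)" by (simp add: N_def fun_eq_iff)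
  then show ?thesis unfolding Sg_def sig_def by (simp only:) (intro sm_all)
qed

lemma sm_th: "sm (th m)"
  unfolding th_def[abs_def] tv_def by (intro sm_all)

text \<open>As \<open>psi\<close> is invariant, the connection terms of \<open>T\<close> become the
  connection term on the index \<open>m\<close>; the rest is \<open>tv_DT\<close>.\<close>

lemma pd_th:
  assumes p: "p \<in> V"
  shows "pd i (th m) p - (\<^bold>\<Sum>s. A i m s p * th s p) = (\<^bold>\<Sum>d. e i d p * N d m p)"
proof -
  interpret curvature_data "\<lambda>a b c. T a b c p" "\<lambda>d a b c. DT d a b c p" "\<lambda>a b c d. R a b c d p"
    by (rule curvature_data_at[OF p])
  have "pd i (th m) p = (\<^bold>\<Sum>a b c. psi a b c m * pd i (T a b c) p)"
    unfolding th_def[abs_def] tv_def by (simp add: pd_rules sm_all p)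
  also have "\<dots> = (\<^bold>\<Sum>s. A i m s p * th s p) + (\<^bold>\<Sum>d. e i d p * N d m p)"
    unfolding contr_pd_T[OF p] act3_psi_dual[OF A_skew[OF p] A_phi[OF p]] th_def N_def tv_DT[symmetric] tv_def ..
  finally show ?thesis by simp
qed

lemma N_sym: "p \<in> V \<Longrightarrow> N m k p = N k m p"
  unfolding N_def using curvature_data.Sg_symm[OF curvature_data_at] by simp

lemma N_th: "p \<in> V \<Longrightarrow> (\<^bold>\<Sum>m. N k m p * th m p) = 0"
proof -
  assume p: "p \<in> V"
  have "(\<^bold>\<Sum>m. N k m p * th m p) = (\<^bold>\<Sum>m. th m p * Sg (sig (\<lambda>a b c. T a b c p)) m k) / 3"
    unfolding N_sym[OF p, of k] by (simp add: N_def th_def sum_divide_distrib mult.commute)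
  then show ?thesis using curvature_data.Sg_tv[OF curvature_data_at[OF p], of k] by (simp add: th_def)
qed

text \<open>The norm of \<open>T\<close> is constant by \<open>T_DT_zero\<close>, whose premise is
  supplied by \<open>T_R_zero\<close>. The norm of theta is constant because its derivative is twice
  theta contracted with \<open>N\<close>.\<close>

lemma tr_N_const:
  assumes p: "p \<in> V"
  shows "pd i (\<lambda>q. \<^bold>\<Sum>k. N k k q) p = 0"
proof -
  interpret curvature_data "\<lambda>a b c. T a b c p" "\<lambda>d a b c. DT d a b c p" "\<lambda>a b c d. R a b c d p"
    by (rule curvature_data_at[OF p])
  define T2 where "T2 q = (\<^bold>\<Sum>a b c. T a b c q * T a b c q)" for q
  define u where "u q = (\<^bold>\<Sum>m. th m q * th m q)" for q
  have s: "sm T2" "sm u" unfolding T2_def[abs_def] u_def[abs_def] by (intro sm_all sm_th)+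
  have "pd i T2 p = (\<^bold>\<Sum>a b c. 2 * (T a b c p * pd i (T a b c) p))"
    unfolding T2_def[abs_def] by (simp add: pd_rules sm_all p mult.commute)
  also have "\<dots> = 2 * (\<^bold>\<Sum>a b c. T a b c p * pd i (T a b c) p)" by (simp only: sum_distrib_left)
  also have "\<dots> = 0"
    unfolding contr_pd_T[OF p] act3_self[OF A_skew[OF p]] T_DT_zero[OF T_R_zero[OF p]] by simp
  finally have T2: "pd i T2 p = 0" .
  have "pd i u p = 2 * (\<^bold>\<Sum>m. th m p * pd i (th m) p)"
    unfolding u_def[abs_def] by (simp add: pd_rules sm_all sm_th p sum_distrib_left)
  also have "(\<^bold>\<Sum>m. th m p * pd i (th m) p) = (\<^bold>\<Sum>m s. A i m s p * (th s p * th m p)) + (\<^bold>\<Sum>m d. e i d p * (N d m p * th m p))"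
  proof -
    have "th m p * pd i (th m) p = (\<^bold>\<Sum>s. A i m s p * (th s p * th m p)) + (\<^bold>\<Sum>d. e i d p * (N d m p * th m p))" for m
    proof -
      have "pd i (th m) p = (\<^bold>\<Sum>s. A i m s p * th s p) + (\<^bold>\<Sum>d. e i d p * N d m p)" using pd_th[OF p, of i m] by simp
      then show ?thesis by (simp add: distrib_left sum_distrib_left algebra_simps)
    qed
    then show ?thesis by (simp only: sum.distrib)
  qed
  also have "(\<^bold>\<Sum>m s. A i m s p * (th s p * th m p)) = 0"
  proof (rule skew_sum_zero)
    fix a b show "A i b a p * (th a p * th b p) = - (A i a b p * (th b p * th a p))"
      using alt2D[OF A_skew[OF p], of i b a] by simp
  qed
  also have "(\<^bold>\<Sum>m d. e i d p * (N d m p * th m p)) = (\<^bold>\<Sum>d m. e i d p * (N d m p * th m p))" by (rule sum.swap)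
  also have "\<dots> = 0" by (simp add: N_th[OF p] flip: sum_distrib_left)
  finally have u: "pd i u p = 0" by simp
  \<comment> \<open>By \<open>tr_Sg_sig\<close> the trace of \<open>N\<close> is the norm of
    \<open>Pm\<close> minus twice that of \<open>T\<close>. Inserting \<open>Pm_norm\<close>, with
    trace \<open>r\<close>, leaves 4/3 - 2 = -2/3 in front of the norm of \<open>T\<close>.\<close>
  have "(\<^bold>\<Sum>k. N k k q) = (- 2 / 3) * T2 q + (1 / 9) * u q + r\<^sup>2 / 9" if q: "q \<in> V" for q
  proof -
    have "(\<^bold>\<Sum>k. N k k q) = (\<^bold>\<Sum>k. Sg (sig (\<lambda>a b c. T a b c q)) k k) / 3" by (simp add: N_def sum_divide_distrib)
    then show ?thesis
      using tr_Sg_sig[OF T_alt[OF q]] Pm_norm[OF T_alt[OF q]] const_type[OF q]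
      by (simp add: Pm_trace T2_def u_def th_def power2_eq_square)
  qed
  then have "pd i (\<lambda>q. \<^bold>\<Sum>k. N k k q) p = pd i (\<lambda>q. (- 2 / 3) * T2 q + (1 / 9) * u q + r\<^sup>2 / 9) p"
    by (rule pd_cong[OF p])
  also have "\<dots> = pd i (\<lambda>q. (- 2 / 3) * T2 q + (1 / 9) * u q) p + pd i (\<lambda>q. r\<^sup>2 / 9) p"
    by (rule pd_add[OF p]) (intro sm_all s)+
  also have "pd i (\<lambda>q. (- 2 / 3) * T2 q + (1 / 9) * u q) p = pd i (\<lambda>q. (- 2 / 3) * T2 q) p + pd i (\<lambda>q. (1 / 9) * u q) p"
    by (rule pd_add[OF p]) (intro sm_all s)+
  also have "\<dots> + pd i (\<lambda>q. r\<^sup>2 / 9) p = 0" by (simp only: pd_cmult[OF p] s T2 u pd_const[OF p])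
  finally show ?thesis .
qed

definition DN where
  "DN d k m p = (\<^bold>\<Sum>i. Ei d i p * (pd i (N k m) p - (\<^bold>\<Sum>s. A i k s p * N s m p) - (\<^bold>\<Sum>s. A i m s p * N k s p)))"

lemma pd_N: "p \<in> V \<Longrightarrow> pd i (N k m) p - (\<^bold>\<Sum>s. A i k s p * N s m p) - (\<^bold>\<Sum>s. A i m s p * N k s p) = (\<^bold>\<Sum>d. e i d p * DN d k m p)"
  unfolding DN_def expand_frame ..

text \<open>\<open>D_comm\<close> is applied to theta, whose covariant derivative is
  \<open>N\<close>. Differentiating \<open>N\<close> in a frame also differentiates the coframe, and
  this produces the term with \<open>T\<close>.\<close>

lemma ricci_identity:
  assumes p: "p \<in> V"
  shows "(\<^bold>\<Sum>s. T d k s p * N s m p) + DN d k m p - DN k d m p = - (\<^bold>\<Sum>s. R d k m s p * th s p)"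
proof (rule cancel2[OF p, where P = "\<lambda>d k. (\<^bold>\<Sum>s. T d k s p * N s m p) + DN d k m p - DN k d m p" and Q = "\<lambda>d k. - (\<^bold>\<Sum>s. R d k m s p * th s p)"])
  fix i j
  let ?d = "\<lambda>i j k. pd i (e j k) p - (\<^bold>\<Sum>s. A i k s p * e j s p)"
  have D: "pd i (\<lambda>q. pd j (th m) q - (\<^bold>\<Sum>s. A j m s q * th s q)) p - (\<^bold>\<Sum>s. A i m s p * (pd j (th s) p - (\<^bold>\<Sum>t. A j s t p * th t p)))
    = (\<^bold>\<Sum>k. ?d i j k * N k m p) + bil (\<lambda>d k. DN d k m p) (\<lambda>a. e i a p) (\<lambda>a. e j a p)" for i j
  proof -
    have "pd i (\<lambda>q. pd j (th m) q - (\<^bold>\<Sum>s. A j m s q * th s q)) p = pd i (\<lambda>q. \<^bold>\<Sum>k. e j k q * N k m q) p"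
      by (rule pd_cong[OF p pd_th])
    also have "\<dots> = (\<^bold>\<Sum>k. pd i (e j k) p * N k m p) + (\<^bold>\<Sum>k. e j k p * pd i (N k m) p)"
      by (simp add: pd_rules sm_all sm_N p sum.distrib)
    also have "(\<^bold>\<Sum>k. e j k p * pd i (N k m) p) = (\<^bold>\<Sum>k. e j k p * (\<^bold>\<Sum>s. A i k s p * N s m p)) + (\<^bold>\<Sum>k. e j k p * (\<^bold>\<Sum>s. A i m s p * N k s p))
        + (\<^bold>\<Sum>k. e j k p * (\<^bold>\<Sum>d. e i d p * DN d k m p))"
    proof -
      have "pd i (N k m) p = (\<^bold>\<Sum>s. A i k s p * N s m p) + (\<^bold>\<Sum>s. A i m s p * N k s p) + (\<^bold>\<Sum>d. e i d p * DN d k m p)" for k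
        using pd_N[OF p, of i k m] by simp
      then show ?thesis by (simp only: distrib_left sum.distrib)
    qed
    also have "(\<^bold>\<Sum>k. e j k p * (\<^bold>\<Sum>s. A i k s p * N s m p)) = - (\<^bold>\<Sum>k. (\<^bold>\<Sum>s. A i k s p * e j s p) * N k m p)"
    proof -
      have "(\<^bold>\<Sum>k. e j k p * (\<^bold>\<Sum>s. A i k s p * N s m p)) = (\<^bold>\<Sum>k s. e j k p * (A i k s p * N s m p))" by (simp only: sum_distrib_left)
      also have "\<dots> = (\<^bold>\<Sum>s k. e j k p * (A i k s p * N s m p))" by (rule sum.swap)
      also have "\<dots> = (\<^bold>\<Sum>s k. - (A i s k p * e j k p * N s m p))"
      proof (intro sum.cong refl)
        fix s k show "e j k p * (A i k s p * N s m p) = - (A i s k p * e j k p * N s m p)"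
          using alt2D[OF A_skew[OF p], of i k s] by simp
      qed
      finally show ?thesis by (simp only: sum_negf sum_distrib_right)
    qed
    also have "(\<^bold>\<Sum>k. e j k p * (\<^bold>\<Sum>s. A i m s p * N k s p)) = (\<^bold>\<Sum>s. A i m s p * (pd j (th s) p - (\<^bold>\<Sum>t. A j s t p * th t p)))"
    proof -
      have "(\<^bold>\<Sum>k. e j k p * (\<^bold>\<Sum>s. A i m s p * N k s p)) = (\<^bold>\<Sum>k s. A i m s p * (e j k p * N k s p))"
        by (simp only: sum_distrib_left mult.left_commute)
      also have "\<dots> = (\<^bold>\<Sum>s k. A i m s p * (e j k p * N k s p))" by (rule sum.swap)
      finally show ?thesis unfolding pd_th[OF p] by (simp only: sum_distrib_left)
    qed
    also have "(\<^bold>\<Sum>k. e j k p * (\<^bold>\<Sum>d. e i d p * DN d k m p)) = bil (\<lambda>d k. DN d k m p) (\<lambda>a. e i a p) (\<lambda>a. e j a p)"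
    proof -
      have "(\<^bold>\<Sum>k. e j k p * (\<^bold>\<Sum>d. e i d p * DN d k m p)) = (\<^bold>\<Sum>k d. DN d k m p * e i d p * e j k p)"
        by (simp only: sum_distrib_left mult.commute mult.left_commute mult.assoc)
      also have "\<dots> = (\<^bold>\<Sum>d k. DN d k m p * e i d p * e j k p)" by (rule sum.swap)
      finally show ?thesis by (simp only: bil_def)
    qed
    finally show ?thesis by (simp add: left_diff_distrib sum_subtractf)
  qed
  have "(\<^bold>\<Sum>k. ?d i j k * N k m p) - (\<^bold>\<Sum>k. ?d j i k * N k m p) = bil (\<lambda>d k. \<^bold>\<Sum>s. T d k s p * N s m p) (\<lambda>a. e i a p) (\<lambda>a. e j a p)"
  proof -
    have "(\<^bold>\<Sum>k. ?d i j k * N k m p) - (\<^bold>\<Sum>k. ?d j i k * N k m p) = (\<^bold>\<Sum>s. (?d i j s - ?d j i s) * N s m p)"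
      by (simp add: left_diff_distrib sum_subtractf)
    also have "\<dots> = (\<^bold>\<Sum>s d k. T d k s p * e i d p * e j k p * N s m p)"
      unfolding cartan1[OF p] bil_def by (simp only: sum_distrib_right)
    also have "\<dots> = (\<^bold>\<Sum>d k s. T d k s p * e i d p * e j k p * N s m p)" by (rule sum_rot3)
    finally show ?thesis by (simp only: bil_def sum_distrib_right sum_distrib_left mult.commute mult.left_commute mult.assoc)
  qed
  moreover have "- (\<^bold>\<Sum>s. Fc i j m s p * th s p) = bil (\<lambda>d k. - (\<^bold>\<Sum>s. R d k m s p * th s p)) (\<lambda>a. e i a p) (\<lambda>a. e j a p)"
  proof -
    have "(\<^bold>\<Sum>s. Fc i j m s p * th s p) = (\<^bold>\<Sum>s d k. R d k m s p * e i d p * e j k p * th s p)"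
      by (simp only: Fc_def bil_def sum_distrib_right)
    also have "\<dots> = (\<^bold>\<Sum>d k s. R d k m s p * e i d p * e j k p * th s p)" by (rule sum_rot3)
    finally show ?thesis
      by (simp only: bil_def sum_distrib_right sum_distrib_left mult.commute mult.left_commute mult.assoc mult_minus_left mult_minus_right sum_negf)
  qed
  moreover have "bil (\<lambda>d k. DN k d m p) (\<lambda>a. e i a p) (\<lambda>a. e j a p) = bil (\<lambda>d k. DN d k m p) (\<lambda>a. e j a p) (\<lambda>a. e i a p)"
    unfolding bil_def by (subst sum.swap) (simp only: mult.commute mult.left_commute mult.assoc)
  ultimately show "bil (\<lambda>d k. (\<^bold>\<Sum>s. T d k s p * N s m p) + DN d k m p - DN k d m p) (\<lambda>a. e i a p) (\<lambda>a. e j a p)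
      = bil (\<lambda>d k. - (\<^bold>\<Sum>s. R d k m s p * th s p)) (\<lambda>a. e i a p) (\<lambda>a. e j a p)"
    using D_comm[where f = th and k = i and i = j and c = m, OF p sm_th] unfolding D bil_add by linarith
qed

text \<open>Trace the Ricci identity over \<open>d\<close> and \<open>m\<close>: \<open>T\<close> is
  skew where \<open>N\<close> is symmetric, the trace of \<open>N\<close> is constant, and the
  curvature term is a Ricci contraction.\<close>

lemma div_N:
  assumes p: "p \<in> V"
  shows "(\<^bold>\<Sum>d. DN d k d p) = 0"
proof -
  have tr: "(\<^bold>\<Sum>d. DN k d d p) = 0"
  proof -
    have "(\<^bold>\<Sum>d. pd i (N d d) p - (\<^bold>\<Sum>s. A i d s p * N s d p) - (\<^bold>\<Sum>s. A i d s p * N d s p)) = 0" for i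
    proof -
      have 1: "(\<^bold>\<Sum>d. pd i (N d d) p) = 0"
        using tr_N_const[OF p, of i] by (simp add: pd_rules sm_N p)
      have 2: "(\<^bold>\<Sum>d s. A i d s p * N d s p) = 0"
      proof (rule skew_sum_zero)
        fix a b show "A i b a p * N b a p = - (A i a b p * N a b p)"
          using alt2D[OF A_skew[OF p], of i b a] N_sym[OF p, of b a] by simp
      qed
      have 3: "(\<^bold>\<Sum>d s. A i d s p * N s d p) = 0"
      proof (rule skew_sum_zero)
        fix a b show "A i b a p * N a b p = - (A i a b p * N b a p)"
          using alt2D[OF A_skew[OF p], of i b a] N_sym[OF p, of b a] by simp
      qed
      show ?thesis by (simp only: sum_subtractf 1 2 3)
    qed
    then have "(\<^bold>\<Sum>i. Ei k i p * (\<^bold>\<Sum>d. pd i (N d d) p - (\<^bold>\<Sum>s. A i d s p * N s d p) - (\<^bold>\<Sum>s. A i d s p * N d s p))) = 0" by simp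
    then show ?thesis unfolding DN_def by (subst sum.swap) (simp only: sum_distrib_left)
  qed
  have 1: "(\<^bold>\<Sum>d s. T d k s p * N s d p) = 0"
  proof (rule skew_sum_zero)
    fix d s show "T s k d p * N d s p = - (T d k s p * N s d p)"
      using alt3D(1)[OF T_alt[OF p], of s k d] alt3D(2)[OF T_alt[OF p], of k s d] alt3D(1)[OF T_alt[OF p], of k d s]
        N_sym[OF p, of d s] by simp
  qed
  have 2: "(\<^bold>\<Sum>d s. R d k d s p * th s p) = 0"
  proof -
    have "(\<^bold>\<Sum>d s. R d k d s p * th s p) = (\<^bold>\<Sum>s d. R d k d s p * th s p)" by (rule sum.swap)
    also have "\<dots> = 0"
    proof -
      have "R d k d s p = - R d k s d p" for d s by (rule R_skew2[OF p])
      then have "(\<^bold>\<Sum>d. R d k d s p) = 0" for s using R_ric[OF p, of k s] by (simp add: sum_negf)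
      then show ?thesis by (simp flip: sum_distrib_right)
    qed
    finally show ?thesis .
  qed
  have "(\<^bold>\<Sum>d. (\<^bold>\<Sum>s. T d k s p * N s d p) + DN d k d p - DN k d d p) = - (\<^bold>\<Sum>d s. R d k d s p * th s p)"
    unfolding ricci_identity[OF p] by (simp add: sum_negf)
  then show ?thesis by (simp add: sum.distrib sum_subtractf tr 1 2)
qed

text \<open>Differentiating \<open>N theta = 0\<close> covariantly gives \<open>DN\<close> applied
  to theta plus the product of \<open>N\<close> with itself. In the trace over the direction and the
  free index the first term is the divergence of \<open>N\<close>, so a sum of squares
  vanishes.\<close>

lemma N_zero:
  assumes p: "p \<in> V"
  shows "N k m p = 0"
proof -
  have "(\<^bold>\<Sum>m. DN d k m p * th m p) + (\<^bold>\<Sum>m. N k m p * N d m p) = 0" for d k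
  proof (rule cancel1[OF p, where y = "\<lambda>d. 0" and x = "\<lambda>d. (\<^bold>\<Sum>m. DN d k m p * th m p) + (\<^bold>\<Sum>m. N k m p * N d m p)"])
    fix i
    have "0 = pd i (\<lambda>q. \<^bold>\<Sum>m. N k m q * th m q) p" by (rule pd_zero[OF p N_th, symmetric])
    also have "\<dots> = (\<^bold>\<Sum>m. pd i (N k m) p * th m p) + (\<^bold>\<Sum>m. N k m p * pd i (th m) p)"
      by (simp add: pd_rules sm_all sm_N sm_th p sum.distrib)
    also have "(\<^bold>\<Sum>m. pd i (N k m) p * th m p) = (\<^bold>\<Sum>m. (\<^bold>\<Sum>s. A i k s p * N s m p) * th m p) + (\<^bold>\<Sum>m. (\<^bold>\<Sum>s. A i m s p * N k s p) * th m p)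
       + (\<^bold>\<Sum>m. (\<^bold>\<Sum>d. e i d p * DN d k m p) * th m p)"
    proof -
      have "pd i (N k m) p = (\<^bold>\<Sum>s. A i k s p * N s m p) + (\<^bold>\<Sum>s. A i m s p * N k s p) + (\<^bold>\<Sum>d. e i d p * DN d k m p)" for m
        using pd_N[OF p, of i k m] by simp
      then show ?thesis by (simp only: distrib_right sum.distrib)
    qed
    also have "(\<^bold>\<Sum>m. (\<^bold>\<Sum>s. A i k s p * N s m p) * th m p) = 0"
      unfolding sum_push1 by (simp add: N_th[OF p])
    also have "(\<^bold>\<Sum>m. (\<^bold>\<Sum>d. e i d p * DN d k m p) * th m p) = (\<^bold>\<Sum>d. e i d p * (\<^bold>\<Sum>m. DN d k m p * th m p))" by (rule sum_push1)
    also have "(\<^bold>\<Sum>m. N k m p * pd i (th m) p) = (\<^bold>\<Sum>m. N k m p * (\<^bold>\<Sum>s. A i m s p * th s p)) + (\<^bold>\<Sum>m. N k m p * (\<^bold>\<Sum>d. e i d p * N d m p))"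
    proof -
      have "pd i (th m) p = (\<^bold>\<Sum>s. A i m s p * th s p) + (\<^bold>\<Sum>d. e i d p * N d m p)" for m using pd_th[OF p, of i m] by simp
      then show ?thesis by (simp only: distrib_left sum.distrib)
    qed
    also have "(\<^bold>\<Sum>m. N k m p * (\<^bold>\<Sum>d. e i d p * N d m p)) = (\<^bold>\<Sum>d. e i d p * (\<^bold>\<Sum>m. N k m p * N d m p))"
    proof -
      have "(\<^bold>\<Sum>m. N k m p * (\<^bold>\<Sum>d. e i d p * N d m p)) = (\<^bold>\<Sum>m. (\<^bold>\<Sum>d. e i d p * N d m p) * N k m p)" by (simp only: mult.commute)
      also have "\<dots> = (\<^bold>\<Sum>d. e i d p * (\<^bold>\<Sum>m. N d m p * N k m p))" by (rule sum_push1)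
      finally show ?thesis by (simp only: mult.commute)
    qed
    also have "(\<^bold>\<Sum>m. (\<^bold>\<Sum>s. A i m s p * N k s p) * th m p) = - (\<^bold>\<Sum>m. N k m p * (\<^bold>\<Sum>s. A i m s p * th s p))"
    proof -
      have "(\<^bold>\<Sum>m. (\<^bold>\<Sum>s. A i m s p * N k s p) * th m p) = (\<^bold>\<Sum>m s. A i m s p * N k s p * th m p)" by (simp only: sum_distrib_right)
      also have "\<dots> = (\<^bold>\<Sum>s m. A i m s p * N k s p * th m p)" by (rule sum.swap)
      also have "\<dots> = (\<^bold>\<Sum>s m. - (N k s p * (A i s m p * th m p)))"
      proof (intro sum.cong refl)
        fix s m show "A i m s p * N k s p * th m p = - (N k s p * (A i s m p * th m p))"
          using alt2D[OF A_skew[OF p], of i m s] by simp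
      qed
      finally show ?thesis by (simp only: sum_negf sum_distrib_left)
    qed
    finally show "(\<^bold>\<Sum>a. e i a p * ((\<^bold>\<Sum>m. DN a k m p * th m p) + (\<^bold>\<Sum>m. N k m p * N a m p))) = (\<^bold>\<Sum>a. e i a p * 0)"
      by (simp add: distrib_left sum.distrib)
  qed
  then have "0 = (\<^bold>\<Sum>k. (\<^bold>\<Sum>m. DN k k m p * th m p) + (\<^bold>\<Sum>m. N k m p * N k m p))" by simp
  also have "\<dots> = (\<^bold>\<Sum>k m. DN k k m p * th m p) + (\<^bold>\<Sum>k m. N k m p * N k m p)" by (simp only: sum.distrib)
  also have "(\<^bold>\<Sum>k m. DN k k m p * th m p) = (\<^bold>\<Sum>m k. DN k k m p * th m p)" by (rule sum.swap)
  also have "\<dots> = 0"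
  proof -
    have "DN d k m p = DN d m k p" for d k m
    proof -
      have "pd i (N k m) p = pd i (N m k) p" for i by (rule pd_cong[OF p N_sym])
      moreover have "N s k p = N k s p" "N m s p = N s m p" for s by (rule N_sym[OF p])+
      ultimately show ?thesis unfolding DN_def by (simp add: algebra_simps)
    qed
    then have "(\<^bold>\<Sum>k. DN k k m p) = 0" for m using div_N[OF p, of m] by simp
    then show ?thesis by (simp flip: sum_distrib_right)
  qed
  finally have "(\<^bold>\<Sum>k m. N k m p * N k m p) = 0" by simp
  then have "\<forall>k. (\<^bold>\<Sum>m. N k m p * N k m p) = 0"
    by (subst (asm) sum_nonneg_eq_0_iff) (auto intro: sum_nonneg)
  then have "(\<^bold>\<Sum>m. N k m p * N k m p) = 0" by blast
  then show ?thesis by (subst (asm) sum_nonneg_eq_0_iff) auto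
qed

text \<open>The embedding \<open>Sg\<close> is injective, so \<open>N = 0\<close> means that sigma
  vanishes, and with it the multiple of sigma to which \<open>dT\<close> was reduced.\<close>

theorem frame_harmonic:
  assumes p: "p \<in> V"
  shows "sig (\<lambda>a b c. T a b c p) a b c d = 0"
    and "DT a b c d p + DT b c a d p + DT c a b d p - DT d a b c p = 0"
    and "(\<^bold>\<Sum>i. DT i i a b p) = 0"
proof -
  interpret curvature_data "\<lambda>a b c. T a b c p" "\<lambda>d a b c. DT d a b c p" "\<lambda>a b c d. R a b c d p"
    by (rule curvature_data_at[OF p])
  show s: "sig (\<lambda>a b c. T a b c p) a b c d = 0"
    by (rule Sg_zero[OF alt4_sig[OF T]]) (use N_zero[OF p] in \<open>simp add: N_def\<close>)
  show "DT a b c d p + DT b c a d p + DT c a b d p - DT d a b c p = 0"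
    using dT_eq[of a b c d] s unfolding dT_def by simp
  show "(\<^bold>\<Sum>i. DT i i a b p) = 0" by (rule div_T)
qed

end

section \<open>Tensors as functions of index lists\<close>

lemma idx_0 [simp]: "idx 0 = {[]}"
  by (auto simp: idx_def)

lemma idx_Suc_iff: "K \<in> idx (Suc k) \<longleftrightarrow> (\<exists>a L. K = a # L \<and> L \<in> idx k)"
  by (auto simp: idx_def length_Suc_conv)

lemma sum_idx_Suc: "(\<Sum>K\<in>idx (Suc k). f K) = (\<^bold>\<Sum>a. \<Sum>K\<in>idx k. f (a # K))"
proof -
  have "(\<Sum>K\<in>idx (Suc k). f K) = (\<Sum>(a, K)\<in>UNIV \<times> idx k. f (a # K))"
    by (rule sum.reindex_bij_witness[where i = "\<lambda>(a, K). a # K" and j = "\<lambda>K. (hd K, tl K)"])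
      (auto simp: idx_Suc_iff)
  then show ?thesis by (simp add: sum.cartesian_product)
qed

lemma sum_idx_add:
  fixes f :: "tens"
  shows "(\<Sum>K\<in>idx (k + l). f K) = (\<Sum>L\<in>idx k. \<Sum>K\<in>idx l. f (L @ K))"
  by (induction k arbitrary: f) (simp_all add: sum_idx_Suc)

lemma prod_lessThan_add:
  fixes f :: "nat \<Rightarrow> real"
  shows "(\<Prod>s<k + l. f s) = (\<Prod>s<k. f s) * (\<Prod>s<l. f (k + s))"
  by (induction l) (simp_all add: mult.assoc)

lemma sum_lessThan_add:
  fixes f :: "nat \<Rightarrow> real"
  shows "(\<Sum>s<k + l. f s) = (\<Sum>s<k. f s) + (\<Sum>s<l. f (k + s))"
  by (induction l) (simp_all add: add.assoc)

text \<open>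
  \<open>tr e k a\<close> are the coordinate components of the tensor with components \<open>a\<close> in the coframe whose
  element number \<open>b\<close> has coordinate components \<open>e i b\<close>.
\<close>

definition tr :: "(7 \<Rightarrow> 7 \<Rightarrow> real) \<Rightarrow> nat \<Rightarrow> tens \<Rightarrow> tens"
  where "tr e k a J = (\<Sum>K\<in>idx k. a K * (\<Prod>s<k. e (J ! s) (K ! s)))"

lemma tr_0 [simp]: "tr e 0 a J = a []"
  by (simp add: tr_def)

lemma tr_Suc: "tr e (Suc k) a (j # J) = (\<^bold>\<Sum>b. e j b * tr e k (\<lambda>K. a (b # K)) J)"
  by (simp add: tr_def sum_idx_Suc prod.lessThan_Suc_shift sum_distrib_left mult_ac del: prod.lessThan_Suc)

lemma tr_cong: "(\<And>K. K \<in> idx k \<Longrightarrow> a K = b K) \<Longrightarrow> tr e k a J = tr e k b J"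
  by (simp add: tr_def)

lemma tr_add: "tr e k (\<lambda>K. a K + b K) J = tr e k a J + tr e k b J"
  by (simp add: tr_def distrib_right sum.distrib)

lemma tr_cmult: "tr e k (\<lambda>K. r * a K) J = r * tr e k a J"
  by (simp add: tr_def sum_distrib_left mult.assoc)

lemma tr_sum: "tr e k (\<lambda>K. \<Sum>x\<in>S. a x K) J = (\<Sum>x\<in>S. tr e k (a x) J)"
  unfolding tr_def sum_distrib_right by (rule sum.swap)

lemma tr_zero: "(\<And>K. K \<in> idx k \<Longrightarrow> a K = 0) \<Longrightarrow> tr e k a J = 0"
  by (simp add: tr_def)

lemma tr_append:
  assumes "length I = k"
  shows "tr e (k + l) a (I @ J) = tr e k (\<lambda>L. tr e l (\<lambda>K. a (L @ K)) J) I"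
  using assms by (induction k arbitrary: a I) (auto simp: tr_Suc length_Suc_conv)

text \<open>Shaped for the terms of an exterior derivative: the differentiating index is put back at
  position \<open>n\<close>, and the frame index belonging to it is read from that position.\<close>

lemma tr_insert:
  assumes "length I1 = n"
  shows "(\<^bold>\<Sum>d. e i d * tr e (n + m) (\<lambda>K. Q d K) (I1 @ I2))
    = tr e (Suc (n + m)) (\<lambda>K. Q (K ! n) (take n K @ drop (Suc n) K)) (I1 @ i # I2)"
  using assms
proof (induction n arbitrary: Q I1)
  case 0
  then show ?case by (simp add: tr_Suc)
next
  case (Suc n)
  then obtain j J where I1: "I1 = j # J" "length J = n" by (auto simp: length_Suc_conv)
  have "(\<^bold>\<Sum>d. e i d * tr e (Suc n + m) (\<lambda>K. Q d K) (I1 @ I2)) = (\<^bold>\<Sum>d b. e j b * (e i d * tr e (n + m) (\<lambda>K. Q d (b # K)) (J @ I2)))"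
    by (simp add: I1 tr_Suc sum_distrib_left mult.left_commute)
  also have "\<dots> = (\<^bold>\<Sum>b d. e j b * (e i d * tr e (n + m) (\<lambda>K. Q d (b # K)) (J @ I2)))" by (rule sum.swap)
  also have "\<dots> = (\<^bold>\<Sum>b. e j b * tr e (Suc (n + m)) (\<lambda>K. Q (K ! n) (b # (take n K @ drop (Suc n) K))) (J @ i # I2))"
    unfolding sum_distrib_left[symmetric] by (simp only: Suc.IH[OF I1(2)])
  finally show ?case by (simp add: I1 tr_Suc)
qed

lemma permute_idx: "I \<in> idx k \<Longrightarrow> permute_list \<sigma> I \<in> idx k"
  by (simp add: idx_def)

lemma sum_idx_permute:
  assumes s: "\<sigma> permutes {..<k}"
  shows "(\<Sum>K\<in>idx k. f K) = (\<Sum>K\<in>idx k. f (permute_list \<sigma> K))"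
proof (rule sum.reindex_bij_witness[where i = "permute_list \<sigma>" and j = "permute_list (inv \<sigma>)"])
  fix K assume K: "K \<in> idx k"
  have l: "length K = k" using K by (simp add: idx_def)
  show "permute_list \<sigma> (permute_list (inv \<sigma>) K) = K" "permute_list (inv \<sigma>) (permute_list \<sigma> K) = K"
    using permute_list_compose[of \<sigma> K "inv \<sigma>"] permute_list_compose[of "inv \<sigma>" K \<sigma>] s l
    by (simp_all add: permutes_inv permutes_inv_o)
  then show "f (permute_list \<sigma> (permute_list (inv \<sigma>) K)) = f K" by simp
qed (simp_all add: permute_idx)

text \<open>Permuting the coordinate indices and the frame indices together does not change the
  product of coframe values, so every permutation in the wedge product can be passed to the frame
  components.\<close>

lemma wedge_tr:
  assumes I: "I \<in> idx (k + l)" and \<alpha>: "\<And>J. J \<in> idx k \<Longrightarrow> \<alpha> J = tr e k a J" and \<beta>: "\<And>J. J \<in> idx l \<Longrightarrow> \<beta> J = tr e l b J"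
  shows "wedge k l \<alpha> \<beta> I = tr e (k + l) (wedge k l a b) I"
proof -
  have len: "length I = k + l" using I by (simp add: idx_def)
  have m: "tr e k a (take k J) * tr e l b (drop k J) = (\<Sum>K\<in>idx (k + l). a (take k K) * b (drop k K) * (\<Prod>s<k + l. e (J ! s) (K ! s)))"
    if "length J = k + l" for J
  proof -
    have "tr e k a (take k J) * tr e l b (drop k J) = (\<Sum>L\<in>idx k. \<Sum>K\<in>idx l. a L * b K * ((\<Prod>s<k. e (J ! s) (L ! s)) * (\<Prod>s<l. e (J ! (k + s)) (K ! s))))"
      using that by (simp add: tr_def sum_product mult_ac)
    also have "\<dots> = (\<Sum>L\<in>idx k. \<Sum>K\<in>idx l. a (take k (L @ K)) * b (drop k (L @ K)) * (\<Prod>s<k + l. e (J ! s) ((L @ K) ! s)))"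
      by (intro sum.cong refl) (simp add: idx_def prod_lessThan_add nth_append)
    finally show ?thesis unfolding sum_idx_add .
  qed
  have "of_int (sign \<sigma>) * \<alpha> (take k (permute_list \<sigma> I)) * \<beta> (drop k (permute_list \<sigma> I))
      = (\<Sum>K\<in>idx (k + l). of_int (sign \<sigma>) * a (take k (permute_list \<sigma> K)) * b (drop k (permute_list \<sigma> K)) * (\<Prod>s<k + l. e (I ! s) (K ! s)))"
    if s: "\<sigma> permutes {..<k + l}" for \<sigma>
  proof -
    have "\<alpha> (take k (permute_list \<sigma> I)) * \<beta> (drop k (permute_list \<sigma> I))
      = tr e k a (take k (permute_list \<sigma> I)) * tr e l b (drop k (permute_list \<sigma> I))"
      using \<alpha> \<beta> len by (simp add: idx_def)
    also have "\<dots> = (\<Sum>K\<in>idx (k + l). a (take k K) * b (drop k K) * (\<Prod>s<k + l. e (permute_list \<sigma> I ! s) (K ! s)))"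
      by (rule m) (simp add: len)
    also have "\<dots> = (\<Sum>K\<in>idx (k + l). a (take k (permute_list \<sigma> K)) * b (drop k (permute_list \<sigma> K))
        * (\<Prod>s<k + l. e (permute_list \<sigma> I ! s) (permute_list \<sigma> K ! s)))"
      by (rule sum_idx_permute[OF s])
    also have "\<dots> = (\<Sum>K\<in>idx (k + l). a (take k (permute_list \<sigma> K)) * b (drop k (permute_list \<sigma> K)) * (\<Prod>s<k + l. e (I ! s) (K ! s)))"
    proof (intro sum.cong refl)
      fix K assume "K \<in> idx (k + l)"
      then have "length K = k + l" by (simp add: idx_def)
      then have "(\<Prod>s<k + l. e (permute_list \<sigma> I ! s) (permute_list \<sigma> K ! s)) = (\<Prod>s<k + l. e (I ! \<sigma> s) (K ! \<sigma> s))"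
        using s len by (intro prod.cong refl) (simp add: permute_list_nth)
      also have "\<dots> = (\<Prod>s<k + l. e (I ! s) (K ! s))"
        using prod.permute[OF s, of "\<lambda>s. e (I ! s) (K ! s)"] by (simp add: o_def)
      finally show "a (take k (permute_list \<sigma> K)) * b (drop k (permute_list \<sigma> K)) * (\<Prod>s<k + l. e (permute_list \<sigma> I ! s) (permute_list \<sigma> K ! s))
        = a (take k (permute_list \<sigma> K)) * b (drop k (permute_list \<sigma> K)) * (\<Prod>s<k + l. e (I ! s) (K ! s))" by simp
    qed
    finally show ?thesis by (simp add: mult.assoc sum_distrib_left)
  qed
  then have "wedge k l \<alpha> \<beta> I = (\<Sum>\<sigma> | \<sigma> permutes {..<k + l}. \<Sum>K\<in>idx (k + l). of_int (sign \<sigma>) * a (take k (permute_list \<sigma> K)) * b (drop k (permute_list \<sigma> K)) * (\<Prod>s<k + l. e (I ! s) (K ! s))) / (fact k * fact l)"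
    unfolding wedge_def by simp
  also have "\<dots> = tr e (k + l) (wedge k l a b) I"
    unfolding tr_def wedge_def sum_divide_distrib sum_distrib_right by (subst sum.swap) simp
  finally show ?thesis .
qed

section \<open>Alternating tensors\<close>

lemma alternating_wedge: "alternating (k + l) (wedge k l \<alpha> \<beta>)"
  unfolding alternating_def
proof (intro ballI allI impI)
  fix I \<tau> assume I: "I \<in> idx (k + l)" and t: "\<tau> permutes {..<k + l}"
  let ?F = "\<lambda>\<sigma>. of_int (sign \<sigma>) * \<alpha> (take k (permute_list \<sigma> I)) * \<beta> (drop k (permute_list \<sigma> I)) :: real"
  let ?S = "{\<sigma>. \<sigma> permutes {..<k + l}}"
  have "(\<Sum>\<sigma>\<in>?S. of_int (sign \<sigma>) * \<alpha> (take k (permute_list \<sigma> (permute_list \<tau> I))) * \<beta> (drop k (permute_list \<sigma> (permute_list \<tau> I))))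
    = (\<Sum>\<sigma>\<in>?S. of_int (sign \<tau>) * ?F (\<tau> \<circ> \<sigma>))"
  proof (intro sum.cong refl)
    fix \<sigma> assume "\<sigma> \<in> ?S"
    then have s: "\<sigma> permutes {..<k + l}" by simp
    have "permute_list \<sigma> (permute_list \<tau> I) = permute_list (\<tau> \<circ> \<sigma>) I"
      using permute_list_compose[of \<sigma> I \<tau>] s I by (simp add: idx_def)
    moreover have "sign (\<tau> \<circ> \<sigma>) = sign \<tau> * sign \<sigma>"
      by (rule sign_compose) (use s t permutes_imp_permutation finite_lessThan in blast)+
    moreover have "of_int (sign \<tau>) * (of_int (sign \<tau>) * x) = (x::real)" for x
      by (cases \<tau> rule: sign_cases) simp_all
    ultimately show "of_int (sign \<sigma>) * \<alpha> (take k (permute_list \<sigma> (permute_list \<tau> I))) * \<beta> (drop k (permute_list \<sigma> (permute_list \<tau> I)))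
      = of_int (sign \<tau>) * ?F (\<tau> \<circ> \<sigma>)" by (simp add: mult.assoc)
  qed
  also have "\<dots> = of_int (sign \<tau>) * (\<Sum>\<sigma>\<in>?S. ?F \<sigma>)"
    using setum_permutations_compose_left[OF t, of ?F] by (simp add: sum_distrib_left)
  finally show "wedge k l \<alpha> \<beta> (permute_list \<tau> I) = of_int (sign \<tau>) * wedge k l \<alpha> \<beta> I"
    unfolding wedge_def by simp
qed

lemma alternating_transpose:
  assumes a: "alternating n \<alpha>" and I: "length I = n" and sr: "s < n" "r < n" "s \<noteq> r"
  shows "\<alpha> (I[s := I ! r, r := I ! s]) = - \<alpha> I"
proof -
  have p: "Transposition.transpose s r permutes {..<n}" using sr by (intro permutes_swap_id) auto
  have "permute_list (Transposition.transpose s r) I = I[s := I ! r, r := I ! s]"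
    by (rule nth_equalityI) (use p sr I in \<open>auto simp: permute_list_nth transpose_def nth_list_update\<close>)
  moreover have "\<alpha> (permute_list (Transposition.transpose s r) I) = of_int (sign (Transposition.transpose s r)) * \<alpha> I"
    using a p I unfolding alternating_def idx_def by blast
  ultimately show ?thesis using sr(3) by (simp add: sign_swap_id)
qed

lemma alternating_swap:
  assumes "alternating n \<alpha>" "length (I @ x # y # J) = n"
  shows "\<alpha> (I @ y # x # J) = - \<alpha> (I @ x # y # J)"
proof -
  have "(I @ x # y # J)[length I := y, Suc (length I) := x] = I @ y # x # J"
    by (simp add: list_update_append)
  then show ?thesis
    using alternating_transpose[OF assms, of "length I" "Suc (length I)"] assms(2) by (simp add: nth_append)
qed

lemma alternating_not_distinct:
  assumes a: "alternating n \<alpha>" and I: "length I = n" and d: "\<not> distinct I"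
  shows "\<alpha> I = 0"
proof -
  obtain s r where sr: "s < n" "r < n" "s \<noteq> r" "I ! s = I ! r" using d I by (auto simp: distinct_conv_nth)
  have "I[s := I ! r, r := I ! s] = I" by (simp add: sr(4)[symmetric]) (metis sr(4) list_update_id)
  then show ?thesis using alternating_transpose[OF a I sr(1-3)] by simp
qed

lemma alternating_move:
  assumes a: "alternating n \<alpha>" and l: "length (I @ B @ x # J) = n"
  shows "\<alpha> (I @ B @ x # J) = (- 1) ^ length B * \<alpha> (I @ x # B @ J)"
  using l
proof (induction B arbitrary: I)
  case (Cons b B)
  have "\<alpha> (I @ (b # B) @ x # J) = (- 1) ^ length B * \<alpha> ((I @ [b]) @ x # B @ J)"
    using Cons.IH[of "I @ [b]"] Cons.prems by simp
  also have "\<alpha> ((I @ [b]) @ x # B @ J) = - \<alpha> (I @ x # b # B @ J)"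
    using alternating_swap[OF a, of I x b "B @ J"] Cons.prems by simp
  finally show ?case by simp
qed simp

text \<open>Antisymmetrising over eight slots in dimension seven gives zero.\<close>

lemma schouten:
  assumes a: "alternating 7 \<epsilon>" and P: "length P = 8"
  shows "(\<Sum>s<8. (- 1) ^ s * kd x (P ! s) * \<epsilon> (take s P @ drop (Suc s) P)) = 0"
proof -
  have "\<not> distinct P"
  proof
    assume "distinct P"
    then have "card (set P) = 8" using P distinct_card by metis
    moreover have "card (set P) \<le> card (UNIV :: 7 set)" by (rule card_mono) auto
    ultimately show False by simp
  qed
  then obtain A y B C where P': "P = A @ [y] @ B @ [y] @ C" using not_distinct_decomp by blast
  let ?u = "length A" and ?v = "length A + Suc (length B)"
  have uv: "?u < 8" "?v < 8" "?u \<noteq> ?v" using P P' by auto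
  have Puv: "P ! ?u = y" "P ! ?v = y" by (auto simp: P' nth_append)
  \<comment> \<open>Eight entries from a type with seven elements repeat some \<open>y\<close>.
    Deleting any other position keeps both copies of \<open>y\<close>, so that term vanishes;
    deleting either copy leaves the same entries up to moving \<open>y\<close> across
    \<open>B\<close>, and the signs are opposite.\<close>
  have "(\<Sum>s<8. (- 1) ^ s * kd x (P ! s) * \<epsilon> (take s P @ drop (Suc s) P))
      = (\<Sum>s\<in>{?u, ?v}. (- 1) ^ s * kd x (P ! s) * \<epsilon> (take s P @ drop (Suc s) P))"
  proof (rule sum.mono_neutral_right)
    show "\<forall>s\<in>{..<8} - {?u, ?v}. (- 1) ^ s * kd x (P ! s) * \<epsilon> (take s P @ drop (Suc s) P) = 0"
    proof
      fix s assume s: "s \<in> {..<8} - {?u, ?v}"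
      let ?Q = "take s P @ drop (Suc s) P"
      have nQ: "?Q ! i = P ! (if i < s then i else Suc i)" if "i < 7" for i
        using that s P by (auto simp: nth_append)
      define j where "j i = (if i < s then i else i - 1)" for i
      have j: "j i < 7 \<and> ?Q ! j i = P ! i" if "i < 8" "i \<noteq> s" for i
      proof (cases "i < s")
        case True
        then show ?thesis using s by (simp add: j_def nQ)
      next
        case False
        then show ?thesis using that by (cases i) (auto simp: j_def nQ)
      qed
      have "j ?u < 7" "j ?v < 7" "?Q ! j ?u = y" "?Q ! j ?v = y" using j[of ?u] j[of ?v] s uv Puv by auto
      moreover have "j ?u \<noteq> j ?v" using s by (auto simp: j_def)
      moreover have lQ: "length ?Q = 7" using s P by auto
      ultimately have "\<not> distinct ?Q" unfolding distinct_conv_nth by metis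
      then have "\<epsilon> ?Q = 0" by (rule alternating_not_distinct[OF a lQ])
      then show "(- 1) ^ s * kd x (P ! s) * \<epsilon> ?Q = 0" by simp
    qed
  qed (use uv in auto)
  also have "\<dots> = (- 1) ^ ?u * kd x y * \<epsilon> (A @ B @ y # C) + (- 1) ^ ?v * kd x y * \<epsilon> (A @ y # B @ C)"
  proof -
    have "take ?u P @ drop (Suc ?u) P = A @ B @ y # C" "take ?v P @ drop (Suc ?v) P = A @ y # B @ C"
      by (simp_all add: P')
    moreover have "sum f {?u, ?v} = f ?u + f ?v" for f :: "nat \<Rightarrow> real" using uv(3) by simp
    ultimately show ?thesis by (simp only: Puv)
  qed
  also have "\<epsilon> (A @ B @ y # C) = (- 1) ^ length B * \<epsilon> (A @ y # B @ C)"
    by (rule alternating_move[OF a]) (use P P' in simp)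
  finally show ?thesis by (simp add: power_add algebra_simps)
qed

text \<open>The Leibniz formula, by induction. \<open>L\<close> shifts a permutation of the
  remaining slots so that it fixes 0; the products \<open>\<sigma> \<circ> L \<tau>\<close> run
  through every permutation \<open>fact n\<close> times, which cancels the normalisation of
  \<open>wedge\<close>.\<close>

lemma wedge_list_det:
  "I \<in> idx (length as) \<Longrightarrow> wedge_list as I =
    (\<Sum>\<sigma> | \<sigma> permutes {..<length as}. of_int (sign \<sigma>) * (\<Prod>s<length as. (as ! s) [I ! \<sigma> s]))"
proof (induction as arbitrary: I)
  case Nil
  then show ?case by simp
next
  case (Cons \<alpha> as)
  let ?n = "length as"
  have I: "length I = Suc ?n" using Cons.prems by (simp add: idx_def)
  let ?S = "\<lambda>n::nat. {\<sigma>. \<sigma> permutes {..<n}}"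
  define G where "G \<rho> = of_int (sign \<rho>) * (\<alpha> [I ! \<rho> 0] * (\<Prod>s<?n. (as ! s) [I ! \<rho> (Suc s)]))" for \<rho> :: "nat \<Rightarrow> nat"
  define L where "L \<tau> = map_permutation {..<?n} Suc \<tau>" for \<tau> :: "nat \<Rightarrow> nat"
  have L: "L \<tau> permutes {..<Suc ?n}" "sign (L \<tau>) = sign \<tau>" "L \<tau> 0 = 0" "\<And>s. s < ?n \<Longrightarrow> L \<tau> (Suc s) = Suc (\<tau> s)"
    if t: "\<tau> permutes {..<?n}" for \<tau>
  proof -
    have "bij_betw Suc {..<?n} (Suc ` {..<?n})" by (simp add: bij_betw_def)
    from map_permutation_permutes[OF this t] have p: "L \<tau> permutes (Suc ` {..<?n})" by (simp add: L_def)
    show "L \<tau> permutes {..<Suc ?n}" by (rule permutes_subset[OF p]) auto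
    show "L \<tau> 0 = 0" using permutes_not_in[OF p] by auto
    show "sign (L \<tau>) = sign \<tau>" unfolding L_def by (rule sign_map_permutation[OF _ t]) auto
    show "L \<tau> (Suc s) = Suc (\<tau> s)" if "s < ?n" for s unfolding L_def by (rule map_permutation_apply) (use that in auto)
  qed
  have summand: "of_int (sign \<sigma>) * \<alpha> (take 1 (permute_list \<sigma> I)) * wedge_list as (drop 1 (permute_list \<sigma> I)) = (\<Sum>\<tau>\<in>?S ?n. G (\<sigma> \<circ> L \<tau>))"
    if s: "\<sigma> permutes {..<Suc ?n}" for \<sigma>
  proof -
    let ?J = "permute_list \<sigma> I"
    have J: "length ?J = Suc ?n" by (simp add: I)
    have nth: "?J ! s = I ! \<sigma> s" if "s < Suc ?n" for s using that s I by (simp add: permute_list_nth)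
    have t1: "take 1 ?J = [I ! \<sigma> 0]" using J nth[of 0] by (cases ?J) auto
    have "wedge_list as (drop 1 ?J) = (\<Sum>\<tau>\<in>?S ?n. of_int (sign \<tau>) * (\<Prod>s<?n. (as ! s) [drop 1 ?J ! \<tau> s]))"
      by (rule Cons.IH) (simp add: idx_def I)
    also have "\<dots> = (\<Sum>\<tau>\<in>?S ?n. of_int (sign \<tau>) * (\<Prod>s<?n. (as ! s) [I ! \<sigma> (Suc (\<tau> s))]))"
    proof (intro sum.cong prod.cong refl arg_cong2[where f = "(*)"])
      fix \<tau> s assume "\<tau> \<in> ?S ?n" "s \<in> {..<?n}"
      then have "\<tau> s < ?n" using permutes_in_image[of \<tau> "{..<?n}" s] by auto
      then show "(as ! s) [drop 1 ?J ! \<tau> s] = (as ! s) [I ! \<sigma> (Suc (\<tau> s))]" using J nth[of "Suc (\<tau> s)"] by simp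
    qed
    finally have w: "wedge_list as (drop 1 ?J) = (\<Sum>\<tau>\<in>?S ?n. of_int (sign \<tau>) * (\<Prod>s<?n. (as ! s) [I ! \<sigma> (Suc (\<tau> s))]))" .
    show ?thesis unfolding t1 w sum_distrib_left
    proof (intro sum.cong refl)
      fix \<tau> assume "\<tau> \<in> ?S ?n"
      then have t: "\<tau> permutes {..<?n}" by simp
      have "sign (\<sigma> \<circ> L \<tau>) = sign \<sigma> * sign \<tau>"
        unfolding L(2)[OF t, symmetric] by (rule sign_compose) (use s L(1)[OF t] permutes_imp_permutation finite_lessThan in blast)+
      then show "of_int (sign \<sigma>) * \<alpha> [I ! \<sigma> 0] * (of_int (sign \<tau>) * (\<Prod>s<?n. (as ! s) [I ! \<sigma> (Suc (\<tau> s))])) = G (\<sigma> \<circ> L \<tau>)"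
        unfolding G_def by (simp add: L[OF t])
    qed
  qed
  have "wedge_list (\<alpha> # as) I = (\<Sum>\<sigma>\<in>?S (Suc ?n). \<Sum>\<tau>\<in>?S ?n. G (\<sigma> \<circ> L \<tau>)) / fact ?n"
    using summand by (simp add: wedge_def)
  also have "(\<Sum>\<sigma>\<in>?S (Suc ?n). \<Sum>\<tau>\<in>?S ?n. G (\<sigma> \<circ> L \<tau>)) = (\<Sum>\<tau>\<in>?S ?n. \<Sum>\<sigma>\<in>?S (Suc ?n). G (\<sigma> \<circ> L \<tau>))" by (rule sum.swap)
  also have "\<dots> = (\<Sum>\<tau>\<in>?S ?n. \<Sum>\<sigma>\<in>?S (Suc ?n). G \<sigma>)"
  proof (rule sum.cong[OF refl])
    fix \<tau> assume "\<tau> \<in> ?S ?n"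
    then have "L \<tau> permutes {..<Suc ?n}" using L(1) by simp
    then show "(\<Sum>\<sigma>\<in>?S (Suc ?n). G (\<sigma> \<circ> L \<tau>)) = (\<Sum>\<sigma>\<in>?S (Suc ?n). G \<sigma>)"
      by (rule sum_permutations_compose_right[symmetric])
  qed
  also have "\<dots> = fact ?n * (\<Sum>\<sigma>\<in>?S (Suc ?n). G \<sigma>)" by (simp add: card_permutations)
  finally show ?case by (simp add: G_def prod.lessThan_Suc_shift del: prod.lessThan_Suc)
qed

lemma wedge_list_3:
  "wedge_list [\<alpha>, \<beta>, \<gamma>] [i, j, k] = \<alpha> [i] * \<beta> [j] * \<gamma> [k] + \<alpha> [j] * \<beta> [k] * \<gamma> [i] + \<alpha> [k] * \<beta> [i] * \<gamma> [j]
    - \<alpha> [j] * \<beta> [i] * \<gamma> [k] - \<alpha> [i] * \<beta> [k] * \<gamma> [j] - \<alpha> [k] * \<beta> [j] * \<gamma> [i]"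
proof -
  have s: "{..<3::nat} = insert 0 (insert 1 {2})" by auto
  have f1: "finite {1, 2::nat}" "0 \<notin> {1, 2::nat}" and f2: "finite {2::nat}" "1 \<notin> {2::nat}" by auto
  have "wedge_list [\<alpha>, \<beta>, \<gamma>] [i, j, k] = (\<Sum>\<sigma> | \<sigma> permutes {..<3}. of_int (sign \<sigma>) * (\<Prod>s<3. ([\<alpha>, \<beta>, \<gamma>] ! s) [[i, j, k] ! \<sigma> s]))"
    using wedge_list_det[of "[i, j, k]" "[\<alpha>, \<beta>, \<gamma>]"] by (simp add: idx_def numeral_3_eq_3)
  also have "\<dots> = \<alpha> [i] * \<beta> [j] * \<gamma> [k] + \<alpha> [j] * \<beta> [k] * \<gamma> [i] + \<alpha> [k] * \<beta> [i] * \<gamma> [j]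
    - \<alpha> [j] * \<beta> [i] * \<gamma> [k] - \<alpha> [i] * \<beta> [k] * \<gamma> [j] - \<alpha> [k] * \<beta> [j] * \<gamma> [i]"
    unfolding s sum_over_permutations_insert[OF f1] sum_over_permutations_insert[OF f2] permutes_sing
    by (simp add: sign_swap_id permutation_swap_id sign_compose transpose_def)
  finally show ?thesis .
qed

section \<open>The standard coframe, its volume form and its G2 form\<close>

definition dl :: "7 \<Rightarrow> tens" where "dl a I = kd a (hd I)"

definition eps :: tens where "eps = wedge_list (map dl [1, 2, 3, 4, 5, 6, 7])"

lemma wedge_list_tr:
  "(\<And>a i. E a [i] = e i a) \<Longrightarrow> I \<in> idx (length as) \<Longrightarrow> wedge_list (map E as) I = tr e (length as) (wedge_list (map dl as)) I"
proof (induction as arbitrary: I)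
  case Nil
  then show ?case by (simp add: idx_def)
next
  case (Cons a as)
  have "wedge 1 (length as) (E a) (wedge_list (map E as)) I = tr e (1 + length as) (wedge 1 (length as) (dl a) (wedge_list (map dl as))) I"
  proof (rule wedge_tr)
    show "I \<in> idx (1 + length as)" using Cons.prems by simp
    show "E a J = tr e 1 (dl a) J" if "J \<in> idx 1" for J
      using that Cons.prems(1) by (auto simp: idx_def length_Suc_conv tr_Suc dl_def)
    show "wedge_list (map E as) J = tr e (length as) (wedge_list (map dl as)) J" if "J \<in> idx (length as)" for J
      using Cons.IH[OF Cons.prems(1) that] .
  qed
  then show ?case by simp
qed

lemma alternating_wedge_list: "as \<noteq> [] \<Longrightarrow> alternating (length as) (wedge_list as)"
  using alternating_wedge[of 1] by (cases as) auto

lemma alternating_eps: "alternating 7 eps"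
proof -
  have l: "length (map dl [1, 2, 3, 4, 5, 6, 7]) = 7" by simp
  have "alternating (length (map dl [1, 2, 3, 4, 5, 6, 7])) (wedge_list (map dl [1, 2, 3, 4, 5, 6, 7]))"
    by (rule alternating_wedge_list) simp
  then show ?thesis unfolding l eps_def .
qed

lemma eps_volume: "eps [1, 2, 3, 4, 5, 6, 7] = 1"
proof -
  let ?L = "[1, 2, 3, 4, 5, 6, 7] :: 7 list"
  have "eps ?L = (\<Sum>\<sigma> | \<sigma> permutes {..<7}. of_int (sign \<sigma>) * (\<Prod>s<7. kd (?L ! s) (?L ! \<sigma> s)))"
  proof -
    have l: "length (map dl ?L) = 7" "?L \<in> idx 7" by (simp_all add: idx_def)
    have "(map dl ?L ! s) [?L ! \<sigma> s] = kd (?L ! s) (?L ! \<sigma> s)" if "s < 7" for s and \<sigma> :: "nat \<Rightarrow> nat"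
      using that by (subst nth_map) (simp_all add: dl_def)
    then show ?thesis unfolding eps_def using wedge_list_det[of ?L "map dl ?L"] unfolding l(1) using l(2) by simp
  qed
  also have "\<dots> = (\<Sum>\<sigma>\<in>{id}. of_int (sign \<sigma>) * (\<Prod>s<7. kd (?L ! s) (?L ! \<sigma> s)))"
  proof (rule sum.mono_neutral_right)
    show "\<forall>\<sigma>\<in>{\<sigma>. \<sigma> permutes {..<7}} - {id}. of_int (sign \<sigma>) * (\<Prod>s<7. kd (?L ! s) (?L ! \<sigma> s)) = 0"
    proof
      fix \<sigma> assume s: "\<sigma> \<in> {\<sigma>. \<sigma> permutes {..<7::nat}} - {id}"
      then obtain s where "\<sigma> s \<noteq> s" by (auto simp: fun_eq_iff)
      moreover from this have "s < 7" "\<sigma> s < 7" using s permutes_not_in[of \<sigma> "{..<7}" s] permutes_in_image[of \<sigma> "{..<7}" s] by auto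
      moreover have "distinct ?L" by simp
      ultimately have "s < 7" "?L ! s \<noteq> ?L ! \<sigma> s" by (simp_all add: nth_eq_iff_index_eq del: distinct.simps)
      then have "(\<Prod>s<7. kd (?L ! s) (?L ! \<sigma> s)) = 0" by (intro prod_zero) (auto simp: kd_def)
      then show "of_int (sign \<sigma>) * (\<Prod>s<7. kd (?L ! s) (?L ! \<sigma> s)) = 0" by simp
    qed
  qed (auto simp: finite_permutations permutes_id)
  also have "\<dots> = 1" by (simp add: kd_self)
  finally show ?thesis .
qed

lemma alternating_alt3:
  assumes "alternating 3 \<alpha>"
  shows "alt3 (\<lambda>i j k. \<alpha> [i, j, k])"
  unfolding alt3_def
proof (intro allI conjI)
  fix i j k
  show "\<alpha> [j, i, k] = - \<alpha> [i, j, k]" "\<alpha> [i, k, j] = - \<alpha> [i, j, k]"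
    using alternating_swap[OF assms, of "[]" i j "[k]"] alternating_swap[OF assms, of "[i]" j k "[]"] by simp_all
qed

text \<open>These equivalences unfold a statement about increasing index tuples into its finitely
  many instances; alternating tensors then need to be compared nowhere else.\<close>

lemma all_above:
  "(\<forall>j. rk 1 < rk j \<longrightarrow> P j) \<longleftrightarrow> P 2 \<and> P 3 \<and> P 4 \<and> P 5 \<and> P 6 \<and> P 7"
  "(\<forall>j. rk 2 < rk j \<longrightarrow> P j) \<longleftrightarrow> P 3 \<and> P 4 \<and> P 5 \<and> P 6 \<and> P 7"
  "(\<forall>j. rk 3 < rk j \<longrightarrow> P j) \<longleftrightarrow> P 4 \<and> P 5 \<and> P 6 \<and> P 7"
  "(\<forall>j. rk 4 < rk j \<longrightarrow> P j) \<longleftrightarrow> P 5 \<and> P 6 \<and> P 7"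
  "(\<forall>j. rk 5 < rk j \<longrightarrow> P j) \<longleftrightarrow> P 6 \<and> P 7"
  "(\<forall>j. rk 6 < rk j \<longrightarrow> P j) \<longleftrightarrow> P 7"
  "(\<forall>j. rk 7 < rk j \<longrightarrow> P j) \<longleftrightarrow> True"
  unfolding all7 rk_table by simp_all

lemma all_less:
  "(\<forall>i j. rk i < rk j \<longrightarrow> P i j) \<longleftrightarrow>
    P 1 2 \<and> P 1 3 \<and> P 1 4 \<and> P 1 5 \<and> P 1 6 \<and> P 1 7 \<and>
    P 2 3 \<and> P 2 4 \<and> P 2 5 \<and> P 2 6 \<and> P 2 7 \<and>
    P 3 4 \<and> P 3 5 \<and> P 3 6 \<and> P 3 7 \<and>
    P 4 5 \<and> P 4 6 \<and> P 4 7 \<and>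
    P 5 6 \<and> P 5 7 \<and>
    P 6 7"
  by (subst all7) (simp only: all_above simp_thms conj_assoc)

lemma alt3_eqI:
  assumes a: "alt3 f" "alt3 g" and e: "\<forall>i j. rk i < rk j \<longrightarrow> (\<forall>k. rk j < rk k \<longrightarrow> f i j k = g i j k)"
  shows "f i j k = g i j k"
proof -
  note e' = e[unfolded all_less all_above simp_thms]
  have "\<forall>i j k. f i j k = g i j k"
    unfolding all7 by (simp add: alt3_sort[OF a(1)] alt3_sort[OF a(2)] rk_table e')
  then show ?thesis by blast
qed

lemma g2_model_dl: "g2_model dl [i, j, k] = phi i j k"
proof -
  define f where "f i j k = g2_model dl [i, j, k]" for i j k
  \<comment> \<open>The six-term determinant occurs seven times in the model form; passing it as the
    argument \<open>w\<close> writes it only once.\<close>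
  have f: "f i j k = (\<lambda>w. w 1 2 7 + w 1 3 5 - w 1 4 6 - w 2 3 6 - w 2 4 5 + w 3 4 7 + w 5 6 7)
     (\<lambda>a b c. kd a i * kd b j * kd c k + kd a j * kd b k * kd c i + kd a k * kd b i * kd c j
       - kd a j * kd b i * kd c k - kd a i * kd b k * kd c j - kd a k * kd b j * kd c i)" for i j k
    unfolding f_def g2_model_def wedge_list_3 dl_def by simp
  have "alt3 f" unfolding alt3_def f by (simp add: algebra_simps)
  then have "f i j k = phi i j k"
  proof (rule alt3_eqI[OF _ alt3_phi])
    show "\<forall>i j. rk i < rk j \<longrightarrow> (\<forall>k. rk j < rk k \<longrightarrow> f i j k = phi i j k)"
      unfolding all_less all_above f phi_def by (simp add: kd_table sg_table pr_table)
  qed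
  then show ?thesis by (simp add: f_def)
qed

lemma g2_model_tr:
  assumes "\<And>a i. E a [i] = e i a" and I: "I \<in> idx 3"
  shows "g2_model E I = tr e 3 (g2_model dl) I"
proof -
  have w: "wedge_list [E a, E b, E c] I = tr e 3 (wedge_list [dl a, dl b, dl c]) I" for a b c
    using wedge_list_tr[of E e I "[a, b, c]", OF assms(1)] I by (simp add: numeral_3_eq_3)
  show ?thesis
    unfolding g2_model_def w by (simp add: tr_def algebra_simps sum.distrib sum_subtractf)
qed

lemma volume_tr:
  assumes "\<And>a i. E a [i] = e i a" and I: "I \<in> idx 7"
  shows "wedge_list [E 1, E 2, E 3, E 4, E 5, E 6, E 7] I = tr e 7 eps I"
proof -
  have l: "length [1, 2, 3, 4, 5, 6, 7 :: 7] = 7" by simp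
  show ?thesis
    using wedge_list_tr[of E e I "[1, 2, 3, 4, 5, 6, 7]", OF assms(1)] I unfolding l eps_def by (simp only: list.map)
qed

lemma sum_idx_3: "(\<Sum>L\<in>idx 3. f L) = (\<^bold>\<Sum>a b c. f [a, b, c])"
  by (simp add: numeral_3_eq_3 sum_idx_Suc)

lemma sum_idx_4: "(\<Sum>L\<in>idx 4. f L) = (\<^bold>\<Sum>a b c d. f [a, b, c, d])"
  by (simp add: eval_nat_numeral sum_idx_Suc)

text \<open>The Hodge star on 3-forms in an oriented orthonormal coframe; the divisor is
  \<open>fact 3\<close>.\<close>

definition hodge3 :: "tens \<Rightarrow> tens"
  where "hodge3 a K = (\<Sum>L\<in>idx 3. a L * eps (L @ K)) / 6"

text \<open>Ties the algebraic \<open>psi\<close> to the orientation. Both sides are alternating,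
  and on increasing indices the seven summands of \<open>phi\<close> select values of
  \<open>eps\<close>, which are sorted to \<open>eps_volume\<close> or vanish by repetition.\<close>

lemma hodge3_phi: "hodge3 (g2_model dl) [i, j, k, l] = psi i j k l"
proof -
  define X where "X i j k l a b c = eps [a, b, c, i, j, k, l]" for i j k l a b c
  note sw = alternating_swap[OF alternating_eps]
  have X3: "alt3 (X i j k l)" for i j k l
    unfolding alt3_def X_def
  proof (intro allI conjI)
    fix a b c
    show "eps [b, a, c, i, j, k, l] = - eps [a, b, c, i, j, k, l]" "eps [a, c, b, i, j, k, l] = - eps [a, b, c, i, j, k, l]"
      using sw[of "[]" a b "[c, i, j, k, l]"] sw[of "[a]" b c "[i, j, k, l]"] by simp_all
  qed
  have hX: "hodge3 (g2_model dl) [i, j, k, l] = (\<^bold>\<Sum>a b c. phi a b c * X i j k l a b c) / 6" for i j k l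
    unfolding hodge3_def sum_idx_3 X_def by (simp add: g2_model_dl)
  have h: "hodge3 (g2_model dl) [i, j, k, l] = X i j k l 1 2 7 + X i j k l 1 3 5 - X i j k l 1 4 6 - X i j k l 2 3 6 - X i j k l 2 4 5
      + X i j k l 3 4 7 + X i j k l 5 6 7" for i j k l
    unfolding hX phi_contr3[OF X3] by simp
  define f where "f i j k l = hodge3 (g2_model dl) [i, j, k, l]" for i j k l
  have f4: "alt4 f"
    unfolding alt4_def
  proof (intro allI conjI)
    fix i j k l
    have "X j i k l a b c = - X i j k l a b c" "X i k j l a b c = - X i j k l a b c" "X i j l k a b c = - X i j k l a b c" for a b c
      using sw[of "[a, b, c]" i j "[k, l]"] sw[of "[a, b, c, i]" j k "[l]"] sw[of "[a, b, c, i, j]" k l "[]"] by (simp_all add: X_def)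
    then show "f j i k l = - f i j k l" "f i k j l = - f i j k l" "f i j l k = - f i j k l" unfolding f_def h by simp_all
  qed
  have p4: "alt4 psi" unfolding alt4_def using psi_alt by blast
  have s: "rk b < rk a \<Longrightarrow> eps [a, b, c, d, e', f', g] = - eps [b, a, c, d, e', f', g]"
    "rk c < rk b \<Longrightarrow> eps [a, b, c, d, e', f', g] = - eps [a, c, b, d, e', f', g]"
    "rk d < rk c \<Longrightarrow> eps [a, b, c, d, e', f', g] = - eps [a, b, d, c, e', f', g]"
    "rk e' < rk d \<Longrightarrow> eps [a, b, c, d, e', f', g] = - eps [a, b, c, e', d, f', g]"
    "rk f' < rk e' \<Longrightarrow> eps [a, b, c, d, e', f', g] = - eps [a, b, c, d, f', e', g]"
    "rk g < rk f' \<Longrightarrow> eps [a, b, c, d, e', f', g] = - eps [a, b, c, d, e', g, f']" for a b c d e' f' g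
    using sw[of "[]" a b "[c, d, e', f', g]"] sw[of "[a]" b c "[d, e', f', g]"] sw[of "[a, b]" c d "[e', f', g]"]
      sw[of "[a, b, c]" d e' "[f', g]"] sw[of "[a, b, c, d]" e' f' "[g]"] sw[of "[a, b, c, d, e']" f' g "[]"] by simp_all
  have z: "eps [a, b, c, d, e', f', g] = 0" if "\<not> distinct [a, b, c, d, e', f', g]" for a b c d e' f' g
    by (rule alternating_not_distinct[OF alternating_eps _ that]) simp
  have zs: "eps [a, a, c, d, e', f', g] = 0" "eps [a, b, b, d, e', f', g] = 0" "eps [a, b, c, c, e', f', g] = 0"
    "eps [a, b, c, d, d, f', g] = 0" "eps [a, b, c, d, e', e', g] = 0" "eps [a, b, c, d, e', f', f'] = 0" for a b c d e' f' g
    by (rule z, simp)+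
  have e: "\<forall>i j. rk i < rk j \<longrightarrow> (\<forall>k l. rk k < rk l \<longrightarrow> rk j < rk k \<longrightarrow> f i j k l = psi i j k l)"
    unfolding all_less f_def h X_def
    by (simp add: rk_table) (simp add: s zs rk_table eps_volume psi_def sg_table pr_table kd_table)
  note e' = e[unfolded all_less, simplified rk_table, simplified]
  have "\<forall>i j k l. f i j k l = psi i j k l"
    unfolding all7 by (simp add: alt4_sort[OF f4] alt4_sort[OF p4] rk_table e')
  then show ?thesis by (simp add: f_def)
qed

section \<open>Smooth functions in a chart\<close>

abbreviation fd :: "(real^7 \<Rightarrow> real) \<Rightarrow> real^7 \<Rightarrow> real^7 \<Rightarrow> real"
  where "fd f x \<equiv> frechet_derivative f (at x)"

lemma has_derivative_fd: "f differentiable (at x) \<Longrightarrow> (f has_derivative fd f x) (at x)"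
  by (simp add: frechet_derivative_works)

lemma fd_eqI: "(f has_derivative f') (at x) \<Longrightarrow> fd f x = f'"
  by (rule frechet_derivative_at[symmetric])

lemma has_derivative_open_cong:
  assumes "open S" "x \<in> S" "\<And>y. y \<in> S \<Longrightarrow> f y = g y"
  shows "(f has_derivative f') (at x) \<longleftrightarrow> (g has_derivative f') (at x)"
  using has_derivative_transform_within_open[of f f' x UNIV S g] has_derivative_transform_within_open[of g f' x UNIV S f] assms
  by (metis)

lemma fd_cong:
  assumes "open S" "x \<in> S" "\<And>y. y \<in> S \<Longrightarrow> f y = g y"
  shows "fd f x = fd g x"
  unfolding frechet_derivative_def using has_derivative_open_cong[OF assms] by simp

lemma ck_on_cong:
  assumes S: "open S"
  shows "(\<And>y. y \<in> S \<Longrightarrow> f y = g y) \<Longrightarrow> ck_on k S f \<Longrightarrow> ck_on k S g"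
proof (induction k arbitrary: f g)
  case 0
  then show ?case using continuous_on_cong[of S S f g] by simp
next
  case (Suc k)
  have "g differentiable (at x)" if "x \<in> S" for x
  proof -
    have "(f has_derivative f') (at x) \<longleftrightarrow> (g has_derivative f') (at x)" for f'
      by (rule has_derivative_open_cong[OF S that]) (rule Suc.prems(1))
    moreover have "f differentiable (at x)" using Suc.prems(2) that by simp
    ultimately show ?thesis unfolding differentiable_def by simp
  qed
  moreover have "ck_on k S (\<lambda>x. fd g x (axis i 1))" for i
  proof (rule Suc.IH)
    show "fd f x (axis i 1) = fd g x (axis i 1)" if "x \<in> S" for x
      using fd_cong[OF S that Suc.prems(1)] by simp
    show "ck_on k S (\<lambda>x. fd f x (axis i 1))" using Suc.prems by simp
  qed
  ultimately show ?case by simp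
qed

lemma ck_on_Suc: "ck_on (Suc k) S f \<Longrightarrow> ck_on k S f"
proof (induction k arbitrary: f)
  case 0
  then show ?case
    by (auto intro!: continuous_at_imp_continuous_on dest: differentiable_imp_continuous_within)
next
  case (Suc k)
  then show ?case by (simp del: ck_on.simps(1))
qed

lemma fd_simps:
  assumes "f differentiable (at x)" "g differentiable (at x)"
  shows "fd (\<lambda>x. f x + g x) x = (\<lambda>h. fd f x h + fd g x h)"
    and "fd (\<lambda>x. f x * g x) x = (\<lambda>h. f x * fd g x h + fd f x h * g x)"
  using fd_eqI[OF has_derivative_add[OF assms[THEN has_derivative_fd]]]
    fd_eqI[OF has_derivative_mult[OF assms[THEN has_derivative_fd]]] by simp_all

lemma fd_inverse:
  assumes "f differentiable (at x)" "f x \<noteq> 0"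
  shows "fd (\<lambda>x. inverse (f x)) x = (\<lambda>h. - (inverse (f x) * fd f x h * inverse (f x)))"
  by (rule fd_eqI) (rule Deriv.has_derivative_inverse[OF assms(2) has_derivative_fd[OF assms(1)]])

lemma ck_on_const: "ck_on k S (\<lambda>x. c)"
  by (induction k arbitrary: c) (simp_all add: frechet_derivative_const)

lemma ck_on_add: "open S \<Longrightarrow> ck_on k S f \<Longrightarrow> ck_on k S g \<Longrightarrow> ck_on k S (\<lambda>x. f x + g x)"
proof (induction k arbitrary: f g)
  case 0
  then show ?case by (simp add: continuous_on_add)
next
  case (Suc k)
  have "ck_on k S (\<lambda>x. fd (\<lambda>x. f x + g x) x (axis i 1))" for i
    by (rule ck_on_cong[OF Suc.prems(1), of "\<lambda>x. fd f x (axis i 1) + fd g x (axis i 1)"])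
      (use Suc in \<open>auto simp: fd_simps\<close>)
  then show ?case using Suc.prems by auto
qed

lemma ck_on_mult: "open S \<Longrightarrow> ck_on k S f \<Longrightarrow> ck_on k S g \<Longrightarrow> ck_on k S (\<lambda>x. f x * g x)"
proof (induction k arbitrary: f g)
  case 0
  then show ?case by (simp add: continuous_on_mult)
next
  case (Suc k)
  have "ck_on k S (\<lambda>x. fd (\<lambda>x. f x * g x) x (axis i 1))" for i
  proof (rule ck_on_cong[OF Suc.prems(1), of "\<lambda>x. f x * fd g x (axis i 1) + fd f x (axis i 1) * g x"])
    show "f x * fd g x (axis i 1) + fd f x (axis i 1) * g x = fd (\<lambda>x. f x * g x) x (axis i 1)" if "x \<in> S" for x
      using Suc.prems that by (simp add: fd_simps)
    show "ck_on k S (\<lambda>x. f x * fd g x (axis i 1) + fd f x (axis i 1) * g x)"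
      using Suc.prems Suc.IH ck_on_Suc by (intro ck_on_add) auto
  qed
  then show ?case using Suc.prems by auto
qed

lemma ck_on_inverse: "open S \<Longrightarrow> (\<And>x. x \<in> S \<Longrightarrow> f x \<noteq> 0) \<Longrightarrow> ck_on k S f \<Longrightarrow> ck_on k S (\<lambda>x. inverse (f x))"
proof (induction k)
  case 0
  then show ?case by (simp add: continuous_on_inverse)
next
  case (Suc k)
  have i: "ck_on k S (\<lambda>x. inverse (f x))" using Suc ck_on_Suc by blast
  have "ck_on k S (\<lambda>x. fd (\<lambda>x. inverse (f x)) x (axis i 1))" for i
  proof (rule ck_on_cong[OF Suc.prems(1), of "\<lambda>x. - 1 * (inverse (f x) * fd f x (axis i 1) * inverse (f x))"])
    show "- 1 * (inverse (f x) * fd f x (axis i 1) * inverse (f x)) = fd (\<lambda>x. inverse (f x)) x (axis i 1)" if "x \<in> S" for x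
      using Suc.prems that by (simp add: fd_inverse)
    show "ck_on k S (\<lambda>x. - 1 * (inverse (f x) * fd f x (axis i 1) * inverse (f x)))"
      using Suc.prems i by (intro ck_on_mult ck_on_const) auto
  qed
  moreover have "(\<lambda>x. inverse (f x)) differentiable (at x)" if "x \<in> S" for x
    using Suc.prems that by (intro differentiable_inverse) auto
  ultimately show ?case by simp
qed

lemma ck_on_subset: "T \<subseteq> S \<Longrightarrow> ck_on k S f \<Longrightarrow> ck_on k T f"
  by (induction k arbitrary: f) (auto intro: continuous_on_subset)

text \<open>Two applications of the mean value theorem to the second difference quotient.\<close>

lemma second_difference:
  fixes f :: "real^7 \<Rightarrow> real"
  assumes f: "ck_on 2 (ball x r) f" and h: "0 < h" "2 * h < r"
  shows "\<exists>y\<in>ball x (3 * h). f (x + h *\<^sub>R axis i 1 + h *\<^sub>R axis j 1) - f (x + h *\<^sub>R axis i 1) - f (x + h *\<^sub>R axis j 1) + f x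
     = h * h * fd (\<lambda>x. fd f x (axis i 1)) y (axis j 1)"
proof -
  let ?u = "axis i 1 :: real^7" and ?v = "axis j 1 :: real^7"
  have nrm: "norm (s *\<^sub>R ?u + t *\<^sub>R ?v) \<le> \<bar>s\<bar> + \<bar>t\<bar>" for s t
    using norm_triangle_ineq[of "s *\<^sub>R ?u" "t *\<^sub>R ?v"] by simp
  have inb: "x + s *\<^sub>R ?u + t *\<^sub>R ?v \<in> ball x R" if "\<bar>s\<bar> + \<bar>t\<bar> < R" for s t R
  proof -
    have "x - (x + s *\<^sub>R ?u + t *\<^sub>R ?v) = - (s *\<^sub>R ?u + t *\<^sub>R ?v)" by simp
    then show ?thesis using nrm[of s t] that unfolding mem_ball dist_norm by (simp only: norm_minus_cancel)
  qed
  have d1: "f differentiable (at y)" if "y \<in> ball x r" for y using f that by (simp add: numeral_2_eq_2)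
  have d2: "(\<lambda>x. fd f x ?u) differentiable (at y)" if "y \<in> ball x r" for y using f that by (simp add: numeral_2_eq_2)
  have der: "DERIV (\<lambda>s. g (z + s *\<^sub>R w)) s :> fd g (z + s *\<^sub>R w) w"
    if "g differentiable (at (z + s *\<^sub>R w))" for g :: "real^7 \<Rightarrow> real" and z w s
  proof -
    have "((\<lambda>s. z + s *\<^sub>R w) has_derivative (\<lambda>t. t *\<^sub>R w)) (at s)" by (auto intro!: derivative_eq_intros)
    from has_derivative_compose[OF this has_derivative_fd[OF that]]
    have "((\<lambda>s. g (z + s *\<^sub>R w)) has_derivative (\<lambda>t. fd g (z + s *\<^sub>R w) (t *\<^sub>R w))) (at s)" .
    moreover have "linear (fd g (z + s *\<^sub>R w))" using that linear_frechet_derivative by blast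
    then have "(\<lambda>t. fd g (z + s *\<^sub>R w) (t *\<^sub>R w)) = (*) (fd g (z + s *\<^sub>R w) w)"
      by (simp add: linear_scale fun_eq_iff)
    ultimately show ?thesis by (simp add: has_field_derivative_def)
  qed
  define G where "G s = f (x + h *\<^sub>R ?v + s *\<^sub>R ?u) - f (x + s *\<^sub>R ?u)" for s
  have "DERIV G s :> fd f (x + h *\<^sub>R ?v + s *\<^sub>R ?u) ?u - fd f (x + s *\<^sub>R ?u) ?u" if "0 \<le> s" "s \<le> h" for s
  proof -
    have "x + h *\<^sub>R ?v + s *\<^sub>R ?u \<in> ball x r" "x + s *\<^sub>R ?u \<in> ball x r"
      using inb[of s h r] inb[of s 0 r] that h by (simp_all add: add.commute add.left_commute)
    then show ?thesis unfolding G_def[abs_def] by (intro DERIV_diff der d1)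
  qed
  from MVT2[OF h(1) this] obtain s where s: "0 < s" "s < h"
    and G: "G h - G 0 = h * (fd f (x + h *\<^sub>R ?v + s *\<^sub>R ?u) ?u - fd f (x + s *\<^sub>R ?u) ?u)" by auto
  define K where "K t = fd f (x + s *\<^sub>R ?u + t *\<^sub>R ?v) ?u" for t
  have "DERIV K t :> fd (\<lambda>x. fd f x ?u) (x + s *\<^sub>R ?u + t *\<^sub>R ?v) ?v" if "0 \<le> t" "t \<le> h" for t
  proof -
    have "x + s *\<^sub>R ?u + t *\<^sub>R ?v \<in> ball x r" using inb[of s t r] that s h by simp
    then show ?thesis unfolding K_def[abs_def] by (intro der[of "\<lambda>x. fd f x ?u"] d2)
  qed
  from MVT2[OF h(1) this] obtain t where t: "0 < t" "t < h"
    and K: "K h - K 0 = h * fd (\<lambda>x. fd f x ?u) (x + s *\<^sub>R ?u + t *\<^sub>R ?v) ?v" by auto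
  have "x + s *\<^sub>R ?u + t *\<^sub>R ?v \<in> ball x (3 * h)" using inb[of s t "3 * h"] s t h by simp
  moreover have "f (x + h *\<^sub>R ?u + h *\<^sub>R ?v) - f (x + h *\<^sub>R ?u) - f (x + h *\<^sub>R ?v) + f x = G h - G 0"
    by (simp add: G_def add.commute add.left_commute)
  moreover have "\<dots> = h * (K h - K 0)" unfolding G K_def by (simp add: add.commute add.left_commute)
  ultimately show ?thesis unfolding K by (intro bexI[of _ "x + s *\<^sub>R ?u + t *\<^sub>R ?v"]) simp_all
qed

text \<open>The mixed second difference of \<open>f\<close> is symmetric in the two directions.
  \<open>second_difference\<close> evaluates it as either mixed derivative at a point near
  \<open>x\<close>, and continuity lets both points tend to \<open>x\<close>.\<close>

lemma fd_comm:
  fixes f :: "real^7 \<Rightarrow> real"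
  assumes S: "open S" "x \<in> S" and f: "ck_on 2 S f"
  shows "fd (\<lambda>x. fd f x (axis i 1)) x (axis j 1) = fd (\<lambda>x. fd f x (axis j 1)) x (axis i 1)"
proof -
  let ?F = "\<lambda>i j y. fd (\<lambda>x. fd f x (axis i 1)) y (axis j 1)"
  obtain r where r: "r > 0" "ball x r \<subseteq> S" using S open_contains_ball by blast
  have c: "continuous_on S (?F i j)" for i j using f by (simp add: numeral_2_eq_2)
  have "\<bar>?F i j x - ?F j i x\<bar> \<le> e" if e: "e > 0" for e
  proof -
    have "\<exists>d>0. \<forall>y\<in>ball x d. \<bar>?F i j y - ?F i j x\<bar> < e / 2" for i j
    proof -
      obtain d where d: "d > 0" "\<And>y. y \<in> S \<Longrightarrow> dist y x < d \<Longrightarrow> dist (?F i j y) (?F i j x) < e / 2"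
        using c[of i j] S(2) e unfolding continuous_on_iff by (metis half_gt_zero)
      then show ?thesis using r by (intro exI[of _ "min d r"]) (auto simp: dist_real_def dist_commute subset_iff)
    qed
    then obtain d1 d2 where d: "d1 > 0" "\<And>y. y \<in> ball x d1 \<Longrightarrow> \<bar>?F i j y - ?F i j x\<bar> < e / 2"
      "d2 > 0" "\<And>y. y \<in> ball x d2 \<Longrightarrow> \<bar>?F j i y - ?F j i x\<bar> < e / 2" by meson
    \<comment> \<open>With a quarter of the minimum both points, at distance less than
      \<open>3 * h\<close>, stay in the two balls of continuity, and \<open>2 * h < r\<close>
      holds.\<close>
    define h where "h = min r (min d1 d2) / 4"
    have h: "0 < h" "2 * h < r" "3 * h < d1" "3 * h < d2" using r d by (auto simp: h_def min_def)
    have fr: "ck_on 2 (ball x r) f" by (rule ck_on_subset[OF r(2) f])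
    obtain y where y: "y \<in> ball x (3 * h)"
      "f (x + h *\<^sub>R axis i 1 + h *\<^sub>R axis j 1) - f (x + h *\<^sub>R axis i 1) - f (x + h *\<^sub>R axis j 1) + f x = h * h * ?F i j y"
      using second_difference[OF fr h(1,2), of i j] by blast
    obtain z where z: "z \<in> ball x (3 * h)"
      "f (x + h *\<^sub>R axis j 1 + h *\<^sub>R axis i 1) - f (x + h *\<^sub>R axis j 1) - f (x + h *\<^sub>R axis i 1) + f x = h * h * ?F j i z"
      using second_difference[OF fr h(1,2), of j i] by blast
    have "h * h * ?F i j y = h * h * ?F j i z"
      unfolding y(2)[symmetric] z(2)[symmetric] by (simp add: add.commute add.left_commute)
    then have "?F i j y = ?F j i z" using h by simp
    moreover have "\<bar>?F i j y - ?F i j x\<bar> < e / 2" "\<bar>?F j i z - ?F j i x\<bar> < e / 2"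
      using d(2)[of y] d(4)[of z] y(1) z(1) h by auto
    ultimately show ?thesis by linarith
  qed
  then show ?thesis using dense_ge[of 0 "\<bar>?F i j x - ?F j i x\<bar>"] by (metis abs_le_zero_iff eq_iff_diff_eq_0)
qed

section \<open>Functions on an open part of a chart domain\<close>

locale chart_domain =
  fixes M :: "'m topology" and c :: "'m chart" and V :: "'m set"
  assumes chart: "is_chart M c" and V_open: "openin M V" and V_sub: "V \<subseteq> fst c"
begin

lemma inj_chart: "inj_on (snd c) (fst c)"
proof -
  have "topspace (subtopology M (fst c)) = fst c"
    using chart openin_subset unfolding is_chart_def by fastforce
  then show ?thesis using chart homeomorphic_imp_injective_map unfolding is_chart_def by metis
qed

lemma open_image: "open (snd c ` V)"
proof -
  have h: "homeomorphic_map (subtopology M (fst c)) (top_of_set (snd c ` fst c)) (snd c)" "open (snd c ` fst c)"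
    using chart by (auto simp: is_chart_def)
  have "openin (subtopology M (fst c)) V"
    using V_open V_sub openin_subtopology_Int[of M V "fst c"] by (simp add: Int_absorb2)
  moreover have "V \<subseteq> topspace (subtopology M (fst c))"
    using V_open V_sub openin_subset by fastforce
  ultimately have "openin (top_of_set (snd c ` fst c)) (snd c ` V)"
    using homeomorphic_map_openness_eq[OF h(1)] by blast
  then show ?thesis using h(2) openin_open_eq by blast
qed

lemma read_in_image: "q \<in> fst c \<Longrightarrow> read_in c f (snd c q) = f q"
  using inj_chart by (simp add: read_in_def)

lemma inv_image: "x \<in> snd c ` V \<Longrightarrow> inv_into (fst c) (snd c) x \<in> V" "x \<in> snd c ` V \<Longrightarrow> snd c (inv_into (fst c) (snd c) x) = x"
  using inj_chart V_sub by (auto simp: subset_iff)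

lemma read_in_cong: "(\<And>q. q \<in> V \<Longrightarrow> f q = g q) \<Longrightarrow> x \<in> snd c ` V \<Longrightarrow> read_in c f x = read_in c g x"
  using inv_image(1)[of x] by (simp add: read_in_def)

lemma smooth_in_differentiable: "smooth_in c V f \<Longrightarrow> p \<in> V \<Longrightarrow> read_in c f differentiable (at (snd c p))"
  unfolding smooth_in_def smooth_on_def by (metis ck_on.simps(2) imageI)

lemma read_in_pd: "x \<in> snd c ` V \<Longrightarrow> read_in c (pd c i f) x = fd (read_in c f) x (axis i 1)"
  using inv_image(2)[of x] by (simp add: pd_def read_in_def[of c "pd c i f"])

lemma smooth_in_cong: "(\<And>q. q \<in> V \<Longrightarrow> f q = g q) \<Longrightarrow> smooth_in c V f \<Longrightarrow> smooth_in c V g"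
  unfolding smooth_in_def smooth_on_def
proof (intro allI)
  fix k assume fg: "\<And>q. q \<in> V \<Longrightarrow> f q = g q" and f: "\<forall>k. ck_on k (snd c ` V) (read_in c f)"
  show "ck_on k (snd c ` V) (read_in c g)"
    by (rule ck_on_cong[OF open_image read_in_cong[of f g], OF fg]) (use f in blast)+
qed

lemma smooth_in_mono: "smooth_in c W f \<Longrightarrow> V \<subseteq> W \<Longrightarrow> smooth_in c V f"
  unfolding smooth_in_def smooth_on_def by (meson ck_on_subset image_mono)

lemma smooth_in_inverse: "smooth_in c V f \<Longrightarrow> (\<And>q. q \<in> V \<Longrightarrow> f q \<noteq> 0) \<Longrightarrow> smooth_in c V (\<lambda>q. inverse (f q))"
  unfolding smooth_in_def smooth_on_def
proof (intro allI)
  fix k assume f: "\<forall>k. ck_on k (snd c ` V) (read_in c f)" and n: "\<And>q. q \<in> V \<Longrightarrow> f q \<noteq> 0"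
  have "read_in c (\<lambda>q. inverse (f q)) = (\<lambda>x. inverse (read_in c f x))" by (simp add: read_in_def fun_eq_iff)
  moreover have "read_in c f x \<noteq> 0" if "x \<in> snd c ` V" for x
    using inv_image(1)[OF that] n by (simp add: read_in_def)
  ultimately show "ck_on k (snd c ` V) (read_in c (\<lambda>q. inverse (f q)))"
    using f ck_on_inverse[OF open_image] by simp
qed

sublocale smooth_derivations V "smooth_in c V" "pd c"
proof
  have add: "read_in c (\<lambda>q. f q + g q) = (\<lambda>x. read_in c f x + read_in c g x)"
    and mult: "read_in c (\<lambda>q. f q * g q) = (\<lambda>x. read_in c f x * read_in c g x)"
    and const: "read_in c (\<lambda>q. r) = (\<lambda>x. r)" for f g r
    by (simp_all add: read_in_def fun_eq_iff)
  show "smooth_in c V (\<lambda>q. r)" for r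
    unfolding smooth_in_def smooth_on_def const by (simp add: ck_on_const)
  show "smooth_in c V (\<lambda>q. f q + g q)" "smooth_in c V (\<lambda>q. f q * g q)" if "smooth_in c V f" "smooth_in c V g" for f g
    using that unfolding smooth_in_def smooth_on_def add mult by (simp_all add: ck_on_add ck_on_mult open_image)
  show "smooth_in c V (pd c i f)" if "smooth_in c V f" for f i
    unfolding smooth_in_def smooth_on_def
  proof
    fix k
    show "ck_on k (snd c ` V) (read_in c (pd c i f))"
    proof (rule ck_on_cong[OF open_image])
      show "ck_on k (snd c ` V) (\<lambda>x. fd (read_in c f) x (axis i 1))"
        using that unfolding smooth_in_def smooth_on_def by (metis ck_on.simps(2))
    qed (rule read_in_pd[symmetric])
  qed
  fix p assume p: "p \<in> V"
  show "pd c i (\<lambda>q. r) p = 0" for i r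
    unfolding pd_def const by (simp add: frechet_derivative_const)
  show "pd c i (\<lambda>q. f q + g q) p = pd c i f p + pd c i g p" "pd c i (\<lambda>q. f q * g q) p = pd c i f p * g p + f p * pd c i g p"
    if "smooth_in c V f" "smooth_in c V g" for f g i
    using that[THEN smooth_in_differentiable[OF _ p]] p V_sub
    unfolding pd_def add mult by (auto simp: fd_simps read_in_image)
  show "pd c i f p = pd c i g p" if "\<And>q. q \<in> V \<Longrightarrow> f q = g q" for f g i
    unfolding pd_def using fd_cong[OF open_image, of "snd c p" "read_in c f" "read_in c g"] p read_in_cong[OF that] by simp
  show "pd c i (pd c j f) p = pd c j (pd c i f) p" if "smooth_in c V f" for f i j
  proof -
    have "pd c i (pd c j f) p = fd (\<lambda>x. fd (read_in c f) x (axis j 1)) (snd c p) (axis i 1)" for i j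
      unfolding pd_def[of c i] using fd_cong[OF open_image, of "snd c p", OF _ read_in_pd] p by simp
    moreover have "ck_on 2 (snd c ` V) (read_in c f)" using that unfolding smooth_in_def smooth_on_def by blast
    ultimately show ?thesis using fd_comm[OF open_image, of "snd c p" "read_in c f"] p by simp
  qed
qed

end

section \<open>Covariant derivatives in a coframe\<close>

lemma tr_comp: "I \<in> idx k \<Longrightarrow> tr f k (\<lambda>J. tr e k a J) I = tr (\<lambda>i b. \<^bold>\<Sum>j. f i j * e j b) k a I"
proof (induction k arbitrary: a I)
  case (Suc k)
  obtain i J where I: "I = i # J" "J \<in> idx k" using Suc.prems unfolding idx_Suc_iff by blast
  have "tr f (Suc k) (\<lambda>J. tr e (Suc k) a J) I = (\<^bold>\<Sum>j b. f i j * (e j b * tr f k (tr e k (\<lambda>K. a (b # K))) J))"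
    by (simp add: I(1) tr_Suc tr_sum tr_cmult sum_distrib_left)
  also have "\<dots> = (\<^bold>\<Sum>b j. f i j * (e j b * tr f k (tr e k (\<lambda>K. a (b # K))) J))" by (rule sum.swap)
  finally show ?case by (simp add: Suc.IH[OF I(2)] I(1) tr_Suc sum_distrib_right mult.assoc)
qed simp

lemma tr_kd: "I \<in> idx k \<Longrightarrow> tr kd k a I = a I"
proof (induction k arbitrary: a I)
  case (Suc k)
  then show ?case unfolding idx_Suc_iff by (auto simp: tr_Suc)
qed simp

lemma tr_dual: "(\<Sum>I\<in>idx k. tr f k a I * c I) = (\<Sum>K\<in>idx k. a K * tr (\<lambda>x i. f i x) k c K)"
  unfolding tr_def sum_distrib_left sum_distrib_right by (subst sum.swap) (simp add: mult_ac)

lemma tr_cancel: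
  assumes "\<And>i j. (\<^bold>\<Sum>a. f i a * e a j) = kd i j" and "I \<in> idx k"
  shows "tr f k (tr e k a) I = a I"
  using assms by (simp add: tr_comp tr_kd)

lemma tr_inj:
  assumes inv: "\<And>i j. (\<^bold>\<Sum>a. f i a * e a j) = kd i j" and z: "\<And>J. J \<in> idx k \<Longrightarrow> tr e k a J = 0" and K: "K \<in> idx k"
  shows "a K = 0"
  using tr_cancel[OF inv K, of a] tr_zero[of k "tr e k a" f K] z by simp

text \<open>The derivation action of a matrix on a tensor with \<open>k\<close> slots. With
  Christoffel symbols or connection matrices for \<open>F\<close> it is the correction term of a
  covariant derivative.\<close>

definition actl :: "(7 \<Rightarrow> 7 \<Rightarrow> real) \<Rightarrow> nat \<Rightarrow> tens \<Rightarrow> tens"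
  where "actl F k a K = (\<Sum>s<k. \<^bold>\<Sum>b. F (K ! s) b * a (K[s := b]))"

lemma actl_0 [simp]: "actl F 0 a K = 0"
  by (simp add: actl_def)

lemma actl_Suc: "actl F (Suc k) a (x # K) = (\<^bold>\<Sum>b. F x b * a (b # K)) + actl F k (\<lambda>L. a (x # L)) K"
  by (simp add: actl_def sum.lessThan_Suc_shift del: sum.lessThan_Suc)

lemma actl_append:
  assumes "length L = k"
  shows "actl F (k + l) a (L @ K) = actl F k (\<lambda>L. a (L @ K)) L + actl F l (\<lambda>K. a (L @ K)) K"
  using assms by (induction k arbitrary: a L) (auto simp: actl_Suc length_Suc_conv)

lemma actl_3: "actl F 3 a [x, y, z] = act3 F (\<lambda>x y z. a [x, y, z]) x y z"
  by (simp add: numeral_3_eq_3 actl_Suc act3_def)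

lemma actl_cong: "(\<And>L. length L = length K \<Longrightarrow> a L = b L) \<Longrightarrow> actl F k a K = actl F k b K"
  by (simp add: actl_def)

lemma actl_sum: "actl F k (\<lambda>K. \<Sum>x\<in>S. c x * a x K) K = (\<Sum>x\<in>S. c x * actl F k (a x) K)"
proof -
  have "(\<Sum>s<k. \<^bold>\<Sum>b. \<Sum>x\<in>S. c x * (F (K ! s) b * a x (K[s := b]))) = (\<Sum>x\<in>S. \<Sum>s<k. \<^bold>\<Sum>b. c x * (F (K ! s) b * a x (K[s := b])))"
    by (simp only: sum.swap[of _ _ S])
  then show ?thesis by (simp add: actl_def sum_distrib_left mult.left_commute)
qed

lemma (in smooth_derivations) sm_tr:
  assumes e: "\<And>j b. sm (e j b)" and a: "\<And>K. K \<in> idx k \<Longrightarrow> sm (a K)" and J: "J \<in> idx k"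
  shows "sm (\<lambda>q. tr (\<lambda>j b. e j b q) k (\<lambda>K. a K q) J)"
  using J a
proof (induction k arbitrary: a J)
  case 0
  then show ?case by simp
next
  case (Suc k)
  obtain j J' where J: "J = j # J'" "J' \<in> idx k" using Suc.prems(1) unfolding idx_Suc_iff by blast
  have "sm (\<lambda>q. tr (\<lambda>j b. e j b q) k (\<lambda>K. a (b # K) q) J')" for b
    by (rule Suc.IH[OF J(2)]) (use Suc.prems(2) in \<open>auto simp: idx_Suc_iff\<close>)
  then show ?case unfolding J(1) tr_Suc by (intro sm_sum sm_mult e)
qed

text \<open>
  \<open>\<nabla>\<close> of a tensor in coordinates (symbols \<open>G\<close>) against the same in the coframe (connection
  forms \<open>A\<close>).
\<close>

lemma (in smooth_derivations) pd_tr: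
  assumes p: "p \<in> V" and e: "\<And>j b. sm (e j b)" and a: "\<And>K. K \<in> idx k \<Longrightarrow> sm (a K)" and J: "J \<in> idx k"
    and de: "\<And>j b. pd i (e j b) p = (\<^bold>\<Sum>l. G j l * e l b p) - (\<^bold>\<Sum>x. A x b * e j x p)"
  shows "pd i (\<lambda>q. tr (\<lambda>j b. e j b q) k (\<lambda>K. a K q) J) p
    = actl G k (tr (\<lambda>j b. e j b p) k (\<lambda>K. a K p)) J
      + tr (\<lambda>j b. e j b p) k (\<lambda>K. pd i (a K) p - actl A k (\<lambda>K. a K p) K) J"
  using J a
proof (induction k arbitrary: a J)
  case 0
  then show ?case by simp
next
  case (Suc k)
  obtain j J' where J: "J = j # J'" "J' \<in> idx k" using Suc.prems(1) unfolding idx_Suc_iff by blast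
  have a: "sm (a (b # K))" if "K \<in> idx k" for b K using that Suc.prems(2) by (auto simp: idx_Suc_iff)
  define t where "t b q = tr (\<lambda>j b. e j b q) k (\<lambda>K. a (b # K) q) J'" for b q
  define g where "g b = actl G k (tr (\<lambda>j b. e j b p) k (\<lambda>K. a (b # K) p)) J'" for b
  define n where "n b = tr (\<lambda>j b. e j b p) k (\<lambda>K. pd i (a (b # K)) p - actl A k (\<lambda>K. a (b # K) p) K) J'" for b
  have t: "sm (t b)" for b unfolding t_def by (rule sm_tr) (use e a J in auto)
  have IH: "pd i (t b) p = g b + n b" for b
    unfolding t_def g_def n_def by (rule Suc.IH[OF J(2)]) (rule a)
  have "pd i (\<lambda>q. tr (\<lambda>j b. e j b q) (Suc k) (\<lambda>K. a K q) J) p = pd i (\<lambda>q. \<^bold>\<Sum>b. e j b q * t b q) p"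
    unfolding J(1) tr_Suc t_def ..
  also have "\<dots> = (\<^bold>\<Sum>b. pd i (e j b) p * t b p + e j b p * (g b + n b))"
    by (simp add: pd_rules sm_rules t e p IH)
  also have "\<dots> = (\<^bold>\<Sum>b l. G j l * e l b p * t b p) - (\<^bold>\<Sum>b x. A x b * e j x p * t b p) + (\<^bold>\<Sum>b. e j b p * g b) + (\<^bold>\<Sum>b. e j b p * n b)"
    by (simp add: de left_diff_distrib distrib_left sum.distrib sum_subtractf sum_distrib_right)
  also have "(\<^bold>\<Sum>b l. G j l * e l b p * t b p) = (\<^bold>\<Sum>l b. G j l * e l b p * t b p)" by (rule sum.swap)
  also have "(\<^bold>\<Sum>b x. A x b * e j x p * t b p) = (\<^bold>\<Sum>x b. A x b * e j x p * t b p)" by (rule sum.swap)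
  finally have L: "pd i (\<lambda>q. tr (\<lambda>j b. e j b q) (Suc k) (\<lambda>K. a K q) J) p
    = (\<^bold>\<Sum>l b. G j l * e l b p * t b p) - (\<^bold>\<Sum>x b. A x b * e j x p * t b p) + (\<^bold>\<Sum>b. e j b p * g b) + (\<^bold>\<Sum>b. e j b p * n b)" .
  have R1: "actl G (Suc k) (tr (\<lambda>j b. e j b p) (Suc k) (\<lambda>K. a K p)) J
    = (\<^bold>\<Sum>l b. G j l * e l b p * t b p) + (\<^bold>\<Sum>b. e j b p * g b)"
    unfolding J(1) actl_Suc tr_Suc actl_sum g_def t_def by (simp add: sum_distrib_left mult.assoc)
  have m: "tr (\<lambda>j b. e j b p) k (\<lambda>K. pd i (a (b # K)) p - actl A (Suc k) (\<lambda>K. a K p) (b # K)) J' = n b - (\<^bold>\<Sum>x. A b x * t x p)" for b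
  proof -
    have "tr (\<lambda>j b. e j b p) k (\<lambda>K. pd i (a (b # K)) p - actl A (Suc k) (\<lambda>K. a K p) (b # K)) J'
      = tr (\<lambda>j b. e j b p) k (\<lambda>K. (pd i (a (b # K)) p - actl A k (\<lambda>K. a (b # K) p) K) + (\<^bold>\<Sum>x. (- A b x) * a (x # K) p)) J'"
      by (rule tr_cong) (simp add: actl_Suc sum_negf)
    also have "\<dots> = n b + (\<^bold>\<Sum>x. (- A b x) * t x p)"
      unfolding tr_add tr_sum tr_cmult n_def t_def ..
    finally show ?thesis by (simp add: sum_negf)
  qed
  have R2: "tr (\<lambda>j b. e j b p) (Suc k) (\<lambda>K. pd i (a K) p - actl A (Suc k) (\<lambda>K. a K p) K) J
    = (\<^bold>\<Sum>b. e j b p * n b) - (\<^bold>\<Sum>x b. A x b * e j x p * t b p)"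
    unfolding J(1) tr_Suc m by (simp add: right_diff_distrib sum_subtractf sum_distrib_left mult_ac)
  show ?case unfolding L R1 R2 by simp
qed

section \<open>Exterior derivatives and the Hodge star in a coframe\<close>

lemma actl_eps:
  assumes F: "alt2 F" and K: "length K = 7"
  shows "actl F 7 eps K = 0"
proof -
  \<comment> \<open>The Schouten identity for \<open>y # K\<close>, with its leading term isolated.
    Summed against \<open>F\<close> it makes the action on \<open>eps\<close> a multiple of the
    trace of \<open>F\<close>, and a skew matrix has trace zero.\<close>
  have k: "kd x y * eps K = (\<Sum>s<7. kd x (K ! s) * eps (K[s := y]))" for x y
  proof -
    have "eps (K[s := y]) = (- 1) ^ s * eps (y # take s K @ drop (Suc s) K)" if s: "s < 7" for s
    proof -
      have "K[s := y] = [] @ take s K @ y # drop (Suc s) K" using s K by (simp add: upd_conv_take_nth_drop)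
      moreover have "length ([] @ take s K @ y # drop (Suc s) K) = 7" using s K by simp
      ultimately show ?thesis using alternating_move[OF alternating_eps, of "[]" "take s K" y "drop (Suc s) K"] s K by simp
    qed
    then have "(\<Sum>s<7. kd x (K ! s) * eps (K[s := y])) = (\<Sum>s<7. (- 1) ^ s * kd x (K ! s) * eps (y # take s K @ drop (Suc s) K))"
      by (intro sum.cong) (simp_all add: mult_ac)
    moreover have "(\<Sum>s<Suc 7. (- 1) ^ s * kd x ((y # K) ! s) * eps (take s (y # K) @ drop (Suc s) (y # K))) = 0"
      using schouten[OF alternating_eps, of "y # K" x] K by simp
    ultimately show ?thesis
      unfolding sum.lessThan_Suc_shift by (simp add: sum_negf)
  qed
  have z: "F y y = 0" for y using alt2D[OF F, of y y] by simp
  have "actl F 7 eps K = (\<Sum>s<7. \<^bold>\<Sum>y. F (K ! s) y * eps (K[s := y]))" by (simp add: actl_def)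
  also have "\<dots> = (\<Sum>s<7. \<^bold>\<Sum>y x. F x y * (kd x (K ! s) * eps (K[s := y])))"
    by (simp add: mult.left_commute[of "F _ _"])
  also have "\<dots> = (\<^bold>\<Sum>y x. F x y * (\<Sum>s<7. kd x (K ! s) * eps (K[s := y])))"
    unfolding sum_distrib_left by (simp only: sum.swap[of _ _ "{..<7}"])
  also have "\<dots> = 0" by (simp add: k[symmetric] mult.left_commute[of "F _ _"] z)
  finally show ?thesis .
qed

text \<open>The volume form is annihilated by \<open>F\<close>, and its slots split into those of
  \<open>L\<close> and those of \<open>K\<close>; on the \<open>L\<close> part the action passes to
  \<open>a\<close> by skew-adjointness.\<close>

lemma actl_hodge3:
  assumes F: "alt2 F" and K: "K \<in> idx 4"
  shows "actl F 4 (hodge3 a) K = hodge3 (actl F 3 a) K"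
proof -
  have K4: "length K = 4" using K by (simp add: idx_def)
  have "a L * actl F 3 (\<lambda>L. eps (L @ K)) L + a L * actl F 4 (\<lambda>K. eps (L @ K)) K = 0" if "L \<in> idx 3" for L
  proof -
    have "length L = 3" using that by (simp add: idx_def)
    then have "actl F (3 + 4) eps (L @ K) = actl F 3 (\<lambda>L. eps (L @ K)) L + actl F 4 (\<lambda>K. eps (L @ K)) K"
      by (rule actl_append)
    then show ?thesis using actl_eps[OF F, of "L @ K"] K4 \<open>length L = 3\<close> by (simp add: distrib_left[symmetric])
  qed
  then have "(\<Sum>L\<in>idx 3. a L * actl F 3 (\<lambda>L. eps (L @ K)) L) + (\<Sum>L\<in>idx 3. a L * actl F 4 (\<lambda>K. eps (L @ K)) K) = 0"
    by (simp add: sum.distrib[symmetric])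
  moreover have "(\<Sum>L\<in>idx 3. a L * actl F 3 (\<lambda>L. eps (L @ K)) L) = - (\<Sum>L\<in>idx 3. actl F 3 a L * eps (L @ K))"
    unfolding sum_idx_3 actl_3 by (rule act3_dual[OF F])
  moreover have "actl F 4 (hodge3 a) K = (\<Sum>L\<in>idx 3. a L * actl F 4 (\<lambda>K. eps (L @ K)) K) / 6"
    using actl_sum[of F 4 "\<lambda>L. a L / 6" "\<lambda>L K. eps (L @ K)" "idx 3" K]
    by (simp add: hodge3_def[abs_def] sum_divide_distrib)
  ultimately show ?thesis by (simp add: hodge3_def)
qed

text \<open>The part of alternation that the exterior derivative uses. For a Hodge dual it can be
  read off from the trailing slots of the volume form, without treating arbitrary
  permutations.\<close>

definition movable :: "nat \<Rightarrow> tens \<Rightarrow> bool"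
  where "movable n \<alpha> \<longleftrightarrow> (\<forall>I B x J. length (I @ B @ x # J) = n \<longrightarrow> \<alpha> (I @ B @ x # J) = (- 1) ^ length B * \<alpha> (I @ x # B @ J))"

lemma alternating_movable: "alternating n \<alpha> \<Longrightarrow> movable n \<alpha>"
  unfolding movable_def using alternating_move by blast

text \<open>The terms of a symmetric connection cancel in pairs in the exterior derivative.\<close>

lemma alternated_actl:
  assumes \<alpha>: "movable n \<alpha>" and G: "\<And>i j l. G i j l = G j i l" and I: "length I = Suc n"
  shows "(\<Sum>s<Suc n. (- 1) ^ s * actl (G (I ! s)) n \<alpha> (take s I @ drop (Suc s) I)) = 0"
proof -
  define f where "f s t = (- 1) ^ s * (\<^bold>\<Sum>l. G (I ! s) (I ! t) l * \<alpha> (take s (I[t := l]) @ drop (Suc s) (I[t := l])))" for s t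
  \<comment> \<open>Differentiating in slot \<open>s\<close> with slot \<open>t\<close> replaced by
    \<open>l\<close>, or the reverse, leaves the same entries up to moving \<open>l\<close> across
    the block \<open>B\<close> between them. With the two alternating signs and the symmetry of
    \<open>G\<close> this gives the factor -1.\<close>
  have anti: "f s t = - f t s" if st: "s < t" "t < Suc n" for s t
  proof -
    define A B C where "A = take s I" and "B = take (t - Suc s) (drop (Suc s) I)" and "C = drop (Suc t) I"
    have "I = A @ I ! s # drop (Suc s) I" using st I unfolding A_def by (simp add: id_take_nth_drop)
    moreover have "drop (Suc s) I = B @ I ! t # C"
      using id_take_nth_drop[of "t - Suc s" "drop (Suc s) I"] st I unfolding B_def C_def by simp
    ultimately have I': "I = A @ I ! s # B @ I ! t # C" by simp
    have l: "length A = s" "length B = t - Suc s" using st I by (auto simp: A_def B_def)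
    have t: "t = Suc (s + length B)" using l st by simp
    obtain x y where xy: "I = A @ x # B @ y # C" using I' by blast
    have st': "take s (I[t := l]) @ drop (Suc s) (I[t := l]) = A @ B @ l # C"
      "take t (I[s := l]) @ drop (Suc t) (I[s := l]) = A @ l # B @ C" for l
      using l(1) by (simp_all add: xy t list_update_append nth_append)
    have "\<alpha> (A @ B @ l # C) = (- 1) ^ length B * \<alpha> (A @ l # B @ C)" for l
      using \<alpha> I unfolding movable_def xy by simp
    then show ?thesis
      unfolding f_def st' by (simp add: t power_add sum_distrib_left sum_negf[symmetric] G[of "I ! s"] mult_ac)
  qed
  have s: "(\<Sum>s<Suc n. \<Sum>t\<in>{..<Suc n} - {s}. f s t) = 0"
  proof -
    define h where "h s t = (if s = t then 0 else f s t)" for s t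
    have h: "h s t = - h t s" if "s < Suc n" "t < Suc n" for s t
      using that anti[of s t] anti[of t s] by (cases s t rule: linorder_cases) (auto simp: h_def)
    have "(\<Sum>s<Suc n. \<Sum>t<Suc n. h s t) = (\<Sum>s<Suc n. \<Sum>t<Suc n. - h t s)"
      by (intro sum.cong refl h) (simp_all only: lessThan_iff)
    also have "\<dots> = - (\<Sum>s<Suc n. \<Sum>t<Suc n. h s t)" by (subst sum.swap) (simp only: sum_negf)
    finally have "(\<Sum>s<Suc n. \<Sum>t<Suc n. h s t) = 0" by linarith
    moreover have "(\<Sum>t<Suc n. h s t) = (\<Sum>t\<in>{..<Suc n} - {s}. f s t)" if "s < Suc n" for s
      by (rule sum.mono_neutral_cong_right) (use that in \<open>auto simp: h_def\<close>)
    ultimately show ?thesis by simp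
  qed
  have "(- 1) ^ s * actl (G (I ! s)) n \<alpha> (take s I @ drop (Suc s) I) = (\<Sum>t\<in>{..<Suc n} - {s}. f s t)" if s: "s < Suc n" for s
  proof -
    have ls: "length (take s I @ drop (Suc s) I) = n" using s I by simp
    define u where "u r = (if r < s then r else Suc r)" for r
    have "(\<Sum>t\<in>{..<Suc n} - {s}. f s t) = (\<Sum>r<n. f s (u r))"
      by (rule sum.reindex_bij_witness[where i = u and j = "\<lambda>t. if t < s then t else t - 1"])
        (use s in \<open>auto simp: u_def\<close>)
    also have "\<dots> = (\<Sum>r<n. (- 1) ^ s * (\<^bold>\<Sum>l. G (I ! s) ((take s I @ drop (Suc s) I) ! r) l * \<alpha> ((take s I @ drop (Suc s) I)[r := l])))"
    proof (intro sum.cong refl)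
      fix r assume "r \<in> {..<n}"
      then have r: "r < n" by simp
      have "(take s I @ drop (Suc s) I) ! r = I ! u r" using r s I by (simp add: u_def nth_append)
      moreover have "(take s I @ drop (Suc s) I)[r := l] = take s (I[u r := l]) @ drop (Suc s) (I[u r := l])" for l
        using r s I by (intro nth_equalityI) (auto simp: u_def nth_append nth_list_update)
      ultimately show "f s (u r) = (- 1) ^ s * (\<^bold>\<Sum>l. G (I ! s) ((take s I @ drop (Suc s) I) ! r) l * \<alpha> ((take s I @ drop (Suc s) I)[r := l]))"
        unfolding f_def by simp
    qed
    finally show ?thesis by (simp add: actl_def sum_distrib_left)
  qed
  then have "(\<Sum>s<Suc n. (- 1) ^ s * actl (G (I ! s)) n \<alpha> (take s I @ drop (Suc s) I)) = (\<Sum>s<Suc n. \<Sum>t\<in>{..<Suc n} - {s}. f s t)"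
    by (intro sum.cong) auto
  then show ?thesis using s by simp
qed

text \<open>In a frame the exterior derivative of a Hodge dual is a divergence: the Schouten
  identity for \<open>[a, b, c] @ K\<close> moves the contraction with the derivative index
  \<open>d\<close> from the slots of \<open>K\<close> to \<open>a\<close>, \<open>b\<close>,
  \<open>c\<close>, where each term contains a divergence of \<open>X\<close>.\<close>

lemma alternated_hodge3:
  assumes X: "\<And>d. alt3 (\<lambda>a b c. X d [a, b, c])" and z: "\<And>b c. (\<^bold>\<Sum>d. X d [d, b, c]) = 0" and K: "length K = 5"
  shows "(\<Sum>s<5. (- 1) ^ s * hodge3 (X (K ! s)) (take s K @ drop (Suc s) K)) = 0"
proof -
  define E where "E s L = eps (L @ take s K @ drop (Suc s) K)" for s L
  have sch: "(\<Sum>s<5. (- 1) ^ s * kd d (K ! s) * E s [a, b, c])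
      = kd d a * eps (b # c # K) - kd d b * eps (a # c # K) + kd d c * eps (a # b # K)" for d a b c
  proof -
    have "(\<Sum>s<3 + 5. (- 1) ^ s * kd d (([a, b, c] @ K) ! s) * eps (take s ([a, b, c] @ K) @ drop (Suc s) ([a, b, c] @ K))) = 0"
      using schouten[OF alternating_eps, of "[a, b, c] @ K" d] K by simp
    then have "(\<Sum>s<3. (- 1) ^ s * kd d ((a # b # c # K) ! s) * eps (take s (a # b # c # K) @ drop (Suc s) (a # b # c # K)))
      = (\<Sum>s<5. (- 1) ^ s * kd d (K ! s) * E s [a, b, c])"
      unfolding sum_lessThan_add by (simp add: power_add E_def sum_negf numeral_3_eq_3)
    then show ?thesis by (simp add: numeral_3_eq_3)
  qed
  have s1: "(\<^bold>\<Sum>a b c. X a [a, b, c] * eps (b # c # K)) = 0"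
    "(\<^bold>\<Sum>a b c. X b [a, b, c] * eps (a # c # K)) = 0" "(\<^bold>\<Sum>a b c. X c [a, b, c] * eps (a # b # K)) = 0"
  proof -
    have w: "X b [a, b, c] = - X b [b, a, c]" "X c [a, b, c] = X c [c, a, b]" for a b c
      using alt3D(1)[OF X[of b], of b a c] alt3_cyc[OF X[of c], of a b c] by simp_all
    have "(\<^bold>\<Sum>a b c. X a [a, b, c] * eps (b # c # K)) = (\<^bold>\<Sum>b c. (\<^bold>\<Sum>a. X a [a, b, c]) * eps (b # c # K))"
      unfolding sum_distrib_right by (rule sum_rot3)
    then show "(\<^bold>\<Sum>a b c. X a [a, b, c] * eps (b # c # K)) = 0" by (simp add: z)
    have "(\<^bold>\<Sum>a b c. X c [a, b, c] * eps (a # b # K)) = (\<^bold>\<Sum>a b. (\<^bold>\<Sum>c. X c [c, a, b]) * eps (a # b # K))"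
      unfolding sum_distrib_right by (intro sum.cong refl arg_cong2[where f = "(*)"] w(2))
    then show "(\<^bold>\<Sum>a b c. X c [a, b, c] * eps (a # b # K)) = 0" by (simp add: z)
    have "(\<^bold>\<Sum>a b c. X b [a, b, c] * eps (a # c # K)) = (\<^bold>\<Sum>a c b. - X b [b, a, c] * eps (a # c # K))"
      unfolding w(1) by (rule sum.cong[OF refl], rule sum.swap)
    also have "\<dots> = (\<^bold>\<Sum>a c. - (\<^bold>\<Sum>b. X b [b, a, c]) * eps (a # c # K))"
      by (simp add: sum_distrib_right sum_negf)
    finally show "(\<^bold>\<Sum>a b c. X b [a, b, c] * eps (a # c # K)) = 0" by (simp add: z)
  qed
  have "6 * (\<Sum>s<5. (- 1) ^ s * hodge3 (X (K ! s)) (take s K @ drop (Suc s) K))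
      = (\<Sum>s<5. \<^bold>\<Sum>a b c. (- 1) ^ s * (X (K ! s) [a, b, c] * E s [a, b, c]))"
    by (simp add: hodge3_def sum_idx_3 E_def sum_distrib_left sum_divide_distrib)
  also have "\<dots> = (\<Sum>s<5. \<^bold>\<Sum>a b c d. X d [a, b, c] * ((- 1) ^ s * kd d (K ! s) * E s [a, b, c]))"
    by (simp add: mult.left_commute[of "X _ _"] mult.assoc sum_distrib_left[symmetric])
  also have "\<dots> = (\<^bold>\<Sum>a b c d. X d [a, b, c] * (\<Sum>s<5. (- 1) ^ s * kd d (K ! s) * E s [a, b, c]))"
    unfolding sum_distrib_left by (simp only: sum.swap[of _ _ "{..<5}"])
  also have "\<dots> = (\<^bold>\<Sum>a b c. X a [a, b, c] * eps (b # c # K) - X b [a, b, c] * eps (a # c # K) + X c [a, b, c] * eps (a # b # K))"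
    unfolding sch by (simp add: right_diff_distrib distrib_left sum.distrib sum_subtractf mult.left_commute[of "X _ _"])
  also have "\<dots> = 0" by (simp add: sum.distrib sum_subtractf s1)
  finally show ?thesis by simp
qed

context smooth_derivations
begin

lemma sm_prod: "finite S \<Longrightarrow> (\<And>x. x \<in> S \<Longrightarrow> sm (\<lambda>q. f x q)) \<Longrightarrow> sm (\<lambda>q. \<Prod>x\<in>S. f x q)"
  by (induction S rule: finite_induct) (simp_all add: sm_const sm_mult)

lemma sm_det: "(\<And>i j. sm (\<lambda>q. B q $ i $ j)) \<Longrightarrow> sm (\<lambda>q. det (B q :: real^7^7))"
  unfolding det_def by (intro sm_finite_sum sm_mult sm_const sm_prod) auto

end

lemma matrix_inv_mult:
  fixes B :: "real^'n^'n"
  assumes "invertible B"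
  shows "B ** matrix_inv B = mat 1" "matrix_inv B ** B = mat 1"
  using someI_ex[OF assms[unfolded invertible_def]] unfolding matrix_inv_def by blast+

lemma matrix_inv_unique:
  fixes B C :: "real^'n^'n"
  assumes "B ** C = mat 1"
  shows "matrix_inv B = C"
proof -
  have "C ** B = mat 1" using assms matrix_left_right_inverse by blast
  then have "invertible B" using assms invertible_def by blast
  then have "matrix_inv B ** B = mat 1" by (rule matrix_inv_mult)
  then show ?thesis using assms by (metis matrix_mul_assoc matrix_mul_lid matrix_mul_rid)
qed

section \<open>The frame components of connection, torsion and curvature\<close>

locale chart_coframe = chart_domain M c V for M :: "'m topology" and c :: "'m chart" and V :: "'m set" +
  fixes e :: "7 \<Rightarrow> 7 \<Rightarrow> 'm \<Rightarrow> real"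
  assumes sm_e: "smooth_in c V (e i a)" and det_e: "q \<in> V \<Longrightarrow> det (\<chi> a i. e i a q) \<noteq> 0"
begin

definition Ei :: "7 \<Rightarrow> 7 \<Rightarrow> 'm \<Rightarrow> real"
  where "Ei a i q = matrix_inv (\<chi> a i. e i a q) $ i $ a"

lemma Ei_e: "q \<in> V \<Longrightarrow> (\<^bold>\<Sum>i. Ei a i q * e i b q) = kd a b"
  and e_Ei: "q \<in> V \<Longrightarrow> (\<^bold>\<Sum>a. e i a q * Ei a j q) = kd i j"
proof -
  assume q: "q \<in> V"
  let ?Q = "\<chi> a i. e i a q"
  have i: "?Q ** matrix_inv ?Q = mat 1" "matrix_inv ?Q ** ?Q = mat 1"
    using matrix_inv_mult[of ?Q] det_e[OF q] by (simp_all add: invertible_det_nz)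
  have "(\<^bold>\<Sum>i. Ei a i q * e i b q) = (?Q ** matrix_inv ?Q) $ b $ a"
    by (simp add: matrix_matrix_mult_def Ei_def mult.commute)
  then show "(\<^bold>\<Sum>i. Ei a i q * e i b q) = kd a b" unfolding i by (simp add: mat_def kd_def)
  have "(\<^bold>\<Sum>a. e i a q * Ei a j q) = (matrix_inv ?Q ** ?Q) $ j $ i"
    by (simp add: matrix_matrix_mult_def Ei_def mult.commute)
  then show "(\<^bold>\<Sum>a. e i a q * Ei a j q) = kd i j" unfolding i by (simp add: mat_def kd_def)
qed

text \<open>By Cramer's rule the entries of the inverse matrix are quotients of determinants with
  smooth entries.\<close>

lemma sm_Ei: "smooth_in c V (Ei a i)"
proof (rule smooth_in_cong)
  let ?N = "\<lambda>q. \<chi> r s. if s = i then kd r a else e s r q"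
  show "det (?N q) * inverse (det (\<chi> a i. e i a q)) = Ei a i q" if q: "q \<in> V" for q
  proof -
    let ?Q = "\<chi> a i. e i a q"
    define x :: "real^7" where "x = (\<chi> i. Ei a i q)"
    have "?Q *v x = axis a 1"
      by (simp add: vec_eq_iff matrix_vector_mult_def x_def axis_def mult.commute[of "e _ _ _"] Ei_e[OF q]) (auto simp: kd_def)
    then have "x = (\<chi> k. det (\<chi> r s. if s = k then axis a 1 $ r else ?Q $ r $ s) / det ?Q)"
      using cramer[OF det_e[OF q]] by blast
    then have "Ei a i q = det (\<chi> r s. if s = i then axis a 1 $ r else ?Q $ r $ s) / det ?Q"
      unfolding x_def by (simp add: vec_eq_iff)
    moreover have "(\<chi> r s. if s = i then axis a 1 $ r else ?Q $ r $ s) = ?N q"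
      by (simp add: vec_eq_iff axis_def kd_def)
    ultimately show ?thesis by (simp add: divide_inverse)
  qed
  have "smooth_in c V (\<lambda>q. ?N q $ r $ s)" for r s
    by (cases "s = i") (simp_all add: sm_const sm_e)
  then show "smooth_in c V (\<lambda>q. det (?N q) * inverse (det (\<chi> a i. e i a q)))"
    by (intro sm_mult smooth_in_inverse sm_det det_e) (simp_all add: sm_e)
qed

text \<open>
  The frame components of the connection with Christoffel symbols \<open>G\<close>; the entry \<open>(x, b)\<close> is
  minus the \<open>\<theta>\<^sub>x\<close>-component of \<open>\<nabla>\<^sub>i \<theta>\<^sub>b\<close> for the coframe \<open>\<theta>\<close>.
\<close>

definition conn :: "('m \<Rightarrow> 7 \<Rightarrow> 7 \<Rightarrow> 7 \<Rightarrow> real) \<Rightarrow> 7 \<Rightarrow> 7 \<Rightarrow> 7 \<Rightarrow> 'm \<Rightarrow> real"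
  where "conn G i x b q = - (\<^bold>\<Sum>j. (pd c i (e j b) q - (\<^bold>\<Sum>l. G q l i j * e l b q)) * Ei x j q)"

lemma sm_conn: "(\<And>l i j. smooth_in c V (\<lambda>q. G q l i j)) \<Longrightarrow> smooth_in c V (conn G i x b)"
  unfolding conn_def[abs_def] by (intro sm_rules sm_e sm_Ei) auto

lemma pd_e: "p \<in> V \<Longrightarrow> pd c i (e j b) p = (\<^bold>\<Sum>l. G p l i j * e l b p) - (\<^bold>\<Sum>x. conn G i x b p * e j x p)"
proof -
  assume p: "p \<in> V"
  let ?u = "\<lambda>j. pd c i (e j b) p - (\<^bold>\<Sum>l. G p l i j * e l b p)"
  have "(\<^bold>\<Sum>x. conn G i x b p * e j x p) = - (\<^bold>\<Sum>x k. ?u k * Ei x k p * e j x p)"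
    unfolding conn_def by (simp add: sum_distrib_right sum_negf)
  also have "(\<^bold>\<Sum>x k. ?u k * Ei x k p * e j x p) = (\<^bold>\<Sum>k x. ?u k * Ei x k p * e j x p)" by (rule sum.swap)
  also have "\<dots> = (\<^bold>\<Sum>k. ?u k * (\<^bold>\<Sum>x. e j x p * Ei x k p))"
    unfolding sum_distrib_left by (simp only: mult.assoc mult.commute[of "Ei _ _ _"])
  also have "\<dots> = ?u j" unfolding e_Ei[OF p] sum_kd ..
  finally show ?thesis by simp
qed

abbreviation "trf k a q \<equiv> tr (\<lambda>i a. e i a q) k a"

lemma pd_trf:
  assumes p: "p \<in> V" and a: "\<And>K. K \<in> idx k \<Longrightarrow> smooth_in c V (a K)" and J: "J \<in> idx k"
    and \<alpha>: "\<And>q J. q \<in> V \<Longrightarrow> J \<in> idx k \<Longrightarrow> \<alpha> q J = trf k (\<lambda>K. a K q) q J"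
  shows "pd c i (\<lambda>q. \<alpha> q J) p = actl (\<lambda>j l. G p l i j) k (\<alpha> p) J
    + trf k (\<lambda>K. pd c i (a K) p - actl (\<lambda>x b. conn G i x b p) k (\<lambda>K. a K p) K) p J"
proof -
  have "pd c i (\<lambda>q. \<alpha> q J) p = pd c i (\<lambda>q. trf k (\<lambda>K. a K q) q J) p"
    by (rule pd_cong[OF p]) (rule \<alpha>[OF _ J])
  also have "\<dots> = actl (\<lambda>j l. G p l i j) k (trf k (\<lambda>K. a K p) p) J
    + trf k (\<lambda>K. pd c i (a K) p - actl (\<lambda>x b. conn G i x b p) k (\<lambda>K. a K p) K) p J"
    by (rule pd_tr[OF p sm_e a J pd_e[OF p]])
  also have "actl (\<lambda>j l. G p l i j) k (trf k (\<lambda>K. a K p) p) J = actl (\<lambda>j l. G p l i j) k (\<alpha> p) J"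
    by (rule actl_cong) (use J in \<open>simp add: \<alpha>[OF p] idx_def\<close>)
  finally show ?thesis .
qed

lemma cov_deriv_trf:
  assumes p: "p \<in> V" and a: "\<And>K. K \<in> idx k \<Longrightarrow> smooth_in c V (a K)" and J: "J \<in> idx k"
    and \<alpha>: "\<And>q J. q \<in> V \<Longrightarrow> J \<in> idx k \<Longrightarrow> \<alpha> c q J = trf k (\<lambda>K. a K q) q J"
  shows "cov_deriv D \<alpha> c p (i # J) = trf k (\<lambda>K. pd c i (a K) p - actl (\<lambda>x b. conn (D c) i x b p) k (\<lambda>K. a K p) K) p J"
  using pd_trf[OF p a J \<alpha>, where i = i and G = "D c"] J by (simp add: cov_deriv_def actl_def idx_def)

lemma trf_inj:
  assumes "p \<in> V" "\<And>J. J \<in> idx k \<Longrightarrow> trf k a p J = 0" "K \<in> idx k"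
  shows "a K = 0"
  by (rule tr_inj[where f = "\<lambda>a i. Ei a i p" and e = "\<lambda>i a. e i a p"]) (use assms Ei_e in auto)

lemma trf_components:
  assumes "q \<in> V" "J \<in> idx k"
  shows "\<alpha> J = trf k (tr (\<lambda>a i. Ei a i q) k \<alpha>) q J"
  by (rule tr_cancel[symmetric]) (use assms e_Ei in auto)

lemma smooth_components:
  assumes "\<And>J. J \<in> idx k \<Longrightarrow> smooth_in c V (\<lambda>q. \<alpha> q J)" "K \<in> idx k"
  shows "smooth_in c V (\<lambda>q. tr (\<lambda>a i. Ei a i q) k (\<alpha> q) K)"
  using sm_tr[of Ei k "\<lambda>K q. \<alpha> q K" K] sm_Ei assms by simp

text \<open>Christoffel symbols symmetric in their lower indices cancel in the alternated sum
  (\<open>alternated_actl\<close>), so partial derivatives may be replaced by covariant ones, whose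
  frame components are \<open>X\<close>. \<open>tr_insert\<close> then restores the differentiating
  slot.\<close>

lemma ext_d_trf:
  assumes p: "p \<in> V" and a: "\<And>K. K \<in> idx k \<Longrightarrow> smooth_in c V (a K)" and I: "I \<in> idx (Suc k)"
    and \<alpha>: "\<And>q J. q \<in> V \<Longrightarrow> J \<in> idx k \<Longrightarrow> \<alpha> c q J = trf k (\<lambda>K. a K q) q J"
    and m: "movable k (\<alpha> c p)" and G: "\<And>l i j. G p l i j = G p l j i"
    and X: "\<And>i K. K \<in> idx k \<Longrightarrow> pd c i (a K) p - actl (\<lambda>x b. conn G i x b p) k (\<lambda>K. a K p) K = (\<^bold>\<Sum>d. e i d p * X d K)"
  shows "ext_d \<alpha> c p I = trf (Suc k) (\<lambda>K. \<Sum>s<Suc k. (- 1) ^ s * X (K ! s) (take s K @ drop (Suc s) K)) p I"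
proof -
  have l: "length I = Suc k" using I by (simp add: idx_def)
  let ?G = "\<lambda>i j l. G p l i j"
  have t: "pd c (I ! s) (\<lambda>q. \<alpha> c q (take s I @ drop (Suc s) I)) p
      = actl (?G (I ! s)) k (\<alpha> c p) (take s I @ drop (Suc s) I)
        + trf (Suc k) (\<lambda>K. X (K ! s) (take s K @ drop (Suc s) K)) p I" if s: "s < Suc k" for s
  proof -
    let ?J = "take s I @ drop (Suc s) I"
    have J: "?J \<in> idx k" using l s by (simp add: idx_def)
    have "trf k (\<lambda>K. pd c (I ! s) (a K) p - actl (\<lambda>x b. conn G (I ! s) x b p) k (\<lambda>K. a K p) K) p ?J
      = trf k (\<lambda>K. \<^bold>\<Sum>d. e (I ! s) d p * X d K) p ?J"
      by (rule tr_cong) (rule X)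
    also have "\<dots> = (\<^bold>\<Sum>d. e (I ! s) d p * trf (s + (k - s)) (X d) p (take s I @ drop (Suc s) I))"
      using s by (simp add: tr_sum tr_cmult)
    also have "\<dots> = trf (Suc (s + (k - s))) (\<lambda>K. X (K ! s) (take s K @ drop (Suc s) K)) p (take s I @ I ! s # drop (Suc s) I)"
      by (rule tr_insert) (use l s in simp)
    also have "take s I @ I ! s # drop (Suc s) I = I" using l s by (simp add: id_take_nth_drop[symmetric])
    finally show ?thesis using pd_trf[OF p a J \<alpha>, where i = "I ! s" and G = G] s by simp
  qed
  have "ext_d \<alpha> c p I = (\<Sum>s<Suc k. (- 1) ^ s * actl (?G (I ! s)) k (\<alpha> c p) (take s I @ drop (Suc s) I))
      + (\<Sum>s<Suc k. (- 1) ^ s * trf (Suc k) (\<lambda>K. X (K ! s) (take s K @ drop (Suc s) K)) p I)"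
    unfolding ext_d_def l by (simp add: t distrib_left sum.distrib del: sum.lessThan_Suc)
  also have "(\<Sum>s<Suc k. (- 1) ^ s * actl (?G (I ! s)) k (\<alpha> c p) (take s I @ drop (Suc s) I)) = 0"
    by (rule alternated_actl[OF m _ l]) (rule G)
  finally show ?thesis by (simp add: tr_sum tr_cmult del: sum.lessThan_Suc)
qed

end

section \<open>The data of the theorem in one adapted coframe\<close>

locale g2_chart = chart_coframe M c V e
  for M :: "'m topology" and c :: "'m chart" and V :: "'m set" and e :: "7 \<Rightarrow> 7 \<Rightarrow> 'm \<Rightarrow> real" +
  fixes g \<omega> \<phi> :: "'m field" and D Dg :: "'m christoffel" and r :: real
  assumes g_e: "q \<in> V \<Longrightarrow> g c q [i, j] = (\<^bold>\<Sum>a. e i a q * e j a q)"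
    and \<omega>_e: "q \<in> V \<Longrightarrow> I \<in> idx 7 \<Longrightarrow> \<omega> c q I = trf 7 eps q I"
    and \<phi>_e: "q \<in> V \<Longrightarrow> I \<in> idx 3 \<Longrightarrow> \<phi> c q I = trf 3 (g2_model dl) q I"
    and alt_\<omega>: "q \<in> V \<Longrightarrow> alternating 7 (\<omega> c q)"
    and alt_\<phi>: "q \<in> V \<Longrightarrow> alternating 3 (\<phi> c q)"
    and alt_T: "q \<in> V \<Longrightarrow> alternating 3 (torsion g D c q)"
    and sm_D: "smooth_in c V (\<lambda>q. D c q l i j)" and sm_Dg: "smooth_in c V (\<lambda>q. Dg c q l i j)"
    and sm_torsion: "I \<in> idx 3 \<Longrightarrow> smooth_in c V (\<lambda>q. torsion g D c q I)"
    and sm_g: "smooth_in c V (\<lambda>q. g c q [i, j])"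
    and par_g: "q \<in> V \<Longrightarrow> I \<in> idx 3 \<Longrightarrow> cov_deriv D g c q I = 0"
    and par_\<phi>: "q \<in> V \<Longrightarrow> I \<in> idx 4 \<Longrightarrow> cov_deriv D \<phi> c q I = 0"
    and par_g': "q \<in> V \<Longrightarrow> I \<in> idx 3 \<Longrightarrow> cov_deriv Dg g c q I = 0"
    and torsion_Dg: "q \<in> V \<Longrightarrow> I \<in> idx 3 \<Longrightarrow> torsion g Dg c q I = 0"
    and inst: "q \<in> V \<Longrightarrow> (\<^bold>\<Sum>a b a' b'. ginv (g c q) a a' * ginv (g c q) b b' * curvature g D c q [a, b, i, j] * \<phi> c q [a', b', k]) = 0"
    and ric: "q \<in> V \<Longrightarrow> I \<in> idx 2 \<Longrightarrow> ricci g D c q I = 0"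
    and ctype: "q \<in> V \<Longrightarrow> form_inner (g c q) 4 (ext_d \<phi> c q) (star g \<omega> 3 \<phi> c q) = r"
begin

lemma ginv_Ei: "q \<in> V \<Longrightarrow> ginv (g c q) i j = (\<^bold>\<Sum>a. Ei a i q * Ei a j q)"
proof -
  assume q: "q \<in> V"
  have "(\<^bold>\<Sum>b. (\<^bold>\<Sum>a. e i a q * e b a q) * (\<^bold>\<Sum>x. Ei x b q * Ei x j q)) = kd i j" for i j
  proof -
    have "(\<^bold>\<Sum>b. (\<^bold>\<Sum>a. e i a q * e b a q) * (\<^bold>\<Sum>x. Ei x b q * Ei x j q))
      = (\<^bold>\<Sum>a x b. e i a q * Ei x j q * (Ei x b q * e b a q))"
      unfolding sum_product by (subst sum_rot3) (simp only: mult_ac)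
    then show ?thesis by (simp only: sum_distrib_left[symmetric] Ei_e[OF q] sum_kd e_Ei[OF q])
  qed
  then have "(\<chi> a b. g c q [a, b]) ** (\<chi> i j. \<^bold>\<Sum>a. Ei a i q * Ei a j q) = mat 1"
    by (simp add: matrix_matrix_mult_def vec_eq_iff g_e[OF q] mat_def kd_def)
  from matrix_inv_unique[OF this] show ?thesis by (simp add: ginv_def)
qed

text \<open>The coframe is orthonormal, so raising indices keeps the frame components and replaces
  the coframe by its dual frame.\<close>

lemma raise_trf:
  assumes q: "q \<in> V" and \<alpha>: "\<And>J. J \<in> idx k \<Longrightarrow> \<alpha> J = trf k a q J" and I: "I \<in> idx k"
  shows "raise (g c q) \<alpha> I = tr (\<lambda>i a. Ei a i q) k a I"
proof -
  have "raise (g c q) \<alpha> I = tr (ginv (g c q)) k \<alpha> I"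
    using I by (simp add: raise_def tr_def idx_def mult.commute)
  also have "\<dots> = tr (ginv (g c q)) k (trf k a q) I" by (rule tr_cong) (rule \<alpha>)
  also have "\<dots> = tr (\<lambda>i b. \<^bold>\<Sum>j. ginv (g c q) i j * e j b q) k a I" by (rule tr_comp[OF I])
  also have "(\<lambda>i b. \<^bold>\<Sum>j. ginv (g c q) i j * e j b q) = (\<lambda>i b. Ei b i q)"
  proof (intro ext)
    fix i b
    have "(\<^bold>\<Sum>j. ginv (g c q) i j * e j b q) = (\<^bold>\<Sum>j a. Ei a i q * (Ei a j q * e j b q))"
      unfolding ginv_Ei[OF q] by (simp only: sum_distrib_right mult.assoc)
    also have "\<dots> = (\<^bold>\<Sum>a j. Ei a i q * (Ei a j q * e j b q))" by (rule sum.swap)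
    finally show "(\<^bold>\<Sum>j. ginv (g c q) i j * e j b q) = Ei b i q"
      by (simp only: sum_distrib_left[symmetric] Ei_e[OF q] sum_kd)
  qed
  finally show ?thesis .
qed

lemma contract_trf:
  assumes q: "q \<in> V" and \<alpha>: "\<And>J. J \<in> idx k \<Longrightarrow> \<alpha> J = trf k a q J" and \<beta>: "\<And>J. J \<in> idx k \<Longrightarrow> \<beta> J = trf k b q J"
  shows "(\<Sum>I\<in>idx k. raise (g c q) \<alpha> I * \<beta> I) = (\<Sum>K\<in>idx k. a K * b K)"
proof -
  have "(\<Sum>I\<in>idx k. raise (g c q) \<alpha> I * \<beta> I) = (\<Sum>I\<in>idx k. tr (\<lambda>i a. Ei a i q) k a I * trf k b q I)"
    using raise_trf[where \<alpha> = \<alpha>, OF q \<alpha>] \<beta> by (intro sum.cong refl) simp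
  also have "\<dots> = (\<Sum>K\<in>idx k. a K * tr (\<lambda>a i. Ei a i q) k (trf k b q) K)" by (rule tr_dual)
  also have "\<dots> = (\<Sum>K\<in>idx k. a K * b K)"
    by (intro sum.cong refl arg_cong2[where f = "(*)"] tr_cancel) (use Ei_e[OF q] in auto)
  finally show ?thesis .
qed

lemma star_trf:
  assumes q: "q \<in> V" and \<alpha>: "\<And>I. I \<in> idx 3 \<Longrightarrow> \<alpha> c q I = trf 3 a q I" and J: "J \<in> idx 4"
  shows "star g \<omega> 3 \<alpha> c q J = trf 4 (hodge3 a) q J"
proof -
  have w: "\<omega> c q (I @ J) = trf 3 (\<lambda>L. trf 4 (\<lambda>K. eps (L @ K)) q J) q I" if "I \<in> idx 3" for I
  proof -
    have "I @ J \<in> idx 7" using that J by (simp add: idx_def)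
    then show ?thesis using \<omega>_e[OF q] tr_append[of I 3 _ 4 eps J] that by (simp add: idx_def)
  qed
  have "(\<Sum>I\<in>idx 3. raise (g c q) (\<alpha> c q) I * \<omega> c q (I @ J)) = (\<Sum>L\<in>idx 3. a L * trf 4 (\<lambda>K. eps (L @ K)) q J)"
    by (rule contract_trf[OF q \<alpha> w])
  then show ?thesis
    unfolding star_def by (simp add: hodge3_def[abs_def] sum_divide_distrib tr_sum tr_cmult[symmetric] fact_numeral)
      (simp add: tr_def sum_divide_distrib)
qed

lemma movable_star: "q \<in> V \<Longrightarrow> movable 4 (star g \<omega> 3 \<alpha> c q)"
proof -
  assume q: "q \<in> V"
  have "\<omega> c q (L @ I @ B @ x # J) = (- 1) ^ length B * \<omega> c q (L @ I @ x # B @ J)"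
    if "L \<in> idx 3" "length (I @ B @ x # J) = 4" for L I B x J
    using alternating_move[OF alt_\<omega>[OF q], of "L @ I" B x J] that by (simp add: idx_def)
  then show ?thesis
    unfolding movable_def star_def by (simp add: sum_distrib_left mult.left_commute)
qed

lemma g_trf: "q \<in> V \<Longrightarrow> J \<in> idx 2 \<Longrightarrow> g c q J = trf 2 (\<lambda>K. kd (K ! 0) (K ! 1)) q J"
  by (auto simp: numeral_2_eq_2 idx_Suc_iff tr_Suc g_e sum_distrib_left[symmetric])

abbreviation "A \<equiv> conn (D c)"
abbreviation "Ag \<equiv> conn (Dg c)"

text \<open>In an orthonormal coframe the metric has the constant components \<open>kd\<close>, so
  its covariant derivative consists of the symmetrised connection matrix alone.\<close>

lemma metric_skew:
  assumes p: "p \<in> V" and par: "\<And>I. I \<in> idx 3 \<Longrightarrow> cov_deriv D' g c p I = 0"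
  shows "alt2 (\<lambda>x b. conn (D' c) i x b p)"
  unfolding alt2_def
proof (intro allI)
  fix x b
  let ?a = "\<lambda>K. pd c i (\<lambda>q. kd (K ! 0) (K ! 1)) p - actl (\<lambda>x b. conn (D' c) i x b p) 2 (\<lambda>K. kd (K ! 0) (K ! 1)) K"
  have "trf 2 ?a p J = 0" if "J \<in> idx 2" for J
    using cov_deriv_trf[where \<alpha> = g and a = "\<lambda>K q. kd (K ! 0) (K ! 1)", OF p _ that g_trf, where D = D' and i = i] par[of "i # J"] that sm_const by (simp add: idx_def)
  from trf_inj[OF p this, of "[x, b]"] show "conn (D' c) i b x p = - conn (D' c) i x b p"
    by (simp add: idx_def numeral_2_eq_2 actl_Suc pd_const[OF p])
qed

lemma A_skew: "p \<in> V \<Longrightarrow> alt2 (\<lambda>a b. A i a b p)"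
  using metric_skew par_g by blast

lemma Ag_skew: "p \<in> V \<Longrightarrow> alt2 (\<lambda>a b. Ag i a b p)"
  using metric_skew par_g' by blast

lemma A_phi:
  assumes p: "p \<in> V"
  shows "act3 (\<lambda>a b. A i a b p) phi a b d = 0"
proof -
  let ?a = "\<lambda>K. pd c i (\<lambda>q. g2_model dl K) p - actl (\<lambda>x b. A i x b p) 3 (g2_model dl) K"
  have "trf 3 ?a p J = 0" if "J \<in> idx 3" for J
    using cov_deriv_trf[where \<alpha> = \<phi> and a = "\<lambda>K q. g2_model dl K", OF p _ that \<phi>_e, where D = D and i = i] par_\<phi>[OF p, of "i # J"] that sm_const by (simp add: idx_def)
  from trf_inj[OF p this, of "[a, b, d]"] show ?thesis
    by (simp add: idx_def pd_const[OF p] actl_3 g2_model_dl)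
qed

definition Tf where "Tf K q = tr (\<lambda>a i. Ei a i q) 3 (torsion g D c q) K"
definition T where "T a b d q = Tf [a, b, d] q"
definition Rf where "Rf K q = tr (\<lambda>a i. Ei a i q) 4 (curvature g D c q) K"

lemma torsion_trf: "q \<in> V \<Longrightarrow> J \<in> idx 3 \<Longrightarrow> torsion g D c q J = trf 3 (\<lambda>K. Tf K q) q J"
  unfolding Tf_def by (rule trf_components)

lemma curvature_trf: "q \<in> V \<Longrightarrow> J \<in> idx 4 \<Longrightarrow> curvature g D c q J = trf 4 (\<lambda>K. Rf K q) q J"
  unfolding Rf_def by (rule trf_components)

lemma sm_Tf: "K \<in> idx 3 \<Longrightarrow> smooth_in c V (Tf K)"
  unfolding Tf_def[abs_def] by (rule smooth_components) (rule sm_torsion)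

lemma sm_Rf: "K \<in> idx 4 \<Longrightarrow> smooth_in c V (Rf K)"
  unfolding Rf_def[abs_def]
  by (rule smooth_components) (unfold curvature_def curv_op_def, intro sm_rules sm_D sm_g)

lemma T_alt:
  assumes q: "q \<in> V"
  shows "alt3 (\<lambda>a b d. T a b d q)"
proof -
  let ?E = "\<lambda>a i. Ei a i q" and ?t = "torsion g D c q"
  have t: "Tf [a, b, d] q = (\<^bold>\<Sum>i j k. ?E a i * ?E b j * ?E d k * ?t [i, j, k])" for a b d
    by (simp add: Tf_def numeral_3_eq_3 tr_Suc sum_distrib_left mult.assoc)
  have s: "?t [j, i, k] = - ?t [i, j, k]" "?t [i, k, j] = - ?t [i, j, k]" for i j k
    using alt3D(1,2)[OF alternating_alt3[OF alt_T[OF q]]] .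
  have "Tf [b, a, d] q = (\<^bold>\<Sum>i j k. ?E b j * ?E a i * ?E d k * ?t [j, i, k])" for a b d
    unfolding t by (rule sum.swap)
  also have "(\<^bold>\<Sum>i j k. ?E b j * ?E a i * ?E d k * ?t [j, i, k]) = (\<^bold>\<Sum>i j k. ?E b j * ?E a i * ?E d k * - ?t [i, j, k])" for a b d
    by (intro sum.cong refl arg_cong2[where f = "(*)"] s)
  finally have 1: "Tf [b, a, d] q = - Tf [a, b, d] q" for a b d
    unfolding t by (simp add: sum_negf[symmetric] mult_ac)
  have "Tf [a, d, b] q = (\<^bold>\<Sum>i j k. ?E a i * ?E d k * ?E b j * ?t [i, k, j])" for a b d
    unfolding t by (rule sum.cong[OF refl], rule sum.swap)
  also have "(\<^bold>\<Sum>i j k. ?E a i * ?E d k * ?E b j * ?t [i, k, j]) = (\<^bold>\<Sum>i j k. ?E a i * ?E d k * ?E b j * - ?t [i, j, k])" for a b d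
    by (intro sum.cong refl arg_cong2[where f = "(*)"] s)
  finally have 2: "Tf [a, d, b] q = - Tf [a, b, d] q" for a b d
    unfolding t by (simp add: sum_negf[symmetric] mult_ac)
  show ?thesis unfolding alt3_def T_def using 1 2 by blast
qed

end

section \<open>Structure equations of the two connections\<close>

context g2_chart
begin

lemma structure_equation:
  assumes p: "p \<in> V" and a: "\<And>i. alt2 (\<lambda>x b. conn (D' c) i x b p)"
  shows "pd c i (e j a) p - (\<^bold>\<Sum>s. conn (D' c) i a s p * e j s p) - (pd c j (e i a) p - (\<^bold>\<Sum>s. conn (D' c) j a s p * e i s p))
    = (\<^bold>\<Sum>l. (D' c p l i j - D' c p l j i) * e l a p)"
proof -
  have "conn (D' c) k a s p = - conn (D' c) k s a p" for k s using alt2D[OF a[of k]] .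
  then show ?thesis
    by (simp add: pd_e[OF p, where G = "D' c"] sum_negf left_diff_distrib sum_subtractf)
qed

lemma torsion_frame:
  "p \<in> V \<Longrightarrow> torsion g D' c p [i, j, k] = (\<^bold>\<Sum>a. (\<^bold>\<Sum>l. (D' c p l i j - D' c p l j i) * e l a p) * e k a p)"
  unfolding torsion_def by (simp add: g_e sum_distrib_left sum_distrib_right mult.assoc) (rule sum.swap)

lemma frame_cancel1:
  assumes p: "p \<in> V" and z: "\<And>k. (\<^bold>\<Sum>a. x a * e k a p) = (\<^bold>\<Sum>a. y a * e k a p)"
  shows "x a = y a"
proof -
  have "x a - y a = 0"
    by (rule coframe_cancel1[OF Ei_e[OF p]]) (simp add: z left_diff_distrib sum_subtractf)
  then show ?thesis by simp
qed

lemma frame_cancel2: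
  assumes p: "p \<in> V" and z: "\<And>i j. bil P (\<lambda>a. e i a p) (\<lambda>a. e j a p) = bil Q (\<lambda>a. e i a p) (\<lambda>a. e j a p)"
  shows "P a b = Q a b"
proof -
  have "P a b - Q a b = 0"
    by (rule coframe_cancel2[OF Ei_e[OF p]]) (simp add: z bil_add)
  then show ?thesis by simp
qed

lemma cartan1:
  assumes p: "p \<in> V"
  shows "pd c i (e j a) p - (\<^bold>\<Sum>s. A i a s p * e j s p) - (pd c j (e i a) p - (\<^bold>\<Sum>s. A j a s p * e i s p))
        = bil (\<lambda>b d. T b d a p) (\<lambda>b. e i b p) (\<lambda>d. e j d p)"
  unfolding structure_equation[where D' = D, OF p A_skew[OF p]]
proof (rule frame_cancel1[OF p, where x = "\<lambda>a. \<^bold>\<Sum>l. (D c p l i j - D c p l j i) * e l a p"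
    and y = "\<lambda>a. bil (\<lambda>b d. T b d a p) (\<lambda>b. e i b p) (\<lambda>d. e j d p)"])
  fix k
  have "torsion g D c p [i, j, k] = (\<^bold>\<Sum>b d a. T b d a p * e i b p * e j d p * e k a p)"
    using torsion_trf[OF p, of "[i, j, k]"] by (simp add: idx_def numeral_3_eq_3 tr_Suc T_def sum_distrib_left mult_ac)
  also have "\<dots> = (\<^bold>\<Sum>a b d. T b d a p * e i b p * e j d p * e k a p)" by (rule sum_rot3[symmetric])
  finally show "(\<^bold>\<Sum>a. (\<^bold>\<Sum>l. (D c p l i j - D c p l j i) * e l a p) * e k a p)
      = (\<^bold>\<Sum>a. bil (\<lambda>b d. T b d a p) (\<lambda>b. e i b p) (\<lambda>d. e j d p) * e k a p)"
    unfolding torsion_frame[OF p] bil_def by (simp add: sum_distrib_right)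
qed

lemma Dg_torsion_free:
  assumes p: "p \<in> V"
  shows "(\<^bold>\<Sum>l. (Dg c p l i j - Dg c p l j i) * e l a p) = 0"
  by (rule frame_cancel1[OF p, where y = "\<lambda>_. 0"])
    (use torsion_frame[OF p, of Dg] torsion_Dg[OF p] in \<open>simp add: idx_def\<close>)

lemma Dg_symmetric: "p \<in> V \<Longrightarrow> Dg c p l i j = Dg c p l j i"
proof -
  assume p: "p \<in> V"
  have "Dg c p l i j - Dg c p l j i = 0"
  \<comment> \<open>Frame and coordinate indices exchange their roles: what is cancelled is a vector
    in the coordinate index \<open>l\<close>, using that the dual frame is also an inverse from the
    other side.\<close>
  proof (rule coframe_cancel1[where x = "\<lambda>l. Dg c p l i j - Dg c p l j i" and e = "\<lambda>a l. e l a p" and Ei = "\<lambda>l a. Ei a l p"])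
    show "(\<^bold>\<Sum>a. Ei a l p * e l' a p) = kd l l'" for l l' using e_Ei[OF p, of l' l] by (simp add: mult.commute kd_sym)
  qed (rule Dg_torsion_free[OF p])
  then show ?thesis by simp
qed

text \<open>The uniqueness argument for the Levi-Civita connection. The difference of the
  connections plus half the torsion, \<open>u\<close>, is skew in its last two indices and symmetric
  in the first and third; applying these rules alternately gives \<open>u = - u\<close>.\<close>

lemma Ag_A:
  assumes p: "p \<in> V"
  shows "Ag i a b p = A i a b p - (\<^bold>\<Sum>x. e i x p * T x a b p) / 2"
proof -
  define W where "W i a b = Ag i a b p - A i a b p" for i a b
  define w where "w x a b = (\<^bold>\<Sum>i. Ei x i p * W i a b)" for x a b
  have W: "W i a b = (\<^bold>\<Sum>x. e i x p * w x a b)" for i a b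
  proof -
    have "(\<^bold>\<Sum>x. e i x p * w x a b) = (\<^bold>\<Sum>x j. e i x p * Ei x j p * W j a b)"
      unfolding w_def by (simp add: sum_distrib_left mult.assoc)
    also have "\<dots> = (\<^bold>\<Sum>j x. e i x p * Ei x j p * W j a b)" by (rule sum.swap)
    finally show ?thesis by (simp add: sum_distrib_right[symmetric] e_Ei[OF p])
  qed
  have Wsk: "W i a s = - W i s a" for i a s
    using alt2D[OF A_skew[OF p]] alt2D[OF Ag_skew[OF p]] unfolding W_def by (metis minus_diff_minus)
  have sk: "w x s a = - w x a s" for x a s
    unfolding w_def by (simp add: sum_negf[symmetric] Wsk[of _ s a])
  have tor: "w x a s - w s a x = T x s a p" for x a s
  proof (rule frame_cancel2[OF p, where P = "\<lambda>x s. w x a s - w s a x" and Q = "\<lambda>x s. T x s a p"])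
    fix i j
    have 1: "bil (\<lambda>x s. w x a s) (\<lambda>x. e i x p) (\<lambda>s. e j s p) = (\<^bold>\<Sum>s. W i a s * e j s p)" for i j
      unfolding bil_def W sum_distrib_right by (subst sum.swap) (simp only: mult_ac)
    have "bil (\<lambda>x s. w s a x) (\<lambda>x. e i x p) (\<lambda>s. e j s p) = bil (\<lambda>x s. w x a s) (\<lambda>x. e j x p) (\<lambda>s. e i s p)"
      unfolding bil_def by (subst sum.swap) (simp only: mult_ac)
    then have 2: "bil (\<lambda>x s. w s a x) (\<lambda>x. e i x p) (\<lambda>s. e j s p) = (\<^bold>\<Sum>s. W j a s * e i s p)"
      unfolding 1 .
    show "bil (\<lambda>x s. w x a s - w s a x) (\<lambda>x. e i x p) (\<lambda>s. e j s p) = bil (\<lambda>x s. T x s a p) (\<lambda>x. e i x p) (\<lambda>s. e j s p)"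
      unfolding bil_add 1 2 cartan1[OF p, symmetric]
      using structure_equation[where D' = Dg, OF p Ag_skew[OF p], of i j a] Dg_torsion_free[OF p, of i j a]
      by (simp add: W_def left_diff_distrib sum_subtractf)
  qed
  define u where "u x a s = w x a s + T x a s p / 2" for x a s
  note T = alt3D(1,2)[OF T_alt[OF p]]
  have u1: "u x s a = - u x a s" for x a s using sk[of x s a] T(2)[of x a s] unfolding u_def by simp
  have u2: "u s a x = u x a s" for x a s
    using tor[of x a s] T(1)[of s a x] T(2)[of a s x] T(1)[of a x s] T(2)[of x a s] unfolding u_def by linarith
  have "u x a s = - u x a s" for x a s
    using u2[of s a x] u1[of s a x] u2[of a x s] u1[of a x s] u2[of x s a] u1[of x a s] by linarith
  then have "w x a b = - T x a b p / 2" for x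
    unfolding u_def by (smt (verit) field_sum_of_halves)
  then have "W i a b = - (\<^bold>\<Sum>x. e i x p * T x a b p) / 2"
    unfolding W by (simp add: sum_negf sum_divide_distrib)
  then show ?thesis by (simp add: W_def)
qed

definition F where
  "F i j a b p = pd c i (A j a b) p - pd c j (A i a b) p - (\<^bold>\<Sum>s. A i a s p * A j s b p) + (\<^bold>\<Sum>s. A j a s p * A i s b p)"

lemma sm_A: "smooth_in c V (A i a b)"
  by (rule sm_conn) (rule sm_D)

text \<open>Differentiate \<open>pd_e\<close> once more and compare the two orders of
  differentiation. The terms \<open>S\<close>, mixing Christoffel symbols and connection matrices,
  enter symmetrically in \<open>i\<close> and \<open>j\<close> and drop out; the others are the two
  expressions of the curvature.\<close>

lemma curv_op_F:
  assumes p: "p \<in> V"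
  shows "(\<^bold>\<Sum>m. curv_op D c p m i j k * e m a p) = (\<^bold>\<Sum>t. F i j t a p * e k t p)"
proof -
  let ?D = "\<lambda>l i j. D c p l i j"
  define P where "P i j = (\<^bold>\<Sum>l. pd c i (\<lambda>q. D c q l j k) p * e l a p)" for i j
  define Q where "Q i j = (\<^bold>\<Sum>m. (\<^bold>\<Sum>l. ?D l j k * ?D m i l) * e m a p)" for i j
  define S where "S i j = (\<^bold>\<Sum>l y. ?D l j k * A i y a p * e l y p)" for i j
  define U where "U i j = (\<^bold>\<Sum>t. pd c i (A j t a) p * e k t p)" for i j
  define Z where "Z i j = (\<^bold>\<Sum>t. (\<^bold>\<Sum>x. A i t x p * A j x a p) * e k t p)" for i j
  have "pd c i (pd c j (e k a)) p = P i j + Q i j - S i j - U i j - S j i + Z i j" for i j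
  proof -
    have "pd c i (pd c j (e k a)) p = pd c i (\<lambda>q. (\<^bold>\<Sum>l. D c q l j k * e l a q) - (\<^bold>\<Sum>x. A j x a q * e k x q)) p"
      by (rule pd_cong[OF p]) (rule pd_e)
    also have "\<dots> = (\<^bold>\<Sum>l. pd c i (\<lambda>q. D c q l j k) p * e l a p + ?D l j k * pd c i (e l a) p)
        - (\<^bold>\<Sum>x. pd c i (A j x a) p * e k x p + A j x a p * pd c i (e k x) p)"
      by (simp add: pd_rules sm_rules sm_D sm_e sm_A p)
    also have "(\<^bold>\<Sum>l. pd c i (\<lambda>q. D c q l j k) p * e l a p + ?D l j k * pd c i (e l a) p)
        = P i j + (\<^bold>\<Sum>l m. ?D l j k * ?D m i l * e m a p) - S i j"
      unfolding pd_e[OF p, where G = "D c"] P_def S_def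
      by (simp add: right_diff_distrib sum.distrib sum_subtractf sum_distrib_left mult.assoc)
    also have "(\<^bold>\<Sum>l m. ?D l j k * ?D m i l * e m a p) = Q i j"
      unfolding Q_def sum_distrib_right by (rule sum.swap)
    also have "(\<^bold>\<Sum>x. pd c i (A j x a) p * e k x p + A j x a p * pd c i (e k x) p)
        = U i j + (\<^bold>\<Sum>x m. ?D m i k * A j x a p * e m x p) - (\<^bold>\<Sum>x y. A i y x p * A j x a p * e k y p)"
      unfolding pd_e[OF p, where G = "D c"] U_def
      by (simp add: right_diff_distrib sum.distrib sum_subtractf sum_distrib_left mult_ac)
    also have "(\<^bold>\<Sum>x m. ?D m i k * A j x a p * e m x p) = S j i"
      unfolding S_def by (rule sum.swap)
    also have "(\<^bold>\<Sum>x y. A i y x p * A j x a p * e k y p) = Z i j"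
      unfolding Z_def sum_distrib_right by (rule sum.swap)
    finally show ?thesis by simp
  qed
  from this[of i j] this[of j i] have "P i j - P j i + Q i j - Q j i = U i j - U j i - Z i j + Z j i"
    using pd_comm[OF p sm_e, of i j k a] by linarith
  moreover have "(\<^bold>\<Sum>m. curv_op D c p m i j k * e m a p) = P i j - P j i + Q i j - Q j i"
    unfolding P_def Q_def curv_op_def by (simp add: sum_subtractf algebra_simps sum.distrib)
  moreover have "(\<^bold>\<Sum>t. F i j t a p * e k t p) = U i j - U j i - Z i j + Z j i"
    unfolding U_def Z_def F_def by (simp add: sum_subtractf algebra_simps sum.distrib)
  ultimately show ?thesis by simp
qed

lemma curvature_F:
  assumes p: "p \<in> V"
  shows "curvature g D c p [i, j, k, l] = bil (\<lambda>t a. F i j t a p) (\<lambda>t. e k t p) (\<lambda>a. e l a p)"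
proof -
  have "curvature g D c p [i, j, k, l] = (\<^bold>\<Sum>m a. curv_op D c p m i j k * e m a p * e l a p)"
    unfolding curvature_def by (simp add: g_e[OF p] sum_distrib_left mult.assoc)
  also have "\<dots> = (\<^bold>\<Sum>a. (\<^bold>\<Sum>m. curv_op D c p m i j k * e m a p) * e l a p)"
    unfolding sum_distrib_right by (rule sum.swap)
  also have "\<dots> = (\<^bold>\<Sum>a t. F i j t a p * e k t p * e l a p)"
    unfolding curv_op_F[OF p] sum_distrib_right ..
  also have "\<dots> = bil (\<lambda>t a. F i j t a p) (\<lambda>t. e k t p) (\<lambda>a. e l a p)"
    unfolding bil_def by (rule sum.swap)
  finally show ?thesis .
qed

definition R where "R a b x y q = Rf [a, b, x, y] q"

lemma cartan2:
  assumes p: "p \<in> V"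
  shows "F i j a b p = bil (\<lambda>x y. R x y a b p) (\<lambda>x. e i x p) (\<lambda>y. e j y p)"
proof (rule frame_cancel2[OF p, where P = "\<lambda>a b. F i j a b p" and Q = "\<lambda>a b. bil (\<lambda>x y. R x y a b p) (\<lambda>x. e i x p) (\<lambda>y. e j y p)"])
  fix k l
  have "bil (\<lambda>t a. F i j t a p) (\<lambda>t. e k t p) (\<lambda>a. e l a p) = curvature g D c p [i, j, k, l]"
    by (rule curvature_F[OF p, symmetric])
  also have "\<dots> = trf 4 (\<lambda>K. Rf K p) p [i, j, k, l]" by (rule curvature_trf[OF p]) (simp add: idx_def)
  also have "\<dots> = (\<^bold>\<Sum>x y t a. R x y t a p * e i x p * e j y p * e k t p * e l a p)"
    by (simp add: tr_Suc numeral_eq_Suc R_def sum_distrib_left mult_ac)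
  also have "\<dots> = (\<^bold>\<Sum>t a x y. R x y t a p * e i x p * e j y p * e k t p * e l a p)" by (rule sum_rot4)
  finally show "bil (\<lambda>a b. F i j a b p) (\<lambda>a. e k a p) (\<lambda>a. e l a p)
    = bil (\<lambda>a b. bil (\<lambda>x y. R x y a b p) (\<lambda>x. e i x p) (\<lambda>y. e j y p)) (\<lambda>a. e k a p) (\<lambda>a. e l a p)"
    unfolding bil_def by (simp add: sum_distrib_right)
qed

lemma F_skew:
  assumes p: "p \<in> V"
  shows "F i j b a p = - F i j a b p" "F j i a b p = - F i j a b p"
proof -
  have sk: "q \<in> V \<Longrightarrow> A i b a q = - A i a b q" for i a b q using alt2D[OF A_skew] .
  have "pd c i (A j b a) p = - pd c i (A j a b) p" for i j
  proof -
    have "pd c i (A j b a) p = pd c i (\<lambda>q. - A j a b q) p" by (rule pd_cong[OF p]) (rule sk)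
    then show ?thesis by (simp add: pd_uminus[OF p] sm_A)
  qed
  moreover have "(\<^bold>\<Sum>s. A i b s p * A j s a p) = (\<^bold>\<Sum>s. A j a s p * A i s b p)" for i j
    by (intro sum.cong refl) (simp add: sk[OF p, of i s b for s] sk[OF p, of j a s for s])
  ultimately show "F i j b a p = - F i j a b p" by (simp add: F_def)
  show "F j i a b p = - F i j a b p" by (simp add: F_def)
qed

lemma R_skew:
  assumes p: "p \<in> V"
  shows "R b a x y p = - R a b x y p" "R a b y x p = - R a b x y p"
proof -
  show "R a b y x p = - R a b x y p"
  proof (rule frame_cancel2[OF p, where P = "\<lambda>a b. R a b y x p" and Q = "\<lambda>a b. - R a b x y p"])
    fix i j
    have "bil (\<lambda>a b. - R a b x y p) u v = - bil (\<lambda>a b. R a b x y p) u v" for u v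
      by (simp add: bil_def sum_negf)
    then show "bil (\<lambda>a b. R a b y x p) (\<lambda>a. e i a p) (\<lambda>a. e j a p) = bil (\<lambda>a b. - R a b x y p) (\<lambda>a. e i a p) (\<lambda>a. e j a p)"
      using F_skew(1)[OF p, of i j y x] unfolding cartan2[OF p] by simp
  qed
  show "R b a x y p = - R a b x y p"
  proof (rule frame_cancel2[OF p, where P = "\<lambda>a b. R b a x y p" and Q = "\<lambda>a b. - R a b x y p"])
    fix i j
    have 1: "bil (\<lambda>a b. - R a b x y p) u v = - bil (\<lambda>a b. R a b x y p) u v" for u v
      by (simp add: bil_def sum_negf)
    have 2: "bil (\<lambda>a b. R b a x y p) u v = bil (\<lambda>a b. R a b x y p) v u" for u v
      unfolding bil_def by (subst sum.swap) (simp only: mult_ac)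
    show "bil (\<lambda>a b. R b a x y p) (\<lambda>a. e i a p) (\<lambda>a. e j a p) = bil (\<lambda>a b. - R a b x y p) (\<lambda>a. e i a p) (\<lambda>a. e j a p)"
      using F_skew(2)[OF p, of j i x y] unfolding cartan2[OF p] 1 2 by simp
  qed
qed

text \<open>\<open>contract_trf\<close> over the pair of contracted slots turns the sum with inverse
  metrics into a plain frame sum; a tensor whose coordinate components vanish has vanishing frame
  components.\<close>

lemma R_inst:
  assumes p: "p \<in> V"
  shows "(\<^bold>\<Sum>a b. R a b i j p * phi a b k) = 0"
proof -
  let ?Q = "\<lambda>K. \<^bold>\<Sum>a b. phi a b (K ! 0) * Rf [a, b, K ! 1, K ! 2] p"
  have z: "trf 3 ?Q p [k, i, j] = 0" for i j k
  proof -
    have 1: "\<phi> c p (J @ [k]) = trf 2 (\<lambda>K. trf 1 (\<lambda>L. g2_model dl (K @ L)) p [k]) p J" if "J \<in> idx 2" for J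
      using \<phi>_e[OF p, of "J @ [k]"] tr_append[of J 2 _ 1 "g2_model dl" "[k]"] that by (simp add: idx_def)
    have 2: "curvature g D c p (J @ [i, j]) = trf 2 (\<lambda>K. trf 2 (\<lambda>L. Rf (K @ L) p) p [i, j]) p J" if "J \<in> idx 2" for J
      using curvature_trf[OF p, of "J @ [i, j]"] tr_append[of J 2 _ 2 "\<lambda>K. Rf K p" "[i, j]"] that by (simp add: idx_def)
    have "(\<Sum>I\<in>idx 2. raise (g c p) (\<lambda>J. \<phi> c p (J @ [k])) I * curvature g D c p (I @ [i, j]))
      = (\<Sum>K\<in>idx 2. trf 1 (\<lambda>L. g2_model dl (K @ L)) p [k] * trf 2 (\<lambda>L. Rf (K @ L) p) p [i, j])"
      by (rule contract_trf[OF p 1 2])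
    moreover have "(\<Sum>I\<in>idx 2. raise (g c p) (\<lambda>J. \<phi> c p (J @ [k])) I * curvature g D c p (I @ [i, j])) = 0"
      using inst[OF p, of i j k]
      by (simp add: numeral_2_eq_2 sum_idx_Suc raise_def sum_distrib_left sum_distrib_right mult_ac)
    moreover have "(\<Sum>K\<in>idx 2. trf 1 (\<lambda>L. g2_model dl (K @ L)) p [k] * trf 2 (\<lambda>L. Rf (K @ L) p) p [i, j]) = trf 3 ?Q p [k, i, j]"
      unfolding tr_sum by (simp add: numeral_2_eq_2 numeral_3_eq_3 sum_idx_Suc tr_Suc g2_model_dl sum_distrib_left sum_distrib_right mult_ac)
        (rule sum.cong[OF refl], rule sum.cong[OF refl], rule sum_rot3[symmetric])
    ultimately show ?thesis by simp
  qed
  have "trf 3 ?Q p J = 0" if "J \<in> idx 3" for J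
    using that z by (auto simp: numeral_3_eq_3 idx_Suc_iff)
  from trf_inj[OF p this, of "[k, i, j]"] show ?thesis
    by (simp add: idx_def R_def mult.commute)
qed

lemma R_ric:
  assumes p: "p \<in> V"
  shows "(\<^bold>\<Sum>a. R a i j a p) = 0"
proof -
  let ?Q = "\<lambda>K. \<^bold>\<Sum>a. Rf [a, K ! 0, K ! 1, a] p"
  have z: "trf 2 ?Q p [i, j] = 0" for i j
  proof -
    define P where "P x y = trf 2 (\<lambda>K. Rf [x, K ! 0, K ! 1, y] p) p [i, j]" for x y
    have cv: "curvature g D c p [a, i, j, b] = (\<^bold>\<Sum>x. e a x p * (\<^bold>\<Sum>y. e b y p * P x y))" for a b
    proof -
      have "curvature g D c p [a, i, j, b] = trf 4 (\<lambda>K. Rf K p) p [a, i, j, b]" by (rule curvature_trf[OF p]) (simp add: idx_def)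
      also have "\<dots> = (\<^bold>\<Sum>x s t y. e a x p * (e i s p * (e j t p * (e b y p * Rf [x, s, t, y] p))))"
        by (simp add: tr_Suc numeral_eq_Suc sum_distrib_left)
      also have "\<dots> = (\<^bold>\<Sum>x y s t. e a x p * (e i s p * (e j t p * (e b y p * Rf [x, s, t, y] p))))"
        by (rule sum.cong[OF refl], rule sum_rot3[symmetric])
      finally show ?thesis
        by (simp add: P_def tr_Suc numeral_2_eq_2 sum_distrib_left mult.left_commute)
    qed
    have r1: "(\<^bold>\<Sum>b. ginv (g c p) a b * (\<^bold>\<Sum>y. e b y p * h y)) = (\<^bold>\<Sum>y. Ei y a p * h y)" for a h
    proof -
      have "raise (g c p) (\<lambda>J. \<^bold>\<Sum>y. e (hd J) y p * h y) [a] = tr (\<lambda>i a. Ei a i p) 1 (\<lambda>K. h (hd K)) [a]"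
        by (rule raise_trf[OF p]) (auto simp: idx_def length_Suc_conv tr_Suc)
      then show ?thesis by (simp add: raise_def tr_Suc sum_idx_Suc)
    qed
    have "0 = ricci g D c p [i, j]" using ric[OF p, of "[i, j]"] by (simp add: idx_def)
    also have "\<dots> = (\<^bold>\<Sum>a b. ginv (g c p) a b * (\<^bold>\<Sum>y. e b y p * (\<^bold>\<Sum>x. e a x p * P x y)))"
    proof -
      have "(\<^bold>\<Sum>x. e a x p * (\<^bold>\<Sum>y. e b y p * P x y)) = (\<^bold>\<Sum>y. e b y p * (\<^bold>\<Sum>x. e a x p * P x y))" for a b
        unfolding sum_distrib_left by (subst sum.swap) (simp only: mult.left_commute)
      then show ?thesis unfolding ricci_def by (simp add: cv)
    qed
    also have "\<dots> = (\<^bold>\<Sum>a y x. Ei y a p * e a x p * P x y)"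
      unfolding r1 by (simp add: sum_distrib_left mult.assoc)
    also have "\<dots> = (\<^bold>\<Sum>y x. \<^bold>\<Sum>a. Ei y a p * e a x p * P x y)" by (rule sum_rot3)
    also have "\<dots> = (\<^bold>\<Sum>y. P y y)" by (simp add: sum_distrib_right[symmetric] Ei_e[OF p])
    also have "\<dots> = trf 2 ?Q p [i, j]" unfolding P_def tr_sum ..
    finally show ?thesis by simp
  qed
  have "trf 2 ?Q p J = 0" if "J \<in> idx 2" for J
    using that z by (auto simp: numeral_2_eq_2 idx_Suc_iff)
  from trf_inj[OF p this, of "[i, j]"] show ?thesis by (simp add: idx_def R_def)
qed

end

section \<open>The type function and the derivatives of the torsion\<close>

context g2_chart
begin

text \<open>The two covariant derivatives of \<open>T\<close> differ by half this action, so they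
  agree exactly when sigma vanishes.\<close>

lemma act3_T_T: "p \<in> V \<Longrightarrow> act3 (\<lambda>a b. T x a b p) (\<lambda>a b d. T a b d p) a b d = sig (\<lambda>a b d. T a b d p) x a b d"
proof -
  assume p: "p \<in> V"
  have t: "T s b d p = T b d s p" "T x b s p * T a s d p = T b x s p * T a d s p" for s
    using alt3D(1,2)[OF T_alt[OF p]] alt3_cyc[OF T_alt[OF p]] by (metis, metis minus_mult_minus)
  show ?thesis unfolding act3_def sig_def t by (simp add: sum.distrib mult.commute)
qed

lemma Dg_components:
  assumes p: "p \<in> V"
  shows "act3 (\<lambda>x y. Ag i x y p) C a b d = act3 (\<lambda>x y. A i x y p) C a b d - (\<^bold>\<Sum>y. e i y p * (act3 (\<lambda>a b. T y a b p) C a b d / 2))"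
proof -
  have s: "(\<^bold>\<Sum>s. (\<^bold>\<Sum>x. e i x p * T x a s p) / 2 * h s) = (\<^bold>\<Sum>x. e i x p * ((\<^bold>\<Sum>s. T x a s p * h s) / 2))" for a h
  proof -
    have "(\<^bold>\<Sum>s. (\<^bold>\<Sum>x. e i x p * T x a s p) / 2 * h s) = (\<^bold>\<Sum>s x. e i x p * T x a s p / 2 * h s)"
      by (simp add: sum_distrib_right sum_divide_distrib)
    also have "\<dots> = (\<^bold>\<Sum>x s. e i x p * T x a s p / 2 * h s)" by (rule sum.swap)
    finally show ?thesis by (simp add: sum_distrib_left sum_divide_distrib mult.assoc)
  qed
  show ?thesis
    unfolding act3_def Ag_A[OF p] left_diff_distrib sum_subtractf s
    by (simp add: add_divide_distrib distrib_left sum.distrib)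
qed

text \<open>As \<open>phi\<close> is parallel for \<open>D\<close>, its Levi-Civita derivative
  \<open>X\<close> is half the action of \<open>T\<close> on it, and \<open>ext_d\<close> is the
  alternation of \<open>X\<close>. In the product with \<open>psi\<close> the four alternated terms
  agree, giving 4/24. Each \<open>X\<close> is half of three cyclic terms, and \<open>psi\<close>
  contracted with \<open>phi\<close> is \<open>4 * phi\<close>, giving 3/2 * 4 = 6; the total factor
  is 1.\<close>

lemma const_type:
  assumes p: "p \<in> V"
  shows "(\<^bold>\<Sum>i j l. phi i j l * T i j l p) = r"
proof -
  define X where "X d K = act3 (\<lambda>a b. T d a b p) phi (K ! 0) (K ! 1) (K ! 2) / 2" for d and K :: "7 list"
  define f where "f x a b d = X x [a, b, d] * psi x a b d" for x a b d
  have ext: "ext_d \<phi> c p I = trf 4 (\<lambda>K. \<Sum>s<4. (- 1) ^ s * X (K ! s) (take s K @ drop (Suc s) K)) p I" if "I \<in> idx 4" for I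
  proof -
    have "ext_d \<phi> c p I = trf (Suc 3) (\<lambda>K. \<Sum>s<Suc 3. (- 1) ^ s * X (K ! s) (take s K @ drop (Suc s) K)) p I"
    proof (rule ext_d_trf[where \<alpha> = \<phi> and a = "\<lambda>K q. g2_model dl K" and G = "Dg c"])
      show "movable 3 (\<phi> c p)" by (rule alternating_movable) (rule alt_\<phi>[OF p])
      show "pd c i (\<lambda>q. g2_model dl K) p - actl (\<lambda>x b. Ag i x b p) 3 (\<lambda>K. g2_model dl K) K = (\<^bold>\<Sum>d. e i d p * X d K)"
        if K3: "K \<in> idx 3" for i K
      proof -
        obtain a b h where K: "K = [a, b, h]" using K3 by (auto simp: numeral_3_eq_3 idx_Suc_iff)
        show ?thesis
          unfolding K actl_3 g2_model_dl Dg_components[OF p] A_phi[OF p] pd_const[OF p] X_def by simp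
      qed
    qed (use p that sm_const \<phi>_e Dg_symmetric in \<open>simp_all add: idx_def\<close>)
    then show ?thesis by simp
  qed
  have "r = form_inner (g c p) 4 (ext_d \<phi> c p) (star g \<omega> 3 \<phi> c p)" by (rule ctype[OF p, symmetric])
  also have "\<dots> = (\<Sum>K\<in>idx 4. (\<Sum>s<4. (- 1) ^ s * X (K ! s) (take s K @ drop (Suc s) K)) * hodge3 (g2_model dl) K) / 24"
  proof -
    have st: "star g \<omega> 3 \<phi> c p I = trf 4 (hodge3 (g2_model dl)) p I" if "I \<in> idx 4" for I
      by (rule star_trf[where \<alpha> = \<phi> and a = "g2_model dl", OF p \<phi>_e[OF p] that])
    show ?thesis unfolding form_inner_def by (subst contract_trf[OF p ext st]) (simp_all add: fact_numeral)
  qed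
  also have "(\<Sum>K\<in>idx 4. (\<Sum>s<4. (- 1) ^ s * X (K ! s) (take s K @ drop (Suc s) K)) * hodge3 (g2_model dl) K)
    = (\<^bold>\<Sum>a b d h. f a b d h + f b a d h + f d a b h + f h a b d)"
    unfolding sum_idx_4
  proof (intro sum.cong refl)
    fix a b d h
    have s: "psi b a d h = - psi a b d h" "psi d a b h = psi a b d h" "psi h a b d = - psi a b d h"
      using psi_alt by (metis, metis minus_minus, metis minus_minus)
    show "(\<Sum>s<4. (- 1) ^ s * X ([a, b, d, h] ! s) (take s [a, b, d, h] @ drop (Suc s) [a, b, d, h])) * hodge3 (g2_model dl) [a, b, d, h]
      = f a b d h + f b a d h + f d a b h + f h a b d"
      unfolding hodge3_phi f_def s by (simp add: eval_nat_numeral algebra_simps)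
  qed
  also have "\<dots> = 4 * (\<^bold>\<Sum>a b d h. f a b d h)"
  proof -
    have 1: "(\<^bold>\<Sum>a b d h. f b a d h) = (\<^bold>\<Sum>a b d h. f a b d h)" by (rule sum.swap)
    have 2: "(\<^bold>\<Sum>a b d h. f d a b h) = (\<^bold>\<Sum>a b d h. f a b d h)" by (rule sum_rot3[symmetric])
    have "(\<^bold>\<Sum>a b d h. f h a b d) = (\<^bold>\<Sum>a b h d. f h a b d)" by (intro sum.cong refl sum.swap)
    also have "\<dots> = (\<^bold>\<Sum>a b d h. f a b d h)" by (rule sum_rot3[symmetric])
    finally show ?thesis by (simp add: sum.distrib 1 2)
  qed
  also have "(\<^bold>\<Sum>a b d h. f a b d h) = 6 * (\<^bold>\<Sum>x a s. phi x a s * T x a s p)"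
  proof -
    have "(\<^bold>\<Sum>a b d. f x a b d) = 6 * (\<^bold>\<Sum>a s. phi x a s * T x a s p)" for x
    proof -
      define u where "u a b d = (\<^bold>\<Sum>s. T x a s p * phi s b d)" for a b d
      have cyc: "psi x b d a = psi x a b d" for a b d using psi_alt by (metis minus_minus)
      have pp: "(\<^bold>\<Sum>b d. psi x a b d * phi s b d) = 4 * phi x a s" for a s
        using psi_contr_T[OF alt3_phi, of x a s] by (simp add: Pm_phi psi_swap_pairs[of _ _ x a] phi_cyc[of _ _ s] mult.left_commute[of _ 6] sum_distrib_left[symmetric])
      have X: "X x [a, b, d] = (u a b d + u b d a + u d a b) / 2" for a b d
        unfolding X_def u_def act3_def by (simp add: phi_cyc[of _ d a] phi_cyc[of a b])
      have "(\<^bold>\<Sum>a b d. f x a b d) = ((\<^bold>\<Sum>a b d. psi x a b d * u a b d) + (\<^bold>\<Sum>a b d. psi x a b d * u b d a) + (\<^bold>\<Sum>a b d. psi x a b d * u d a b)) / 2"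
        unfolding f_def X by (simp add: add_divide_distrib distrib_left distrib_right sum.distrib sum_divide_distrib mult.commute)
      also have "\<dots> = 3 / 2 * (\<^bold>\<Sum>a b d. psi x a b d * u a b d)"
        unfolding alt3_contr_rot[of "psi x" u, OF cyc] by simp
      also have "(\<^bold>\<Sum>a b d. psi x a b d * u a b d) = (\<^bold>\<Sum>a s. T x a s p * (\<^bold>\<Sum>b d. psi x a b d * phi s b d))"
      proof -
        have "(\<^bold>\<Sum>b d. psi x a b d * u a b d) = (\<^bold>\<Sum>s. T x a s p * (\<^bold>\<Sum>b d. psi x a b d * phi s b d))" for a
        proof -
          have "(\<^bold>\<Sum>b d. psi x a b d * u a b d) = (\<^bold>\<Sum>b d s. T x a s p * (psi x a b d * phi s b d))"
            unfolding u_def by (simp add: sum_distrib_left mult.left_commute)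
          also have "\<dots> = (\<^bold>\<Sum>s b d. T x a s p * (psi x a b d * phi s b d))" by (rule sum_rot3[symmetric])
          finally show ?thesis by (simp add: sum_distrib_left)
        qed
        then show ?thesis by simp
      qed
      finally show ?thesis unfolding pp by (simp add: sum_distrib_left mult_ac)
    qed
    then show ?thesis by (simp add: sum_distrib_left)
  qed
  finally show ?thesis by simp
qed

sublocale moving_frame V "smooth_in c V" "pd c" e Ei A T R r
proof
  show "smooth_in c V (e i a)" for i a by (rule sm_e)
  show "smooth_in c V (A i a b)" for i a b by (rule sm_A)
  show "smooth_in c V (T a b d)" for a b d unfolding T_def[abs_def] by (rule sm_Tf) (simp add: idx_def)
  show "smooth_in c V (R a b x y)" for a b x y unfolding R_def[abs_def] by (rule sm_Rf) (simp add: idx_def)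
  fix p assume p: "p \<in> V"
  show "(\<^bold>\<Sum>i. Ei a i p * e i b p) = kd a b" for a b by (rule Ei_e[OF p])
  show "(\<^bold>\<Sum>a. e i a p * Ei a j p) = kd i j" for i j by (rule e_Ei[OF p])
  show "alt2 (\<lambda>a b. A i a b p)" for i by (rule A_skew[OF p])
  show "act3 (\<lambda>a b. A i a b p) phi a b d = 0" for i a b d by (rule A_phi[OF p])
  show "alt3 (\<lambda>a b d. T a b d p)" by (rule T_alt[OF p])
  show "pd c i (e j a) p - (\<^bold>\<Sum>s. A i a s p * e j s p) - (pd c j (e i a) p - (\<^bold>\<Sum>s. A j a s p * e i s p))
        = bil (\<lambda>b d. T b d a p) (\<lambda>b. e i b p) (\<lambda>d. e j d p)" for i j a by (rule cartan1[OF p])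
  show "pd c i (A j a b) p - pd c j (A i a b) p - (\<^bold>\<Sum>s. A i a s p * A j s b p) + (\<^bold>\<Sum>s. A j a s p * A i s b p)
        = bil (\<lambda>x y. R x y a b p) (\<lambda>x. e i x p) (\<lambda>y. e j y p)" for i j a b
    using cartan2[OF p] unfolding F_def .
  show "R b a x y p = - R a b x y p" "R a b y x p = - R a b x y p" for a b x y by (rule R_skew[OF p])+
  show "(\<^bold>\<Sum>a b. R a b i j p * phi a b k) = 0" for i j k by (rule R_inst[OF p])
  show "(\<^bold>\<Sum>a. R a i j a p) = 0" for i j by (rule R_ric[OF p])
  show "(\<^bold>\<Sum>i j l. phi i j l * T i j l p) = r" by (rule const_type[OF p])
qed

definition DTl where "DTl p d K = DT d (K ! 0) (K ! 1) (K ! 2) p"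

text \<open>The second part is where the vanishing of sigma makes the Levi-Civita derivative of
  \<open>T\<close> equal to the characteristic one.\<close>

lemma Tf_derivatives:
  assumes p: "p \<in> V" and K: "K \<in> idx 3"
  shows "pd c i (Tf K) p - actl (\<lambda>x b. A i x b p) 3 (\<lambda>K. Tf K p) K = (\<^bold>\<Sum>d. e i d p * DTl p d K)"
    and "pd c i (Tf K) p - actl (\<lambda>x b. Ag i x b p) 3 (\<lambda>K. Tf K p) K = (\<^bold>\<Sum>d. e i d p * DTl p d K)"
proof -
  obtain a b d where K': "K = [a, b, d]" using K by (auto simp: numeral_3_eq_3 idx_Suc_iff)
  have t: "(\<lambda>x y z. Tf [x, y, z] p) = (\<lambda>x y z. T x y z p)" "Tf [a, b, d] = T a b d"
    by (simp_all add: T_def fun_eq_iff)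
  have g: "act3 (\<lambda>x y. Ag i x y p) (\<lambda>x y z. T x y z p) a b d = act3 (\<lambda>x y. A i x y p) (\<lambda>x y z. T x y z p) a b d"
    unfolding Dg_components[OF p] act3_T_T[OF p] frame_harmonic(1)[OF p] by simp
  show "pd c i (Tf K) p - actl (\<lambda>x b. A i x b p) 3 (\<lambda>K. Tf K p) K = (\<^bold>\<Sum>d. e i d p * DTl p d K)"
    "pd c i (Tf K) p - actl (\<lambda>x b. Ag i x b p) 3 (\<lambda>K. Tf K p) K = (\<^bold>\<Sum>d. e i d p * DTl p d K)"
    unfolding K' actl_3 t g pd_T[OF p] DTl_def by simp_all
qed

lemma cov_deriv_torsion_eq:
  assumes p: "p \<in> V" and I: "I \<in> idx 4"
  shows "cov_deriv Dg (torsion g D) c p I = cov_deriv D (torsion g D) c p I"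
proof -
  obtain i J where I': "I = i # J" "J \<in> idx 3" using I by (auto simp: eval_nat_numeral idx_Suc_iff)
  have t: "cov_deriv D' (torsion g D) c p (i # J)
    = trf 3 (\<lambda>K. pd c i (Tf K) p - actl (\<lambda>x b. conn (D' c) i x b p) 3 (\<lambda>K. Tf K p) K) p J" for D'
    by (rule cov_deriv_trf[where \<alpha> = "torsion g D" and a = Tf, OF p sm_Tf I'(2) torsion_trf])
  show ?thesis
    unfolding I'(1) t by (rule tr_cong) (simp add: Tf_derivatives[OF p])
qed

lemma alt3_DT: "p \<in> V \<Longrightarrow> alt3 (\<lambda>a b d. DT i a b d p)"
  by (rule curvature_data.DT) (rule curvature_data_at)

lemma ext_d_torsion:
  assumes p: "p \<in> V" and I: "I \<in> idx 4"
  shows "ext_d (torsion g D) c p I = 0"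
proof -
  have "ext_d (torsion g D) c p I = trf (Suc 3) (\<lambda>K. \<Sum>s<Suc 3. (- 1) ^ s * DTl p (K ! s) (take s K @ drop (Suc s) K)) p I"
  proof (rule ext_d_trf[where \<alpha> = "torsion g D" and a = Tf and G = "Dg c"])
    show "movable 3 (torsion g D c p)" by (rule alternating_movable) (rule alt_T[OF p])
  qed (use p I sm_Tf torsion_trf Dg_symmetric Tf_derivatives(2) in \<open>simp_all add: idx_def\<close>)
  also have "\<dots> = 0"
  proof (rule tr_zero)
    fix K assume "K \<in> idx (Suc 3)"
    then obtain a b d h where K: "K = [a, b, d, h]" by (auto simp: eval_nat_numeral idx_Suc_iff)
    have "DT b d a h p = - DT b a d h p" "DT d a b h p = DT d a b h p"
      using alt3D(1)[OF alt3_DT[OF p, of b], of a d h] by simp_all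
    then show "(\<Sum>s<Suc 3. (- 1) ^ s * DTl p (K ! s) (take s K @ drop (Suc s) K)) = 0"
      using frame_harmonic(2)[OF p, of a b d h] by (simp add: K DTl_def eval_nat_numeral)
  qed
  finally show ?thesis .
qed

text \<open>The Hodge star has constant frame components and commutes with skew connection matrices,
  so the dual of \<open>T\<close> has covariant derivative \<open>hodge3\<close> of
  \<open>DT\<close>. Alternating it gives a divergence of \<open>T\<close>, which is zero.\<close>

lemma ext_d_star_torsion:
  assumes p: "p \<in> V" and I: "I \<in> idx 5"
  shows "ext_d (star g \<omega> 3 (torsion g D)) c p I = 0"
proof -
  have sm_h: "smooth_in c V (\<lambda>q. hodge3 (\<lambda>L. Tf L q) K)" for K
    unfolding hodge3_def divide_inverse by (intro sm_finite_sum sm_mult sm_const sm_Tf)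
  have "ext_d (star g \<omega> 3 (torsion g D)) c p I
    = trf (Suc 4) (\<lambda>K. \<Sum>s<Suc 4. (- 1) ^ s * hodge3 (DTl p (K ! s)) (take s K @ drop (Suc s) K)) p I"
  proof (rule ext_d_trf[where \<alpha> = "star g \<omega> 3 (torsion g D)" and a = "\<lambda>K q. hodge3 (\<lambda>L. Tf L q) K" and G = "Dg c"
        and X = "\<lambda>d. hodge3 (DTl p d)"])
    fix i K assume K: "K \<in> idx 4"
    have "pd c i (\<lambda>q. hodge3 (\<lambda>L. Tf L q) K) p = hodge3 (\<lambda>L. pd c i (Tf L) p) K"
    proof -
      have "pd c i (\<lambda>q. hodge3 (\<lambda>L. Tf L q) K) p = pd c i (\<lambda>q. \<Sum>L\<in>idx 3. (eps (L @ K) / 6) * Tf L q) p"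
        by (rule pd_cong[OF p]) (simp add: hodge3_def sum_divide_distrib mult.commute)
      also have "\<dots> = (\<Sum>L\<in>idx 3. pd c i (\<lambda>q. (eps (L @ K) / 6) * Tf L q) p)"
        by (rule pd_finite_sum[OF p]) (intro sm_mult sm_const sm_Tf)
      also have "\<dots> = (\<Sum>L\<in>idx 3. (eps (L @ K) / 6) * pd c i (Tf L) p)"
        by (intro sum.cong refl pd_cmult[OF p] sm_Tf)
      finally show ?thesis by (simp add: hodge3_def sum_divide_distrib mult.commute)
    qed
    moreover have "actl (\<lambda>x b. Ag i x b p) 4 (hodge3 (\<lambda>L. Tf L p)) K = hodge3 (actl (\<lambda>x b. Ag i x b p) 3 (\<lambda>L. Tf L p)) K"
      by (rule actl_hodge3[OF Ag_skew[OF p] K])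
    ultimately have "pd c i (\<lambda>q. hodge3 (\<lambda>L. Tf L q) K) p - actl (\<lambda>x b. Ag i x b p) 4 (hodge3 (\<lambda>L. Tf L p)) K
      = (\<Sum>L\<in>idx 3. (pd c i (Tf L) p - actl (\<lambda>x b. Ag i x b p) 3 (\<lambda>L. Tf L p) L) * eps (L @ K)) / 6"
      by (simp add: hodge3_def left_diff_distrib sum_subtractf diff_divide_distrib)
    also have "\<dots> = (\<Sum>L\<in>idx 3. (\<^bold>\<Sum>d. e i d p * DTl p d L) * eps (L @ K)) / 6"
      by (simp add: Tf_derivatives(2)[OF p])
    also have "\<dots> = (\<^bold>\<Sum>d. e i d p * hodge3 (DTl p d) K)"
      unfolding hodge3_def sum_distrib_right
      by (subst sum.swap) (simp add: sum_distrib_left sum_divide_distrib mult.assoc)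
    finally show "pd c i (\<lambda>q. hodge3 (\<lambda>L. Tf L q) K) p - actl (\<lambda>x b. Ag i x b p) 4 (\<lambda>K. hodge3 (\<lambda>L. Tf L p) K) K
      = (\<^bold>\<Sum>d. e i d p * hodge3 (DTl p d) K)" .
  next
    show "star g \<omega> 3 (torsion g D) c q J = trf 4 (\<lambda>K. hodge3 (\<lambda>L. Tf L q) K) q J" if "q \<in> V" "J \<in> idx 4" for q J
      by (rule star_trf[where \<alpha> = "torsion g D" and a = "\<lambda>K. Tf K q", OF that(1) torsion_trf[OF that(1)] that(2)])
  qed (use p I sm_h movable_star Dg_symmetric in \<open>simp_all add: idx_def\<close>)
  also have "\<dots> = 0"
  proof (rule tr_zero)
    fix K assume "K \<in> idx (Suc 4)"
    then have "(\<Sum>s<5. (- 1) ^ s * hodge3 (DTl p (K ! s)) (take s K @ drop (Suc s) K)) = 0"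
      by (intro alternated_hodge3) (simp_all add: DTl_def alt3_DT[OF p] frame_harmonic(3)[OF p] idx_def)
    then show "(\<Sum>s<Suc 4. (- 1) ^ s * hodge3 (DTl p (K ! s)) (take s K @ drop (Suc s) K)) = 0" by simp
  qed
  finally show ?thesis .
qed

text \<open>The outer star acts on a form of degree 8 - 3 = 5 that has just been shown to vanish, so
  no property of the index list is needed.\<close>

lemma codiff_torsion: "p \<in> V \<Longrightarrow> codiff g \<omega> 3 (torsion g D) c p I = 0"
proof -
  assume p: "p \<in> V"
  have "raise (g c p) (ext_d (star g \<omega> 3 (torsion g D)) c p) J = 0" if "J \<in> idx 5" for J
    using that ext_d_star_torsion[OF p] by (simp add: raise_def idx_def)
  then show ?thesis by (simp add: codiff_def star_def[of g \<omega> 5])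
qed

end

theorem theorem1p1:
  fixes M :: "'m topology" and A :: "'m chart set"
    and \<phi> g \<omega> :: "'m field" and Dg D :: "'m christoffel"
  assumes "smooth_manifold M A"
    and "g2_structure M A \<phi>"
    and "g2_metric_volume M A \<phi> g \<omega>"
    and "levi_civita A g Dg"
    and "g2_integrable A g \<omega> \<phi>"
    and "g2_constant_type A g \<omega> \<phi>"
    and "characteristic_connection A g \<phi> D"
    and "g2_instanton A g \<phi> D"
    and "field_eq A 2 (ricci g D) zero_field"
  shows "field_eq A 2 (codiff g \<omega> 3 (torsion g D)) zero_field \<and>
         field_eq A 4 (ext_d (torsion g D)) zero_field \<and>
         field_eq A 4 (cov_deriv Dg (torsion g D)) (cov_deriv D (torsion g D))"
proof -
  obtain r where r: "\<And>c p. c \<in> A \<Longrightarrow> p \<in> fst c \<Longrightarrow> form_inner (g c p) 4 (ext_d \<phi> c p) (star g \<omega> 3 \<phi> c p) = r"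
    using assms(6) unfolding g2_constant_type_def by blast
  have "codiff g \<omega> 3 (torsion g D) c p I = 0 \<and> (I' \<in> idx 4 \<longrightarrow> ext_d (torsion g D) c p I' = 0 \<and>
      cov_deriv Dg (torsion g D) c p I' = cov_deriv D (torsion g D) c p I')"
    if c: "c \<in> A" and p: "p \<in> fst c" for c p I I'
  proof -
    \<comment> \<open>All three claims are equations of components at a point of a chart, so one
      adapted coframe near that point suffices.\<close>
    obtain V E where V: "p \<in> V" "adapted_coframe M \<phi> c V E"
      using assms(2) c p unfolding g2_structure_def by blast
    then have VE: "openin M V" "V \<subseteq> fst c" "\<And>a i. smooth_in c V (\<lambda>q. E q a [i])"
      "\<And>q. q \<in> V \<Longrightarrow> det (\<chi> a i. E q a [i]) \<noteq> 0" "\<And>q I. q \<in> V \<Longrightarrow> I \<in> idx 3 \<Longrightarrow> \<phi> c q I = g2_model (E q) I"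
      unfolding adapted_coframe_def coframe_def by blast+
    have chart: "is_chart M c" using assms(1) c unfolding smooth_manifold_def by blast
    \<comment> \<open>The coframe is stored with its number first, \<open>E q a [i]\<close>; the
      frame calculus puts the coordinate index first and the point last.\<close>
    interpret chart_coframe M c V "\<lambda>i a q. E q a [i]"
      by unfold_locales (use chart VE in auto)
    have g\<omega>: "g c q [i, j] = (\<^bold>\<Sum>a. E q a [i] * E q a [j])"
      "I \<in> idx 7 \<Longrightarrow> \<omega> c q I = wedge_list [E q 1, E q 2, E q 3, E q 4, E q 5, E q 6, E q 7] I" if "q \<in> V" for q i j I
      using assms(3) c V(2) that unfolding g2_metric_volume_def by blast+
    have conn: "connection A D" "connection A Dg" "parallel A D 2 g" "parallel A D 3 \<phi>" "parallel A Dg 2 g"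
      "field_eq A 3 (torsion g Dg) zero_field" "diff_form A 3 (torsion g D)"
      using assms(4,7) unfolding levi_civita_def characteristic_connection_def by blast+
    have forms: "diff_form A 3 \<phi>" "diff_form A 7 \<omega>" "riemannian_metric A g"
      using assms(2,3) unfolding g2_structure_def g2_metric_volume_def by blast+
    interpret g2_chart M c V "\<lambda>i a q. E q a [i]" g \<omega> \<phi> D Dg r
    proof
      fix q assume q: "q \<in> V"
      then have q': "q \<in> fst c" using VE(2) by blast
      show "g c q [i, j] = (\<^bold>\<Sum>a. E q a [i] * E q a [j])" for i j by (rule g\<omega>(1)[OF q])
      show "\<omega> c q I = tr (\<lambda>i a. E q a [i]) 7 eps I" if "I \<in> idx 7" for I
        unfolding g\<omega>(2)[OF q that] by (rule volume_tr[OF refl that])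
      show "\<phi> c q I = tr (\<lambda>i a. E q a [i]) 3 (g2_model dl) I" if "I \<in> idx 3" for I
        unfolding VE(5)[OF q that] by (rule g2_model_tr[OF refl that])
      show "alternating 7 (\<omega> c q)" "alternating 3 (\<phi> c q)" "alternating 3 (torsion g D c q)"
        using forms(1,2) conn(7) c q' unfolding diff_form_def by blast+
      show "cov_deriv D g c q I = 0" "cov_deriv Dg g c q I = 0" if "I \<in> idx 3" for I
        using conn(3,5) c q' that unfolding parallel_def field_eq_def by (simp_all add: eval_nat_numeral)
      show "cov_deriv D \<phi> c q I = 0" if "I \<in> idx 4" for I
        using conn(4) c q' that unfolding parallel_def field_eq_def by (simp add: eval_nat_numeral)
      show "torsion g Dg c q I = 0" if "I \<in> idx 3" for I
        using conn(6) c q' that unfolding field_eq_def by blast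
      show "(\<^bold>\<Sum>a b a' b'. ginv (g c q) a a' * ginv (g c q) b b' * curvature g D c q [a, b, i, j] * \<phi> c q [a', b', k]) = 0" for i j k
        using assms(8) c q' unfolding g2_instanton_def by blast
      show "ricci g D c q I = 0" if "I \<in> idx 2" for I
        using assms(9) c q' that unfolding field_eq_def by blast
      show "form_inner (g c q) 4 (ext_d \<phi> c q) (star g \<omega> 3 \<phi> c q) = r" by (rule r[OF c q'])
    next
      show "smooth_in c V (\<lambda>q. D c q l i j)" "smooth_in c V (\<lambda>q. Dg c q l i j)" for l i j
        using conn(1,2) c VE(2) unfolding connection_def by (auto intro!: smooth_in_mono[of "fst c"])
      show "smooth_in c V (\<lambda>q. torsion g D c q I)" if "I \<in> idx 3" for I
        using conn(7) c VE(2) that unfolding diff_form_def tensor_field_def by (blast intro: smooth_in_mono)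
      have "[i, j] \<in> idx 2" for i j by (simp add: idx_def)
      then show "smooth_in c V (\<lambda>q. g c q [i, j])" for i j
        using forms(3) c VE(2) unfolding riemannian_metric_def tensor_field_def by (blast intro: smooth_in_mono)
    qed
    show ?thesis
      using codiff_torsion[OF V(1)] ext_d_torsion[OF V(1)] cov_deriv_torsion_eq[OF V(1)] by blast
  qed
  then show ?thesis unfolding field_eq_def by blast
qed

end
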